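(* Let $V$ and $W$ be Banach spaces, let $T>0$, and let $\alpha\in(\frac13,\frac12]$. Let $f_0:W\to W$ be Lipschitz continuous and let $f:W\to L(V,W)$ be of class $C_b^3$. Let $\mathcal{M}$ be a finite dimensional $C^3$-submanifold of $W$. Suppose that $\mathbf{X}=(X,\mathbb{X})\in\mathscr{C}_g^{\alpha}([0,T],V)$ is a weakly geometric rough path such that $X$ is truly rough. Then the following statements are equivalent: (i) $\mathcal{M}$ is locally invariant for the rough differential equation $dY_t=f_0(Y_t)\,dt+f(Y_t)\,d\mathbf{X}_t$, $Y_0=\xi$. (ii) For each $y\in\mathcal{M}$ we have $$f_0(y)\in T_y\mathcal{M},\qquad\text{and}\qquad f(y)v\in T_y\mathcal{M}\ \text{ for all } v\in V.$$ Moreover, if the equivalent statements (i) and (ii) are fulfilled and $\mathcal{M}$ is closed as a subset of $W$, then $\mathcal{M}$ is globally invariant for this rough differential equation.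
   Context: Notation: $L(V,W)$ is the space of bounded linear operators. For a path $X$ write $X_{s,t}=X_t-X_s$. $C_b^k$ denotes $k$ times continuously Fréchet differentiable mappings which are bounded together with their derivatives up to order $k$. $\mathcal{C}^{\alpha}([0,T],W)$ is the space of $\alpha$-Hölder continuous paths. $V\otimes V$ is a completed tensor product with a symmetric cross-norm for which the canonical injection $L(V,L(V,W))\hookrightarrow L(V\otimes V,W)$, $A\mapsto(v\otimes w\mapsto (Av)w)$, holds (e.g. the projective tensor product). Rough paths: $\mathscr{C}^{\alpha}([0,T],V)$ is the set of pairs $(X,\mathbb{X})$ with $X\in\mathcal{C}^{\alpha}([0,T],V)$ and $\mathbb{X}:[0,T]^2\to V\otimes V$ satisfying $\sup_{s\ne t}|\mathbb{X}_{s,t}|/|t-s|^{2\alpha}<\infty$ and Chen's relation $\mathbb{X}_{s,t}-\mathbb{X}_{s,u}-\mathbb{X}_{u,t}=X_{s,u}\otimes X_{u,t}$. The set $\mathscr{C}_g^{\alpha}([0,T],V)$ of weakly geometric rough paths consists of all $(X,\mathbb{X})\in\mathscr{C}^{\alpha}([0,T],V)$ with $\mathrm{Sym}(\mathbb{X}_{s,t})=\frac12X_{s,t}\otimes X_{s,t}$ for all $s,t\in[0,T]$. Truly rough: $X\in\mathcal{C}^{\alpha}([0,T],V)$ is truly rough if there is a dense subset $D\subset[0,T)$ such that $\limsup_{t\downarrow s}|\langle v,X_{s,t}\rangle|/|t-s|^{2\alpha}=\infty$ for all $s\in D$ and all $v\in V^*\setminus\{0\}$. Controlled rough paths: $\mathscr{D}_X^{2\alpha}([0,T],W)$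 is the space of pairs $(Y,Y')$ with $Y\in\mathcal{C}^{\alpha}([0,T],W)$, $Y'\in\mathcal{C}^{\alpha}([0,T],L(V,W))$ and $\sup_{s\neq t}|Y_{s,t}-Y'_sX_{s,t}|/|t-s|^{2\alpha}<\infty$. For $(Y,Y')\in\mathscr{D}_X^{2\alpha}([0,T],L(V,W))$ the rough integral over $[0,t]$ is $\int_0^tY_s\,d\mathbf{X}_s=\lim_{|\Pi|\to0}\sum_{[u,v]\in\Pi}(Y_uX_{u,v}+Y'_u\mathbb{X}_{u,v})$, the limit being over partitions $\Pi$ of $[0,t]$ with mesh tending to $0$. For $(Y,Y')\in\mathscr{D}_X^{2\alpha}([0,T],W)$ the path $f(Y)$ is controlled with Gubinelli derivative $f(Y)'_t=Df(Y_t)Y'_t$. Solutions: a solution of the equation with $Y_0=\xi$ is $(Y,Y')\in\mathscr{D}_X^{2\alpha}([0,T],W)$ with $Y'=f(Y)$ and $Y_t=\xi+\int_0^tf_0(Y_s)\,ds+\int_0^tf(Y_s)\,d\mathbf{X}_s$ for $t\in[0,T]$. Under the stated assumptions on $f_0,f$ it is known that for every $\xi\in W$ there is a unique solution on $[0,T]$. Invariance: $\mathcal{M}$ is locally invariant if for each $\xi\in\mathcal{M}$ there is $T_0\in(0,T]$ such that the solution $Y$ with $Y_0=\xi$ satisfies $Y_t\in\mathcal{M}$ for all $t\in[0,T_0]$; it is globally invariant if for each $\xi\in\mathcal{M}$ this holds for all $t\in[0,T]$. Submanifolds: $\mathcal{M}\subset W$ is an $m$-dimensional $C^k$-submanifold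 ($m,k\ge1$) if for every $y\in\mathcal{M}$ there are an open neighborhood $U\subset W$ of $y$, an open set $O\subset\mathbb{R}^m$ and $\phi\in C^k(O,W)$ such that $\phi:O\to U\cap\mathcal{M}$ is a homeomorphism and $D\phi(z)\in L(\mathbb{R}^m,W)$ is one-to-one for all $z\in O$. The tangent space is $T_y\mathcal{M}:=D\phi(z)\mathbb{R}^m$ with $z=\phi^{-1}(y)$ (independent of the choice of $\phi$). *)

theory Defs
  imports "HOL-Analysis.Analysis"
begin

section \<open>Differentiability classes\<close>

definition frechet_blinfun ::
  "('a::real_normed_vector \<Rightarrow> 'b::real_normed_vector) \<Rightarrow> 'a \<Rightarrow> 'a \<Rightarrow>\<^sub>L 'b"
  where "frechet_blinfun g x = Blinfun (frechet_derivative g (at x))"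

text \<open>
  The derivatives are operator valued, so that all continuity and boundedness requirements
  refer to the operator norms. Continuity of the functions of lower order is implied.
\<close>

definition C3_derivatives ::
  "'a set \<Rightarrow> ('a::real_normed_vector \<Rightarrow> 'b::real_normed_vector) \<Rightarrow> ('a \<Rightarrow> 'a \<Rightarrow>\<^sub>L 'b)
    \<Rightarrow> ('a \<Rightarrow> 'a \<Rightarrow>\<^sub>L 'a \<Rightarrow>\<^sub>L 'b) \<Rightarrow> ('a \<Rightarrow> 'a \<Rightarrow>\<^sub>L 'a \<Rightarrow>\<^sub>L 'a \<Rightarrow>\<^sub>L 'b) \<Rightarrow> bool"
  where "C3_derivatives S g g1 g2 g3 \<longleftrightarrow>
    (\<forall>x\<in>S. (g has_derivative blinfun_apply (g1 x)) (at x)) \<and>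
    (\<forall>x\<in>S. (g1 has_derivative blinfun_apply (g2 x)) (at x)) \<and>
    (\<forall>x\<in>S. (g2 has_derivative blinfun_apply (g3 x)) (at x)) \<and>
    continuous_on S g3"

definition C3_on :: "'a set \<Rightarrow> ('a::real_normed_vector \<Rightarrow> 'b::real_normed_vector) \<Rightarrow> bool"
  where "C3_on S g \<longleftrightarrow> (\<exists>g1 g2 g3. C3_derivatives S g g1 g2 g3)"

definition Cb3 :: "('a::real_normed_vector \<Rightarrow> 'b::real_normed_vector) \<Rightarrow> bool"
  where "Cb3 g \<longleftrightarrow> (\<exists>g1 g2 g3. C3_derivatives UNIV g g1 g2 g3 \<and>
    bounded (range g) \<and> bounded (range g1) \<and> bounded (range g2) \<and> bounded (range g3))"


section \<open>Submanifolds\<close>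

text \<open>
  The dimension is \<open>CARD('m)\<close>, hence positive. The map \<open>\<psi>\<close> is the inverse of the parametrization
  \<open>\<phi>\<close>.
\<close>

definition C3_chart ::
  "'w::real_normed_vector set \<Rightarrow> 'w set \<Rightarrow> (real ^ 'm) set \<Rightarrow> (real ^ 'm \<Rightarrow> 'w) \<Rightarrow> ('w \<Rightarrow> real ^ 'm)
    \<Rightarrow> bool"
  where "C3_chart M U Om \<phi> \<psi> \<longleftrightarrow>
    open U \<and> open Om \<and> C3_on Om \<phi> \<and> homeomorphism Om (U \<inter> M) \<phi> \<psi> \<and>
    (\<forall>z\<in>Om. inj (frechet_derivative \<phi> (at z)))"

definition C3_submanifold :: "'m::finite itself \<Rightarrow> 'w::real_normed_vector set \<Rightarrow> bool"
  where "C3_submanifold m M \<longleftrightarrow>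
    (\<forall>y\<in>M. \<exists>U Om (\<phi> :: real ^ 'm \<Rightarrow> 'w) \<psi>. y \<in> U \<and> C3_chart M U Om \<phi> \<psi>)"

text \<open>
  For \<open>y \<in> M\<close> the range of the derivative is the same for all charts around \<open>y\<close>, so the union
  below is taken over copies of a single space.
\<close>

definition tangent_space ::
  "'m::finite itself \<Rightarrow> 'w::real_normed_vector set \<Rightarrow> 'w \<Rightarrow> 'w set"
  where "tangent_space m M y =
    \<Union> {range (frechet_derivative \<phi> (at (\<psi> y))) | U Om (\<phi> :: real ^ 'm \<Rightarrow> 'w) \<psi>.
         y \<in> U \<inter> M \<and> C3_chart M U Om \<phi> \<psi>}"


section \<open>Completed tensor products\<close>

text \<open>
  The condition on independent sets says that the span of the elementary tensors is the algebraic
  tensor product of \<open>'v\<close> with itself; this span is dense, so the Banach space \<open>'e\<close> is its completion.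
  The existence of \<open>F\<close> is the symmetry of the norm: \<open>v \<otimes> w \<mapsto> w \<otimes> v\<close> is isometric.
\<close>

locale completed_tensor_product =
  fixes tensor :: "'v::banach \<Rightarrow> 'v \<Rightarrow> 'e::banach"
  assumes bilinear_tensor: "bilinear tensor"
    and norm_tensor: "norm (tensor v w) = norm v * norm w"
    and independent_tensor: "independent A \<Longrightarrow> independent B \<Longrightarrow>
      inj_on (\<lambda>(v, w). tensor v w) (A \<times> B) \<and> independent ((\<lambda>(v, w). tensor v w) ` (A \<times> B))"
    and dense_tensor: "closure (span (range (\<lambda>(v, w). tensor v w))) = UNIV"
    and symmetric_tensor: "\<exists>F :: 'e \<Rightarrow>\<^sub>L 'e.
      (\<forall>v w. F (tensor v w) = tensor w v) \<and> (\<forall>x. norm (F x) = norm x)"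

text \<open>
  The canonical embedding of \<open>L(V, L(V, W))\<close> into \<open>L(V \<otimes> V, W)\<close>; its injectivity is automatic.
\<close>

definition canonical_injection ::
  "'w::banach itself \<Rightarrow> ('v::banach \<Rightarrow> 'v \<Rightarrow> 'e::banach) \<Rightarrow> bool"
  where "canonical_injection w tensor \<longleftrightarrow>
    (\<exists>\<iota> :: ('v \<Rightarrow>\<^sub>L 'v \<Rightarrow>\<^sub>L 'w) \<Rightarrow>\<^sub>L ('e \<Rightarrow>\<^sub>L 'w). \<forall>A v w.
      blinfun_apply (blinfun_apply \<iota> A) (tensor v w) = blinfun_apply (blinfun_apply A v) w)"

definition tensor_lift ::
  "('v::banach \<Rightarrow> 'v \<Rightarrow> 'e::banach) \<Rightarrow> ('v \<Rightarrow>\<^sub>L 'v \<Rightarrow>\<^sub>L 'w::banach) \<Rightarrow> 'e \<Rightarrow>\<^sub>L 'w"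
  where "tensor_lift tensor A = (THE L. \<forall>v w. blinfun_apply L (tensor v w) = A v w)"

definition tensor_flip :: "('v::banach \<Rightarrow> 'v \<Rightarrow> 'e::banach) \<Rightarrow> 'e \<Rightarrow>\<^sub>L 'e"
  where "tensor_flip tensor = (THE F. \<forall>v w. blinfun_apply F (tensor v w) = tensor w v)"

definition tensor_Sym :: "('v::banach \<Rightarrow> 'v \<Rightarrow> 'e::banach) \<Rightarrow> 'e \<Rightarrow> 'e"
  where "tensor_Sym tensor x = (1/2) *\<^sub>R (x + tensor_flip tensor x)"

context completed_tensor_product
begin

lemma blinfun_eq_on_tensors:
  fixes L L' :: "'e \<Rightarrow>\<^sub>L 'w::real_normed_vector"
  assumes "\<And>v w. L (tensor v w) = L' (tensor v w)"
  shows "L = L'"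
proof (rule blinfun_eqI)
  fix x
  have eq: "L y = L' y" if "y \<in> span (range (\<lambda>(v, w). tensor v w))" for y
    using that
  proof (rule linear_eq_on_span[rotated 3])
    show "linear L" "linear L'"
      by (auto intro: bounded_linear.linear blinfun.bounded_linear_right)
  qed (use assms in auto)
  have "closed {y. L y = L' y}"
    by (intro closed_Collect_eq continuous_intros)
  then have "closure (span (range (\<lambda>(v, w). tensor v w))) \<subseteq> {y. L y = L' y}"
    by (rule closure_minimal[rotated]) (use eq in auto)
  then show "L x = L' x"
    using dense_tensor by auto
qed

lemma tensor_lift:
  assumes "canonical_injection TYPE('w::banach) tensor"
  shows "tensor_lift tensor (A :: 'v \<Rightarrow>\<^sub>L 'v \<Rightarrow>\<^sub>L 'w) (tensor v w) = A v w"
proof -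
  obtain L :: "'e \<Rightarrow>\<^sub>L 'w" where "\<forall>v w. L (tensor v w) = A v w"
    using assms unfolding canonical_injection_def by blast
  then have "\<forall>v w. tensor_lift tensor A (tensor v w) = A v w"
    unfolding tensor_lift_def by (rule theI) (auto intro: blinfun_eq_on_tensors simp: \<open>\<forall>v w. L (tensor v w) = A v w\<close>)
  then show ?thesis by blast
qed

lemma tensor_flip: "tensor_flip tensor (tensor v w) = tensor w v"
proof -
  obtain F :: "'e \<Rightarrow>\<^sub>L 'e" where F: "\<forall>v w. F (tensor v w) = tensor w v"
    using symmetric_tensor by blast
  then have "\<forall>v w. tensor_flip tensor (tensor v w) = tensor w v"
    unfolding tensor_flip_def by (rule theI) (auto intro: blinfun_eq_on_tensors simp: F)
  then show ?thesis by blast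
qed

end


section \<open>Rough paths\<close>

text \<open>
  Paths on \<open>[0,T]\<close> are functions on \<open>real\<close> of which only the values on \<open>{0..T}\<close> matter.
\<close>

definition holder2 :: "real \<Rightarrow> real \<Rightarrow> (real \<Rightarrow> real \<Rightarrow> 'a::real_normed_vector) \<Rightarrow> bool"
  where "holder2 \<beta> T R \<longleftrightarrow>
    bdd_above {norm (R s t) / \<bar>t - s\<bar> powr \<beta> | s t. s \<in> {0..T} \<and> t \<in> {0..T} \<and> s \<noteq> t}"

definition holder_path :: "real \<Rightarrow> real \<Rightarrow> (real \<Rightarrow> 'a::real_normed_vector) \<Rightarrow> bool"
  where "holder_path \<alpha> T X \<longleftrightarrow> holder2 \<alpha> T (\<lambda>s t. X t - X s)"

definition rough_path ::
  "('v::banach \<Rightarrow> 'v \<Rightarrow> 'e::banach) \<Rightarrow> real \<Rightarrow> real \<Rightarrow> (real \<Rightarrow> 'v) \<Rightarrow> (real \<Rightarrow> real \<Rightarrow> 'e) \<Rightarrow> bool"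
  where "rough_path tensor \<alpha> T X XX \<longleftrightarrow>
    holder_path \<alpha> T X \<and> holder2 (2 * \<alpha>) T XX \<and>
    (\<forall>s\<in>{0..T}. \<forall>u\<in>{0..T}. \<forall>t\<in>{0..T}.
      XX s t - XX s u - XX u t = tensor (X u - X s) (X t - X u))"

definition weakly_geometric_rough_path ::
  "('v::banach \<Rightarrow> 'v \<Rightarrow> 'e::banach) \<Rightarrow> real \<Rightarrow> real \<Rightarrow> (real \<Rightarrow> 'v) \<Rightarrow> (real \<Rightarrow> real \<Rightarrow> 'e) \<Rightarrow> bool"
  where "weakly_geometric_rough_path tensor \<alpha> T X XX \<longleftrightarrow>
    rough_path tensor \<alpha> T X XX \<and>
    (\<forall>s\<in>{0..T}. \<forall>t\<in>{0..T}.
      tensor_Sym tensor (XX s t) = (1/2) *\<^sub>R tensor (X t - X s) (X t - X s))"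

definition truly_rough :: "real \<Rightarrow> real \<Rightarrow> (real \<Rightarrow> 'v::real_normed_vector) \<Rightarrow> bool"
  where "truly_rough \<alpha> T X \<longleftrightarrow>
    holder_path \<alpha> T X \<and>
    (\<exists>D. D \<subseteq> {0..<T} \<and> {0..<T} \<subseteq> closure D \<and>
      (\<forall>s\<in>D. \<forall>v :: 'v \<Rightarrow>\<^sub>L real. v \<noteq> 0 \<longrightarrow>
        Limsup (at_right s) (\<lambda>t. ereal (\<bar>blinfun_apply v (X t - X s)\<bar> / \<bar>t - s\<bar> powr (2 * \<alpha>))) = \<infinity>))"

definition controlled_path ::
  "real \<Rightarrow> real \<Rightarrow> (real \<Rightarrow> 'v::real_normed_vector) \<Rightarrow> (real \<Rightarrow> 'w::real_normed_vector)
    \<Rightarrow> (real \<Rightarrow> 'v \<Rightarrow>\<^sub>L 'w) \<Rightarrow> bool"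
  where "controlled_path \<alpha> T X Y Y' \<longleftrightarrow>
    holder_path \<alpha> T Y \<and> holder_path \<alpha> T Y' \<and>
    holder2 (2 * \<alpha>) T (\<lambda>s t. Y t - Y s - Y' s (X t - X s))"


section \<open>The rough integral\<close>

text \<open>
  A partition of \<open>[0,t]\<close> is the strictly increasing list of its points; for \<open>t = 0\<close> this is \<open>[0]\<close>.
\<close>

definition partitions :: "real \<Rightarrow> real list set"
  where "partitions t = {ps. ps \<noteq> [] \<and> sorted_wrt (<) ps \<and> hd ps = 0 \<and> last ps = t}"

definition mesh_to_zero :: "real \<Rightarrow> real list filter"
  where "mesh_to_zero t = (INF \<delta>\<in>{0<..}. principal
    {ps \<in> partitions t. \<forall>i < length ps - 1. ps ! Suc i - ps ! i < \<delta>})"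

definition rough_sum ::
  "('v::banach \<Rightarrow> 'v \<Rightarrow> 'e::banach) \<Rightarrow> (real \<Rightarrow> 'v) \<Rightarrow> (real \<Rightarrow> real \<Rightarrow> 'e)
    \<Rightarrow> (real \<Rightarrow> 'v \<Rightarrow>\<^sub>L 'w::banach) \<Rightarrow> (real \<Rightarrow> 'v \<Rightarrow>\<^sub>L 'v \<Rightarrow>\<^sub>L 'w) \<Rightarrow> real list \<Rightarrow> 'w"
  where "rough_sum tensor X XX Y Y' ps =
    (\<Sum>i < length ps - 1. let u = ps ! i; v = ps ! Suc i in
      Y u (X v - X u) + tensor_lift tensor (Y' u) (XX u v))"

definition has_rough_integral ::
  "('v::banach \<Rightarrow> 'v \<Rightarrow> 'e::banach) \<Rightarrow> (real \<Rightarrow> 'v) \<Rightarrow> (real \<Rightarrow> real \<Rightarrow> 'e)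
    \<Rightarrow> (real \<Rightarrow> 'v \<Rightarrow>\<^sub>L 'w::banach) \<Rightarrow> (real \<Rightarrow> 'v \<Rightarrow>\<^sub>L 'v \<Rightarrow>\<^sub>L 'w) \<Rightarrow> real \<Rightarrow> 'w \<Rightarrow> bool"
  where "has_rough_integral tensor X XX Y Y' t I \<longleftrightarrow>
    (rough_sum tensor X XX Y Y' \<longlongrightarrow> I) (mesh_to_zero t)"


section \<open>Rough differential equations and invariance\<close>

text \<open>
  The Gubinelli derivative of \<open>f(Y)\<close> is \<open>t \<mapsto> Df(Y\<^sub>t) Y'\<^sub>t\<close>.
\<close>

definition rde_solution ::
  "('v::banach \<Rightarrow> 'v \<Rightarrow> 'e::banach) \<Rightarrow> real \<Rightarrow> real \<Rightarrow> (real \<Rightarrow> 'v) \<Rightarrow> (real \<Rightarrow> real \<Rightarrow> 'e)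
    \<Rightarrow> ('w::banach \<Rightarrow> 'w) \<Rightarrow> ('w \<Rightarrow> 'v \<Rightarrow>\<^sub>L 'w) \<Rightarrow> 'w \<Rightarrow> (real \<Rightarrow> 'w) \<Rightarrow> (real \<Rightarrow> 'v \<Rightarrow>\<^sub>L 'w) \<Rightarrow> bool"
  where "rde_solution tensor \<alpha> T X XX f0 f \<xi> Y Y' \<longleftrightarrow>
    controlled_path \<alpha> T X Y Y' \<and>
    (\<forall>t\<in>{0..T}. Y' t = f (Y t)) \<and>
    (\<forall>t\<in>{0..T}. \<exists>I.
      has_rough_integral tensor X XX
        (\<lambda>s. f (Y s)) (\<lambda>s. frechet_blinfun f (Y s) o\<^sub>L Y' s) t I \<and>
      Y t = \<xi> + integral {0..t} (\<lambda>s. f0 (Y s)) + I)"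

text \<open>
  For Lipschitz \<open>f0\<close> and \<open>f\<close> of class \<open>Cb3\<close> there is exactly one solution on \<open>[0,T]\<close> for every
  initial value, so quantifying over all solutions refers to this solution.
\<close>

definition locally_invariant ::
  "('v::banach \<Rightarrow> 'v \<Rightarrow> 'e::banach) \<Rightarrow> real \<Rightarrow> real \<Rightarrow> (real \<Rightarrow> 'v) \<Rightarrow> (real \<Rightarrow> real \<Rightarrow> 'e)
    \<Rightarrow> ('w::banach \<Rightarrow> 'w) \<Rightarrow> ('w \<Rightarrow> 'v \<Rightarrow>\<^sub>L 'w) \<Rightarrow> 'w set \<Rightarrow> bool"
  where "locally_invariant tensor \<alpha> T X XX f0 f M \<longleftrightarrow>
    (\<forall>\<xi>\<in>M. \<exists>T0\<in>{0<..T}. \<forall>Y Y'.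
      rde_solution tensor \<alpha> T X XX f0 f \<xi> Y Y' \<longrightarrow> (\<forall>t\<in>{0..T0}. Y t \<in> M))"

definition globally_invariant ::
  "('v::banach \<Rightarrow> 'v \<Rightarrow> 'e::banach) \<Rightarrow> real \<Rightarrow> real \<Rightarrow> (real \<Rightarrow> 'v) \<Rightarrow> (real \<Rightarrow> real \<Rightarrow> 'e)
    \<Rightarrow> ('w::banach \<Rightarrow> 'w) \<Rightarrow> ('w \<Rightarrow> 'v \<Rightarrow>\<^sub>L 'w) \<Rightarrow> 'w set \<Rightarrow> bool"
  where "globally_invariant tensor \<alpha> T X XX f0 f M \<longleftrightarrow>
    (\<forall>\<xi>\<in>M. \<forall>Y Y'.
      rde_solution tensor \<alpha> T X XX f0 f \<xi> Y Y' \<longrightarrow> (\<forall>t\<in>{0..T}. Y t \<in> M))"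

end

theory Submission
  imports Defs
begin

text \<open>
  Write \<open>J y s t = f(y) X\<^sub>s\<^sub>,\<^sub>t + (Df(y) f(y)) XX\<^sub>s\<^sub>,\<^sub>t\<close> for the second-order Euler increment of the rough
  integral. A path solves the equation if and only if
  \<open>Y\<^sub>t = Y\<^sub>s + (t - s) f\<^sub>0(Y\<^sub>s) + J (Y\<^sub>s) s t + O((t - s)\<^bsup>3\<alpha>\<^esup>)\<close> for close \<open>s \<le> t\<close>; such paths are called
  Davie paths below. One direction is the sewing argument, applied to the increments of the integral;
  for the other one, errors of order \<open>3\<alpha> > 1\<close> add up to nothing along partitions of vanishing mesh.

  The iterates of the one-step map, the Euler orbits, depend Lipschitz continuously on their starting
  point, uniformly in the step size (\<open>orbit_lipschitz\<close>). Hence a chain of \<open>k\<close> points that follows the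
  one-step map up to an error \<open>\<epsilon>\<close> per step stays within \<open>C k \<epsilon>\<close> of the solution with the same
  start (\<open>davie_path_shadowed_by_approximate_orbit\<close>). With steps of length \<open>d\<close> and
  \<open>\<epsilon> = O(d\<^bsup>3\<alpha>\<^esup>)\<close> this tends to zero with \<open>d\<close>. Existence, uniqueness and invariance all follow from
  this one estimate: for invariance it suffices that every step from a point of \<open>M\<close> can be replaced
  by a step inside \<open>M\<close> with an error of order \<open>3\<alpha>\<close>.

  If the coefficients are tangent, such a replacement exists. Let \<open>\<phi>\<close> be a chart and \<open>y = \<phi>(x)\<close>. The
  first-order terms are \<open>D\<phi>(x) a\<^sub>0\<close> and \<open>D\<phi>(x) a\<close> for suitable coordinate vectors. The second-level term
  is in general not tangent; but differentiating the tangency of \<open>f\<close> along \<open>M\<close> shows that, modulo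
  tangent vectors, \<open>(v, w) \<mapsto> Df(y)(f(y)v) w\<close> is given by the symmetric second derivative of \<open>\<phi>\<close>. So only
  the symmetric part of \<open>XX\<close> matters, and weak geometricity turns the second-level term into
  \<open>\<onehalf> D\<^sup>2\<phi>(x)(a, a) + D\<phi>(x) q\<close> (\<open>second_level_tangential\<close>). This is exactly what the Taylor
  expansion of \<open>\<phi>(x + (t - s) a\<^sub>0 + a + q)\<close> requires (\<open>step_in_chart\<close>). If \<open>M\<close> is closed, the local
  argument can be restarted at the last time up to which the solution is known to lie in \<open>M\<close>.

  Conversely, increments of a path in \<open>M\<close> are tangent up to order \<open>2\<alpha>\<close>, so every functional \<open>l\<close> that
  vanishes on the tangent space at \<open>Y\<^sub>s\<close> satisfies \<open>l(f(Y\<^sub>s) X\<^sub>s\<^sub>,\<^sub>t) = O((t - s)\<^bsup>2\<alpha>\<^esup>)\<close>. At the times of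
  true roughness this forces \<open>l \<circ> f(Y\<^sub>s) = 0\<close>, and by the Hahn--Banach theorem \<open>f(Y\<^sub>s)\<close> is tangent
  (\<open>roughness_forces_tangency\<close>); density of these times gives tangency at the starting point. Once
  \<open>f\<close> is tangent, all terms of the expansion except \<open>(t - s) f\<^sub>0\<close> agree with a Taylor expansion inside
  \<open>M\<close> up to order \<open>3\<alpha>\<close>, and since \<open>3\<alpha> > 1\<close> the drift is tangent too (\<open>drift_tangent\<close>).
\<close>

section \<open>Extension of functionals and left inverses\<close>

text \<open>
  The value \<open>a\<close> at the new point \<open>x0\<close> has to lie between all \<open>c - C * norm (x - x0)\<close> and all
  \<open>C * norm (y + x0) - d\<close>; the triangle inequality leaves room for it.
\<close>

lemma dominated_graph_extend:
  fixes G :: "('a::real_normed_vector \<times> real) set"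
  assumes G: "subspace G" and dom: "\<And>x c. (x, c) \<in> G \<Longrightarrow> c \<le> C * norm x" and C: "0 \<le> C"
  obtains G' a where "subspace G'" "G \<subseteq> G'" "(x0, a) \<in> G'" "\<And>x c. (x, c) \<in> G' \<Longrightarrow> c \<le> C * norm x"
proof -
  let ?L = "(\<lambda>(x, c). c - C * norm (x - x0)) ` G"
  have sep: "c - C * norm (x - x0) \<le> C * norm (y + x0) - d" if "(x, c) \<in> G" "(y, d) \<in> G" for x c y d
  proof -
    have "(x + y, c + d) \<in> G" using subspace_add[OF G that] by simp
    then have "c + d \<le> C * norm (x + y)" by (rule dom)
    also have "norm (x + y) \<le> norm (x - x0) + norm (y + x0)" by norm
    then have "C * norm (x + y) \<le> C * norm (x - x0) + C * norm (y + x0)"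
      using C by (metis distrib_left mult_left_mono)
    finally show ?thesis by simp
  qed
  have zero: "(0, 0) \<in> G" using subspace_0[OF G] by (simp add: zero_prod_def)
  define a where "a = Sup ?L"
  have ne: "?L \<noteq> {}" using zero by blast
  have bdd: "bdd_above ?L" using sep[OF _ zero] by (intro bdd_aboveI[of _ "C * norm (0 + x0) - 0"]) auto
  have low: "c - C * norm (x - x0) \<le> a" if "(x, c) \<in> G" for x c
    unfolding a_def using that by (intro cSup_upper[OF _ bdd]) force
  have up: "a \<le> C * norm (y + x0) - d" if "(y, d) \<in> G" for y d
    unfolding a_def using sep[OF _ that] by (intro cSup_least[OF ne]) auto
  define G' where "G' = {p + q | p q. p \<in> G \<and> q \<in> span {(x0, a)}}"
  have "c \<le> C * norm x" if xc: "(x, c) \<in> G'" for x c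
  proof -
    obtain y d r where yd: "(y, d) \<in> G" and x: "x = y + r *\<^sub>R x0" and c: "c = d + r * a"
      using xc unfolding G'_def by (auto simp: span_singleton)
    consider "r = 0" | "r > 0" | "r < 0" by linarith
    then show ?thesis
    proof cases
      case 1
      then show ?thesis using dom[OF yd] x c by simp
    next
      case 2
      have "((1 / r) *\<^sub>R y, d / r) \<in> G" using subspace_scale[OF G yd, of "1 / r"] by simp
      from up[OF this] have "r * a \<le> r * (C * norm ((1 / r) *\<^sub>R y + x0) - d / r)"
        using 2 by (intro mult_left_mono) auto
      also have "\<dots> = C * norm (r *\<^sub>R ((1 / r) *\<^sub>R y + x0)) - d"
        unfolding norm_scaleR using 2 by (simp add: right_diff_distrib)
      also have "r *\<^sub>R ((1 / r) *\<^sub>R y + x0) = x" using 2 by (simp add: x scaleR_add_right)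
      finally show ?thesis by (simp add: c)
    next
      case 3
      let ?\<rho> = "- r"
      have "((1 / ?\<rho>) *\<^sub>R y, d / ?\<rho>) \<in> G" using subspace_scale[OF G yd, of "1 / ?\<rho>"] by simp
      from low[OF this] have "?\<rho> * (d / ?\<rho> - C * norm ((1 / ?\<rho>) *\<^sub>R y - x0)) \<le> ?\<rho> * a"
        using 3 by (intro mult_left_mono) auto
      also have "?\<rho> * (d / ?\<rho> - C * norm ((1 / ?\<rho>) *\<^sub>R y - x0)) = d - C * norm (?\<rho> *\<^sub>R ((1 / ?\<rho>) *\<^sub>R y - x0))"
        unfolding norm_scaleR using 3 by (simp add: right_diff_distrib)
      also have "?\<rho> *\<^sub>R ((1 / ?\<rho>) *\<^sub>R y - x0) = x" using 3 by (simp add: x scaleR_diff_right)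
      finally show ?thesis by (simp add: c)
    qed
  qed
  moreover have "subspace G'" unfolding G'_def by (intro subspace_sums G subspace_span)
  moreover have "G \<subseteq> G'"
  proof
    fix p assume "p \<in> G"
    then show "p \<in> G'" unfolding G'_def by (intro CollectI exI[of _ p] exI[of _ 0]) (auto simp: span_zero)
  qed
  moreover have "(x0, a) \<in> G'"
    unfolding G'_def using subspace_0[OF G]
    by (intro CollectI exI[of _ 0] exI[of _ "(x0, a)"]) (auto simp: span_base)
  ultimately show ?thesis using that by blast
qed

text \<open>
  A partially defined functional is represented by its graph, so that extension is inclusion of
  sets. Domination by the norm makes such a graph single valued, because it applies to both \<open>(0, c)\<close>
  and \<open>(0, -c)\<close>.
\<close>

lemma hahn_banach_graph:
  fixes G :: "('a::real_normed_vector \<times> real) set"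
  assumes G: "subspace G" and dom: "\<And>x c. (x, c) \<in> G \<Longrightarrow> c \<le> C * norm x" and C: "0 \<le> C"
  obtains l :: "'a \<Rightarrow>\<^sub>L real" where "\<And>x c. (x, c) \<in> G \<Longrightarrow> l x = c"
proof -
  define \<A> where "\<A> = {G'. subspace G' \<and> G \<subseteq> G' \<and> (\<forall>(x, c)\<in>G'. c \<le> C * norm x)}"
  have "\<exists>M\<in>\<A>. \<forall>X\<in>\<A>. M \<subseteq> X \<longrightarrow> X = M"
  proof (rule subset_Zorn_nonempty)
    show "\<A> \<noteq> {}" using G dom by (auto simp: \<A>_def)
    fix \<C> assume ne: "\<C> \<noteq> {}" and ch: "subset.chain \<A> \<C>"
    have sub: "subspace K" "G \<subseteq> K" "\<And>x c. (x, c) \<in> K \<Longrightarrow> c \<le> C * norm x" if "K \<in> \<C>" for K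
      using that ch by (auto simp: \<A>_def subset_chain_def)
    have "subspace (\<Union>\<C>)"
      unfolding subspace_def
    proof (intro conjI ballI allI)
      show "0 \<in> \<Union>\<C>" using ne sub subspace_0 by blast
      fix p q assume "p \<in> \<Union>\<C>" "q \<in> \<Union>\<C>"
      then obtain K L where KL: "K \<in> \<C>" "p \<in> K" "L \<in> \<C>" "q \<in> L" by blast
      then consider "K \<subseteq> L" | "L \<subseteq> K" using ch unfolding subset_chain_def by blast
      then show "p + q \<in> \<Union>\<C>"
        by cases (use KL sub(1) subspace_add in blast)+
    next
      fix p and r :: real assume "p \<in> \<Union>\<C>"
      then show "r *\<^sub>R p \<in> \<Union>\<C>" using sub(1) subspace_scale by blast
    qed
    then show "\<Union>\<C> \<in> \<A>" using ne sub by (fastforce simp: \<A>_def)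
  qed
  then obtain K where K: "K \<in> \<A>" and max: "\<And>X. X \<in> \<A> \<Longrightarrow> K \<subseteq> X \<Longrightarrow> X = K" by blast
  have KG: "subspace K" "G \<subseteq> K" and Kdom: "\<And>x c. (x, c) \<in> K \<Longrightarrow> c \<le> C * norm x"
    using K by (auto simp: \<A>_def)
  have unique: "c = d" if "(x, c) \<in> K" "(x, d) \<in> K" for x c d
  proof -
    have "(0, c - d) \<in> K" "(0, d - c) \<in> K"
      using subspace_diff[OF KG(1) that] subspace_diff[OF KG(1) that(2,1)] by auto
    then show ?thesis using Kdom[of 0 "c - d"] Kdom[of 0 "d - c"] by simp
  qed
  have total: "\<exists>c. (x, c) \<in> K" for x
  proof -
    obtain K' a where K': "subspace K'" "K \<subseteq> K'" "(x, a) \<in> K'" "\<And>x c. (x, c) \<in> K' \<Longrightarrow> c \<le> C * norm x"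
      using dominated_graph_extend[OF KG(1) Kdom C] by metis
    then have "K' = K" using max[of K'] KG(2) by (auto simp: \<A>_def)
    then show ?thesis using K'(3) by blast
  qed
  define l where "l x = (THE c. (x, c) \<in> K)" for x
  have l: "(x, l x) \<in> K" for x
    unfolding l_def using total[of x] unique by (metis theI)
  have l_eq: "l x = c" if "(x, c) \<in> K" for x c using unique[OF l that] .
  have bl: "bounded_linear l"
  proof (rule bounded_linear_intro[where K = C])
    show "l (x + y) = l x + l y" for x y using subspace_add[OF KG(1) l[of x] l[of y]] by (intro l_eq) simp
    show "l (r *\<^sub>R x) = r *\<^sub>R l x" for r x using subspace_scale[OF KG(1) l[of x], of r] by (intro l_eq) simp
    show "norm (l x) \<le> norm x * C" for x
      using Kdom[OF l[of x]] Kdom[of "- x" "- l x"] subspace_neg[OF KG(1) l[of x]] by (auto simp: mult.commute)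
  qed
  show ?thesis
    by (rule that[of "Blinfun l"]) (use KG(2) l_eq bl in \<open>auto simp: bounded_linear_Blinfun_apply\<close>)
qed

lemma separating_functional:
  fixes w :: "'a::real_normed_vector"
  assumes "w \<noteq> 0"
  obtains l :: "'a \<Rightarrow>\<^sub>L real" where "l w \<noteq> 0"
proof -
  let ?G = "range (\<lambda>r. (r *\<^sub>R w, r * norm w))"
  have "linear (\<lambda>r. (r *\<^sub>R w, r * norm w))"
    by (auto intro!: linearI simp: scaleR_add_left distrib_right)
  then have "subspace ?G" by (rule linear_subspace_image[OF _ subspace_UNIV])
  then obtain l :: "'a \<Rightarrow>\<^sub>L real" where l: "\<And>x c. (x, c) \<in> ?G \<Longrightarrow> l x = c"
    by (rule hahn_banach_graph[of _ 1]) (auto intro!: mult_right_mono[OF abs_ge_self norm_ge_zero])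
  have "l w = norm w" by (rule l) (auto intro: image_eqI[of _ _ 1])
  then show ?thesis using assms by (intro that[of l]) simp
qed

lemma injective_bounded_below:
  fixes A :: "(real ^ 'm) \<Rightarrow>\<^sub>L 'w::real_normed_vector"
  assumes "inj (blinfun_apply A)"
  obtains c where "0 < c" "\<And>u. norm u \<le> c * norm (A u)"
proof -
  have "continuous_on (sphere 0 1) (\<lambda>u. norm (A u))" by (intro continuous_intros)
  moreover have "sphere (0 :: real ^ 'm) 1 \<noteq> {}"
    using vector_choose_size[of 1] by (auto simp: dist_norm)
  ultimately obtain u0 where u0: "u0 \<in> sphere 0 1" "\<And>u. u \<in> sphere 0 1 \<Longrightarrow> norm (A u0) \<le> norm (A u)"
    using continuous_attains_inf[of "sphere 0 1" "\<lambda>u. norm (A u)"] by (metis compact_sphere)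
  have "A u0 \<noteq> 0"
  proof
    assume "A u0 = 0"
    then have "A u0 = A 0" by (simp add: blinfun.zero_right)
    then have "u0 = 0" by (rule injD[OF assms])
    then show False using u0(1) by simp
  qed
  then have m: "0 < norm (A u0)" by simp
  have "norm u \<le> 1 / norm (A u0) * norm (A u)" for u
  proof (cases "u = 0")
    case False
    have "(1 / norm u) *\<^sub>R u \<in> sphere 0 1" using False by simp
    from u0(2)[OF this] have "norm (A u0) \<le> norm (A u) / norm u" by (simp add: blinfun.scaleR_right)
    then show ?thesis using False m by (simp add: field_simps)
  qed simp
  then show ?thesis using m by (intro that[of "1 / norm (A u0)"]) auto
qed

text \<open>
  The coordinates of \<open>u\<close> are functionals of \<open>A u\<close> on the range of \<open>A\<close>. They are bounded because \<open>A\<close> is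
  bounded below, so each of them extends to the whole space.
\<close>

lemma bounded_left_inverse:
  fixes A :: "(real ^ 'm) \<Rightarrow>\<^sub>L 'w::real_normed_vector"
  assumes inj: "inj (blinfun_apply A)"
  obtains P :: "'w \<Rightarrow>\<^sub>L (real ^ 'm)" where "\<And>u. P (A u) = u"
proof -
  obtain c where c: "0 < c" "\<And>u. norm u \<le> c * norm (A u)"
    using injective_bounded_below[OF inj] by blast
  have "\<exists>l :: 'w \<Rightarrow>\<^sub>L real. \<forall>u. l (A u) = u $ i" for i
  proof -
    let ?G = "range (\<lambda>u. (A u, u $ i))"
    have "linear (\<lambda>u. (A u, u $ i))"
      by (auto intro!: linearI simp: blinfun.add_right blinfun.scaleR_right)
    then have "subspace ?G" by (rule linear_subspace_image[OF _ subspace_UNIV])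
    have le: "u $ i \<le> c * norm (A u)" for u
      using component_le_norm_cart[of u i] c(2)[of u] by linarith
    from \<open>subspace ?G\<close>
    obtain l :: "'w \<Rightarrow>\<^sub>L real" where "\<And>x r. (x, r) \<in> ?G \<Longrightarrow> l x = r"
      by (rule hahn_banach_graph[of _ c]) (use c le in auto)
    then show ?thesis by blast
  qed
  then obtain l :: "'m \<Rightarrow> 'w \<Rightarrow>\<^sub>L real" where l: "\<And>i u. l i (A u) = u $ i" by metis
  let ?P = "\<lambda>w. \<Sum>i\<in>UNIV. l i w *\<^sub>R (axis i 1 :: real ^ 'm)"
  have bl: "bounded_linear ?P"
    by (intro bounded_linear_sum bounded_linear_compose[OF bounded_linear_scaleR_left] blinfun.bounded_linear_right)
  have "?P (A u) = u" for u
    by (simp add: vec_eq_iff l axis_def if_distrib cong: if_cong)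
  then show ?thesis using bl by (intro that[of "Blinfun ?P"]) (simp add: bounded_linear_Blinfun_apply)
qed

section \<open>Taylor estimates in normed spaces\<close>

lemma mean_value_norm_bound:
  fixes p :: "real \<Rightarrow> 'a::real_normed_vector"
  assumes "\<And>\<theta>. 0 \<le> \<theta> \<Longrightarrow> \<theta> \<le> 1 \<Longrightarrow> (p has_vector_derivative p' \<theta>) (at \<theta>)" "\<And>\<theta>. 0 < \<theta> \<Longrightarrow> \<theta> < 1 \<Longrightarrow> norm (p' \<theta>) \<le> B"
  shows "norm (p 1 - p 0) \<le> B"
proof -
  have "norm (p 1 - p 0) \<le> B * 1 - B * 0"
  proof (rule differentiable_bound_general[where f' = p' and \<phi>' = "\<lambda>_. B"])
    show "continuous_on {0..1} p"
      using assms(1) by (intro continuous_at_imp_continuous_on ballI) (auto intro: has_vector_derivative_continuous)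
  qed (use assms in \<open>auto intro!: continuous_intros derivative_eq_intros\<close>)
  then show ?thesis by simp
qed

lemma has_vector_derivative_along_line:
  assumes "(g has_derivative blinfun_apply g') (at (y + \<theta> *\<^sub>R a))"
  shows "((\<lambda>\<theta>. g (y + \<theta> *\<^sub>R a)) has_vector_derivative g' a) (at \<theta>)"
proof -
  have "((\<lambda>\<theta>. y + \<theta> *\<^sub>R a) has_derivative (\<lambda>h. h *\<^sub>R a)) (at \<theta>)"
    by (auto intro!: derivative_eq_intros)
  from has_derivative_compose[OF this assms] show ?thesis
    by (simp add: has_vector_derivative_def o_def blinfun.scaleR_right)
qed

lemma has_vector_derivative_quotient:
  fixes p :: "real \<Rightarrow> 'a::real_normed_vector"
  assumes "(p has_vector_derivative v) (at 0)"
  shows "((\<lambda>h. (1 / h) *\<^sub>R (p h - p 0)) \<longlongrightarrow> v) (at 0)"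
proof -
  have "((\<lambda>h. norm (p h - p 0 - h *\<^sub>R v) / norm h) \<longlongrightarrow> 0) (at 0)"
    using assms by (simp add: has_vector_derivative_def has_derivative_at)
  moreover have "norm (p h - p 0 - h *\<^sub>R v) / norm h = norm ((1 / h) *\<^sub>R (p h - p 0) - v)" if "h \<noteq> 0" for h
  proof -
    have "(1 / h) *\<^sub>R (p h - p 0) - v = (1 / h) *\<^sub>R (p h - p 0 - h *\<^sub>R v)"
      using that by (simp add: scaleR_diff_right)
    then show ?thesis by (simp add: divide_inverse mult.commute)
  qed
  then have "\<forall>\<^sub>F h in at 0. norm (p h - p 0 - h *\<^sub>R v) / norm h = norm ((1 / h) *\<^sub>R (p h - p 0) - v)"
    by (simp add: eventually_at_filter)
  ultimately have "((\<lambda>h. norm ((1 / h) *\<^sub>R (p h - p 0) - v)) \<longlongrightarrow> 0) (at 0)"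
    by (rule Lim_transform_eventually)
  then show ?thesis by (simp add: tendsto_norm_zero_iff LIM_zero_iff)
qed

lemma taylor_first_on_convex:
  assumes S: "convex S" "a \<in> S" "b \<in> S"
    and d: "\<And>x. x \<in> S \<Longrightarrow> (g has_derivative blinfun_apply (g1 x)) (at x)"
    and L: "\<And>x. x \<in> S \<Longrightarrow> norm (g1 x - A) \<le> L"
  shows "norm (g b - g a - A (b - a)) \<le> L * norm (b - a)"
proof -
  have "norm ((g b - A b) - (g a - A a)) \<le> L * norm (b - a)"
  proof (rule differentiable_bound[OF S(1) _ _ S(3,2)])
    fix x assume x: "x \<in> S"
    show "((\<lambda>x. g x - A x) has_derivative blinfun_apply (g1 x - A)) (at x within S)"
      unfolding blinfun.diff_left
      by (intro has_derivative_diff has_derivative_at_withinI[OF d[OF x]] bounded_linear_imp_has_derivative blinfun.bounded_linear_right)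
    show "onorm (blinfun_apply (g1 x - A)) \<le> L" using L[OF x] by (simp add: norm_blinfun.rep_eq)
  qed
  then show ?thesis by (simp add: blinfun.diff_right algebra_simps)
qed

lemma taylor_second_on_convex:
  fixes g :: "'a::real_normed_vector \<Rightarrow> 'b::real_normed_vector"
  assumes S: "convex S" "a \<in> S" "a + h \<in> S"
    and d1: "\<And>x. x \<in> S \<Longrightarrow> (g has_derivative blinfun_apply (g1 x)) (at x)"
    and d2: "\<And>x. x \<in> S \<Longrightarrow> (g1 has_derivative blinfun_apply (g2 x)) (at x)"
    and L: "\<And>x y. x \<in> S \<Longrightarrow> y \<in> S \<Longrightarrow> norm (g2 x - g2 y) \<le> L * norm (x - y)" and L0: "0 \<le> L"
  shows "norm (g (a + h) - g a - g1 a h - (1/2) *\<^sub>R g2 a h h) \<le> L * norm h ^ 3"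
proof -
  have seg: "a + \<theta> *\<^sub>R h \<in> S" if "0 \<le> \<theta>" "\<theta> \<le> 1" for \<theta>
    using convexD_alt[OF S that] by (simp add: algebra_simps)
  let ?p = "\<lambda>\<theta>. g (a + \<theta> *\<^sub>R h) - \<theta> *\<^sub>R g1 a h - (\<theta>\<^sup>2 / 2) *\<^sub>R g2 a h h"
  have "norm (?p 1 - ?p 0) \<le> L * norm h ^ 3"
  proof (rule mean_value_norm_bound)
    fix \<theta> :: real assume \<theta>: "0 \<le> \<theta>" "\<theta> \<le> 1"
    have lin: "((\<lambda>\<theta>. \<theta> *\<^sub>R w) has_vector_derivative w) (at \<theta>)" for w :: 'b
      by (auto intro!: derivative_eq_intros)
    have quad: "((\<lambda>\<theta>. (\<theta>\<^sup>2 / 2) *\<^sub>R w) has_vector_derivative \<theta> *\<^sub>R w) (at \<theta>)" for w :: 'b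
      unfolding has_vector_derivative_def by (auto intro!: derivative_eq_intros simp: mult.commute)
    show "(?p has_vector_derivative (g1 (a + \<theta> *\<^sub>R h) - g1 a - \<theta> *\<^sub>R g2 a h) h) (at \<theta>)"
      using has_vector_derivative_diff[OF has_vector_derivative_diff[OF
          has_vector_derivative_along_line[OF d1[OF seg[OF \<theta>]]] lin[of "g1 a h"]] quad[of "g2 a h h"]]
      by (simp add: blinfun.diff_left blinfun.scaleR_left)
  next
    fix \<theta> :: real assume \<theta>: "0 < \<theta>" "\<theta> < 1"
    let ?S = "closed_segment a (a + \<theta> *\<^sub>R h)"
    have sub: "?S \<subseteq> S" using S(1,2) seg \<theta> by (intro closed_segment_subset) auto
    have "norm (g1 (a + \<theta> *\<^sub>R h) - g1 a - g2 a (a + \<theta> *\<^sub>R h - a)) \<le> (L * norm h) * norm (a + \<theta> *\<^sub>R h - a)"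
    proof (rule taylor_first_on_convex[of ?S])
      fix x assume x: "x \<in> ?S"
      show "(g1 has_derivative blinfun_apply (g2 x)) (at x)" using x sub by (intro d2) auto
      have "norm (x - a) \<le> norm (\<theta> *\<^sub>R h)" using segment_bound(1)[OF x] by simp
      also have "\<dots> \<le> norm h" using \<theta> by (simp add: mult_left_le_one_le)
      finally show "norm (g2 x - g2 a) \<le> L * norm h"
        using x sub S(2) L0 by (intro order_trans[OF L] mult_left_mono) auto
    qed auto
    also have "\<dots> \<le> (L * norm h) * norm h" using \<theta> L0 by (intro mult_left_mono) (auto simp: mult_left_le_one_le)
    finally have "norm (g1 (a + \<theta> *\<^sub>R h) - g1 a - \<theta> *\<^sub>R g2 a h) \<le> L * norm h * norm h"
      by (simp add: blinfun.scaleR_right)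
    then have "norm ((g1 (a + \<theta> *\<^sub>R h) - g1 a - \<theta> *\<^sub>R g2 a h) h) \<le> (L * norm h * norm h) * norm h"
      by (meson mult_right_mono norm_blinfun norm_ge_zero order_trans)
    then show "norm ((g1 (a + \<theta> *\<^sub>R h) - g1 a - \<theta> *\<^sub>R g2 a h) h) \<le> L * norm h ^ 3"
      by (simp add: power3_eq_cube mult.assoc)
  qed
  then show ?thesis by (simp add: algebra_simps)
qed

text \<open>
  The second difference of \<open>\<phi>\<close> over the parallelogram with sides \<open>t u\<close> and \<open>t v\<close> equals
  \<open>t\<^sup>2 \<phi>2 x u v\<close> up to \<open>o(t\<^sup>2)\<close>, and it does not change when \<open>u\<close> and \<open>v\<close> are exchanged.
\<close>

lemma second_derivative_symmetric:
  fixes \<phi> :: "'a::real_normed_vector \<Rightarrow> 'b::real_normed_vector"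
  assumes S: "open S" "x \<in> S"
    and d1: "\<And>y. y \<in> S \<Longrightarrow> (\<phi> has_derivative blinfun_apply (\<phi>1 y)) (at y)"
    and d2: "\<And>y. y \<in> S \<Longrightarrow> (\<phi>1 has_derivative blinfun_apply (\<phi>2 y)) (at y)"
    and cont: "continuous_on S \<phi>2"
  shows "\<phi>2 x u v = \<phi>2 x v u"
proof -
  have "norm (\<phi>2 x u v - \<phi>2 x v u) \<le> 0 + e" if e: "0 < e" for e
  proof -
    let ?c = "2 * norm u * norm v + 1"
    have c: "0 < ?c" by (intro add_nonneg_pos) auto
    define \<epsilon> where "\<epsilon> = e / ?c"
    have \<epsilon>: "0 < \<epsilon>" using e c by (simp add: \<epsilon>_def)
    have "isCont \<phi>2 x" using cont S by (simp add: continuous_on_eq_continuous_at)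
    then obtain d0 where d0: "0 < d0" "\<And>y. dist y x < d0 \<Longrightarrow> dist (\<phi>2 y) (\<phi>2 x) < \<epsilon>"
      using \<epsilon> unfolding continuous_at_eps_delta by blast
    obtain d1' where d1': "0 < d1'" "ball x d1' \<subseteq> S" using S by (auto simp: open_contains_ball)
    define r where "r = min d0 d1'"
    have r: "0 < r" "ball x r \<subseteq> S" "\<And>y. y \<in> ball x r \<Longrightarrow> norm (\<phi>2 y - \<phi>2 x) \<le> \<epsilon>"
    proof -
      show "0 < r" "ball x r \<subseteq> S" using d0(1) d1' by (auto simp: r_def)
      fix y assume "y \<in> ball x r"
      then have "dist y x < d0" by (simp add: r_def dist_commute)
      then show "norm (\<phi>2 y - \<phi>2 x) \<le> \<epsilon>" using d0(2)[of y] by (simp add: dist_norm)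
    qed
    define t where "t = r / (2 * (norm u + norm v + 1))"
    have n1: "0 < norm u + norm v + 1" by (intro add_nonneg_pos) auto
    have t: "0 < t" using r(1) n1 by (simp add: t_def)
    have "t * (norm u + norm v) \<le> t * (norm u + norm v + 1)" using t by simp
    also have "\<dots> = r / 2"
    proof -
      have div: "r / (2 * n) * n = r / 2" if "n \<noteq> 0" for n :: real using that by simp
      show ?thesis unfolding t_def by (rule div) (use n1 in linarith)
    qed
    finally have tr: "t * (norm u + norm v) < r" using r(1) by linarith
    have inb: "x + a *\<^sub>R u + b *\<^sub>R v \<in> ball x r" if "0 \<le> a" "a \<le> t" "0 \<le> b" "b \<le> t" for a b
    proof -
      have "norm (a *\<^sub>R u + b *\<^sub>R v) \<le> a * norm u + b * norm v" using that norm_triangle_ineq[of "a *\<^sub>R u" "b *\<^sub>R v"] by simp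
      also have "\<dots> \<le> t * norm u + t * norm v" using that by (intro add_mono mult_right_mono) auto
      also have "\<dots> < r" using tr by (simp add: algebra_simps)
      finally have "norm (a *\<^sub>R u + b *\<^sub>R v) < r" .
      moreover have "x - (x + a *\<^sub>R u + b *\<^sub>R v) = - (a *\<^sub>R u + b *\<^sub>R v)" by simp
      ultimately show ?thesis by (simp only: mem_ball dist_norm norm_minus_cancel)
    qed
    \<comment> \<open>Stated for fresh \<open>u\<close> and \<open>v\<close>, so that it also applies with the two sides exchanged.\<close>
    have key: "norm (\<phi> (x + t *\<^sub>R u + t *\<^sub>R v) - \<phi> (x + t *\<^sub>R v) - (\<phi> (x + t *\<^sub>R u) - \<phi> x) - (t * t) *\<^sub>R \<phi>2 x u v) \<le> \<epsilon> * (t * norm u) * (t * norm v)"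
      if inb: "\<And>a b. 0 \<le> a \<Longrightarrow> a \<le> t \<Longrightarrow> 0 \<le> b \<Longrightarrow> b \<le> t \<Longrightarrow> x + a *\<^sub>R u + b *\<^sub>R v \<in> ball x r" for u v
    proof -
      let ?p = "\<lambda>\<theta>. \<phi> ((x + t *\<^sub>R u) + \<theta> *\<^sub>R (t *\<^sub>R v)) - \<phi> (x + \<theta> *\<^sub>R (t *\<^sub>R v)) - \<theta> *\<^sub>R (t * t) *\<^sub>R \<phi>2 x u v"
      have in1: "x + t *\<^sub>R u + \<theta> *\<^sub>R t *\<^sub>R v \<in> ball x r" "x + \<theta> *\<^sub>R t *\<^sub>R v \<in> ball x r" if "0 \<le> \<theta>" "\<theta> \<le> 1" for \<theta>
        using inb[of t "\<theta> * t"] inb[of 0 "\<theta> * t"] that t by (auto simp: mult_left_le_one_le)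
      have "norm (?p 1 - ?p 0) \<le> \<epsilon> * (t * norm u) * (t * norm v)"
      proof (rule mean_value_norm_bound)
        fix \<theta> :: real assume \<theta>: "0 \<le> \<theta>" "\<theta> \<le> 1"
        have in2: "x + t *\<^sub>R u + \<theta> *\<^sub>R t *\<^sub>R v \<in> S" "x + \<theta> *\<^sub>R t *\<^sub>R v \<in> S" using in1[OF \<theta>] r(2) by auto
        show "(?p has_vector_derivative (\<phi>1 (x + t *\<^sub>R u + \<theta> *\<^sub>R t *\<^sub>R v) - \<phi>1 (x + \<theta> *\<^sub>R t *\<^sub>R v) - \<phi>2 x (t *\<^sub>R u)) (t *\<^sub>R v)) (at \<theta>)"
        proof -
          have lin: "((\<lambda>\<theta>. \<theta> *\<^sub>R w) has_vector_derivative w) (at \<theta>)" for w :: 'b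
            by (auto intro!: derivative_eq_intros)
          show ?thesis
            using has_vector_derivative_diff[OF has_vector_derivative_diff[OF
              has_vector_derivative_along_line[OF d1[OF in2(1)]] has_vector_derivative_along_line[OF d1[OF in2(2)]]]
              lin[of "(t * t) *\<^sub>R \<phi>2 x u v"]]
            by (simp add: blinfun.diff_left blinfun.scaleR_left blinfun.scaleR_right blinfun.diff_right scaleR_diff_right)
        qed
      next
        fix \<theta> :: real assume \<theta>: "0 < \<theta>" "\<theta> < 1"
        have "norm (\<phi>1 (x + t *\<^sub>R u + \<theta> *\<^sub>R t *\<^sub>R v) - \<phi>1 (x + \<theta> *\<^sub>R t *\<^sub>R v) - \<phi>2 x ((x + t *\<^sub>R u + \<theta> *\<^sub>R t *\<^sub>R v) - (x + \<theta> *\<^sub>R t *\<^sub>R v)))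
            \<le> \<epsilon> * norm ((x + t *\<^sub>R u + \<theta> *\<^sub>R t *\<^sub>R v) - (x + \<theta> *\<^sub>R t *\<^sub>R v))"
          by (rule taylor_first_on_convex[of "ball x r"]) (use in1 \<theta> r(2) in \<open>auto intro!: d2 r(3)\<close>)
        then have "norm (\<phi>1 (x + t *\<^sub>R u + \<theta> *\<^sub>R t *\<^sub>R v) - \<phi>1 (x + \<theta> *\<^sub>R t *\<^sub>R v) - \<phi>2 x (t *\<^sub>R u)) \<le> \<epsilon> * (t * norm u)"
          using t by simp
        then have "norm ((\<phi>1 (x + t *\<^sub>R u + \<theta> *\<^sub>R t *\<^sub>R v) - \<phi>1 (x + \<theta> *\<^sub>R t *\<^sub>R v) - \<phi>2 x (t *\<^sub>R u)) (t *\<^sub>R v)) \<le> \<epsilon> * (t * norm u) * norm (t *\<^sub>R v)"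
          by (meson mult_right_mono norm_blinfun norm_ge_zero order_trans)
        then show "norm ((\<phi>1 (x + t *\<^sub>R u + \<theta> *\<^sub>R t *\<^sub>R v) - \<phi>1 (x + \<theta> *\<^sub>R t *\<^sub>R v) - \<phi>2 x (t *\<^sub>R u)) (t *\<^sub>R v)) \<le> \<epsilon> * (t * norm u) * (t * norm v)"
          using t by simp
      qed
      then show ?thesis by (simp add: algebra_simps)
    qed
    let ?s = "\<phi> (x + t *\<^sub>R u + t *\<^sub>R v) - \<phi> (x + t *\<^sub>R v) - (\<phi> (x + t *\<^sub>R u) - \<phi> x)"
    have uv: "norm (?s - (t * t) *\<^sub>R \<phi>2 x u v) \<le> \<epsilon> * (t * norm u) * (t * norm v)"
      by (rule key[OF inb])
    have inb': "x + a *\<^sub>R v + b *\<^sub>R u \<in> ball x r" if "0 \<le> a" "a \<le> t" "0 \<le> b" "b \<le> t" for a b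
      using inb[of b a] that by (simp add: add_ac)
    have swap: "\<phi> (x + t *\<^sub>R v + t *\<^sub>R u) - \<phi> (x + t *\<^sub>R u) - (\<phi> (x + t *\<^sub>R v) - \<phi> x) = ?s" by (simp add: algebra_simps)
    have vu: "norm (?s - (t * t) *\<^sub>R \<phi>2 x v u) \<le> \<epsilon> * (t * norm v) * (t * norm u)"
      using key[OF inb'] unfolding swap .
    have "(t * t) *\<^sub>R (\<phi>2 x u v - \<phi>2 x v u) = (?s - (t * t) *\<^sub>R \<phi>2 x v u) - (?s - (t * t) *\<^sub>R \<phi>2 x u v)"
      by (simp add: scaleR_diff_right)
    then have "norm ((t * t) *\<^sub>R (\<phi>2 x u v - \<phi>2 x v u)) \<le> \<epsilon> * (t * norm v) * (t * norm u) + \<epsilon> * (t * norm u) * (t * norm v)"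
      by (simp only:) (rule order_trans[OF norm_triangle_ineq4 add_mono[OF vu uv]])
    then have "(t * t) * norm (\<phi>2 x u v - \<phi>2 x v u) \<le> (t * t) * (\<epsilon> * (2 * norm u * norm v))"
      unfolding norm_scaleR using t by (simp add: mult_ac)
    then have "norm (\<phi>2 x u v - \<phi>2 x v u) \<le> \<epsilon> * (2 * norm u * norm v)" using t by simp
    also have "\<dots> \<le> \<epsilon> * ?c" using \<epsilon> by (intro mult_left_mono) auto
    also have "\<dots> = e"
    proof -
      have div: "e / c * c = e" if "c \<noteq> 0" for c :: real using that by simp
      show ?thesis unfolding \<epsilon>_def by (rule div) (use c in linarith)
    qed
    finally show ?thesis by simp
  qed
  then have "norm (\<phi>2 x u v - \<phi>2 x v u) \<le> 0" by (rule field_le_epsilon)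
  then show ?thesis by simp
qed

lemma compose_le: "norm A \<le> r \<Longrightarrow> norm B \<le> s \<Longrightarrow> norm (A o\<^sub>L B) \<le> r * s"
  for A :: "'x::real_normed_vector \<Rightarrow>\<^sub>L 'y::real_normed_vector" and B :: "'z::real_normed_vector \<Rightarrow>\<^sub>L 'x"
  by (meson mult_mono norm_blinfun_compose norm_ge_zero order_trans)

lemma apply_le: "norm A \<le> r \<Longrightarrow> norm x \<le> s \<Longrightarrow> norm (blinfun_apply A x) \<le> r * s"
  by (meson mult_mono norm_blinfun norm_ge_zero order_trans)

lemma lipschitz_of_bounded_derivative:
  assumes "\<And>x. (g has_derivative blinfun_apply (g1 x)) (at x)" "\<And>x. norm (g1 x) \<le> H"
  shows "norm (g x - g y) \<le> H * norm (x - y)"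
  using assms by (intro differentiable_bound[of UNIV g "\<lambda>x. blinfun_apply (g1 x)"])
    (auto simp flip: norm_blinfun.rep_eq)

text \<open>
  The derivative is a parameter and not computed from \<open>g\<close>. Thus \<open>f, f1\<close> and \<open>f1, f2\<close> can both be
  instances, which is how a function with three bounded derivatives enters below.
\<close>

locale C2_bounded =
  fixes g :: "'a::real_normed_vector \<Rightarrow> 'b::real_normed_vector" and g1 :: "'a \<Rightarrow> 'a \<Rightarrow>\<^sub>L 'b" and H :: real
  assumes deriv: "(g has_derivative blinfun_apply (g1 x)) (at x)"
    and bound: "norm (g1 x) \<le> H"
    and lip: "norm (g1 x - g1 y) \<le> H * norm (x - y)"
begin

lemma H_nonneg: "0 \<le> H"
  using bound[of undefined] norm_ge_zero order_trans by blast

lemma taylor_first: "norm (g (y + a) - g y - g1 y a) \<le> H * (norm a)\<^sup>2"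
proof -
  let ?p = "\<lambda>\<theta>. g (y + \<theta> *\<^sub>R a) - \<theta> *\<^sub>R g1 y a"
  have "norm (?p 1 - ?p 0) \<le> H * norm a * norm a"
  proof (rule mean_value_norm_bound)
    fix \<theta> :: real
    show "(?p has_vector_derivative (g1 (y + \<theta> *\<^sub>R a) - g1 y) a) (at \<theta>)"
      by (rule derivative_eq_intros has_vector_derivative_along_line deriv refl)+
        (simp add: blinfun.diff_left)
    assume \<theta>: "0 < \<theta>" "\<theta> < 1"
    have "norm (g1 (y + \<theta> *\<^sub>R a) - g1 y) \<le> H * (\<theta> * norm a)" using lip[of "y + \<theta> *\<^sub>R a" y] \<theta> by simp
    also have "\<dots> \<le> H * (1 * norm a)" using \<theta> H_nonneg by (intro mult_left_mono mult_right_mono) auto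
    finally show "norm ((g1 (y + \<theta> *\<^sub>R a) - g1 y) a) \<le> H * norm a * norm a"
      by (metis mult_1 mult_right_mono norm_blinfun norm_ge_zero order_trans)
  qed
  then show ?thesis by (simp add: power2_eq_square algebra_simps)
qed

text \<open>
  The increments of \<open>g\<close> from two base points are compared. The right-hand side is linear in
  \<open>y - z\<close> and \<open>a - c\<close>, as needed to propagate differences of two paths. It follows by
  differentiating along both segments at the same parameter.
\<close>

lemma four_point:
  "norm ((g (y + a) - g y) - (g (z + c) - g z)) \<le> H * norm (a - c) + H * (norm (y - z) + norm (a - c)) * norm a"
proof -
  let ?p = "\<lambda>\<theta>. g (y + \<theta> *\<^sub>R a) - g (z + \<theta> *\<^sub>R c)"
  have "norm (?p 1 - ?p 0) \<le> H * norm (a - c) + H * (norm (y - z) + norm (a - c)) * norm a"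
  proof (rule mean_value_norm_bound)
    fix \<theta> :: real
    show "(?p has_vector_derivative g1 (y + \<theta> *\<^sub>R a) a - g1 (z + \<theta> *\<^sub>R c) c) (at \<theta>)"
      by (intro has_vector_derivative_diff has_vector_derivative_along_line deriv)
    assume \<theta>: "0 < \<theta>" "\<theta> < 1"
    have e: "g1 (y + \<theta> *\<^sub>R a) a - g1 (z + \<theta> *\<^sub>R c) c =
        g1 (z + \<theta> *\<^sub>R c) (a - c) + (g1 (y + \<theta> *\<^sub>R a) - g1 (z + \<theta> *\<^sub>R c)) a"
      by (simp add: blinfun.diff_left blinfun.diff_right)
    have yz: "y + \<theta> *\<^sub>R a - (z + \<theta> *\<^sub>R c) = (y - z) + \<theta> *\<^sub>R (a - c)" by (simp add: algebra_simps)
    have "norm (y + \<theta> *\<^sub>R a - (z + \<theta> *\<^sub>R c)) \<le> norm (y - z) + \<theta> * norm (a - c)"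
      unfolding yz using norm_triangle_ineq[of "y - z" "\<theta> *\<^sub>R (a - c)"] \<theta> by simp
    also have "\<dots> \<le> norm (y - z) + 1 * norm (a - c)" using \<theta> by (intro add_left_mono mult_right_mono) auto
    finally have "norm (g1 (y + \<theta> *\<^sub>R a) - g1 (z + \<theta> *\<^sub>R c)) \<le> H * (norm (y - z) + norm (a - c))"
      using H_nonneg by (intro order_trans[OF lip] mult_left_mono) auto
    then have "norm ((g1 (y + \<theta> *\<^sub>R a) - g1 (z + \<theta> *\<^sub>R c)) a) \<le> H * (norm (y - z) + norm (a - c)) * norm a"
      by (meson mult_right_mono norm_blinfun norm_ge_zero order_trans)
    then show "norm (g1 (y + \<theta> *\<^sub>R a) a - g1 (z + \<theta> *\<^sub>R c) c)
        \<le> H * norm (a - c) + H * (norm (y - z) + norm (a - c)) * norm a"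
      unfolding e by (rule norm_triangle_le[OF add_mono[OF apply_le[OF bound order_refl]]])
  qed
  then show ?thesis by (simp add: algebra_simps)
qed

end

text \<open>
  For first-order Taylor remainders the estimate improves by one order: \<open>a - c\<close> is now multiplied
  by a small displacement, and \<open>y - z\<close> by the square of one.
\<close>

lemma four_point_taylor:
  assumes g: "C2_bounded g g1 H" and g1: "C2_bounded g1 g2 H"
  shows "norm ((g (y + a) - g y - g1 y a) - (g (z + c) - g z - g1 z c))
    \<le> H * (norm a + norm c) * norm (a - c) + H * (norm (y - z) + norm (a - c)) * (norm a)\<^sup>2"
proof -
  interpret g: C2_bounded g g1 H by fact
  interpret g1: C2_bounded g1 g2 H by fact
  let ?p = "\<lambda>\<theta>. (g (y + \<theta> *\<^sub>R a) - \<theta> *\<^sub>R g1 y a) - (g (z + \<theta> *\<^sub>R c) - \<theta> *\<^sub>R g1 z c)"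
  have "norm (?p 1 - ?p 0) \<le> (H * norm (a - c) + H * (norm (y - z) + norm (a - c)) * norm a) * norm a
      + H * norm c * norm (a - c)"
  proof (rule mean_value_norm_bound)
    fix \<theta> :: real
    show "(?p has_vector_derivative (g1 (y + \<theta> *\<^sub>R a) - g1 y) a - (g1 (z + \<theta> *\<^sub>R c) - g1 z) c) (at \<theta>)"
      by (rule derivative_eq_intros has_vector_derivative_along_line g.deriv refl)+
        (simp add: blinfun.diff_left)
    assume \<theta>: "0 < \<theta>" "\<theta> < 1"
    have e: "(g1 (y + \<theta> *\<^sub>R a) - g1 y) a - (g1 (z + \<theta> *\<^sub>R c) - g1 z) c =
        ((g1 (y + \<theta> *\<^sub>R a) - g1 y) - (g1 (z + \<theta> *\<^sub>R c) - g1 z)) a + (g1 (z + \<theta> *\<^sub>R c) - g1 z) (a - c)"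
      by (simp add: blinfun.diff_left blinfun.diff_right)
    have s: "\<theta> * r \<le> r" if "0 \<le> r" for r using \<theta> that by (simp add: mult_left_le_one_le)
    have "norm ((g1 (y + \<theta> *\<^sub>R a) - g1 y) - (g1 (z + \<theta> *\<^sub>R c) - g1 z))
        \<le> H * norm (\<theta> *\<^sub>R a - \<theta> *\<^sub>R c) + H * (norm (y - z) + norm (\<theta> *\<^sub>R a - \<theta> *\<^sub>R c)) * norm (\<theta> *\<^sub>R a)"
      by (rule g1.four_point)
    also have "\<theta> *\<^sub>R a - \<theta> *\<^sub>R c = \<theta> *\<^sub>R (a - c)" by (simp add: algebra_simps)
    also have "H * norm (\<theta> *\<^sub>R (a - c)) + H * (norm (y - z) + norm (\<theta> *\<^sub>R (a - c))) * norm (\<theta> *\<^sub>R a)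
        \<le> H * norm (a - c) + H * (norm (y - z) + norm (a - c)) * norm a"
      using \<theta> g.H_nonneg s by (intro add_mono mult_mono mult_left_mono order_refl) (auto intro!: mult_nonneg_nonneg)
    finally have 1: "norm (((g1 (y + \<theta> *\<^sub>R a) - g1 y) - (g1 (z + \<theta> *\<^sub>R c) - g1 z)) a)
        \<le> (H * norm (a - c) + H * (norm (y - z) + norm (a - c)) * norm a) * norm a"
      by (meson mult_right_mono norm_blinfun norm_ge_zero order_trans)
    have "norm (g1 (z + \<theta> *\<^sub>R c) - g1 z) \<le> H * (\<theta> * norm c)" using g.lip[of "z + \<theta> *\<^sub>R c" z] \<theta> by simp
    also have "\<dots> \<le> H * norm c" using s g.H_nonneg by (intro mult_left_mono) auto
    finally have 2: "norm ((g1 (z + \<theta> *\<^sub>R c) - g1 z) (a - c)) \<le> H * norm c * norm (a - c)"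
      by (meson mult_right_mono norm_blinfun norm_ge_zero order_trans)
    show "norm ((g1 (y + \<theta> *\<^sub>R a) - g1 y) a - (g1 (z + \<theta> *\<^sub>R c) - g1 z) c) \<le>
      (H * norm (a - c) + H * (norm (y - z) + norm (a - c)) * norm a) * norm a + H * norm c * norm (a - c)"
      unfolding e using 1 2 by (intro norm_triangle_le add_mono)
  qed
  then show ?thesis by (simp add: power2_eq_square algebra_simps)
qed

lemma four_point_compose:
  assumes p: "C2_bounded p p1 H" and q: "C2_bounded q q1 H"
    and bp: "\<And>x. norm (p x) \<le> H" and bq: "\<And>x. norm (q x) \<le> H"
  shows "norm (((p (y + a) o\<^sub>L q (y + a)) - (p y o\<^sub>L q y)) - ((p (z + c) o\<^sub>L q (z + c)) - (p z o\<^sub>L q z)))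
    \<le> 2 * H\<^sup>2 * (norm (a - c) + (norm (y - z) + norm (a - c)) * norm a) + H\<^sup>2 * (norm c * (norm (y - z) + norm (a - c)) + norm (y - z) * norm a)"
proof -
  interpret p: C2_bounded p p1 H by fact
  interpret q: C2_bounded q q1 H by fact
  have H: "0 \<le> H" by (rule p.H_nonneg)
  note lp = lipschitz_of_bounded_derivative[OF p.deriv p.bound] and lq = lipschitz_of_bounded_derivative[OF q.deriv q.bound]
  let ?\<Psi> = "norm (a - c) + (norm (y - z) + norm (a - c)) * norm a"
  have e: "((p (y + a) o\<^sub>L q (y + a)) - (p y o\<^sub>L q y)) - ((p (z + c) o\<^sub>L q (z + c)) - (p z o\<^sub>L q z)) =
     (((p (y + a) - p y - (p (z + c) - p z)) o\<^sub>L q (y + a)) + ((p (z + c) - p z) o\<^sub>L (q (y + a) - q (z + c)))) +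
     (((p y - p z) o\<^sub>L (q (y + a) - q y)) + (p z o\<^sub>L (q (y + a) - q y - (q (z + c) - q z))))"
    by (rule blinfun_eqI) (simp add: blinfun.diff_left blinfun.add_left blinfun.diff_right)
  have yz: "norm (y + a - (z + c)) \<le> norm (y - z) + norm (a - c)" by norm
  have "norm (p (y + a) - p y - (p (z + c) - p z)) \<le> H * ?\<Psi>" "norm (q (y + a) - q y - (q (z + c) - q z)) \<le> H * ?\<Psi>"
    using p.four_point[of y a z c] q.four_point[of y a z c] by (simp_all add: algebra_simps)
  moreover have "norm (q (y + a) - q (z + c)) \<le> H * (norm (y - z) + norm (a - c))"
    using lq[of "y + a" "z + c"] mult_left_mono[OF yz H] by linarith
  ultimately have "norm (((p (y + a) o\<^sub>L q (y + a)) - (p y o\<^sub>L q y)) - ((p (z + c) o\<^sub>L q (z + c)) - (p z o\<^sub>L q z)))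
      \<le> ((H * ?\<Psi>) * H + (H * norm c) * (H * (norm (y - z) + norm (a - c)))) + ((H * norm (y - z)) * (H * norm a) + H * (H * ?\<Psi>))"
    unfolding e using lp[of "z + c" z] lp[of y z] lq[of "y + a" y] bq bp
    by (intro norm_triangle_le add_mono compose_le) auto
  then show ?thesis by (simp add: power2_eq_square algebra_simps)
qed

section \<open>Discrete sewing\<close>

text \<open>
  Cutting an interval of at least two grid cells near its middle leaves pieces of at most two thirds
  of its length, the worst case being \<open>3 = 1 + 2\<close>. The factor \<open>(2/3) powr (\<theta> - 1)\<close> is less than one.
\<close>

lemma powr_split_le:
  fixes p q \<theta> :: real
  assumes "\<theta> > 1" "0 \<le> p" "0 \<le> q" "p \<le> 2/3 * (p + q)" "q \<le> 2/3 * (p + q)"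
  shows "p powr \<theta> + q powr \<theta> \<le> (2/3) powr (\<theta> - 1) * (p + q) powr \<theta>"
proof -
  have e: "x powr \<theta> = x * x powr (\<theta> - 1)" if "0 \<le> x" for x :: real
    using that powr_mult_base[of x "\<theta> - 1"] by simp
  have "p * p powr (\<theta> - 1) \<le> p * (2/3 * (p + q)) powr (\<theta> - 1)"
    "q * q powr (\<theta> - 1) \<le> q * (2/3 * (p + q)) powr (\<theta> - 1)"
    using assms by (auto intro!: mult_left_mono powr_mono2)
  then have "p powr \<theta> + q powr \<theta> \<le> (p + q) * (2/3 * (p + q)) powr (\<theta> - 1)"
    using assms by (simp add: e algebra_simps)
  also have "\<dots> = (2/3) powr (\<theta> - 1) * (p + q) powr \<theta>"
    using assms e[of "p + q"] by (simp only: powr_mult) simp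
  finally show ?thesis .
qed

text \<open>
  Cut \<open>{j..k}\<close> near its middle; by \<open>powr_split_le\<close> the two halves account for a fraction of the
  claimed bound, and the defect may use up the rest. The hypothesis on the defect is only required
  where the bound is already known for the left piece. This matters because the defect of an
  Euler orbit depends on how far the orbit has moved on that piece.
\<close>

lemma discrete_sewing:
  fixes r :: "nat \<Rightarrow> nat \<Rightarrow> 'a::real_normed_vector"
  assumes \<theta>: "\<theta> > 1" and d: "d \<ge> 0" and K: "K \<ge> 0"
    and diag: "\<And>j. j < N \<Longrightarrow> r j (Suc j) = 0"
    and defect: "\<And>j i k. j < i \<Longrightarrow> i < k \<Longrightarrow> k \<le> N \<Longrightarrow>
      norm (r j i) \<le> K * (real (i - j) * d) powr \<theta> \<Longrightarrow>
      norm (r j k - r j i - r i k) \<le> (1 - (2/3) powr (\<theta> - 1)) * K * (real (k - j) * d) powr \<theta>"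
    and "j < k" "k \<le> N"
  shows "norm (r j k) \<le> K * (real (k - j) * d) powr \<theta>"
  using \<open>j < k\<close> \<open>k \<le> N\<close>
proof (induction "k - j" arbitrary: j k rule: less_induct)
  case less
  show ?case
  proof (cases "k = Suc j")
    case True
    then show ?thesis using diag[of j] less.prems K by simp
  next
    case False
    define i where "i = j + (k - j) div 2"
    have i: "j < i" "i < k" using False less.prems by (auto simp: i_def)
    have ij: "norm (r j i) \<le> K * (real (i - j) * d) powr \<theta>"
      using i less.prems by (intro less.hyps) auto
    have ik: "norm (r i k) \<le> K * (real (k - i) * d) powr \<theta>"
      using i less.prems by (intro less.hyps) auto
    have sum: "real (i - j) * d + real (k - i) * d = real (k - j) * d"
      using i by (simp add: of_nat_diff algebra_simps)
    have nats: "3 * (i - j) \<le> 2 * (k - j)" "3 * (k - i) \<le> 2 * (k - j)"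
    proof -
      define l where "l = k - j"
      have "i - j = l div 2" "k - i = l - l div 2" "2 \<le> l"
        using False less.prems by (auto simp: i_def l_def)
      then show "3 * (i - j) \<le> 2 * (k - j)" "3 * (k - i) \<le> 2 * (k - j)"
        unfolding l_def[symmetric] by linarith+
    qed
    have "3 * real (i - j) \<le> 2 * real (k - j)" "3 * real (k - i) \<le> 2 * real (k - j)"
      using nats by linarith+
    then have "3 * real (i - j) * d \<le> 2 * real (k - j) * d" "3 * real (k - i) * d \<le> 2 * real (k - j) * d"
      using d by (auto intro: mult_right_mono)
    then have split: "(real (i - j) * d) powr \<theta> + (real (k - i) * d) powr \<theta> \<le>
        (2/3) powr (\<theta> - 1) * (real (k - j) * d) powr \<theta>"
      using powr_split_le[of \<theta> "real (i - j) * d" "real (k - i) * d"] \<theta> d unfolding sum by auto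
    have "r j k = (r j k - r j i - r i k) + r j i + r i k" by simp
    then have "norm (r j k) \<le> norm (r j k - r j i - r i k) + norm (r j i) + norm (r i k)"
      by (metis norm_triangle_ineq norm_triangle_le add_mono_thms_linordered_semiring(1) order_refl)
    also have "\<dots> \<le> (1 - (2/3) powr (\<theta> - 1)) * K * (real (k - j) * d) powr \<theta>
        + K * ((real (i - j) * d) powr \<theta> + (real (k - i) * d) powr \<theta>)"
      using defect[OF i less.prems(2) ij] ij ik by (simp add: algebra_simps)
    also have "\<dots> \<le> (1 - (2/3) powr (\<theta> - 1)) * K * (real (k - j) * d) powr \<theta>
        + K * ((2/3) powr (\<theta> - 1) * (real (k - j) * d) powr \<theta>)"
      using split K by (intro add_left_mono mult_left_mono)
    finally show ?thesis by (simp add: algebra_simps)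
  qed
qed

lemma iterate_bound_over_windows:
  fixes b :: "nat \<Rightarrow> real"
  assumes F: "mono F"
    and window: "\<And>j k. j \<le> k \<Longrightarrow> k \<le> N \<Longrightarrow> k - j \<le> n \<Longrightarrow> b k \<le> F (b j)"
    and "k \<le> N" "k \<le> p * n"
  shows "b k \<le> (F ^^ p) (b 0)"
  using assms(3,4)
proof (induction p arbitrary: k)
  case (Suc p)
  have "b (k - n) \<le> (F ^^ p) (b 0)" using Suc by auto
  then have "F (b (k - n)) \<le> (F ^^ Suc p) (b 0)" using F by (simp add: monoD)
  then show ?case using window[of "k - n" k] Suc.prems by linarith
qed simp

text \<open>
  A window consists of \<open>n\<close> grid steps and has length at most \<open>h\<close>. How many windows are needed to cover
  time \<open>T\<close> depends on \<open>h\<close> but not on the step size \<open>d\<close>; the factor two pays for rounding \<open>h / d\<close> down.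
\<close>

lemma window_count:
  fixes d h T :: real
  assumes "0 < d" "d \<le> h / 2"
  obtains n :: nat where "real n * d \<le> h" "\<And>N. real N * d \<le> T \<Longrightarrow> N \<le> nat \<lceil>2 * T / h\<rceil> * n"
proof
  let ?n = "nat \<lfloor>h / d\<rfloor>"
  have h: "h > 0" using assms by simp
  have n: "real ?n \<le> h / d" "h / d < real ?n + 1" using assms h by (auto simp: floor_less_iff)
  show "real ?n * d \<le> h" using n(1) assms by (simp only: pos_le_divide_eq)
  have "h < (real ?n + 1) * d" using n(2) assms by (simp only: pos_divide_less_eq)
  then have nd: "h / 2 \<le> real ?n * d" using assms by (simp add: algebra_simps)
  fix N :: nat assume N: "real N * d \<le> T"
  have T: "0 \<le> T" using N assms by (meson dual_order.trans less_imp_le mult_nonneg_nonneg of_nat_0_le_iff)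
  let ?p = "nat \<lceil>2 * T / h\<rceil>"
  have "2 * T / h \<le> real ?p" by (rule real_nat_ceiling_ge)
  then have "T \<le> real ?p * (h / 2)" using h by (simp add: field_simps)
  also have "\<dots> \<le> real ?p * (real ?n * d)" using nd by (intro mult_left_mono) auto
  finally have "real N * d \<le> real (?p * ?n) * d" using N by simp
  then have "real N \<le> real (?p * ?n)" using assms by (metis mult_le_cancel_right_pos)
  then show "N \<le> ?p * ?n" by linarith
qed

lemma small_powr:
  fixes c e \<alpha> :: real
  assumes "\<alpha> > 0" "e > 0"
  obtains h where "0 < h" "h \<le> 1" "\<And>x. 0 \<le> x \<Longrightarrow> x \<le> h \<Longrightarrow> c * x powr \<alpha> \<le> e"
proof
  define c' where "c' = max c 1"
  let ?h = "min 1 ((e / c') powr (1 / \<alpha>))"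
  show "0 < ?h" "?h \<le> 1" using assms by (auto simp: c'_def)
  fix x :: real assume x: "0 \<le> x" "x \<le> ?h"
  have "x powr \<alpha> \<le> ((e / c') powr (1 / \<alpha>)) powr \<alpha>"
    using x assms by (intro powr_mono2) auto
  also have "\<dots> = e / c'" using assms by (simp add: powr_powr c'_def)
  finally have "c' * x powr \<alpha> \<le> e" by (simp add: field_simps c'_def)
  moreover have "c * x powr \<alpha> \<le> c' * x powr \<alpha>" by (simp add: c'_def mult_right_mono)
  ultimately show "c * x powr \<alpha> \<le> e" by linarith
qed

section \<open>Approximate flows and the growth of Euler orbits\<close>

text \<open>
  \<open>J y s t\<close> is the contribution of the rough signal to a step from \<open>y\<close>. The assumption \<open>J_defect\<close>
  compares one long step with two short ones, where \<open>b\<close> is any further displacement present at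
  the intermediate time (from the drift, or from an accumulated error); \<open>J_defect_lip\<close> is the
  corresponding Lipschitz estimate in the starting point. Its constant depends on the size \<open>P\<close> of
  the displacements because they enter quadratically.

  The drift \<open>f0\<close> is kept apart. It is merely Lipschitz, so the defect of a drift step
  \<open>(t - s) f0(y)\<close>, as a function of \<open>y\<close>, has a Lipschitz constant of order \<open>t - s\<close> only, and sewing
  requires a higher order.
\<close>

locale rough_flow =
  fixes f0 :: "'w::banach \<Rightarrow> 'w" and J :: "'w \<Rightarrow> real \<Rightarrow> real \<Rightarrow> 'w" and \<alpha> T H :: real
  assumes \<alpha>: "1/3 < \<alpha>" "\<alpha> \<le> 1/2" and T: "0 < T" and H: "1 \<le> H"
    and drift_lip: "norm (f0 x - f0 y) \<le> H * norm (x - y)"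
    and J_bound: "0 \<le> s \<Longrightarrow> s \<le> t \<Longrightarrow> t \<le> T \<Longrightarrow> t - s \<le> 1 \<Longrightarrow> norm (J y s t) \<le> H * (t - s) powr \<alpha>"
    and J_lip: "0 \<le> s \<Longrightarrow> s \<le> t \<Longrightarrow> t \<le> T \<Longrightarrow> t - s \<le> 1 \<Longrightarrow>
      norm (J y s t - J z s t) \<le> H * (t - s) powr \<alpha> * norm (y - z)"
    and J_defect: "0 \<le> s \<Longrightarrow> s \<le> u \<Longrightarrow> u \<le> t \<Longrightarrow> t \<le> T \<Longrightarrow> t - s \<le> 1 \<Longrightarrow>
      norm (J y s t - J y s u - J (y + J y s u + b) u t)
        \<le> H * (t - s) powr \<alpha> * ((t - s) powr (2 * \<alpha>) + norm b)"
    and J_defect_lip: "0 \<le> P \<Longrightarrow> \<exists>C\<ge>0. \<forall>y z b c s u t. 0 \<le> s \<longrightarrow> s \<le> u \<longrightarrow> u \<le> t \<longrightarrow> t \<le> T \<longrightarrow> t - s \<le> 1 \<longrightarrow>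
      norm b \<le> P * (t - s) powr (2 * \<alpha>) \<longrightarrow> norm c \<le> P * (t - s) powr (2 * \<alpha>) \<longrightarrow>
      norm ((J y s t - J y s u - J (y + J y s u + b) u t) - (J z s t - J z s u - J (z + J z s u + c) u t))
        \<le> C * (t - s) powr \<alpha> * ((t - s) powr (2 * \<alpha>) * norm (y - z) + norm (b - c))"
    and J_continuous: "(\<And>n. 0 \<le> s' n \<and> s' n \<le> t' n \<and> t' n \<le> T) \<Longrightarrow>
      s' \<longlonglongrightarrow> s \<Longrightarrow> t' \<longlonglongrightarrow> t \<Longrightarrow> (\<lambda>n. J y (s' n) (t' n)) \<longlonglongrightarrow> J y s t"
begin

lemma le_powr2: "0 \<le> x \<Longrightarrow> x \<le> y \<Longrightarrow> y \<le> 1 \<Longrightarrow> x \<le> y powr (2 * \<alpha>)"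
proof -
  assume a: "0 \<le> x" "x \<le> y" "y \<le> 1"
  have "x \<le> y" using a by simp
  also have "\<dots> = y powr 1" using a by simp
  also have "\<dots> \<le> y powr (2 * \<alpha>)"
    using a \<alpha> powr_mono'[of "2 * \<alpha>" 1 y] by simp
  finally show ?thesis .
qed

lemma powr3: "x powr (3 * \<alpha>) = x powr \<alpha> * x powr (2 * \<alpha>)"
  by (simp flip: powr_add)

lemma powr2: "x powr (2 * \<alpha>) = x powr \<alpha> * x powr \<alpha>"
  by (simp flip: powr_add)

lemma powr_le_1: "0 \<le> x \<Longrightarrow> x \<le> 1 \<Longrightarrow> 0 \<le> a \<Longrightarrow> x powr a \<le> (1::real)"
  using powr_mono2[of a x 1] by simp

definition step :: "'w \<Rightarrow> real \<Rightarrow> real \<Rightarrow> 'w"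
  where "step y s t = y + (t - s) *\<^sub>R f0 y + J y s t"

definition is_orbit :: "real \<Rightarrow> real \<Rightarrow> nat \<Rightarrow> (nat \<Rightarrow> 'w) \<Rightarrow> bool"
  where "is_orbit a d N y \<longleftrightarrow> 0 \<le> a \<and> 0 < d \<and> a + real N * d \<le> T \<and>
    (\<forall>k<N. y (Suc k) = step (y k) (a + real k * d) (a + real (Suc k) * d))"

text \<open>
  The drift enters as the sum over the points visited, not as \<open>(t - s) f0 (y j)\<close>. The sum is additive
  over adjacent intervals and therefore disappears from the defect.
\<close>

definition remainder :: "real \<Rightarrow> real \<Rightarrow> (nat \<Rightarrow> 'w) \<Rightarrow> nat \<Rightarrow> nat \<Rightarrow> 'w"
  where "remainder a d y j k =
    y k - y j - d *\<^sub>R (\<Sum>i\<in>{j..<k}. f0 (y i)) - J (y j) (a + real j * d) (a + real k * d)"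

definition orbit_window :: "real \<Rightarrow> real \<Rightarrow> real \<Rightarrow> nat \<Rightarrow> (nat \<Rightarrow> 'w) \<Rightarrow> real \<Rightarrow> bool"
  where "orbit_window h a d N y B \<longleftrightarrow>
    is_orbit a d N y \<and> real N * d \<le> h \<and> 0 \<le> B \<and> (\<forall>i<N. norm (f0 (y i)) \<le> B)"

lemma is_orbit_window:
  assumes "is_orbit a d N y" "j \<le> k" "k \<le> N"
  shows "is_orbit (a + real j * d) d (k - j) (\<lambda>i. y (j + i))"
proof -
  have "real k * d \<le> real N * d" using assms by (auto simp: is_orbit_def)
  then have "a + real k * d \<le> T" using assms unfolding is_orbit_def by linarith
  then show ?thesis
    using assms by (auto simp: is_orbit_def algebra_simps)
qed

lemma remainder_step: "is_orbit a d N y \<Longrightarrow> j < N \<Longrightarrow> remainder a d y j (Suc j) = 0"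
  by (simp add: remainder_def is_orbit_def step_def algebra_simps)

lemma remainder_defect:
  assumes "j \<le> i" "i \<le> k"
  shows "remainder a d y j k - remainder a d y j i - remainder a d y i k =
    - (J (y j) (a + real j * d) (a + real k * d) - J (y j) (a + real j * d) (a + real i * d)
       - J (y i) (a + real i * d) (a + real k * d))"
proof -
  have "(\<Sum>i\<in>{j..<k}. f0 (y i)) = (\<Sum>i\<in>{j..<i}. f0 (y i)) + (\<Sum>i\<in>{i..<k}. f0 (y i))"
    using assms by (simp add: sum.atLeastLessThan_concat)
  then show ?thesis by (simp add: remainder_def algebra_simps)
qed

lemma orbit_expand:
  "y i = y j + J (y j) (a + real j * d) (a + real i * d) + (d *\<^sub>R (\<Sum>i\<in>{j..<i}. f0 (y i)) + remainder a d y j i)"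
  by (simp add: remainder_def)

lemma drift_sum_bound:
  assumes "\<And>i. i < N \<Longrightarrow> norm (g i) \<le> B" "j \<le> k" "k \<le> N" "0 \<le> d"
  shows "norm (d *\<^sub>R (\<Sum>i\<in>{j..<k}. (g i :: 'w))) \<le> B * (real (k - j) * d)"
proof -
  have "norm (\<Sum>i\<in>{j..<k}. g i) \<le> real (card {j..<k}) * B"
    using assms by (intro sum_norm_bound) auto
  then have "d * norm (\<Sum>i\<in>{j..<k}. g i) \<le> d * (real (k - j) * B)"
    using assms by (intro mult_left_mono) auto
  then show ?thesis using assms by (simp add: mult_ac)
qed

lemma orbit_time:
  assumes "is_orbit a d N y" "k \<le> N"
  shows "0 \<le> a + real k * d" "a + real k * d \<le> T"
proof -
  have "real k * d \<le> real N * d" using assms by (auto simp: is_orbit_def)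
  then show "a + real k * d \<le> T" using assms unfolding is_orbit_def by linarith
  show "0 \<le> a + real k * d" using assms by (simp add: is_orbit_def)
qed

text \<open>
The share of the bound that is left to the defect in \<open>discrete_sewing\<close> for the exponent \<open>3\<alpha>\<close>.
\<close>

definition gap :: real where "gap = 1 - (2/3) powr (3 * \<alpha> - 1)"

lemma gap: "0 < gap"
  unfolding gap_def using powr_less_mono2_neg[of "3*\<alpha>-1" "2/3" 1] \<alpha> powr_less_mono2[of "3*\<alpha>-1" "2/3" 1] by simp

text \<open>
  Both \<open>h\<close> and \<open>C\<close> are chosen before the drift bound \<open>B\<close>. This is possible because \<open>J_defect\<close> is linear
  in the displacement: the unknown remainder comes with the factor \<open>H x\<^bsup>\<alpha>\<^esup>\<close>, which is absorbed once
  \<open>x \<le> h\<close>, however large \<open>B\<close> is.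
\<close>

lemma orbit_remainder_bound:
  obtains h C where "0 < h" "h \<le> 1" "0 \<le> C"
    "\<And>a d N y B j k. orbit_window h a d N y B \<Longrightarrow> j < k \<Longrightarrow> k \<le> N \<Longrightarrow>
      norm (remainder a d y j k) \<le> C * (1 + B) * (real (k - j) * d) powr (3 * \<alpha>)"
proof -
  obtain h where h: "0 < h" "h \<le> 1" "\<And>x. 0 \<le> x \<Longrightarrow> x \<le> h \<Longrightarrow> H * x powr \<alpha> \<le> gap / 2"
    using small_powr[of \<alpha> "gap / 2" H] \<alpha> gap by auto
  define C where "C = 2 * H / gap"
  have C: "0 \<le> C" "H = gap * C / 2" using gap H by (auto simp: C_def)
  have "norm (remainder a d y j k) \<le> C * (1 + B) * (real (k - j) * d) powr (3 * \<alpha>)"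
    if win: "orbit_window h a d N y B" and jk: "j < k" "k \<le> N" for a d N y B j k
  proof (rule discrete_sewing[where N = N and \<theta> = "3 * \<alpha>", folded gap_def])
    have orb: "is_orbit a d N y" and Nd: "real N * d \<le> h" and B: "0 \<le> B"
      and f0B: "\<And>i. i < N \<Longrightarrow> norm (f0 (y i)) \<le> B"
      using win by (auto simp: orbit_window_def)
    have d: "0 < d" "0 \<le> a" using orb by (auto simp: is_orbit_def)
    show "3 * \<alpha> > 1" "0 \<le> d" "0 \<le> C * (1 + B)" "j < k" "k \<le> N" using \<alpha> d B C jk by auto
    show "remainder a d y j (Suc j) = 0" if "j < N" for j using remainder_step[OF orb that] .
    fix j i k
    assume ji: "j < i" "i < k" "k \<le> N"
      and IH: "norm (remainder a d y j i) \<le> C * (1 + B) * (real (i - j) * d) powr (3 * \<alpha>)"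
    let ?s = "a + real j * d" and ?u = "a + real i * d" and ?t = "a + real k * d"
    let ?x = "real (k - j) * d" and ?K = "C * (1 + B)"
    have x: "?t - ?s = ?x" using ji by (simp add: of_nat_diff algebra_simps)
    have xh: "0 \<le> ?x" "?x \<le> h"
    proof -
      have "?x \<le> real N * d" using ji d by (intro mult_right_mono) auto
      then show "?x \<le> h" using Nd by linarith
      show "0 \<le> ?x" using d by simp
    qed
    have x1: "?x \<le> 1" using xh h by simp
    have xij: "real (i - j) * d \<le> ?x" "0 \<le> real (i - j) * d" using ji d by auto
    have tm: "0 \<le> ?s" "?s \<le> ?u" "?u \<le> ?t" "?t \<le> T"
      using orbit_time[OF orb] ji d by simp_all
    define b where "b = d *\<^sub>R (\<Sum>i\<in>{j..<i}. f0 (y i)) + remainder a d y j i"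
    have "norm (d *\<^sub>R (\<Sum>i\<in>{j..<i}. f0 (y i))) \<le> B * (real (i - j) * d)"
      using f0B ji d by (intro drift_sum_bound[where N = N]) auto
    then have "norm b \<le> B * (real (i - j) * d) + ?K * (real (i - j) * d) powr (3 * \<alpha>)"
      unfolding b_def using IH by (intro norm_triangle_le add_mono)
    also have "\<dots> \<le> B * ?x powr (2 * \<alpha>) + ?K * ?x powr (3 * \<alpha>)"
      using B C xij x1 \<alpha> by (intro add_mono mult_left_mono le_powr2 powr_mono2) auto
    finally have b: "norm b \<le> B * ?x powr (2 * \<alpha>) + ?K * ?x powr (3 * \<alpha>)" .
    have "norm (remainder a d y j k - remainder a d y j i - remainder a d y i k)
        = norm (J (y j) ?s ?t - J (y j) ?s ?u - J (y i) ?u ?t)"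
      using ji by (simp only: remainder_defect less_imp_le norm_minus_cancel)
    also have "\<dots> \<le> H * ?x powr \<alpha> * (?x powr (2 * \<alpha>) + norm b)"
      using J_defect[OF tm, of "y j" b] orbit_expand[of y i j a d] x1 unfolding x b_def by simp
    also have "\<dots> \<le> H * ?x powr \<alpha> * (?x powr (2 * \<alpha>) + (B * ?x powr (2 * \<alpha>) + ?K * ?x powr (3 * \<alpha>)))"
      using b H by (intro mult_left_mono add_left_mono) auto
    also have "\<dots> = H * (1 + B) * ?x powr (3 * \<alpha>) + (H * ?x powr \<alpha>) * ?K * ?x powr (3 * \<alpha>)"
      unfolding powr3 by (simp add: algebra_simps)
    also have "(H * ?x powr \<alpha>) * ?K * ?x powr (3 * \<alpha>) \<le> (gap / 2) * ?K * ?x powr (3 * \<alpha>)"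
    proof (intro mult_right_mono)
      show "H * ?x powr \<alpha> \<le> gap / 2" using h(3)[of ?x] xh by simp
      show "0 \<le> ?K" using B C by simp
    qed simp
    also have "H * (1 + B) * ?x powr (3 * \<alpha>) = (gap / 2) * ?K * ?x powr (3 * \<alpha>)"
      using C(2) by simp
    finally show "norm (remainder a d y j k - remainder a d y j i - remainder a d y i k)
      \<le> gap * ?K * ?x powr (3 * \<alpha>)" by (simp add: algebra_simps)
  qed
  then show ?thesis by (rule that[OF h(1,2) C(1)])
qed

lemma J_same [simp]: "0 \<le> s \<Longrightarrow> s \<le> T \<Longrightarrow> J y s s = 0"
  using J_bound[of s s y] by simp

lemma orbit_local_expansion:
  obtains h C where "0 < h" "h \<le> 1" "0 \<le> C"
    "\<And>a d N y B j k. orbit_window h a d N y B \<Longrightarrow> j \<le> k \<Longrightarrow> k \<le> N \<Longrightarrow>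
      norm (remainder a d y j k) \<le> C * (1 + B) * (real (k - j) * d) powr (3 * \<alpha>) \<and>
      norm (d *\<^sub>R (\<Sum>i\<in>{j..<k}. f0 (y i)) + remainder a d y j k)
        \<le> C * (1 + B) * (real (k - j) * d) powr (2 * \<alpha>) \<and>
      norm (y k - y j) \<le> C * (1 + B) * (real (k - j) * d) powr \<alpha>"
proof -
  obtain h C where h: "0 < h" "h \<le> 1" "0 \<le> C"
    and rem: "\<And>a d N y B j k. orbit_window h a d N y B \<Longrightarrow> j < k \<Longrightarrow> k \<le> N \<Longrightarrow>
      norm (remainder a d y j k) \<le> C * (1 + B) * (real (k - j) * d) powr (3 * \<alpha>)"
    by (rule orbit_remainder_bound) blast
  let ?C = "1 + H + C"
  have C: "0 \<le> ?C" using h H by simp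
  have "norm (remainder a d y j k) \<le> ?C * (1 + B) * (real (k - j) * d) powr (3 * \<alpha>) \<and>
      norm (d *\<^sub>R (\<Sum>i\<in>{j..<k}. f0 (y i)) + remainder a d y j k)
        \<le> ?C * (1 + B) * (real (k - j) * d) powr (2 * \<alpha>) \<and>
      norm (y k - y j) \<le> ?C * (1 + B) * (real (k - j) * d) powr \<alpha>"
    if win: "orbit_window h a d N y B" and jk: "j \<le> k" "k \<le> N" for a d N y B j k
  proof (cases "j = k")
    case True
    then show ?thesis using orbit_time[of a d N y k] win jk by (simp add: remainder_def orbit_window_def)
  next
    case False
    have orb: "is_orbit a d N y" and Nd: "real N * d \<le> h" and B: "0 \<le> B"
      and f0B: "\<And>i. i < N \<Longrightarrow> norm (f0 (y i)) \<le> B"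
      using win by (auto simp: orbit_window_def)
    have d: "0 < d" using orb by (simp add: is_orbit_def)
    define x where "x = real (k - j) * d"
    have "x \<le> real N * d" using jk d unfolding x_def by (intro mult_right_mono) auto
    then have x: "x \<le> 1" "0 \<le> x" using Nd h d by (linarith, simp add: x_def)
    have tx: "(a + real k * d) - (a + real j * d) = x"
      using jk by (simp add: x_def of_nat_diff algebra_simps)
    have r: "norm (remainder a d y j k) \<le> C * (1 + B) * x powr (3 * \<alpha>)"
      unfolding x_def using False jk by (intro rem[OF win]) auto
    have s: "norm (d *\<^sub>R (\<Sum>i\<in>{j..<k}. f0 (y i))) \<le> B * x"
      unfolding x_def using f0B jk d by (intro drift_sum_bound[where N = N]) auto
    have p: "x \<le> x powr (2 * \<alpha>)" "x powr (3 * \<alpha>) \<le> x powr (2 * \<alpha>)" "x powr (2 * \<alpha>) \<le> x powr \<alpha>"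
      using x \<alpha> by (auto intro!: le_powr2 powr_mono')
    have "norm (d *\<^sub>R (\<Sum>i\<in>{j..<k}. f0 (y i)) + remainder a d y j k) \<le> B * x + C * (1 + B) * x powr (3 * \<alpha>)"
      using r s by (intro norm_triangle_le add_mono)
    also have "\<dots> \<le> B * x powr (2 * \<alpha>) + C * (1 + B) * x powr (2 * \<alpha>)"
      using p B h by (intro add_mono mult_left_mono) auto
    also have "\<dots> \<le> (1 + C) * (1 + B) * x powr (2 * \<alpha>)"
      by (simp add: algebra_simps)
    finally have e: "norm (d *\<^sub>R (\<Sum>i\<in>{j..<k}. f0 (y i)) + remainder a d y j k)
      \<le> (1 + C) * (1 + B) * x powr (2 * \<alpha>)" .
    have "norm (y k - y j) \<le> norm (J (y j) (a + real j * d) (a + real k * d)) +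
        norm (d *\<^sub>R (\<Sum>i\<in>{j..<k}. f0 (y i)) + remainder a d y j k)"
      by (rule order_trans[OF eq_refl norm_triangle_ineq]) (simp add: remainder_def)
    also have "\<dots> \<le> H * x powr \<alpha> + (1 + C) * (1 + B) * x powr (2 * \<alpha>)"
      using J_bound[of "a + real j * d" "a + real k * d" "y j"] orbit_time[OF orb] jk x d e
      unfolding tx by (intro add_mono) auto
    also have "\<dots> \<le> H * (1 + B) * x powr \<alpha> + (1 + C) * (1 + B) * x powr \<alpha>"
      using p B h H by (intro add_mono mult_left_mono mult_right_mono) auto
    finally have 3: "norm (y k - y j) \<le> ?C * (1 + B) * x powr \<alpha>" by (simp add: algebra_simps)
    have "C * (1 + B) * x powr (3 * \<alpha>) \<le> ?C * (1 + B) * x powr (3 * \<alpha>)"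
      "(1 + C) * (1 + B) * x powr (2 * \<alpha>) \<le> ?C * (1 + B) * x powr (2 * \<alpha>)"
      using B H by (auto intro!: mult_right_mono)
    then show ?thesis using r e 3 unfolding x_def[symmetric] by linarith
  qed
  then show ?thesis by (rule that[OF h(1,2) C])
qed

text \<open>
  The drift need not be bounded. If \<open>S\<close> is the largest displacement in the window, the drift is at
  most \<open>B + H S\<close> there, and the local expansion gives \<open>S \<le> (1 + B) / 2 + S / 2\<close>. The argument is not
  circular since \<open>h\<close> does not depend on the drift bound.
\<close>

lemma orbit_growth_window:
  obtains h where "0 < h" "h \<le> 1"
    "\<And>a d N y B k. is_orbit a d N y \<Longrightarrow> real N * d \<le> h \<Longrightarrow> 0 \<le> B \<Longrightarrow>
      norm (f0 (y 0)) \<le> B \<Longrightarrow> k \<le> N \<Longrightarrow> norm (f0 (y k)) \<le> B + H * (1 + B)"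
proof -
  obtain h C where h: "0 < h" "h \<le> 1" "0 \<le> C"
    and ex: "\<And>a d N y B j k. orbit_window h a d N y B \<Longrightarrow> j \<le> k \<Longrightarrow> k \<le> N \<Longrightarrow>
      norm (remainder a d y j k) \<le> C * (1 + B) * (real (k - j) * d) powr (3 * \<alpha>) \<and>
      norm (d *\<^sub>R (\<Sum>i\<in>{j..<k}. f0 (y i)) + remainder a d y j k)
        \<le> C * (1 + B) * (real (k - j) * d) powr (2 * \<alpha>) \<and>
      norm (y k - y j) \<le> C * (1 + B) * (real (k - j) * d) powr \<alpha>"
    by (rule orbit_local_expansion) blast
  obtain h' where h': "0 < h'" "h' \<le> 1" "\<And>x. 0 \<le> x \<Longrightarrow> x \<le> h' \<Longrightarrow> C * x powr \<alpha> \<le> 1 / (2 * H)"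
    using small_powr[of \<alpha> "1 / (2 * H)" C] \<alpha> H by auto
  have "norm (f0 (y k)) \<le> B + H * (1 + B)"
    if orb: "is_orbit a d N y" and Nd: "real N * d \<le> min h h'" and B: "0 \<le> B"
      and f0B: "norm (f0 (y 0)) \<le> B" and k: "k \<le> N" for a d N y B k
  proof -
    have d: "0 < d" using orb by (simp add: is_orbit_def)
    define S where "S = Max ((\<lambda>i. norm (y i - y 0)) ` {..N})"
    have le: "norm (y i - y 0) \<le> S" if "i \<le> N" for i
      unfolding S_def using that by (intro Max_ge) auto
    have S0: "0 \<le> S" using le[of 0] by simp
    have f: "norm (f0 (y i)) \<le> B + H * S" if "i \<le> N" for i
    proof -
      have "norm (f0 (y i)) \<le> norm (f0 (y 0)) + norm (f0 (y i) - f0 (y 0))" by norm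
      also have "norm (f0 (y i) - f0 (y 0)) \<le> H * S"
        using H by (intro order_trans[OF drift_lip] mult_left_mono le that) auto
      finally show ?thesis using f0B by simp
    qed
    have "norm (y i - y 0) \<le> (1 + B) / 2 + S / 2" if i: "i \<le> N" for i
    proof -
      let ?x = "real (i - 0) * d"
      have "?x \<le> real N * d" using i d by (intro mult_right_mono) auto
      then have x: "?x \<le> h'" "0 \<le> ?x" using Nd d by (linarith, simp)
      have "norm (y i - y 0) \<le> C * (1 + (B + H * S)) * ?x powr \<alpha>"
        using f B H S0 i Nd orb
        by (intro conjunct2[OF conjunct2[OF ex[where N = N]]]) (auto simp: orbit_window_def)
      also have "\<dots> = (1 + (B + H * S)) * (C * ?x powr \<alpha>)" by simp
      also have "\<dots> \<le> (1 + (B + H * S)) * (1 / (2 * H))"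
        using h'(3)[OF x(2,1)] B H S0 by (intro mult_left_mono) auto
      also have "\<dots> = (1 + B) / (2 * H) + S / 2" using H by (simp add: field_simps)
      also have "(1 + B) / (2 * H) \<le> (1 + B) / 2" using H B by (intro divide_left_mono) auto
      finally show ?thesis by simp
    qed
    then have "S \<le> (1 + B) / 2 + S / 2" unfolding S_def by (subst Max_le_iff) auto
    then have "S \<le> 1 + B" by argo
    then have "H * S \<le> H * (1 + B)" using H by (intro mult_left_mono) auto
    then show ?thesis using f[OF k] by simp
  qed
  then show ?thesis using h h' by (intro that[of "min h h'"]) auto
qed

text \<open>
  The window length of \<open>orbit_growth_window\<close> is the same whatever drift bound has been reached, so
  finitely many windows exhaust \<open>[0, T]\<close>.
\<close>

lemma orbit_growth:
  obtains h where "0 < h" "h \<le> 1"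
    "\<And>B. 0 \<le> B \<Longrightarrow> \<exists>B'\<ge>B. \<forall>a d N y k. is_orbit a d N y \<longrightarrow> d \<le> h \<longrightarrow> norm (f0 (y 0)) \<le> B \<longrightarrow> k \<le> N \<longrightarrow>
      norm (f0 (y k)) \<le> B'"
proof -
  obtain h where h: "0 < h" "h \<le> 1"
    and win: "\<And>a d N y B k. is_orbit a d N y \<Longrightarrow> real N * d \<le> h \<Longrightarrow> 0 \<le> B \<Longrightarrow>
      norm (f0 (y 0)) \<le> B \<Longrightarrow> k \<le> N \<Longrightarrow> norm (f0 (y k)) \<le> B + H * (1 + B)"
    by (rule orbit_growth_window) blast
  define F where "F B = B + H * (1 + B)" for B
  have F: "mono F" unfolding F_def using H by (intro monoI add_mono mult_left_mono) auto
  define p where "p = nat \<lceil>2 * T / h\<rceil>"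
  have "norm (f0 (y k)) \<le> (F ^^ p) B"
    if B: "0 \<le> B" and orb: "is_orbit a d N y" and d: "d \<le> h / 2" and f0B: "norm (f0 (y 0)) \<le> B" and k: "k \<le> N"
    for B a d N y k
  proof -
    have d0: "0 < d" and Nd: "real N * d \<le> T" using orb by (auto simp: is_orbit_def)
    obtain n where n: "real n * d \<le> h" "\<And>N. real N * d \<le> T \<Longrightarrow> N \<le> p * n"
      using window_count[OF d0 d] p_def by metis
    have "norm (f0 (y k)) \<le> (F ^^ p) (norm (f0 (y 0)))"
    proof (rule iterate_bound_over_windows[OF F, where N = N and n = n])
      fix j k assume jk: "j \<le> k" "k \<le> N" "k - j \<le> n"
      have "real (k - j) * d \<le> real n * d" using jk d0 by (intro mult_right_mono) auto
      then have "norm (f0 ((\<lambda>i. y (j + i)) (k - j))) \<le> F (norm (f0 (y j)))"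
        unfolding F_def using n by (intro win[OF is_orbit_window[OF orb jk(1,2)]]) auto
      then show "norm (f0 (y k)) \<le> F (norm (f0 (y j)))" using jk by simp
    qed (use k n(2)[OF Nd] in auto)
    also have "\<dots> \<le> (F ^^ p) B" by (rule funpow_mono[OF F f0B])
    finally show ?thesis .
  qed
  note bound = this
  show ?thesis
  proof (rule that[of "h / 2"])
    show "\<exists>B'\<ge>B. \<forall>a d N y k. is_orbit a d N y \<longrightarrow> d \<le> h / 2 \<longrightarrow> norm (f0 (y 0)) \<le> B \<longrightarrow> k \<le> N \<longrightarrow>
      norm (f0 (y k)) \<le> B'" if "0 \<le> B" for B
      by (intro exI[of _ "max B ((F ^^ p) B)"] conjI allI impI max.cobounded1
          max.coboundedI2 bound[OF that])
  qed (use h in auto)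
qed

section \<open>Lipschitz dependence of Euler orbits on the starting point\<close>

text \<open>
  Let \<open>D\<close> be the largest distance of the two orbits in the window. Sewing the difference of the
  remainders gives a bound by \<open>K D\<close>, and then \<open>D \<le> norm (y 0 - z 0) + D / 2\<close> for short windows. Here the
  window length does depend on \<open>B\<close>, because the displacements must be bounded before \<open>J_defect_lip\<close>
  applies; \<open>orbit_growth\<close> has already supplied such a bound.
\<close>

lemma orbit_lipschitz_window:
  assumes B: "0 \<le> B"
  obtains h where "0 < h" "h \<le> 1"
    "\<And>a d N y z k. orbit_window h a d N y B \<Longrightarrow> orbit_window h a d N z B \<Longrightarrow> k \<le> N \<Longrightarrow>
      norm (y k - z k) \<le> 2 * norm (y 0 - z 0)"
proof -
  obtain h0 C where h0: "0 < h0" "h0 \<le> 1" "0 \<le> C"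
    and ex: "\<And>a d N y B j k. orbit_window h0 a d N y B \<Longrightarrow> j \<le> k \<Longrightarrow> k \<le> N \<Longrightarrow>
      norm (remainder a d y j k) \<le> C * (1 + B) * (real (k - j) * d) powr (3 * \<alpha>) \<and>
      norm (d *\<^sub>R (\<Sum>i\<in>{j..<k}. f0 (y i)) + remainder a d y j k)
        \<le> C * (1 + B) * (real (k - j) * d) powr (2 * \<alpha>) \<and>
      norm (y k - y j) \<le> C * (1 + B) * (real (k - j) * d) powr \<alpha>"
    by (rule orbit_local_expansion) blast
  define P where "P = C * (1 + B)"
  have P: "0 \<le> P" using h0 B by (simp add: P_def)
  obtain Q where Q: "0 \<le> Q" and defect_lip: "\<And>y z b c s u t. 0 \<le> s \<Longrightarrow> s \<le> u \<Longrightarrow> u \<le> t \<Longrightarrow> t \<le> T \<Longrightarrow> t - s \<le> 1 \<Longrightarrow>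
      norm b \<le> P * (t - s) powr (2 * \<alpha>) \<Longrightarrow> norm c \<le> P * (t - s) powr (2 * \<alpha>) \<Longrightarrow>
      norm ((J y s t - J y s u - J (y + J y s u + b) u t) - (J z s t - J z s u - J (z + J z s u + c) u t))
        \<le> Q * (t - s) powr \<alpha> * ((t - s) powr (2 * \<alpha>) * norm (y - z) + norm (b - c))"
    using J_defect_lip[OF P] by blast
  define K where "K = 2 * Q * (1 + H) / gap"
  have K: "0 \<le> K" "Q * (1 + H) = gap / 2 * K" using Q H gap by (auto simp: K_def)
  obtain h1 where h1: "0 < h1" "h1 \<le> 1" "\<And>x. 0 \<le> x \<Longrightarrow> x \<le> h1 \<Longrightarrow> Q * x powr \<alpha> \<le> gap / 2"
    using small_powr[of \<alpha> "gap / 2" Q] \<alpha> gap by auto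
  obtain h2 where h2: "0 < h2" "h2 \<le> 1" "\<And>x. 0 \<le> x \<Longrightarrow> x \<le> h2 \<Longrightarrow> (2 * H + K) * x powr \<alpha> \<le> 1 / 2"
    using small_powr[of \<alpha> "1 / 2" "2 * H + K"] \<alpha> by auto
  define h where "h = min h0 (min h1 h2)"
  have h: "0 < h" "h \<le> 1" using h0 h1 h2 by (auto simp: h_def)
  have "norm (y k - z k) \<le> 2 * norm (y 0 - z 0)"
    if wy: "orbit_window h a d N y B" and wz: "orbit_window h a d N z B" and k: "k \<le> N" for a d N y z k
  proof -
    have oy: "is_orbit a d N y" and oz: "is_orbit a d N z" and Nd: "real N * d \<le> h"
      using wy wz by (auto simp: orbit_window_def)
    have wy0: "orbit_window h0 a d N y B" and wz0: "orbit_window h0 a d N z B"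
      using wy wz by (auto simp: orbit_window_def h_def)
    have d: "0 < d" using oy by (simp add: is_orbit_def)
    define D where "D = Max ((\<lambda>i. norm (y i - z i)) ` {..N})"
    have le: "norm (y i - z i) \<le> D" if "i \<le> N" for i
      unfolding D_def using that by (intro Max_ge) auto
    have D0: "0 \<le> D" using order_trans[OF norm_ge_zero le[of 0]] by simp
    have span: "real (k - j) * d \<le> h" "0 \<le> real (k - j) * d" if "k \<le> N" for j k
    proof -
      have "real (k - j) * d \<le> real N * d" using that d by (intro mult_right_mono) auto
      then show "real (k - j) * d \<le> h" using Nd by linarith
      show "0 \<le> real (k - j) * d" using d by simp
    qed
    have drift: "norm (d *\<^sub>R (\<Sum>i\<in>{j..<k}. f0 (y i)) - d *\<^sub>R (\<Sum>i\<in>{j..<k}. f0 (z i))) \<le> H * D * (real (k - j) * d)"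
      if "j \<le> k" "k \<le> N" for j k
    proof -
      have "norm (f0 (y i) - f0 (z i)) \<le> H * D" if "i < N" for i
        using H that by (intro order_trans[OF drift_lip] mult_left_mono le) auto
      then have "norm (d *\<^sub>R (\<Sum>i\<in>{j..<k}. f0 (y i) - f0 (z i))) \<le> H * D * (real (k - j) * d)"
        using that d by (intro drift_sum_bound[where N = N]) auto
      then show ?thesis by (simp add: sum_subtractf scaleR_diff_right)
    qed
    let ?r = "\<lambda>j k. remainder a d y j k - remainder a d z j k"
    have rem: "norm (?r j k) \<le> K * D * (real (k - j) * d) powr (3 * \<alpha>)" if "j < k" "k \<le> N" for j k
    proof (rule discrete_sewing[where N = N and \<theta> = "3 * \<alpha>" and r = ?r, folded gap_def])
      show "3 * \<alpha> > 1" "0 \<le> d" "0 \<le> K * D" "j < k" "k \<le> N" using \<alpha> d K D0 that by auto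
      show "?r j (Suc j) = 0" if "j < N" for j
        using remainder_step[OF oy that] remainder_step[OF oz that] by simp
      fix j i k
      assume ji: "j < i" "i < k" "k \<le> N"
        and IH: "norm (?r j i) \<le> K * D * (real (i - j) * d) powr (3 * \<alpha>)"
      let ?s = "a + real j * d" and ?u = "a + real i * d" and ?t = "a + real k * d"
      let ?x = "real (k - j) * d"
      have x: "?t - ?s = ?x" using ji by (simp add: of_nat_diff algebra_simps)
      have xh: "0 \<le> ?x" "?x \<le> h1" "?x \<le> 1" using span[of k j] ji h by (auto simp: h_def)
      have xij: "real (i - j) * d \<le> ?x" "0 \<le> real (i - j) * d" using ji d by auto
      have tm: "0 \<le> ?s" "?s \<le> ?u" "?u \<le> ?t" "?t \<le> T"
        using orbit_time[OF oy] ji d by simp_all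
      define b where "b = d *\<^sub>R (\<Sum>i\<in>{j..<i}. f0 (y i)) + remainder a d y j i"
      define c where "c = d *\<^sub>R (\<Sum>i\<in>{j..<i}. f0 (z i)) + remainder a d z j i"
      have mono2: "P * (real (i - j) * d) powr (2 * \<alpha>) \<le> P * ?x powr (2 * \<alpha>)"
        using P xij \<alpha> by (intro mult_left_mono powr_mono2) auto
      have b: "norm b \<le> P * ?x powr (2 * \<alpha>)" and c: "norm c \<le> P * ?x powr (2 * \<alpha>)"
        using ex[OF wy0, of j i] ex[OF wz0, of j i] ji mono2
        unfolding b_def c_def P_def by (auto elim: order_trans)
      have "norm (b - c) \<le> H * D * (real (i - j) * d) + K * D * (real (i - j) * d) powr (3 * \<alpha>)"
      proof -
        have "b - c = (d *\<^sub>R (\<Sum>i\<in>{j..<i}. f0 (y i)) - d *\<^sub>R (\<Sum>i\<in>{j..<i}. f0 (z i))) + ?r j i"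
          by (simp add: b_def c_def)
        moreover have "norm (d *\<^sub>R (\<Sum>i\<in>{j..<i}. f0 (y i)) - d *\<^sub>R (\<Sum>i\<in>{j..<i}. f0 (z i)))
            \<le> H * D * (real (i - j) * d)"
          using ji by (intro drift) auto
        ultimately show ?thesis using IH by (simp only: norm_triangle_le add_mono)
      qed
      also have "\<dots> \<le> H * D * ?x powr (2 * \<alpha>) + K * D * ?x powr (3 * \<alpha>)"
        using H D0 K xij xh \<alpha> by (intro add_mono mult_left_mono le_powr2 powr_mono2) auto
      finally have bc: "norm (b - c) \<le> H * D * ?x powr (2 * \<alpha>) + K * D * ?x powr (3 * \<alpha>)" .
      let ?dy = "J (y j) ?s ?t - J (y j) ?s ?u - J (y i) ?u ?t"
      let ?dz = "J (z j) ?s ?t - J (z j) ?s ?u - J (z i) ?u ?t"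
      have "?r j k - ?r j i - ?r i k = (remainder a d y j k - remainder a d y j i - remainder a d y i k)
          - (remainder a d z j k - remainder a d z j i - remainder a d z i k)"
        by simp
      also have "\<dots> = - (?dy - ?dz)"
        using ji by (simp only: remainder_defect less_imp_le) simp
      finally have "norm (?r j k - ?r j i - ?r i k) = norm (?dy - ?dz)"
        by (simp only: norm_minus_cancel)
      also have "\<dots> \<le> Q * ?x powr \<alpha> * (?x powr (2 * \<alpha>) * norm (y j - z j) + norm (b - c))"
        using defect_lip[OF tm, of b c "y j" "z j"] b c xh orbit_expand[of y i j a d] orbit_expand[of z i j a d]
        unfolding x b_def c_def by simp
      also have "\<dots> \<le> Q * ?x powr \<alpha> * (?x powr (2 * \<alpha>) * D + (H * D * ?x powr (2 * \<alpha>) + K * D * ?x powr (3 * \<alpha>)))"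
        using bc le[of j] ji Q by (intro mult_left_mono add_mono) auto
      also have "\<dots> = Q * (1 + H) * D * ?x powr (3 * \<alpha>) + (Q * ?x powr \<alpha>) * (K * D * ?x powr (3 * \<alpha>))"
        unfolding powr3 by (simp add: algebra_simps)
      also have "(Q * ?x powr \<alpha>) * (K * D * ?x powr (3 * \<alpha>)) \<le> (gap / 2) * (K * D * ?x powr (3 * \<alpha>))"
        using h1(3)[OF xh(1,2)] K D0 by (intro mult_right_mono) auto
      finally show "norm (?r j k - ?r j i - ?r i k) \<le> gap * (K * D) * ?x powr (3 * \<alpha>)"
        unfolding K(2) by (simp add: algebra_simps)
    qed
    have "norm (y i - z i) \<le> norm (y 0 - z 0) + D / 2" if i: "i \<le> N" for i
    proof (cases "i = 0")
      case False
      define x where "x = real (i - 0) * d"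
      have x: "0 \<le> x" "x \<le> h2" "x \<le> 1" using span[OF i, of 0] h unfolding x_def by (auto simp: h_def)
      have p: "x powr (2 * \<alpha>) \<le> x powr \<alpha>" "x powr (3 * \<alpha>) \<le> x powr \<alpha>" "x \<le> x powr \<alpha>"
        using x \<alpha> powr_mono'[of \<alpha> 1 x] by (auto intro!: powr_mono')
      let ?Jd = "J (y 0) (a + real 0 * d) (a + real i * d) - J (z 0) (a + real 0 * d) (a + real i * d)"
      let ?dd = "d *\<^sub>R (\<Sum>i\<in>{0..<i}. f0 (y i)) - d *\<^sub>R (\<Sum>i\<in>{0..<i}. f0 (z i))"
      have J: "norm ?Jd \<le> H * x powr \<alpha> * D"
      proof -
        have "norm ?Jd \<le> H * x powr \<alpha> * norm (y 0 - z 0)"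
          using J_lip[of "a + real 0 * d" "a + real i * d" "y 0" "z 0"] orbit_time[OF oy, of 0] orbit_time[OF oy i] x
          by (simp add: x_def)
        also have "\<dots> \<le> H * x powr \<alpha> * D" using H by (intro mult_left_mono le) auto
        finally show ?thesis .
      qed
      have dd: "norm ?dd \<le> H * D * x" using drift[of 0 i] i by (simp add: x_def)
      have r: "norm (?r 0 i) \<le> K * D * x powr (3 * \<alpha>)" using rem[of 0 i] i False by (simp add: x_def)
      have "y i - z i = (y 0 - z 0) + (?Jd + (?dd + ?r 0 i))" by (simp add: remainder_def)
      also have "norm \<dots> \<le> norm (y 0 - z 0) + (H * x powr \<alpha> * D + (H * D * x + K * D * x powr (3 * \<alpha>)))"
        by (intro norm_triangle_le add_mono J dd r order_refl)
      also have "\<dots> \<le> norm (y 0 - z 0) + (H * x powr \<alpha> * D + (H * D * x powr \<alpha> + K * D * x powr \<alpha>))"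
        using p H D0 K by (intro add_mono mult_left_mono) auto
      also have "\<dots> = norm (y 0 - z 0) + D * ((2 * H + K) * x powr \<alpha>)" by (simp add: algebra_simps)
      also have "\<dots> \<le> norm (y 0 - z 0) + D * (1 / 2)"
        using h2(3)[OF x(1,2)] D0 by (intro add_left_mono mult_left_mono) auto
      finally show ?thesis by simp
    qed (use D0 in auto)
    then have "D \<le> norm (y 0 - z 0) + D / 2" unfolding D_def by (subst Max_le_iff) auto
    then have "D \<le> 2 * norm (y 0 - z 0)" by argo
    then show ?thesis using le[OF k] by linarith
  qed
  then show ?thesis by (rule that[OF h])
qed

text \<open>
  The distance at most doubles in each window, and the number of windows does not depend on the step
  size.
\<close>

lemma orbit_lipschitz:
  assumes B: "0 \<le> B"
  obtains h C where "0 < h" "0 \<le> C"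
    "\<And>a d N y z k. is_orbit a d N y \<Longrightarrow> is_orbit a d N z \<Longrightarrow> d \<le> h \<Longrightarrow>
      norm (f0 (y 0)) \<le> B \<Longrightarrow> norm (f0 (z 0)) \<le> B \<Longrightarrow> k \<le> N \<Longrightarrow> norm (y k - z k) \<le> C * norm (y 0 - z 0)"
proof -
  obtain h0 where h0: "0 < h0" "h0 \<le> 1" and
    grow: "\<And>B. 0 \<le> B \<Longrightarrow> \<exists>B'\<ge>B. \<forall>a d N y k. is_orbit a d N y \<longrightarrow> d \<le> h0 \<longrightarrow> norm (f0 (y 0)) \<le> B \<longrightarrow> k \<le> N \<longrightarrow>
      norm (f0 (y k)) \<le> B'"
    by (rule orbit_growth) blast
  obtain B' where B': "B \<le> B'" and
    bd: "\<And>a d N y k. is_orbit a d N y \<Longrightarrow> d \<le> h0 \<Longrightarrow> norm (f0 (y 0)) \<le> B \<Longrightarrow> k \<le> N \<Longrightarrow> norm (f0 (y k)) \<le> B'"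
    using grow[OF B] by blast
  have B'0: "0 \<le> B'" using B B' by simp
  obtain h where h: "0 < h" "h \<le> 1" and
    win: "\<And>a d N y z k. orbit_window h a d N y B' \<Longrightarrow> orbit_window h a d N z B' \<Longrightarrow> k \<le> N \<Longrightarrow>
      norm (y k - z k) \<le> 2 * norm (y 0 - z 0)"
    using orbit_lipschitz_window[OF B'0] by metis
  define F :: "real \<Rightarrow> real" where "F = (\<lambda>b. 2 * b)"
  have F: "mono F" unfolding F_def by (intro monoI) auto
  have Fp: "(F ^^ p) b = 2 ^ p * b" for p b by (induction p) (auto simp: F_def)
  define p where "p = nat \<lceil>2 * T / h\<rceil>"
  have "norm (y k - z k) \<le> 2 ^ p * norm (y 0 - z 0)"
    if oy: "is_orbit a d N y" and oz: "is_orbit a d N z" and d: "d \<le> min h0 (h / 2)"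
      and y0: "norm (f0 (y 0)) \<le> B" and z0: "norm (f0 (z 0)) \<le> B" and k: "k \<le> N"
    for a d N y z k
  proof -
    have d0: "0 < d" and Nd: "real N * d \<le> T" using oy by (auto simp: is_orbit_def)
    obtain n where n: "real n * d \<le> h" "\<And>N. real N * d \<le> T \<Longrightarrow> N \<le> p * n"
      using window_count[OF d0, of h T] d p_def by (metis min.boundedE)
    have "norm (y k - z k) \<le> (F ^^ p) (norm (y 0 - z 0))"
    proof (rule iterate_bound_over_windows[OF F, where N = N and n = n])
      fix j k assume jk: "j \<le> k" "k \<le> N" "k - j \<le> n"
      have "real (k - j) * d \<le> real n * d" using jk d0 by (intro mult_right_mono) auto
      then have Nj: "real (k - j) * d \<le> h" using n by linarith
      have "orbit_window h (a + real j * d) d (k - j) (\<lambda>i. y (j + i)) B'"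
        "orbit_window h (a + real j * d) d (k - j) (\<lambda>i. z (j + i)) B'"
        using is_orbit_window[OF oy jk(1,2)] is_orbit_window[OF oz jk(1,2)] Nj B'0 d jk
        by (auto simp: orbit_window_def intro!: bd[OF oy _ y0] bd[OF oz _ z0])
      from win[OF this, of "k - j"] show "norm (y k - z k) \<le> F (norm (y j - z j))"
        using jk by (simp add: F_def)
    qed (use k n(2)[OF Nd] in auto)
    then show ?thesis by (simp add: Fp)
  qed
  then show ?thesis using h h0 by (intro that[of "min h0 (h / 2)" "2 ^ p"]) auto
qed

text \<open>
  Freezing the drift at the left end point costs the Lipschitz constant times displacement times
  time, which is of order \<open>1 + \<alpha>\<close>. This is at least \<open>3\<alpha>\<close> because \<open>\<alpha> \<le> 1/2\<close>.
\<close>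

lemma orbit_davie:
  assumes B: "0 \<le> B"
  obtains h K where "0 < h" "h \<le> 1" "0 \<le> K"
    "\<And>a d N y j k. is_orbit a d N y \<Longrightarrow> d \<le> h \<Longrightarrow> norm (f0 (y 0)) \<le> B \<Longrightarrow> j \<le> k \<Longrightarrow> k \<le> N \<Longrightarrow>
      real (k - j) * d \<le> h \<Longrightarrow>
      norm (y k - step (y j) (a + real j * d) (a + real k * d)) \<le> K * (real (k - j) * d) powr (3 * \<alpha>) \<and>
      norm (y k - y j) \<le> K * (real (k - j) * d) powr \<alpha>"
proof -
  obtain h0 where h0: "0 < h0" "h0 \<le> 1" and
    grow: "\<And>B. 0 \<le> B \<Longrightarrow> \<exists>B'\<ge>B. \<forall>a d N y k. is_orbit a d N y \<longrightarrow> d \<le> h0 \<longrightarrow> norm (f0 (y 0)) \<le> B \<longrightarrow> k \<le> N \<longrightarrow>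
      norm (f0 (y k)) \<le> B'"
    by (rule orbit_growth) blast
  obtain B' where B': "B \<le> B'" and
    bd: "\<And>a d N y k. is_orbit a d N y \<Longrightarrow> d \<le> h0 \<Longrightarrow> norm (f0 (y 0)) \<le> B \<Longrightarrow> k \<le> N \<Longrightarrow> norm (f0 (y k)) \<le> B'"
    using grow[OF B] by blast
  have B'0: "0 \<le> B'" using B B' by simp
  obtain h1 C where h1: "0 < h1" "h1 \<le> 1" "0 \<le> C"
    and ex: "\<And>a d N y B j k. orbit_window h1 a d N y B \<Longrightarrow> j \<le> k \<Longrightarrow> k \<le> N \<Longrightarrow>
      norm (remainder a d y j k) \<le> C * (1 + B) * (real (k - j) * d) powr (3 * \<alpha>) \<and>
      norm (d *\<^sub>R (\<Sum>i\<in>{j..<k}. f0 (y i)) + remainder a d y j k)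
        \<le> C * (1 + B) * (real (k - j) * d) powr (2 * \<alpha>) \<and>
      norm (y k - y j) \<le> C * (1 + B) * (real (k - j) * d) powr \<alpha>"
    by (rule orbit_local_expansion) blast
  let ?h = "min h0 h1"
  define P where "P = C * (1 + B')"
  have P: "0 \<le> P" using h1 B'0 by (simp add: P_def)
  let ?K = "P + H * P"
  have "norm (y k - step (y j) (a + real j * d) (a + real k * d)) \<le> ?K * (real (k - j) * d) powr (3 * \<alpha>) \<and>
      norm (y k - y j) \<le> ?K * (real (k - j) * d) powr \<alpha>"
    if orb: "is_orbit a d N y" and d: "d \<le> ?h" and y0: "norm (f0 (y 0)) \<le> B"
      and jk: "j \<le> k" "k \<le> N" and len: "real (k - j) * d \<le> ?h" for a d N y j k
  proof -
    let ?y = "\<lambda>i. y (j + i)" and ?a = "a + real j * d" and ?n = "k - j"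
    let ?x = "real (k - j) * d"
    have d0: "0 < d" using orb by (simp add: is_orbit_def)
    have x: "0 \<le> ?x" "?x \<le> 1" using d0 len h0 by auto
    have win: "orbit_window h1 ?a d ?n ?y B'"
      using is_orbit_window[OF orb jk] len B'0 d jk by (auto simp: orbit_window_def intro!: bd[OF orb _ y0])
    have t: "?a + real ?n * d = a + real k * d" using jk by (simp add: of_nat_diff algebra_simps)
    have e: "norm (remainder ?a d ?y 0 ?n) \<le> P * ?x powr (3 * \<alpha>)" "norm (y k - y j) \<le> P * ?x powr \<alpha>"
      using ex[OF win, of 0 ?n] jk by (auto simp: P_def)
    have "norm (f0 (?y i) - f0 (y j)) \<le> H * (P * ?x powr \<alpha>)" if "i < ?n" for i
    proof -
      have "norm (?y i - y j) \<le> P * (real i * d) powr \<alpha>"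
        using ex[OF win, of 0 i] that by (auto simp: P_def)
      also have "\<dots> \<le> P * ?x powr \<alpha>"
        using that d0 P \<alpha> by (intro mult_left_mono powr_mono2 mult_right_mono) auto
      finally show ?thesis using H by (intro order_trans[OF drift_lip] mult_left_mono) auto
    qed
    then have "norm (d *\<^sub>R (\<Sum>i\<in>{0..<?n}. f0 (?y i) - f0 (y j))) \<le> H * (P * ?x powr \<alpha>) * (real (?n - 0) * d)"
      using d0 by (intro drift_sum_bound[where N = ?n]) auto
    also have "\<dots> \<le> H * (P * ?x powr \<alpha>) * ?x powr (2 * \<alpha>)"
      using H P le_powr2[OF x(1) order_refl x(2)] by (intro mult_left_mono) auto
    also have "\<dots> = H * P * ?x powr (3 * \<alpha>)" unfolding powr3 by simp
    finally have drift: "norm (d *\<^sub>R (\<Sum>i\<in>{0..<?n}. f0 (?y i) - f0 (y j))) \<le> H * P * ?x powr (3 * \<alpha>)" .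
    have "y k - step (y j) ?a (a + real k * d)
        = remainder ?a d ?y 0 ?n + d *\<^sub>R (\<Sum>i\<in>{0..<?n}. f0 (?y i) - f0 (y j))"
      using jk by (simp add: step_def remainder_def sum_subtractf t scaleR_diff_right sum_constant_scaleR
          of_nat_diff scaleR_left_diff_distrib algebra_simps)
    then have "norm (y k - step (y j) ?a (a + real k * d)) \<le> P * ?x powr (3 * \<alpha>) + H * P * ?x powr (3 * \<alpha>)"
      using e(1) drift by (simp only: norm_triangle_le add_mono)
    moreover have "P * ?x powr \<alpha> \<le> ?K * ?x powr \<alpha>" using H P by (intro mult_right_mono) auto
    ultimately show ?thesis using e(2) by (auto simp: algebra_simps)
  qed
  then show ?thesis using h0 h1 P H by (intro that[of ?h ?K]) auto
qed

section \<open>Davie paths\<close>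

lemma continuous_on_f0: "continuous_on S f0"
proof -
  have "H-lipschitz_on S f0" using drift_lip H by (auto intro!: lipschitz_onI simp: dist_norm)
  then show ?thesis by (rule lipschitz_on_continuous_on)
qed

primrec euler_orbit :: "real \<Rightarrow> real \<Rightarrow> 'w \<Rightarrow> nat \<Rightarrow> 'w" where
  "euler_orbit a d y 0 = y"
| "euler_orbit a d y (Suc k) = step (euler_orbit a d y k) (a + real k * d) (a + real (Suc k) * d)"

lemma is_orbit_euler_orbit: "0 \<le> a \<Longrightarrow> 0 < d \<Longrightarrow> a + real N * d \<le> T \<Longrightarrow> is_orbit a d N (euler_orbit a d y)"
  by (simp add: is_orbit_def)

lemma euler_orbit_Suc_shift: "euler_orbit a d y (Suc k) = euler_orbit (a + d) d (step y a (a + d)) k"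
proof (induction k)
  case (Suc k)
  have "euler_orbit a d y (Suc (Suc k)) = step (euler_orbit a d y (Suc k)) (a + real (Suc k) * d) (a + real (Suc (Suc k)) * d)"
    by simp
  also have "\<dots> = euler_orbit (a + d) d (step y a (a + d)) (Suc k)"
    unfolding Suc by (simp add: algebra_simps)
  finally show ?case .
qed simp

text \<open>
  Each of the \<open>k\<close> errors is transported to the end by an exact orbit, and all these orbits are Lipschitz
  in their starting point with the same constant. The drift bound is raised to \<open>B + H\<close> since the exact
  orbits start within distance \<open>\<epsilon> \<le> 1\<close> of points of \<open>y\<close>.
\<close>

lemma approximate_orbit_shadowing:
  assumes B: "0 \<le> B"
  obtains h C where "0 < h" "0 \<le> C"
    "\<And>a d N y \<epsilon> k. 0 \<le> a \<Longrightarrow> 0 < d \<Longrightarrow> d \<le> h \<Longrightarrow> a + real N * d \<le> T \<Longrightarrow> 0 \<le> \<epsilon> \<Longrightarrow> \<epsilon> \<le> 1 \<Longrightarrow>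
      \<forall>k\<le>N. norm (f0 (y k)) \<le> B \<Longrightarrow>
      \<forall>k<N. norm (y (Suc k) - step (y k) (a + real k * d) (a + real (Suc k) * d)) \<le> \<epsilon> \<Longrightarrow>
      k \<le> N \<Longrightarrow> norm (y k - euler_orbit a d (y 0) k) \<le> C * real k * \<epsilon>"
proof -
  have BH: "0 \<le> B + H" using B H by simp
  obtain h C where h: "0 < h" and C: "0 \<le> C"
    and lip: "\<And>a d N y z k. is_orbit a d N y \<Longrightarrow> is_orbit a d N z \<Longrightarrow> d \<le> h \<Longrightarrow>
      norm (f0 (y 0)) \<le> B + H \<Longrightarrow> norm (f0 (z 0)) \<le> B + H \<Longrightarrow> k \<le> N \<Longrightarrow> norm (y k - z k) \<le> C * norm (y 0 - z 0)"
    by (rule orbit_lipschitz[OF BH]) blast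
  have "norm (y k - euler_orbit a d (y 0) k) \<le> C * real k * \<epsilon>"
    if "0 \<le> a" "0 < d" "d \<le> h" "a + real N * d \<le> T" "0 \<le> \<epsilon>" "\<epsilon> \<le> 1"
      "\<forall>k\<le>N. norm (f0 (y k)) \<le> B"
      "\<forall>k<N. norm (y (Suc k) - step (y k) (a + real k * d) (a + real (Suc k) * d)) \<le> \<epsilon>"
      "k \<le> N" for a d N y \<epsilon> k
    using that
  proof (induction k arbitrary: a N y)
    case (Suc k)
    obtain N' where N: "N = Suc N'" using Suc.prems by (cases N) auto
    have len: "a + d + real N' * d \<le> T" using Suc.prems N by (simp add: algebra_simps)
    have IH: "norm (y (Suc k) - euler_orbit (a + d) d (y (Suc 0)) k) \<le> C * real k * \<epsilon>"
    proof (rule Suc.IH[where N = N' and y = "\<lambda>i. y (Suc i)"])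
      show "\<forall>k<N'. norm (y (Suc (Suc k)) - step (y (Suc k)) (a + d + real k * d) (a + d + real (Suc k) * d)) \<le> \<epsilon>"
      proof (intro allI impI)
        fix k assume "k < N'"
        then show "norm (y (Suc (Suc k)) - step (y (Suc k)) (a + d + real k * d) (a + d + real (Suc k) * d)) \<le> \<epsilon>"
          using Suc.prems(8)[unfolded N, rule_format, of "Suc k"] by (simp add: algebra_simps)
      qed
    qed (use Suc.prems len N in auto)
    let ?z = "step (y 0) a (a + d)"
    have e: "norm (y (Suc 0) - ?z) \<le> \<epsilon>" using Suc.prems(8) N by force
    have "norm (f0 ?z) \<le> norm (f0 (y (Suc 0))) + norm (f0 ?z - f0 (y (Suc 0)))" by norm
    also have "\<dots> \<le> B + H * 1"
      using Suc.prems(6,7) N e H by (intro add_mono order_trans[OF drift_lip] mult_left_mono) (auto simp: norm_minus_commute)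
    finally have "norm (f0 ?z) \<le> B + H" by simp
    then have "norm (euler_orbit (a + d) d (y (Suc 0)) k - euler_orbit (a + d) d ?z k) \<le> C * norm (y (Suc 0) - ?z)"
      using lip[OF is_orbit_euler_orbit is_orbit_euler_orbit, of "a + d" d N' "y (Suc 0)" ?z k] Suc.prems len N H by fastforce
    also have "\<dots> \<le> C * \<epsilon>" using e C by (intro mult_left_mono)
    finally have "norm (y (Suc k) - euler_orbit (a + d) d ?z k) \<le> C * real k * \<epsilon> + C * \<epsilon>"
      using norm_diff_triangle_le[OF IH] by simp
    then show ?case unfolding euler_orbit_Suc_shift by (simp add: algebra_simps)
  qed simp
  then show ?thesis by (rule that[OF h C])
qed

text \<open>
Davie's description of the solutions of a differential equation by its one-step map.
\<close>

definition davie_path :: "real \<Rightarrow> real \<Rightarrow> (real \<Rightarrow> 'w) \<Rightarrow> bool"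
  where "davie_path K h Y \<longleftrightarrow> 0 \<le> K \<and> 0 < h \<and> h \<le> 1 \<and>
    (\<forall>s t. 0 \<le> s \<longrightarrow> s \<le> t \<longrightarrow> t \<le> T \<longrightarrow> t - s \<le> h \<longrightarrow>
      norm (Y t - step (Y s) s t) \<le> K * (t - s) powr (3 * \<alpha>))"

lemma dyadic_floor:
  fixes t d :: real
  assumes "0 \<le> t" "0 < d" 
  defines "k \<equiv> \<lambda>d. nat \<lfloor>t / d\<rfloor>"
  shows "real (k d) * d \<le> t" "t < real (k d) * d + d" "k (d / 2) = 2 * k d \<or> k (d / 2) = Suc (2 * k d)"
proof -
  have k: "real (k d) = of_int \<lfloor>t / d\<rfloor>" using assms by (simp add: k_def)
  have "real (k d) \<le> t / d" "t / d < real (k d) + 1" unfolding k by linarith+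
  then show "real (k d) * d \<le> t" "t < real (k d) * d + d"
    using assms by (simp_all only: pos_le_divide_eq pos_divide_less_eq) (simp_all add: algebra_simps)
  have "\<lfloor>2 * x\<rfloor> = 2 * \<lfloor>x\<rfloor> \<or> \<lfloor>2 * x\<rfloor> = 2 * \<lfloor>x\<rfloor> + 1" for x :: real by linarith
  from this[of "t / d"] have "\<lfloor>t / (d / 2)\<rfloor> = 2 * \<lfloor>t / d\<rfloor> \<or> \<lfloor>t / (d / 2)\<rfloor> = 2 * \<lfloor>t / d\<rfloor> + 1"
    by (simp add: mult.commute)
  moreover have "0 \<le> \<lfloor>t / d\<rfloor>" using assms by simp
  ultimately show "k (d / 2) = 2 * k d \<or> k (d / 2) = Suc (2 * k d)"
    unfolding k_def by (auto simp: nat_mult_distrib nat_add_distrib)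
qed

text \<open>
  Two steps of length \<open>d / 2\<close> differ from one step of length \<open>d\<close> by \<open>O(d\<^bsup>3\<alpha>\<^esup>)\<close>. So every other point of
  the orbit with step \<open>T / 2\<^bsup>n+1\<^esup>\<close> is an approximate orbit with step \<open>T / 2\<^bsup>n\<^esup>\<close>, and shadowing over
  \<open>2\<^bsup>n\<^esup>\<close> steps bounds the distance of consecutive approximations by a geometric sequence with ratio
  \<open>2\<^bsup>1-3\<alpha>\<^esup>\<close>. The Davie estimate passes to the limit.
\<close>

lemma davie_path_exists:
  obtains Y K h B where "davie_path K h Y" "Y 0 = \<xi>" "\<And>t. 0 \<le> t \<Longrightarrow> t \<le> T \<Longrightarrow> norm (f0 (Y t)) \<le> B"
proof -
  let ?B = "norm (f0 \<xi>)"
  obtain h0 where h0: "0 < h0" "h0 \<le> 1" and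
    grow: "\<And>B. 0 \<le> B \<Longrightarrow> \<exists>B'\<ge>B. \<forall>a d N y k. is_orbit a d N y \<longrightarrow> d \<le> h0 \<longrightarrow> norm (f0 (y 0)) \<le> B \<longrightarrow> k \<le> N \<longrightarrow>
      norm (f0 (y k)) \<le> B'"
    by (rule orbit_growth) blast
  obtain B' where B': "?B \<le> B'" and
    bd: "\<And>a d N y k. is_orbit a d N y \<Longrightarrow> d \<le> h0 \<Longrightarrow> norm (f0 (y 0)) \<le> ?B \<Longrightarrow> k \<le> N \<Longrightarrow> norm (f0 (y k)) \<le> B'"
    using grow[OF norm_ge_zero] by blast
  have B'0: "0 \<le> B'" using B' norm_ge_zero order_trans by blast
  obtain h1 K where h1: "0 < h1" "h1 \<le> 1" and K: "0 \<le> K" and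
    davie: "\<And>a d N y j k. is_orbit a d N y \<Longrightarrow> d \<le> h1 \<Longrightarrow> norm (f0 (y 0)) \<le> ?B \<Longrightarrow> j \<le> k \<Longrightarrow> k \<le> N \<Longrightarrow>
      real (k - j) * d \<le> h1 \<Longrightarrow>
      norm (y k - step (y j) (a + real j * d) (a + real k * d)) \<le> K * (real (k - j) * d) powr (3 * \<alpha>) \<and>
      norm (y k - y j) \<le> K * (real (k - j) * d) powr \<alpha>"
    by (rule orbit_davie[OF norm_ge_zero]) blast
  obtain h2 C where h2: "0 < h2" and C: "0 \<le> C" and
    shadow: "\<And>a d N y \<epsilon> k. 0 \<le> a \<Longrightarrow> 0 < d \<Longrightarrow> d \<le> h2 \<Longrightarrow> a + real N * d \<le> T \<Longrightarrow> 0 \<le> \<epsilon> \<Longrightarrow> \<epsilon> \<le> 1 \<Longrightarrow>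
      \<forall>k\<le>N. norm (f0 (y k)) \<le> B' \<Longrightarrow>
      \<forall>k<N. norm (y (Suc k) - step (y k) (a + real k * d) (a + real (Suc k) * d)) \<le> \<epsilon> \<Longrightarrow>
      k \<le> N \<Longrightarrow> norm (y k - euler_orbit a d (y 0) k) \<le> C * real k * \<epsilon>"
    by (rule approximate_orbit_shadowing[OF B'0]) blast
  obtain h3 where h3: "0 < h3" "\<And>x. 0 \<le> x \<Longrightarrow> x \<le> h3 \<Longrightarrow> K * x powr (3 * \<alpha>) \<le> 1"
    using small_powr[of "3 * \<alpha>" 1 K] \<alpha> by auto
  define d where "d n = T / 2 ^ n" for n :: nat
  define y where "y n = euler_orbit 0 (d n) \<xi>" for n
  define P where "P n t = y n (nat \<lfloor>t / d n\<rfloor>)" for n t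
  have d0: "0 < d n" for n using T by (simp add: d_def)
  have d2: "d (Suc n) = d n / 2" for n by (simp add: d_def)
  have dlim: "d \<longlonglongrightarrow> 0" unfolding d_def by real_asymp
  have dN: "real (2 ^ n) * d n = T" for n by (simp add: d_def)
  have orb: "is_orbit 0 (d n) (2 ^ n) (y n)" for n
    unfolding y_def using d0 dN by (intro is_orbit_euler_orbit) auto
  have y0: "norm (f0 (y n 0)) \<le> ?B" for n by (simp add: y_def)
  define e where "e = min (min h0 (h1 / 2)) (min h2 h3)"
  have e: "0 < e" using h0 h1 h2 h3 by (simp add: e_def)
  have "\<forall>\<^sub>F n in sequentially. d n < e" using dlim e by (rule order_tendstoD)
  then obtain n0 where n0: "\<And>n. n0 \<le> n \<Longrightarrow> d n < e" by (auto simp: eventually_sequentially)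
  have dle: "d n \<le> h0" "d n \<le> h1" "d n \<le> h1 / 2" "d n \<le> h2" "d n \<le> h3" if "n0 \<le> n" for n
    using n0[OF that] h1 by (auto simp: e_def)
  have kle: "nat \<lfloor>t / d n\<rfloor> \<le> 2 ^ n" if "0 \<le> t" "t \<le> T" for t n
  proof -
    have "real (nat \<lfloor>t / d n\<rfloor>) * d n \<le> real (2 ^ n) * d n" using dyadic_floor(1)[OF that(1) d0, of n] dN[of n] that by linarith
    then have "real (nat \<lfloor>t / d n\<rfloor>) \<le> real (2 ^ n)" using d0[of n] by (simp only: mult_le_cancel_right_pos)
    then show ?thesis by linarith
  qed
  define q :: real where "q = 2 powr (1 - 3 * \<alpha>)"
  have q: "0 < q" "q < 1" using \<alpha> powr_less_mono[of "1 - 3 * \<alpha>" 0 2] by (auto simp: q_def)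
  define A where "A = C * K * T powr (3 * \<alpha>) + K * T powr \<alpha>"
  have incr: "norm (P (Suc n) t - P n t) \<le> A * q ^ n" if n: "n0 \<le> n" and t: "0 \<le> t" "t \<le> T" for n t
  proof -
    let ?k = "nat \<lfloor>t / d n\<rfloor>" and ?k' = "nat \<lfloor>t / d (Suc n)\<rfloor>"
    let ?eps = "K * d n powr (3 * \<alpha>)"
    have Sn: "n0 \<le> Suc n" using n by simp
    have "norm (y (Suc n) (2 * ?k) - euler_orbit 0 (d n) (y (Suc n) (2 * 0)) ?k) \<le> C * real ?k * ?eps"
    proof (rule shadow[where N = "2 ^ n" and y = "\<lambda>i. y (Suc n) (2 * i)"])
      show "\<forall>k\<le>2 ^ n. norm (f0 (y (Suc n) (2 * k))) \<le> B'"
        using bd[OF orb[of "Suc n"] dle(1)[OF Sn] y0] by simp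
      show "\<forall>k<2 ^ n. norm (y (Suc n) (2 * Suc k) - step (y (Suc n) (2 * k)) (0 + real k * d n) (0 + real (Suc k) * d n)) \<le> ?eps"
      proof (intro allI impI)
        fix k :: nat assume k: "k < 2 ^ n"
        have "norm (y (Suc n) (2 * Suc k) - step (y (Suc n) (2 * k)) (0 + real (2 * k) * d (Suc n)) (0 + real (2 * Suc k) * d (Suc n)))
            \<le> K * (real (2 * Suc k - 2 * k) * d (Suc n)) powr (3 * \<alpha>)"
          using davie[OF orb[of "Suc n"] dle(2)[OF Sn] y0, of "2 * k" "2 * Suc k"] k dle(2)[OF n] by (simp add: d2)
        then show "norm (y (Suc n) (2 * Suc k) - step (y (Suc n) (2 * k)) (0 + real k * d n) (0 + real (Suc k) * d n)) \<le> ?eps"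
          by (simp add: d2 algebra_simps)
      qed
      show "?eps \<le> 1" using h3(2)[of "d n"] d0[of n] dle(5)[OF n] by simp
      show "d n \<le> h2" using dle(4)[OF n] .
      show "?k \<le> 2 ^ n" using kle t .
    qed (use d0[of n] dN[of n] K in auto)
    then have 1: "norm (y (Suc n) (2 * ?k) - P n t) \<le> C * real ?k * ?eps" by (simp add: P_def y_def)
    have k': "?k' = 2 * ?k \<or> ?k' = Suc (2 * ?k)"
      using dyadic_floor(3)[OF t(1) d0, of n] by (simp add: d2)
    have 2: "norm (P (Suc n) t - y (Suc n) (2 * ?k)) \<le> K * d n powr \<alpha>"
    proof -
      have "real (?k' - 2 * ?k) * d (Suc n) \<le> d n" using k' d0[of n] by (auto simp: d2)
      moreover have "2 * ?k \<le> ?k'" "?k' \<le> 2 ^ Suc n" using k' kle[OF t, of "Suc n"] by auto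
      ultimately have "norm (P (Suc n) t - y (Suc n) (2 * ?k)) \<le> K * (real (?k' - 2 * ?k) * d (Suc n)) powr \<alpha>"
        using davie[OF orb[of "Suc n"] dle(2)[OF Sn] y0, of "2 * ?k" ?k'] dle(2)[OF n] by (simp add: P_def)
      also have "\<dots> \<le> K * d n powr \<alpha>"
        using \<open>real (?k' - 2 * ?k) * d (Suc n) \<le> d n\<close> K \<alpha> d0[of "Suc n"] by (intro mult_left_mono powr_mono2) auto
      finally show ?thesis .
    qed
    have "real ?k \<le> 2 ^ n" using kle[OF t, of n] by (metis of_nat_le_iff of_nat_numeral of_nat_power)
    then have "C * real ?k * ?eps \<le> C * 2 ^ n * ?eps" using C K by (intro mult_right_mono mult_left_mono) auto
    also have "2 ^ n * d n powr (3 * \<alpha>) = T powr (3 * \<alpha>) * q ^ n"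
      using T by (simp add: d_def q_def powr_divide powr_power powr_diff powr_realpow[symmetric] powr_powr powr_add[symmetric] field_simps)
    then have "C * 2 ^ n * ?eps = C * K * T powr (3 * \<alpha>) * q ^ n" by simp
    finally have 3: "C * real ?k * ?eps \<le> C * K * T powr (3 * \<alpha>) * q ^ n" .
    have "d n powr \<alpha> = T powr \<alpha> * 2 powr (- real n * \<alpha>)"
      using T by (simp add: d_def powr_divide powr_realpow[symmetric] powr_powr powr_minus field_simps)
    also have "\<dots> \<le> T powr \<alpha> * 2 powr ((1 - 3 * \<alpha>) * real n)"
      using \<alpha> mult_left_mono[of "2 * \<alpha>" 1 "real n"] by (intro mult_left_mono powr_mono) (auto simp: algebra_simps)
    also have "2 powr ((1 - 3 * \<alpha>) * real n) = q ^ n" by (simp add: q_def powr_power mult.commute)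
    finally have 4: "K * d n powr \<alpha> \<le> K * T powr \<alpha> * q ^ n" using K mult_left_mono by fastforce
    have "norm (P (Suc n) t - P n t) \<le> norm (y (Suc n) (2 * ?k) - P n t) + norm (P (Suc n) t - y (Suc n) (2 * ?k))"
      by norm
    then show ?thesis using 1 2 3 4 by (simp add: A_def algebra_simps)
  qed
  have conv: "convergent (\<lambda>n. P n t)" if t: "0 \<le> t" "t \<le> T" for t
  proof -
    have "summable (\<lambda>n. P (Suc n) t - P n t)"
    proof (rule summable_comparison_test)
      show "summable (\<lambda>n. A * q ^ n)" using q by (intro summable_mult summable_geometric) auto
      show "\<exists>N. \<forall>n\<ge>N. norm (P (Suc n) t - P n t) \<le> A * q ^ n" using incr t by blast
    qed
    then have "convergent (\<lambda>n. \<Sum>i<n. P (Suc i) t - P i t)" by (simp add: summable_iff_convergent)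
    then have "convergent (\<lambda>n. P n t - P 0 t)" by (simp add: sum_lessThan_telescope[of "\<lambda>n. P n t"])
    then show ?thesis by (metis convergent_diff_const_right_iff)
  qed
  define Y where "Y t = lim (\<lambda>n. P n t)" for t
  have lim: "(\<lambda>n. P n t) \<longlonglongrightarrow> Y t" if t: "0 \<le> t" "t \<le> T" for t
    using conv[OF t] by (simp add: convergent_LIMSEQ_iff Y_def)
  have f0c: "(\<lambda>n. f0 (P n t)) \<longlonglongrightarrow> f0 (Y t)" if t: "0 \<le> t" "t \<le> T" for t
    using continuous_on_tendsto_compose[OF continuous_on_f0[of UNIV] lim[OF t]] by simp
  have f0Y: "norm (f0 (Y t)) \<le> B'" if t: "0 \<le> t" "t \<le> T" for t
    using kle[OF t] bd[OF orb dle(1) y0]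
    by (intro Lim_bounded[OF tendsto_norm[OF f0c[OF t]], of n0]) (auto simp: P_def)
  have "Y 0 = \<xi>" by (simp add: Y_def P_def y_def)
  moreover have "davie_path K (h1 / 2) Y"
    unfolding davie_path_def
  proof (intro conjI allI impI)
    fix s t :: real assume st: "0 \<le> s" "s \<le> t" "t \<le> T" "t - s \<le> h1 / 2"
    have T0: "0 \<le> t" "s \<le> T" using st by auto
    define s' where "s' n = real (nat \<lfloor>s / d n\<rfloor>) * d n" for n
    define t' where "t' n = real (nat \<lfloor>t / d n\<rfloor>) * d n" for n
    have fl: "(\<lambda>n. real (nat \<lfloor>r / d n\<rfloor>) * d n) \<longlonglongrightarrow> r" if r: "0 \<le> r" for r
    proof (rule tendsto_sandwich[where f = "\<lambda>n. r - d n" and h = "\<lambda>_. r"])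
      show "(\<lambda>n. r - d n) \<longlonglongrightarrow> r" using tendsto_diff[OF tendsto_const dlim, of r] by simp
      show "\<forall>\<^sub>F n in sequentially. r - d n \<le> real (nat \<lfloor>r / d n\<rfloor>) * d n"
        "\<forall>\<^sub>F n in sequentially. real (nat \<lfloor>r / d n\<rfloor>) * d n \<le> r"
        using dyadic_floor(1,2)[OF r d0] by (auto intro!: always_eventually simp: algebra_simps less_imp_le)
    qed simp
    have s'lim: "s' \<longlonglongrightarrow> s" and t'lim: "t' \<longlonglongrightarrow> t" unfolding s'_def t'_def using st T0 by (auto intro!: fl)
    have kst: "nat \<lfloor>s / d n\<rfloor> \<le> nat \<lfloor>t / d n\<rfloor>" for n
      using st d0[of n] by (intro nat_mono floor_mono divide_right_mono) auto
    have ord: "0 \<le> s' n" "s' n \<le> t' n" "t' n \<le> T" for n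
    proof -
      show "s' n \<le> t' n"
        unfolding s'_def t'_def using d0[of n] by (intro mult_right_mono of_nat_mono kst) simp
      show "0 \<le> s' n" using d0[of n] by (simp add: s'_def)
      show "t' n \<le> T" using dyadic_floor(1)[OF T0(1) d0, of n] st by (simp add: t'_def)
    qed
    have len: "t' n - s' n \<le> h1" if "n0 \<le> n" for n
      using dyadic_floor[OF st(1) d0, of n] dyadic_floor[OF T0(1) d0, of n] st dle(3)[OF that]
      unfolding s'_def t'_def by linarith
    have est: "norm (P n t - step (P n s) (s' n) (t' n)) \<le> K * (t' n - s' n) powr (3 * \<alpha>)" if n: "n0 \<le> n" for n
    proof -
      have "t' n - s' n = real (nat \<lfloor>t / d n\<rfloor> - nat \<lfloor>s / d n\<rfloor>) * d n"
        using kst by (simp add: s'_def t'_def of_nat_diff left_diff_distrib)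
      then show ?thesis
        using davie[OF orb[of n] dle(2)[OF n] y0 kst kle[OF T0(1) st(3)]] len[OF n]
        by (simp add: P_def s'_def t'_def)
    qed
    show "norm (Y t - step (Y s) s t) \<le> K * (t - s) powr (3 * \<alpha>)"
    proof (cases "s = t")
      case True
      then show ?thesis using st K by (simp add: step_def)
    next
      case False
      have Jc: "(\<lambda>n. J (P n s) (s' n) (t' n)) \<longlonglongrightarrow> J (Y s) s t"
      proof -
        have "(\<lambda>n. J (P n s) (s' n) (t' n) - J (Y s) (s' n) (t' n)) \<longlonglongrightarrow> 0"
        proof (rule Lim_null_comparison)
          show "\<forall>\<^sub>F n in sequentially. norm (J (P n s) (s' n) (t' n) - J (Y s) (s' n) (t' n)) \<le> H * norm (P n s - Y s)"
            unfolding eventually_sequentially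
          proof (intro exI allI impI)
            fix n assume "n0 \<le> n"
            then have l: "0 \<le> t' n - s' n" "t' n - s' n \<le> 1" using len h1 ord[of n] by force+
            then have "norm (J (P n s) (s' n) (t' n) - J (Y s) (s' n) (t' n)) \<le> H * (t' n - s' n) powr \<alpha> * norm (P n s - Y s)"
              using ord by (intro J_lip) auto
            also have "\<dots> \<le> H * 1 * norm (P n s - Y s)"
              using H l \<alpha> by (intro mult_right_mono mult_left_mono powr_le_1) auto
            finally show "norm (J (P n s) (s' n) (t' n) - J (Y s) (s' n) (t' n)) \<le> H * norm (P n s - Y s)" by simp
          qed
          show "(\<lambda>n. H * norm (P n s - Y s)) \<longlonglongrightarrow> 0"
            using lim[OF st(1) T0(2)] by (auto intro!: tendsto_mult_right_zero tendsto_norm_zero simp: LIM_zero_iff)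
        qed
        from tendsto_add[OF this J_continuous[OF _ s'lim t'lim, of "Y s"]] ord show ?thesis by simp
      qed
      show ?thesis
      proof (rule tendsto_le[OF sequentially_bot])
        show "(\<lambda>n. norm (P n t - step (P n s) (s' n) (t' n))) \<longlonglongrightarrow> norm (Y t - step (Y s) s t)"
          unfolding step_def by (intro tendsto_intros lim f0c st T0 s'lim t'lim Jc)
        show "(\<lambda>n. K * (t' n - s' n) powr (3 * \<alpha>)) \<longlonglongrightarrow> K * (t - s) powr (3 * \<alpha>)"
          using False by (intro tendsto_intros s'lim t'lim) auto
        show "\<forall>\<^sub>F n in sequentially. norm (P n t - step (P n s) (s' n) (t' n)) \<le> K * (t' n - s' n) powr (3 * \<alpha>)"
          using est by (auto simp: eventually_sequentially)
      qed
    qed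
  qed (use K h1 in auto)
  ultimately show ?thesis using that f0Y by blast
qed

text \<open>
  Along the grid the Davie path is itself an approximate orbit, so both are close to the exact orbit
  with the same start.
\<close>

lemma davie_path_shadowed_by_approximate_orbit:
  assumes Y: "davie_path K h Y" and B: "0 \<le> B" "\<And>t. 0 \<le> t \<Longrightarrow> t \<le> T \<Longrightarrow> norm (f0 (Y t)) \<le> B"
  obtains h' C where "0 < h'" "0 \<le> C"
    "\<And>a d N z \<epsilon> k. 0 \<le> a \<Longrightarrow> 0 < d \<Longrightarrow> d \<le> h' \<Longrightarrow> a + real N * d \<le> T \<Longrightarrow> K * d powr (3 * \<alpha>) \<le> \<epsilon> \<Longrightarrow> \<epsilon> \<le> 1 \<Longrightarrow>
      \<forall>k\<le>N. norm (f0 (z k)) \<le> B \<Longrightarrow>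
      \<forall>k<N. norm (z (Suc k) - step (z k) (a + real k * d) (a + real (Suc k) * d)) \<le> \<epsilon> \<Longrightarrow>
      z 0 = Y a \<Longrightarrow> k \<le> N \<Longrightarrow> norm (z k - Y (a + real k * d)) \<le> C * real k * \<epsilon>"
proof -
  have K: "0 \<le> K" and h: "0 < h" and davie: "\<And>s t. 0 \<le> s \<Longrightarrow> s \<le> t \<Longrightarrow> t \<le> T \<Longrightarrow> t - s \<le> h \<Longrightarrow>
      norm (Y t - step (Y s) s t) \<le> K * (t - s) powr (3 * \<alpha>)"
    using Y by (auto simp: davie_path_def)
  obtain h1 C where h1: "0 < h1" and C: "0 \<le> C" and
    shadow: "\<And>a d N y \<epsilon> k. 0 \<le> a \<Longrightarrow> 0 < d \<Longrightarrow> d \<le> h1 \<Longrightarrow> a + real N * d \<le> T \<Longrightarrow> 0 \<le> \<epsilon> \<Longrightarrow> \<epsilon> \<le> 1 \<Longrightarrow>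
      \<forall>k\<le>N. norm (f0 (y k)) \<le> B \<Longrightarrow>
      \<forall>k<N. norm (y (Suc k) - step (y k) (a + real k * d) (a + real (Suc k) * d)) \<le> \<epsilon> \<Longrightarrow>
      k \<le> N \<Longrightarrow> norm (y k - euler_orbit a d (y 0) k) \<le> C * real k * \<epsilon>"
    by (rule approximate_orbit_shadowing[OF B(1)]) blast
  have "norm (z k - Y (a + real k * d)) \<le> 2 * C * real k * \<epsilon>"
    if "0 \<le> a" "0 < d" and dh: "d \<le> min h h1" and N: "a + real N * d \<le> T" and e: "K * d powr (3 * \<alpha>) \<le> \<epsilon>" "\<epsilon> \<le> 1"
      and z: "\<forall>k\<le>N. norm (f0 (z k)) \<le> B"
        "\<forall>k<N. norm (z (Suc k) - step (z k) (a + real k * d) (a + real (Suc k) * d)) \<le> \<epsilon>"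
        "z 0 = Y a" and k: "k \<le> N" for a d N z \<epsilon> k
  proof -
    have e0: "0 \<le> \<epsilon>" using e(1) K by (meson mult_nonneg_nonneg order_trans powr_ge_zero)
    have tm: "0 \<le> a + real k * d" "a + real k * d \<le> T" if "k \<le> N" for k
    proof -
      have "real k * d \<le> real N * d" using that \<open>0 < d\<close> by simp
      then show "a + real k * d \<le> T" using N by linarith
    qed (use that \<open>0 \<le> a\<close> \<open>0 < d\<close> in auto)
    have zk: "norm (z k - euler_orbit a d (z 0) k) \<le> C * real k * \<epsilon>"
      using that e0 by (intro shadow[where N = N]) auto
    have yk: "norm (Y (a + real k * d) - euler_orbit a d (Y (a + real 0 * d)) k) \<le> C * real k * \<epsilon>"
    proof (rule shadow[where N = N and y = "\<lambda>k. Y (a + real k * d)"])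
      show "\<forall>k<N. norm (Y (a + real (Suc k) * d) - step (Y (a + real k * d)) (a + real k * d) (a + real (Suc k) * d)) \<le> \<epsilon>"
      proof (intro allI impI)
        fix k assume "k < N"
        then have "norm (Y (a + real (Suc k) * d) - step (Y (a + real k * d)) (a + real k * d) (a + real (Suc k) * d))
            \<le> K * (a + real (Suc k) * d - (a + real k * d)) powr (3 * \<alpha>)"
          using tm[of k] tm[of "Suc k"] dh \<open>0 < d\<close> by (intro davie) (auto simp: algebra_simps)
        also have "a + real (Suc k) * d - (a + real k * d) = d" by (simp add: algebra_simps)
        finally show "norm (Y (a + real (Suc k) * d) - step (Y (a + real k * d)) (a + real k * d) (a + real (Suc k) * d)) \<le> \<epsilon>"
          using e by simp
      qed
      show "\<forall>k\<le>N. norm (f0 (Y (a + real k * d))) \<le> B" using tm B by simp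
    qed (use that e0 in auto)
    show ?thesis using norm_diff_triangle_le[OF zk, of "Y (a + real k * d)" "C * real k * \<epsilon>"] yk z(3)
      by (simp add: norm_minus_commute mult_ac)
  qed
  then show ?thesis using h h1 C by (intro that[of "min h h1" "2 * C"]) auto
qed

end

section \<open>The rough differential equation as an approximate flow\<close>

context completed_tensor_product
begin

lemma tensor_lift_bounded_linear:
  assumes "canonical_injection TYPE('w::banach) tensor"
  shows "bounded_linear (tensor_lift tensor :: ('v \<Rightarrow>\<^sub>L 'v \<Rightarrow>\<^sub>L 'w) \<Rightarrow> 'e \<Rightarrow>\<^sub>L 'w)"
proof -
  obtain i :: "('v \<Rightarrow>\<^sub>L 'v \<Rightarrow>\<^sub>L 'w) \<Rightarrow>\<^sub>L ('e \<Rightarrow>\<^sub>L 'w)" where i: "\<forall>A v w. i A (tensor v w) = A v w"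
    using assms unfolding canonical_injection_def by blast
  have "tensor_lift tensor = blinfun_apply i"
    by (intro ext blinfun_eq_on_tensors) (simp add: tensor_lift[OF assms] i)
  then show ?thesis by (simp add: blinfun.bounded_linear_right)
qed

end

text \<open>
  A single constant \<open>H \<ge> 1\<close> bounds all data, so that products of bounds become powers of \<open>H\<close> and
  lower powers are dominated by higher ones.
\<close>

locale rough_equation = completed_tensor_product tensor
  for tensor :: "'v::banach \<Rightarrow> 'v \<Rightarrow> 'e::banach" +
  fixes f0 :: "'w::banach \<Rightarrow> 'w" and f :: "'w \<Rightarrow> 'v \<Rightarrow>\<^sub>L 'w"
    and f1 :: "'w \<Rightarrow> 'w \<Rightarrow>\<^sub>L 'v \<Rightarrow>\<^sub>L 'w" and f2 :: "'w \<Rightarrow> 'w \<Rightarrow>\<^sub>L 'w \<Rightarrow>\<^sub>L 'v \<Rightarrow>\<^sub>L 'w"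
    and X :: "real \<Rightarrow> 'v" and XX :: "real \<Rightarrow> real \<Rightarrow> 'e" and \<alpha> T H :: real
  assumes injection: "canonical_injection TYPE('w) tensor"
    and exponent: "1/3 < \<alpha>" "\<alpha> \<le> 1/2" and horizon: "0 < T" and H1: "1 \<le> H"
    and drift_lipschitz: "norm (f0 x - f0 y) \<le> H * norm (x - y)"
    and f_C2: "C2_bounded f f1 H" and f1_C2: "C2_bounded f1 f2 H" and f_bound: "norm (f x) \<le> H"
    and lift_bound: "norm (tensor_lift tensor (A :: 'v \<Rightarrow>\<^sub>L 'v \<Rightarrow>\<^sub>L 'w)) \<le> H * norm A"
    and X_holder: "s \<in> {0..T} \<Longrightarrow> t \<in> {0..T} \<Longrightarrow> norm (X t - X s) \<le> H * \<bar>t - s\<bar> powr \<alpha>"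
    and XX_holder: "s \<in> {0..T} \<Longrightarrow> t \<in> {0..T} \<Longrightarrow> norm (XX s t) \<le> H * \<bar>t - s\<bar> powr (2 * \<alpha>)"
    and chen: "s \<in> {0..T} \<Longrightarrow> u \<in> {0..T} \<Longrightarrow> t \<in> {0..T} \<Longrightarrow>
      XX s t = XX s u + XX u t + tensor (X u - X s) (X t - X u)"
begin

sublocale f: C2_bounded f f1 H by (rule f_C2)
sublocale f1: C2_bounded f1 f2 H by (rule f1_C2)

text \<open>
  The coefficient \<open>Df(y) f(y)\<close> of the second level, regarded as an operator on the tensor product.
\<close>

definition g :: "'w \<Rightarrow> 'e \<Rightarrow>\<^sub>L 'w"
  where "g y = tensor_lift tensor (f1 y o\<^sub>L f y)"

definition J :: "'w \<Rightarrow> real \<Rightarrow> real \<Rightarrow> 'w"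
  where "J y s t = f y (X t - X s) + g y (XX s t)"

lemma g_tensor: "g y (tensor v w) = f1 y (f y v) w"
  by (simp add: g_def tensor_lift[OF injection])

lemma lift_diff: "tensor_lift tensor (A - B :: 'v \<Rightarrow>\<^sub>L 'v \<Rightarrow>\<^sub>L 'w) = tensor_lift tensor A - tensor_lift tensor B"
  by (rule linear_diff[OF bounded_linear.linear[OF tensor_lift_bounded_linear[OF injection]]])

lemma f_lip: "norm (f y - f z) \<le> H * norm (y - z)"
  by (rule lipschitz_of_bounded_derivative[OF f.deriv f.bound])

lemma H0: "0 \<le> H" and H_power: "a \<le> b \<Longrightarrow> H ^ a \<le> H ^ b" "1 \<le> H ^ a" "0 \<le> H ^ a"
  using H1 by (auto intro: power_increasing one_le_power)

lemma g_bound: "norm (g y) \<le> H ^ 3"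
proof -
  have "norm (g y) \<le> H * norm (f1 y o\<^sub>L f y)" unfolding g_def by (rule lift_bound)
  also have "\<dots> \<le> H * (H * H)" using H0 by (intro mult_left_mono compose_le f.bound f_bound)
  finally show ?thesis by (simp add: power3_eq_cube)
qed

lemma g_lip: "norm (g y - g z) \<le> 2 * H ^ 3 * norm (y - z)"
proof -
  have "(f1 y o\<^sub>L f y) - (f1 z o\<^sub>L f z) = ((f1 y - f1 z) o\<^sub>L f y) + (f1 z o\<^sub>L (f y - f z))"
    by (rule blinfun_eqI) (simp add: blinfun.diff_left blinfun.add_left blinfun.diff_right)
  then have "norm ((f1 y o\<^sub>L f y) - (f1 z o\<^sub>L f z)) \<le> (H * norm (y - z)) * H + H * (H * norm (y - z))"
    by (simp only:) (intro norm_triangle_le add_mono compose_le f.lip f_lip f.bound f_bound)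
  then have "H * norm ((f1 y o\<^sub>L f y) - (f1 z o\<^sub>L f z)) \<le> H * ((H * norm (y - z)) * H + H * (H * norm (y - z)))"
    using H0 by (rule mult_left_mono)
  then show ?thesis unfolding g_def lift_diff[symmetric]
    using order_trans[OF lift_bound] by (simp add: power3_eq_cube algebra_simps)
qed

lemma g_four_point:
  "norm ((g (y + a) - g y) - (g (z + c) - g z))
    \<le> 3 * H ^ 3 * (norm (a - c) + (norm (y - z) + norm (a - c)) * (norm a + norm c))"
proof -
  let ?m = "norm (a - c)" and ?n = "norm (y - z)"
  let ?D = "((f1 (y + a) o\<^sub>L f (y + a)) - (f1 y o\<^sub>L f y)) - ((f1 (z + c) o\<^sub>L f (z + c)) - (f1 z o\<^sub>L f z))"
  have "norm ((g (y + a) - g y) - (g (z + c) - g z)) \<le> H * norm ?D"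
    unfolding g_def lift_diff[symmetric] by (rule lift_bound)
  also have "\<dots> \<le> H * (2 * H\<^sup>2 * (?m + (?n + ?m) * norm a) + H\<^sup>2 * (norm c * (?n + ?m) + ?n * norm a))"
    using H0 by (intro mult_left_mono four_point_compose[OF f1_C2 f_C2 f.bound f_bound])
  also have "\<dots> = H ^ 3 * (2 * (?m + (?n + ?m) * norm a) + (norm c * (?n + ?m) + ?n * norm a))"
    by (simp add: power2_eq_square power3_eq_cube algebra_simps)
  also have "\<dots> \<le> H ^ 3 * (3 * (?m + (?n + ?m) * (norm a + norm c)))"
    using H0 by (intro mult_left_mono) (auto simp: algebra_simps)
  finally show ?thesis by (simp add: algebra_simps)
qed

text \<open>
  Chen's relation produces the cross term \<open>f1 y (f y X\<^sub>s\<^sub>,\<^sub>u) X\<^sub>u\<^sub>,\<^sub>t\<close>, which is the linear part of the change of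
  \<open>f\<close> between \<open>s\<close> and \<open>u\<close>. After this cancellation there remain a Taylor remainder of \<open>f\<close>, the effect
  of the smaller displacement \<open>w\<close>, and the change of \<open>g\<close>.
\<close>

lemma J_defect_eq:
  fixes y b
  assumes "s \<in> {0..T}" "u \<in> {0..T}" "t \<in> {0..T}"
  defines "w \<equiv> g y (XX s u) + b" and "a \<equiv> f y (X u - X s)"
  shows "J y s t - J y s u - J (y + J y s u + b) u t =
    - ((f (y + (a + w)) - f y - f1 y (a + w)) + f1 y w) (X t - X u) - (g (y + (a + w)) - g y) (XX u t)"
proof -
  have eq: "y + J y s u + b = y + (a + w)" by (simp add: J_def w_def a_def)
  have X: "f y (X t - X s) = f y (X u - X s) + f y (X t - X u)"
    by (simp flip: blinfun.add_right)
  show ?thesis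
    unfolding eq unfolding J_def chen[OF assms(1-3)] X a_def
    by (simp add: blinfun.add_left blinfun.diff_left blinfun.minus_left blinfun.add_right g_tensor algebra_simps)
qed

context
  fixes s u t :: real
  assumes tm: "0 \<le> s" "s \<le> u" "u \<le> t" "t \<le> T" "t - s \<le> 1"
begin

lemma in_range: "s \<in> {0..T}" "u \<in> {0..T}" "t \<in> {0..T}" using tm by auto

lemma tau: "0 \<le> (t - s) powr \<alpha>" "(t - s) powr \<alpha> \<le> 1"
  "(t - s) powr (2 * \<alpha>) = (t - s) powr \<alpha> * (t - s) powr \<alpha>"
  "(t - s) powr (2 * \<alpha>) \<le> (t - s) powr \<alpha>"
proof -
  show "(t - s) powr \<alpha> \<le> 1" using powr_mono2[of \<alpha> "t - s" 1] tm exponent by simp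
  show "(t - s) powr (2 * \<alpha>) = (t - s) powr \<alpha> * (t - s) powr \<alpha>"
    by (simp flip: powr_add)
  show "(t - s) powr (2 * \<alpha>) \<le> (t - s) powr \<alpha>"
    using tm exponent by (intro powr_mono') auto
qed simp

lemma local_bounds:
  "norm (X u - X s) \<le> H * (t - s) powr \<alpha>" "norm (X t - X u) \<le> H * (t - s) powr \<alpha>"
  "norm (XX s u) \<le> H * (t - s) powr (2 * \<alpha>)" "norm (XX u t) \<le> H * (t - s) powr (2 * \<alpha>)"
proof -
  have "(u - s) powr \<beta> \<le> (t - s) powr \<beta>" "(t - u) powr \<beta> \<le> (t - s) powr \<beta>" if "0 \<le> \<beta>" for \<beta>
    using tm that by (auto intro!: powr_mono2)
  then have "H * (u - s) powr \<beta> \<le> H * (t - s) powr \<beta>" "H * (t - u) powr \<beta> \<le> H * (t - s) powr \<beta>" if "0 \<le> \<beta>" for \<beta>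
    using that H0 by (auto intro!: mult_left_mono)
  then show "norm (X u - X s) \<le> H * (t - s) powr \<alpha>" "norm (X t - X u) \<le> H * (t - s) powr \<alpha>"
    "norm (XX s u) \<le> H * (t - s) powr (2 * \<alpha>)" "norm (XX u t) \<le> H * (t - s) powr (2 * \<alpha>)"
    using X_holder[OF in_range(1,2)] X_holder[OF in_range(2,3)] XX_holder[OF in_range(1,2)] XX_holder[OF in_range(2,3)]
      tm exponent by (auto intro: order_trans)
qed

lemma fX_bound: "norm (f y (X u - X s)) \<le> H\<^sup>2 * (t - s) powr \<alpha>"
  using apply_le[OF f_bound local_bounds(1)] by (simp add: power2_eq_square mult.assoc)

lemma gXX_bound: "norm (g y (XX s u)) \<le> H ^ 4 * (t - s) powr (2 * \<alpha>)"
  using apply_le[OF g_bound local_bounds(3)] by (simp add: power_numeral_reduce mult_ac)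

lemma fX_lip: "norm (f y (X u - X s) - f z (X u - X s)) \<le> H\<^sup>2 * norm (y - z) * (t - s) powr \<alpha>"
  using apply_le[OF f_lip[of y z] local_bounds(1)] by (simp add: power2_eq_square blinfun.diff_left mult_ac)

lemma gXX_lip: "norm (g y (XX s u) - g z (XX s u)) \<le> 2 * H ^ 4 * norm (y - z) * (t - s) powr (2 * \<alpha>)"
  using apply_le[OF g_lip[of y z] local_bounds(3)] by (simp add: power_numeral_reduce blinfun.diff_left mult_ac)

lemma J_defect_bound:
  "norm (J y s t - J y s u - J (y + J y s u + b) u t)
    \<le> 10 * H ^ 8 * (t - s) powr \<alpha> * ((t - s) powr (2 * \<alpha>) + norm b)"
proof -
  define \<tau> where "\<tau> = (t - s) powr \<alpha>"
  define \<sigma> where "\<sigma> = (t - s) powr (2 * \<alpha>)"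
  have \<tau>: "0 \<le> \<tau>" "\<tau> \<le> 1" "\<sigma> = \<tau> * \<tau>" "\<sigma> \<le> \<tau>" "0 \<le> \<sigma>" using tau by (auto simp: \<tau>_def \<sigma>_def)
  define w where "w = g y (XX s u) + b"
  define a where "a = f y (X u - X s)"
  define S where "S = \<sigma> + norm b"
  have S: "0 \<le> S" "\<sigma> \<le> S" "norm b \<le> S" using \<tau> by (auto simp: S_def)
  have a: "norm a \<le> H\<^sup>2 * \<tau>" using fX_bound by (simp add: a_def \<tau>_def)
  have "norm w \<le> H ^ 4 * \<sigma> + norm b" unfolding w_def \<sigma>_def by (intro norm_triangle_le add_mono gXX_bound order_refl)
  also have "\<dots> \<le> H ^ 4 * \<sigma> + H ^ 4 * norm b" using H_power(2)[of 4] mult_right_mono[of 1 "H ^ 4" "norm b"] by simp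
  finally have w: "norm w \<le> H ^ 4 * S" by (simp add: S_def algebra_simps)
  have R: "norm ((f (y + (a + w)) - f y - f1 y (a + w)) + f1 y w) \<le> 2 * H ^ 5 * S"
  proof -
    have "(f (y + (a + w)) - f y - f1 y (a + w)) + f1 y w = (f (y + a) - f y - f1 y a) + (f (y + (a + w)) - f (y + a))"
      by (simp add: blinfun.add_right)
    then have "norm ((f (y + (a + w)) - f y - f1 y (a + w)) + f1 y w) \<le> H * (norm a)\<^sup>2 + H * norm (y + (a + w) - (y + a))"
      by (simp only:) (intro norm_triangle_le add_mono f.taylor_first f_lip)
    also have "\<dots> \<le> H * (H\<^sup>2 * \<tau>)\<^sup>2 + H * (H ^ 4 * S)"
      using a w H0 by (intro add_mono mult_left_mono power_mono) auto
    also have "\<dots> = H ^ 5 * \<sigma> + H ^ 5 * S" by (simp add: \<tau>(3) power_numeral_reduce mult_ac)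
    also have "\<dots> \<le> H ^ 5 * S + H ^ 5 * S" using S H0 by (intro add_mono mult_left_mono) auto
    finally show ?thesis by (simp add: mult_ac)
  qed
  have A: "\<tau> * norm (a + w) \<le> 2 * H ^ 4 * S"
  proof -
    have "\<tau> * norm (a + w) \<le> \<tau> * (H\<^sup>2 * \<tau> + H ^ 4 * S)"
      using a w \<tau>(1) by (intro mult_left_mono norm_triangle_le add_mono)
    also have "\<dots> = H\<^sup>2 * \<sigma> + \<tau> * (H ^ 4 * S)" by (simp add: \<tau> algebra_simps)
    also have "\<dots> \<le> H ^ 4 * S + 1 * (H ^ 4 * S)"
      using \<tau> S H_power by (intro add_mono mult_mono) auto
    finally show ?thesis by (simp add: mult_ac)
  qed
  have G: "norm ((g (y + (a + w)) - g y) (XX u t)) \<le> 4 * H ^ 8 * \<tau> * S"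
  proof -
    have "norm ((g (y + (a + w)) - g y) (XX u t)) \<le> (2 * H ^ 3 * norm (a + w)) * (H * \<sigma>)"
      using g_lip[of "y + (a + w)" y] local_bounds(4) by (intro apply_le) (simp_all add: \<sigma>_def)
    also have "\<dots> = (2 * H ^ 4 * \<tau>) * (\<tau> * norm (a + w))" by (simp add: \<tau> power_numeral_reduce mult_ac)
    also have "\<dots> \<le> (2 * H ^ 4 * \<tau>) * (2 * H ^ 4 * S)" using A \<tau>(1) H_power by (intro mult_left_mono) auto
    also have "\<dots> = 4 * H ^ 8 * \<tau> * S" by (simp add: power_numeral_reduce mult_ac)
    finally show ?thesis .
  qed
  have "norm (((f (y + (a + w)) - f y - f1 y (a + w)) + f1 y w) (X t - X u)) \<le> (2 * H ^ 5 * S) * (H * \<tau>)"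
    using R local_bounds(2) by (intro apply_le) (simp_all add: \<tau>_def)
  also have "\<dots> = 2 * H ^ 6 * (\<tau> * S)" by (simp add: power_numeral_reduce mult_ac)
  also have "\<dots> \<le> 2 * H ^ 8 * (\<tau> * S)"
    using H_power \<tau>(1) S(1) by (intro mult_right_mono mult_left_mono) auto
  finally have F: "norm (((f (y + (a + w)) - f y - f1 y (a + w)) + f1 y w) (X t - X u)) \<le> 2 * H ^ 8 * (\<tau> * S)" .
  have "norm (J y s t - J y s u - J (y + J y s u + b) u t) \<le> 2 * H ^ 8 * (\<tau> * S) + 4 * H ^ 8 * \<tau> * S"
    unfolding J_defect_eq[OF in_range, of y b] w_def[symmetric] a_def[symmetric]
    using F G by (intro order_trans[OF norm_triangle_ineq4] add_mono) (simp_all add: blinfun.minus_left)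
  also have "\<dots> \<le> 10 * H ^ 8 * \<tau> * S"
    using mult_nonneg_nonneg[OF H_power(3)[of 8] mult_nonneg_nonneg[OF \<tau>(1) S(1)]] by (simp add: mult_ac)
  finally show ?thesis by (simp add: \<tau>_def S_def \<sigma>_def)
qed

text \<open>
  The decomposition of \<open>J_defect_eq\<close> at two starting points; each term is a four-point difference. The
  constant is spelled out because it must not depend on the times, the points or the displacements.
\<close>

lemma J_defect_four_point:
  assumes P: "0 \<le> P" and b: "norm b \<le> P * (t - s) powr (2 * \<alpha>)" and c: "norm c \<le> P * (t - s) powr (2 * \<alpha>)"
  defines "E \<equiv> H\<^sup>2 + H ^ 4 + P"
  shows "norm ((J y s t - J y s u - J (y + J y s u + b) u t) - (J z s t - J z s u - J (z + J z s u + c) u t))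
    \<le> (H * (6 * H ^ 5 * E + 4 * H ^ 5 * E\<^sup>2 + H * E + 2 * H ^ 5) + 3 * H ^ 4 * (3 * H ^ 4 + 2 * E + 6 * H ^ 4 * E))
      * (t - s) powr \<alpha> * ((t - s) powr (2 * \<alpha>) * norm (y - z) + norm (b - c))"
proof -
  define \<tau> where "\<tau> = (t - s) powr \<alpha>"
  define \<sigma> where "\<sigma> = (t - s) powr (2 * \<alpha>)"
  have \<tau>: "0 \<le> \<tau>" "\<tau> \<le> 1" "\<sigma> = \<tau> * \<tau>" "\<sigma> \<le> \<tau>" "0 \<le> \<sigma>" using tau by (auto simp: \<tau>_def \<sigma>_def)
  define n where "n = norm (y - z)"
  define S where "S = \<sigma> * n + norm (b - c)"
  have S: "0 \<le> S" "\<sigma> * n \<le> S" "norm (b - c) \<le> S" "0 \<le> n" using \<tau> by (auto simp: S_def n_def)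
  have E: "0 \<le> E" "H ^ 4 + P \<le> E" using P H_power(3)[of 2] H_power(3)[of 4] by (auto simp: E_def)
  define wy where "wy = g y (XX s u) + b"
  define wz where "wz = g z (XX s u) + c"
  define ay where "ay = f y (X u - X s)"
  define az where "az = f z (X u - X s)"
  have wbd: "norm wy \<le> E * \<sigma>" "norm wz \<le> E * \<sigma>"
  proof -
    have "norm wy \<le> H ^ 4 * \<sigma> + P * \<sigma>" "norm wz \<le> H ^ 4 * \<sigma> + P * \<sigma>"
      unfolding wy_def wz_def using gXX_bound b c by (auto intro!: norm_triangle_le add_mono simp: \<sigma>_def)
    moreover have "(H ^ 4 + P) * \<sigma> \<le> E * \<sigma>" using E \<tau> by (intro mult_right_mono) auto
    ultimately show "norm wy \<le> E * \<sigma>" "norm wz \<le> E * \<sigma>" by (auto simp: algebra_simps)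
  qed
  have Abd: "norm (ay + wy) \<le> E * \<tau>" "norm (az + wz) \<le> E * \<tau>"
  proof -
    have "H ^ 4 * \<sigma> + P * \<sigma> \<le> H ^ 4 * \<tau> + P * \<tau>" using P \<tau> H_power by (intro add_mono mult_left_mono) auto
    moreover have "norm wy \<le> H ^ 4 * \<sigma> + P * \<sigma>" "norm wz \<le> H ^ 4 * \<sigma> + P * \<sigma>"
      unfolding wy_def wz_def using gXX_bound b c by (auto intro!: norm_triangle_le add_mono simp: \<sigma>_def)
    moreover have "norm ay \<le> H\<^sup>2 * \<tau>" "norm az \<le> H\<^sup>2 * \<tau>" using fX_bound by (auto simp: ay_def az_def \<tau>_def)
    ultimately show "norm (ay + wy) \<le> E * \<tau>" "norm (az + wz) \<le> E * \<tau>"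
      using norm_triangle_ineq[of ay wy] norm_triangle_ineq[of az wz] by (simp_all add: E_def algebra_simps)
  qed
  have wd: "norm (wy - wz) \<le> 2 * H ^ 4 * S"
  proof -
    have "wy - wz = (g y (XX s u) - g z (XX s u)) + (b - c)" by (simp add: wy_def wz_def)
    then have "norm (wy - wz) \<le> 2 * H ^ 4 * n * \<sigma> + norm (b - c)"
      using gXX_lip[of y z] by (simp only: norm_triangle_le add_mono n_def \<sigma>_def order_refl)
    also have "\<dots> \<le> 2 * H ^ 4 * (\<sigma> * n) + 2 * H ^ 4 * norm (b - c)"
      using mult_right_mono[of 1 "2 * H ^ 4" "norm (b - c)"] H_power(2)[of 4] by (simp add: mult_ac)
    finally show ?thesis by (simp add: S_def algebra_simps)
  qed
  have Ad: "\<tau> * norm ((ay + wy) - (az + wz)) \<le> 3 * H ^ 4 * S"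
  proof -
    have "(ay + wy) - (az + wz) = (ay - az) + (wy - wz)" by simp
    then have "norm ((ay + wy) - (az + wz)) \<le> H\<^sup>2 * n * \<tau> + 2 * H ^ 4 * S"
      using fX_lip[of y z] wd by (simp only: norm_triangle_le add_mono n_def \<tau>_def ay_def az_def)
    then have "\<tau> * norm ((ay + wy) - (az + wz)) \<le> \<tau> * (H\<^sup>2 * n * \<tau> + 2 * H ^ 4 * S)" using \<tau>(1) by (intro mult_left_mono)
    also have "\<dots> = H\<^sup>2 * (\<sigma> * n) + \<tau> * (2 * H ^ 4 * S)" by (simp add: \<tau> algebra_simps)
    also have "\<dots> \<le> H ^ 4 * S + 1 * (2 * H ^ 4 * S)" using \<tau> S H_power by (intro add_mono mult_mono) auto
    finally show ?thesis by (simp add: mult_ac)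
  qed
  let ?A = "ay + wy" and ?C = "az + wz"
  let ?m = "norm (?A - ?C)"
  have \<tau>m: "\<sigma> * ?m \<le> 3 * H ^ 4 * S"
    using mult_mono[OF \<tau>(2) Ad] \<tau> by (simp add: mult.assoc)
  let ?R = "(f (y + ?A) - f y - f1 y ?A) - (f (z + ?C) - f z - f1 z ?C)"
  have R: "norm ?R \<le> (6 * H ^ 5 * E + 4 * H ^ 5 * E\<^sup>2) * S"
  proof -
    have "norm ?R \<le> H * (norm ?A + norm ?C) * ?m + H * (norm (y - z) + ?m) * (norm ?A)\<^sup>2"
      by (rule four_point_taylor[OF f_C2 f1_C2])
    also have "\<dots> \<le> H * (E * \<tau> + E * \<tau>) * ?m + H * (n + ?m) * (E * \<tau>)\<^sup>2"
      using Abd H0 E S unfolding n_def by (intro add_mono mult_right_mono mult_left_mono power_mono) auto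
    also have "\<dots> = 2 * H * E * (\<tau> * ?m) + H * E\<^sup>2 * (\<sigma> * n + \<sigma> * ?m)"
      by (simp add: \<tau>(3) power2_eq_square algebra_simps)
    also have "\<dots> \<le> 2 * H * E * (3 * H ^ 4 * S) + H * E\<^sup>2 * (H ^ 4 * S + 3 * H ^ 4 * S)"
    proof -
      have "\<sigma> * n \<le> H ^ 4 * S" using S(2) mult_right_mono[OF H_power(2)[of 4] S(1)] by simp
      then show ?thesis using Ad \<tau>m H0 E by (intro add_mono mult_left_mono) auto
    qed
    also have "\<dots> = (6 * H ^ 5 * E + 4 * H ^ 5 * E\<^sup>2) * S" by (simp add: power_numeral_reduce algebra_simps)
    finally show ?thesis .
  qed
  have W: "norm (f1 y wy - f1 z wz) \<le> (H * E + 2 * H ^ 5) * S"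
  proof -
    have "f1 y wy - f1 z wz = (f1 y - f1 z) wy + f1 z (wy - wz)"
      by (simp add: blinfun.diff_left blinfun.diff_right)
    then have "norm (f1 y wy - f1 z wz) \<le> (H * norm (y - z)) * (E * \<sigma>) + H * (2 * H ^ 4 * S)"
      by (simp only:) (intro norm_triangle_le add_mono apply_le f.lip f.bound wbd wd)
    also have "\<dots> = H * E * (\<sigma> * n) + 2 * H ^ 5 * S" by (simp add: n_def power_numeral_reduce algebra_simps)
    also have "\<dots> \<le> H * E * S + 2 * H ^ 5 * S" using S E H0 by (intro add_mono mult_left_mono) auto
    finally show ?thesis by (simp add: algebra_simps)
  qed
  have G: "norm (((g (y + ?A) - g y) - (g (z + ?C) - g z)) (XX u t)) \<le> 3 * H ^ 4 * (3 * H ^ 4 + 2 * E + 6 * H ^ 4 * E) * \<tau> * S"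
  proof -
    have "norm (((g (y + ?A) - g y) - (g (z + ?C) - g z)) (XX u t))
      \<le> (3 * H ^ 3 * (?m + (norm (y - z) + ?m) * (norm ?A + norm ?C))) * (H * \<sigma>)"
      using local_bounds(4) by (intro apply_le g_four_point) (simp add: \<sigma>_def)
    also have "\<dots> \<le> (3 * H ^ 3 * (?m + (n + ?m) * (E * \<tau> + E * \<tau>))) * (H * \<sigma>)"
      using Abd H_power H0 \<tau> S unfolding n_def by (intro mult_right_mono mult_left_mono add_mono) auto
    also have "\<dots> = 3 * H ^ 4 * \<tau> * (\<tau> * ?m + 2 * E * (\<sigma> * n) + 2 * E * (\<sigma> * ?m))"
      by (simp add: \<tau>(3) power_numeral_reduce algebra_simps)
    also have "\<dots> \<le> 3 * H ^ 4 * \<tau> * (3 * H ^ 4 * S + 2 * E * S + 2 * E * (3 * H ^ 4 * S))"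
      using Ad \<tau>m S E \<tau>(1) H_power by (intro mult_left_mono add_mono) auto
    also have "\<dots> = 3 * H ^ 4 * (3 * H ^ 4 + 2 * E + 6 * H ^ 4 * E) * \<tau> * S" by (simp add: algebra_simps)
    finally show ?thesis .
  qed
  have F: "norm ((?R + (f1 y wy - f1 z wz)) (X t - X u))
    \<le> ((6 * H ^ 5 * E + 4 * H ^ 5 * E\<^sup>2) * S + (H * E + 2 * H ^ 5) * S) * (H * \<tau>)"
    using local_bounds(2) R W by (intro apply_le norm_triangle_le add_mono) (simp_all add: \<tau>_def)
  have "(J y s t - J y s u - J (y + J y s u + b) u t) - (J z s t - J z s u - J (z + J z s u + c) u t)
      = - ((?R + (f1 y wy - f1 z wz)) (X t - X u)) - ((g (y + ?A) - g y) - (g (z + ?C) - g z)) (XX u t)"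
    unfolding J_defect_eq[OF in_range] wy_def[symmetric] wz_def[symmetric] ay_def[symmetric] az_def[symmetric]
    by (simp add: blinfun.add_left blinfun.diff_left blinfun.minus_left)
  also have "norm \<dots> \<le> ((6 * H ^ 5 * E + 4 * H ^ 5 * E\<^sup>2) * S + (H * E + 2 * H ^ 5) * S) * (H * \<tau>)
      + 3 * H ^ 4 * (3 * H ^ 4 + 2 * E + 6 * H ^ 4 * E) * \<tau> * S"
    using F G by (intro order_trans[OF norm_triangle_ineq4] add_mono) simp_all
  also have "\<dots> = (H * (6 * H ^ 5 * E + 4 * H ^ 5 * E\<^sup>2 + H * E + 2 * H ^ 5) + 3 * H ^ 4 * (3 * H ^ 4 + 2 * E + 6 * H ^ 4 * E)) * \<tau> * S"
    by (simp add: algebra_simps)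
  finally show ?thesis by (simp add: \<tau>_def S_def \<sigma>_def n_def)
qed

end

lemma X_tendsto:
  assumes "\<And>n. s' n \<in> {0..T}" "s \<in> {0..T}" "s' \<longlonglongrightarrow> s"
  shows "(\<lambda>n. X (s' n)) \<longlonglongrightarrow> X s"
proof -
  have "(\<lambda>n. \<bar>s' n - s\<bar> powr \<alpha>) \<longlonglongrightarrow> 0"
    using exponent assms(3) by (intro tendsto_zero_powrI[of _ _ "\<lambda>_. \<alpha>"] tendsto_rabs_zero) (auto simp: LIM_zero_iff)
  then have "(\<lambda>n. H * \<bar>s' n - s\<bar> powr \<alpha>) \<longlonglongrightarrow> 0" by (rule tendsto_mult_right_zero)
  then have "(\<lambda>n. X (s' n) - X s) \<longlonglongrightarrow> 0"
    by (rule Lim_null_comparison[rotated]) (use X_holder assms in auto)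
  then show ?thesis by (simp add: LIM_zero_iff)
qed

lemma bounded_bilinear_tensor: "bounded_bilinear tensor"
  using bilinear_tensor norm_tensor
  by (auto simp: bilinear_def linear_iff intro!: bounded_bilinear.intro exI[of _ 1])

text \<open>
  Chen's relation expresses the change of \<open>XX\<close> under a change of its end points by values of \<open>XX\<close> and \<open>X\<close> over
  short intervals.
\<close>

lemma XX_tendsto:
  assumes "\<And>n. s' n \<in> {0..T}" "\<And>n. t' n \<in> {0..T}" "s \<in> {0..T}" "t \<in> {0..T}" "s' \<longlonglongrightarrow> s" "t' \<longlonglongrightarrow> t"
  shows "(\<lambda>n. XX (s' n) (t' n)) \<longlonglongrightarrow> XX s t"
proof -
  have null: "(\<lambda>n. XX (p n) (q n)) \<longlonglongrightarrow> 0"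
    if "\<And>n. p n \<in> {0..T}" "\<And>n. q n \<in> {0..T}" "(\<lambda>n. q n - p n) \<longlonglongrightarrow> 0" for p q
  proof -
    have "(\<lambda>n. \<bar>q n - p n\<bar> powr (2 * \<alpha>)) \<longlonglongrightarrow> 0"
      using exponent that(3) by (intro tendsto_zero_powrI[of _ _ "\<lambda>_. 2 * \<alpha>"] tendsto_rabs_zero) auto
    then have "(\<lambda>n. H * \<bar>q n - p n\<bar> powr (2 * \<alpha>)) \<longlonglongrightarrow> 0" by (rule tendsto_mult_right_zero)
    then show ?thesis by (rule Lim_null_comparison[rotated]) (use XX_holder that in auto)
  qed
  have eq: "XX (s' n) (t' n) = XX s t - XX s (s' n) - XX (t' n) t
      - tensor (X (s' n) - X s) (X t - X (s' n)) - tensor (X (t' n) - X (s' n)) (X t - X (t' n))" for n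
    using chen[of s "s' n" t] chen[of "s' n" "t' n" t] assms by simp
  have "(\<lambda>n. XX s t - XX s (s' n) - XX (t' n) t
      - tensor (X (s' n) - X s) (X t - X (s' n)) - tensor (X (t' n) - X (s' n)) (X t - X (t' n)))
    \<longlonglongrightarrow> XX s t - 0 - 0 - tensor (X s - X s) (X t - X s) - tensor (X t - X s) (X t - X t)"
    using assms
    by (intro tendsto_intros null bounded_bilinear.tendsto[OF bounded_bilinear_tensor] X_tendsto)
      (auto intro!: tendsto_eq_intros)
  then show ?thesis
    unfolding eq using bounded_bilinear.zero_left[OF bounded_bilinear_tensor] bounded_bilinear.zero_right[OF bounded_bilinear_tensor]
    by simp
qed

text \<open>
  The constant \<open>10 H\<^bsup>8\<^esup>\<close> is chosen generously enough for all the estimates of the locale at once.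
\<close>

sublocale rough_flow f0 J \<alpha> T "10 * H ^ 8"
proof
  show "1/3 < \<alpha>" "\<alpha> \<le> 1/2" "0 < T" using exponent horizon by auto
  show "1 \<le> 10 * H ^ 8" using H_power(2)[of 8] by simp
  have HH: "H \<le> 10 * H ^ 8" "H\<^sup>2 + H ^ 4 \<le> 10 * H ^ 8" "H\<^sup>2 + 2 * H ^ 4 \<le> 10 * H ^ 8"
  proof -
    have "H \<le> H ^ 8" "H\<^sup>2 \<le> H ^ 8" "H ^ 4 \<le> H ^ 8" "0 \<le> H ^ 8"
      using H_power(1)[of 1 8] H_power(1)[of 2 8] H_power(1)[of 4 8] H_power(3)[of 8] by simp_all
    then show "H \<le> 10 * H ^ 8" "H\<^sup>2 + H ^ 4 \<le> 10 * H ^ 8" "H\<^sup>2 + 2 * H ^ 4 \<le> 10 * H ^ 8" by linarith+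
  qed
  show "norm (f0 x - f0 y) \<le> 10 * H ^ 8 * norm (x - y)" for x y
    using HH by (intro order_trans[OF drift_lipschitz] mult_right_mono) auto
  fix s u t :: real and y z b
  { assume st: "0 \<le> s" "s \<le> t" "t \<le> T" "t - s \<le> 1"
    note tm = st(1,2) order_refl st(3,4)
    let ?\<tau> = "(t - s) powr \<alpha>" and ?\<sigma> = "(t - s) powr (2 * \<alpha>)"
    have "norm (J y s t) \<le> H\<^sup>2 * ?\<tau> + H ^ 4 * ?\<sigma>"
      unfolding J_def by (intro norm_triangle_le add_mono fX_bound[OF tm] gXX_bound[OF tm])
    also have "\<dots> \<le> H\<^sup>2 * ?\<tau> + H ^ 4 * ?\<tau>" using tau(4)[OF tm] H_power by (intro add_mono mult_left_mono) auto
    also have "\<dots> \<le> 10 * H ^ 8 * ?\<tau>" using mult_right_mono[OF HH(2), of ?\<tau>] by (simp add: algebra_simps)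
    finally show "norm (J y s t) \<le> 10 * H ^ 8 * ?\<tau>" .
    have "J y s t - J z s t = (f y (X t - X s) - f z (X t - X s)) + (g y (XX s t) - g z (XX s t))" by (simp add: J_def)
    then have "norm (J y s t - J z s t) \<le> H\<^sup>2 * norm (y - z) * ?\<tau> + 2 * H ^ 4 * norm (y - z) * ?\<sigma>"
      by (simp only:) (intro norm_triangle_le add_mono fX_lip[OF tm] gXX_lip[OF tm])
    also have "\<dots> \<le> H\<^sup>2 * norm (y - z) * ?\<tau> + 2 * H ^ 4 * norm (y - z) * ?\<tau>"
      using tau(4)[OF tm] H_power by (intro add_mono mult_left_mono) auto
    also have "\<dots> \<le> 10 * H ^ 8 * ?\<tau> * norm (y - z)"
      using mult_right_mono[OF HH(3), of "?\<tau> * norm (y - z)"] by (simp add: algebra_simps)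
    finally show "norm (J y s t - J z s t) \<le> 10 * H ^ 8 * ?\<tau> * norm (y - z)" .
  }
  assume "0 \<le> s" "s \<le> u" "u \<le> t" "t \<le> T" "t - s \<le> 1"
  then show "norm (J y s t - J y s u - J (y + J y s u + b) u t)
        \<le> 10 * H ^ 8 * (t - s) powr \<alpha> * ((t - s) powr (2 * \<alpha>) + norm b)"
    by (rule J_defect_bound)
next
  fix P :: real assume P: "0 \<le> P"
  define E where "E = H\<^sup>2 + H ^ 4 + P"
  define C where "C = H * (6 * H ^ 5 * E + 4 * H ^ 5 * E\<^sup>2 + H * E + 2 * H ^ 5) + 3 * H ^ 4 * (3 * H ^ 4 + 2 * E + 6 * H ^ 4 * E)"
  have "norm ((J y s t - J y s u - J (y + J y s u + b) u t) - (J z s t - J z s u - J (z + J z s u + c) u t))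
      \<le> C * (t - s) powr \<alpha> * ((t - s) powr (2 * \<alpha>) * norm (y - z) + norm (b - c))"
    if tm: "0 \<le> s" "s \<le> u" "u \<le> t" "t \<le> T" "t - s \<le> 1"
      and bc: "norm b \<le> P * (t - s) powr (2 * \<alpha>)" "norm c \<le> P * (t - s) powr (2 * \<alpha>)" for y z b c s u t
    using J_defect_four_point[OF tm P bc] unfolding C_def E_def .
  moreover have "0 \<le> C" using H0 P by (auto simp: C_def E_def intro!: add_nonneg_nonneg mult_nonneg_nonneg)
  ultimately show "\<exists>C\<ge>0. \<forall>y z b c s u t. 0 \<le> s \<longrightarrow> s \<le> u \<longrightarrow> u \<le> t \<longrightarrow> t \<le> T \<longrightarrow> t - s \<le> 1 \<longrightarrow>
      norm b \<le> P * (t - s) powr (2 * \<alpha>) \<longrightarrow> norm c \<le> P * (t - s) powr (2 * \<alpha>) \<longrightarrow>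
      norm ((J y s t - J y s u - J (y + J y s u + b) u t) - (J z s t - J z s u - J (z + J z s u + c) u t))
        \<le> C * (t - s) powr \<alpha> * ((t - s) powr (2 * \<alpha>) * norm (y - z) + norm (b - c))"
    by blast
next
  fix s' t' :: "nat \<Rightarrow> real" and s t y
  assume r: "\<And>n. 0 \<le> s' n \<and> s' n \<le> t' n \<and> t' n \<le> T" and lim: "s' \<longlonglongrightarrow> s" "t' \<longlonglongrightarrow> t"
  have r': "s' n \<in> {0..T}" "t' n \<in> {0..T}" for n using r[of n] by auto
  have "s \<in> {0..T}" "t \<in> {0..T}"
    using closed_sequentially[OF closed_atLeastAtMost] r' lim by blast+
  then show "(\<lambda>n. J y (s' n) (t' n)) \<longlonglongrightarrow> J y s t"
    unfolding J_def using r' lim by (intro tendsto_intros X_tendsto XX_tendsto)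
qed

end

section \<open>Solutions and Davie paths coincide\<close>

definition consecutive_sum :: "(real \<Rightarrow> real \<Rightarrow> 'a::comm_monoid_add) \<Rightarrow> real list \<Rightarrow> 'a"
  where "consecutive_sum F ps = (\<Sum>i<length ps - 1. F (ps ! i) (ps ! Suc i))"

text \<open>
  The condition on neighbouring entries includes that the list increases, so that sums over partitions
  can be treated by induction on the list.
\<close>

definition mesh_below :: "real \<Rightarrow> real list \<Rightarrow> bool"
  where "mesh_below \<delta> = successively (\<lambda>u v. u < v \<and> v - u < \<delta>)"

lemma consecutive_sum_single [simp]: "consecutive_sum F [a] = 0"
  by (simp add: consecutive_sum_def)

lemma consecutive_sum_Cons [simp]: "consecutive_sum F (a # b # ps) = F a b + consecutive_sum F (b # ps)"
  by (simp add: consecutive_sum_def sum.lessThan_Suc_shift del: sum.lessThan_Suc)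

lemma consecutive_sum_append:
  "consecutive_sum F (ps @ x # qs) = consecutive_sum F (ps @ [x]) + consecutive_sum F (x # qs)"
proof (induction ps)
  case (Cons a ps)
  then show ?case by (cases ps) (auto simp: add_ac)
qed simp

lemma mesh_below_iff: "mesh_below \<delta> ps \<longleftrightarrow> sorted_wrt (<) ps \<and> (\<forall>i < length ps - 1. ps ! Suc i - ps ! i < \<delta>)"
proof -
  have "mesh_below \<delta> ps \<longleftrightarrow> successively (<) ps \<and> (\<forall>i < length ps - 1. ps ! Suc i - ps ! i < \<delta>)"
    by (auto simp: mesh_below_def successively_conv_nth)
  also have "successively (<) ps \<longleftrightarrow> sorted_wrt (<) ps"
    by (rule successively_iff_sorted_wrt_strong) auto
  finally show ?thesis .
qed

lemma eventually_mesh_to_zero: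
  "eventually P (mesh_to_zero t) \<longleftrightarrow>
    (\<exists>\<delta>>0. \<forall>ps. ps \<noteq> [] \<longrightarrow> mesh_below \<delta> ps \<longrightarrow> hd ps = 0 \<longrightarrow> last ps = t \<longrightarrow> P ps)"
proof -
  have "eventually P (mesh_to_zero t) \<longleftrightarrow> (\<exists>\<delta>\<in>{0<..}. eventually P (principal
    {ps \<in> partitions t. \<forall>i < length ps - 1. ps ! Suc i - ps ! i < \<delta>}))"
    unfolding mesh_to_zero_def
  proof (rule eventually_INF_base)
    fix a b :: real assume "a \<in> {0<..}" "b \<in> {0<..}"
    then show "\<exists>x\<in>{0<..}. principal {ps \<in> partitions t. \<forall>i < length ps - 1. ps ! Suc i - ps ! i < x} \<le>
      inf (principal {ps \<in> partitions t. \<forall>i < length ps - 1. ps ! Suc i - ps ! i < a})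
        (principal {ps \<in> partitions t. \<forall>i < length ps - 1. ps ! Suc i - ps ! i < b})"
      by (intro bexI[of _ "min a b"]) auto
  qed auto
  then show ?thesis by (auto simp: eventually_principal partitions_def mesh_below_iff)
qed

lemma mesh_below_hd_le_last: "ps \<noteq> [] \<Longrightarrow> mesh_below \<delta> ps \<Longrightarrow> hd ps \<le> last ps"
proof (induction ps)
  case (Cons a ps)
  then show ?case by (cases ps) (auto simp: mesh_below_def)
qed simp

lemma consecutive_sum_bound:
  fixes E :: "real \<Rightarrow> real \<Rightarrow> 'a::real_normed_vector"
  assumes "ps \<noteq> []" "mesh_below \<delta> ps" "a \<le> hd ps" "last ps \<le> b"
    and "\<And>u v. a \<le> u \<Longrightarrow> u < v \<Longrightarrow> v \<le> b \<Longrightarrow> v - u < \<delta> \<Longrightarrow> norm (E u v) \<le> c * (v - u)"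
  shows "norm (consecutive_sum E ps) \<le> c * (last ps - hd ps)"
  using assms(1-4)
proof (induction ps)
  case (Cons x ps)
  show ?case
  proof (cases ps)
    case (Cons y qs)
    have f: "mesh_below \<delta> ps" "x < y" "y - x < \<delta>" using Cons.prems Cons by (auto simp: mesh_below_def)
    have "y \<le> last ps" using mesh_below_hd_le_last[OF _ f(1)] Cons by simp
    then have "norm (E x y) \<le> c * (y - x)" using assms(5) f Cons.prems Cons by auto
    moreover have "norm (consecutive_sum E ps) \<le> c * (last ps - hd ps)"
      using Cons.IH f Cons.prems Cons by auto
    ultimately have "norm (E x y + consecutive_sum E ps) \<le> c * (y - x) + c * (last ps - hd ps)"
      by (intro norm_triangle_le add_mono)
    then show ?thesis using Cons by (simp add: algebra_simps)
  qed simp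
qed simp

lemma consecutive_sum_telescope:
  fixes G :: "real \<Rightarrow> 'a::ab_group_add"
  shows "ps \<noteq> [] \<Longrightarrow> consecutive_sum (\<lambda>u v. G v - G u) ps = G (last ps) - G (hd ps)"
proof (induction ps)
  case (Cons a ps)
  then show ?case by (cases ps) auto
qed simp

text \<open>
  The points of the \<open>n\<close>-th dyadic partition of \<open>[s, t]\<close> without the left end point, so that partitions
  of adjacent intervals can be appended.
\<close>

primrec bisection :: "nat \<Rightarrow> real \<Rightarrow> real \<Rightarrow> real list" where
  "bisection 0 s t = [t]"
| "bisection (Suc n) s t = bisection n s ((s + t) / 2) @ bisection n ((s + t) / 2) t"

lemma bisection_last: "bisection n s t \<noteq> [] \<and> last (bisection n s t) = t"
  by (induction n arbitrary: s t) auto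

lemma bisection_mesh_below: "s < t \<Longrightarrow> (t - s) / 2 ^ n < \<delta> \<Longrightarrow> mesh_below \<delta> (s # bisection n s t)"
proof (induction n arbitrary: s t)
  case (Suc n)
  define m where "m = (s + t) / 2"
  have m: "s < m" "m < t" using Suc.prems by (auto simp: m_def)
  have h: "(m - s) / 2 ^ n < \<delta>" "(t - m) / 2 ^ n < \<delta>" using Suc.prems by (simp_all add: m_def field_simps)
  have "mesh_below \<delta> (s # bisection n s m)" "mesh_below \<delta> (m # bisection n m t)"
    using Suc.IH[OF m(1) h(1)] Suc.IH[OF m(2) h(2)] .
  then show ?case
    unfolding mesh_below_def bisection.simps m_def[symmetric] append_Cons[symmetric] successively_append_iff
    using bisection_last[of n s m] by (auto simp: successively_Cons)
qed (simp add: mesh_below_def)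

lemma consecutive_sum_bisection:
  "consecutive_sum F (s # bisection (Suc n) s t) =
    consecutive_sum F (s # bisection n s ((s + t) / 2)) + consecutive_sum F ((s + t) / 2 # bisection n ((s + t) / 2) t)"
proof -
  let ?m = "(s + t) / 2"
  obtain ps where ps: "bisection n s ?m = ps @ [?m]"
    using bisection_last[of n s ?m] by (metis append_butlast_last_id)
  show ?thesis
    using consecutive_sum_append[of F "s # ps" ?m "bisection n ?m t"] by (simp add: ps)
qed

text \<open>
  Each halving improves the error by the factor \<open>2 powr (1 - \<theta>)\<close>, and the geometric series gives the
  constant. Bisections suffice, because they are only used where the limit over all partitions is
  known to exist.
\<close>

lemma bisection_sewing:
  fixes F :: "real \<Rightarrow> real \<Rightarrow> 'a::real_normed_vector"
  assumes \<theta>: "\<theta> > 1" and C: "0 \<le> C"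
    and defect: "\<And>s t. a \<le> s \<Longrightarrow> s < t \<Longrightarrow> t \<le> b \<Longrightarrow> norm (F s t - F s ((s + t) / 2) - F ((s + t) / 2) t) \<le> C * (t - s) powr \<theta>"
    and "a \<le> s" "s < t" "t \<le> b"
  shows "norm (consecutive_sum F (s # bisection n s t) - F s t) \<le> C / (1 - 2 powr (1 - \<theta>)) * (t - s) powr \<theta>"
  using assms(4-6)
proof (induction n arbitrary: s t)
  case 0
  then show ?case using \<theta> C powr_less_mono[of "1 - \<theta>" 0 2] by simp
next
  case (Suc n)
  let ?m = "(s + t) / 2" and ?K = "C / (1 - 2 powr (1 - \<theta>))"
  have q: "2 powr (1 - \<theta>) < 1" using \<theta> powr_less_mono[of "1 - \<theta>" 0 2] by simp
  have half: "((t - s) / 2) powr \<theta> = (2 powr (1 - \<theta>) / 2) * (t - s) powr \<theta>"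
    using Suc.prems by (simp add: powr_divide powr_diff)
  let ?A = "consecutive_sum F (s # bisection n s ?m) - F s ?m"
  let ?B = "consecutive_sum F (?m # bisection n ?m t) - F ?m t"
  have ms: "?m - s = (t - s) / 2" "t - ?m = (t - s) / 2" by (auto simp: field_simps)
  have A: "norm ?A \<le> ?K * ((t - s) / 2) powr \<theta>" and B: "norm ?B \<le> ?K * ((t - s) / 2) powr \<theta>"
    using Suc.IH[of s ?m] Suc.IH[of ?m t] Suc.prems unfolding ms by auto
  have "consecutive_sum F (s # bisection (Suc n) s t) - F s t = ?A + ?B - (F s t - F s ?m - F ?m t)"
    unfolding consecutive_sum_bisection by (simp add: algebra_simps)
  then have "norm (consecutive_sum F (s # bisection (Suc n) s t) - F s t) \<le>
      (?K * ((t - s) / 2) powr \<theta> + ?K * ((t - s) / 2) powr \<theta>) + C * (t - s) powr \<theta>"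
    using A B defect[OF Suc.prems]
    by (simp only:) (rule order_trans[OF norm_triangle_ineq4 add_mono[OF norm_triangle_le[OF add_mono]]])
  also have "\<dots> = (?K * 2 powr (1 - \<theta>) + C) * (t - s) powr \<theta>"
  proof -
    have "(K * (p / 2 * x) + K * (p / 2 * x)) + C * x = (K * p + C) * x" for K p x :: real
      by (simp add: field_simps)
    then show ?thesis unfolding half .
  qed
  also have "?K * 2 powr (1 - \<theta>) + C = ?K"
  proof -
    have "C / (1 - p) * p + C = C / (1 - p)" if "p < 1" for p :: real
      using that by (simp add: divide_simps) (simp add: algebra_simps)
    then show ?thesis using q by blast
  qed
  finally show ?case .
qed

lemma holder2E:
  assumes "holder2 \<beta> T R"
  obtains C where "0 \<le> C" "\<And>s t. s \<in> {0..T} \<Longrightarrow> t \<in> {0..T} \<Longrightarrow> s \<noteq> t \<Longrightarrow> norm (R s t) \<le> C * \<bar>t - s\<bar> powr \<beta>"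
proof -
  obtain C where C: "\<And>s t. s \<in> {0..T} \<Longrightarrow> t \<in> {0..T} \<Longrightarrow> s \<noteq> t \<Longrightarrow> norm (R s t) / \<bar>t - s\<bar> powr \<beta> \<le> C"
    using assms unfolding holder2_def bdd_above_def by blast
  have "norm (R s t) \<le> max C 0 * \<bar>t - s\<bar> powr \<beta>" if "s \<in> {0..T}" "t \<in> {0..T}" "s \<noteq> t" for s t
  proof -
    have "norm (R s t) \<le> C * \<bar>t - s\<bar> powr \<beta>" using C[OF that] that by (simp add: pos_divide_le_eq)
    also have "\<dots> \<le> max C 0 * \<bar>t - s\<bar> powr \<beta>" by (intro mult_right_mono) auto
    finally show ?thesis .
  qed
  then show ?thesis by (intro that[of "max C 0"]) auto
qed

lemma holder2_from_local:
  assumes h: "0 < h" and C: "0 \<le> C" and \<beta>: "0 \<le> \<beta>"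
    and loc: "\<And>s t. s \<in> {0..T} \<Longrightarrow> t \<in> {0..T} \<Longrightarrow> s \<noteq> t \<Longrightarrow> \<bar>t - s\<bar> \<le> h \<Longrightarrow> norm (R s t) \<le> C * \<bar>t - s\<bar> powr \<beta>"
    and bd: "\<And>s t. s \<in> {0..T} \<Longrightarrow> t \<in> {0..T} \<Longrightarrow> norm (R s t) \<le> M"
  shows "holder2 \<beta> T R"
proof -
  have "norm (R s t) / \<bar>t - s\<bar> powr \<beta> \<le> max C (M / h powr \<beta>)" if st: "s \<in> {0..T}" "t \<in> {0..T}" "s \<noteq> t" for s t
  proof (cases "\<bar>t - s\<bar> \<le> h")
    case True
    then have "norm (R s t) / \<bar>t - s\<bar> powr \<beta> \<le> C" using loc[OF st] st by (simp add: pos_divide_le_eq)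
    then show ?thesis by simp
  next
    case False
    have M: "0 \<le> M" using bd[OF st(1,2)] norm_ge_zero order_trans by blast
    have "norm (R s t) / \<bar>t - s\<bar> powr \<beta> \<le> M / h powr \<beta>"
      using False h \<beta> M bd[OF st(1,2)] by (intro frac_le powr_mono2) auto
    then show ?thesis by simp
  qed
  then show ?thesis unfolding holder2_def bdd_above_def by blast
qed

context rough_equation
begin

lemma frechet_f: "frechet_blinfun f y = f1 y"
  unfolding frechet_blinfun_def frechet_derivative_at[OF f.deriv[of y], symmetric]
  by (rule blinfun_apply_inverse)

lemma rough_sum_eq:
  "rough_sum tensor X XX (\<lambda>s. f (Y s)) (\<lambda>s. frechet_blinfun f (Y s) o\<^sub>L Y' s) ps =
    consecutive_sum (\<lambda>u v. f (Y u) (X v - X u) + tensor_lift tensor (f1 (Y u) o\<^sub>L Y' u) (XX u v)) ps"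
  by (simp add: rough_sum_def consecutive_sum_def Let_def frechet_f)

lemma drift_integral_expansion:
  assumes Y: "continuous_on {0..T} Y" and st: "0 \<le> s" "s \<le> t" "t \<le> T"
    and D: "\<And>r. s \<le> r \<Longrightarrow> r \<le> t \<Longrightarrow> norm (Y r - Y s) \<le> D"
  shows "norm (integral {0..t} (\<lambda>r. f0 (Y r)) - integral {0..s} (\<lambda>r. f0 (Y r)) - (t - s) *\<^sub>R f0 (Y s))
    \<le> H * D * (t - s)"
proof -
  have c: "continuous_on S (\<lambda>r. f0 (Y r))" if "S \<subseteq> {0..T}" for S
    using continuous_on_compose2[OF continuous_on_f0[of UNIV] continuous_on_subset[OF Y that]] by auto
  have "integral {0..s} (\<lambda>r. f0 (Y r)) + integral {s..t} (\<lambda>r. f0 (Y r)) = integral {0..t} (\<lambda>r. f0 (Y r))"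
    using st by (intro Henstock_Kurzweil_Integration.integral_combine integrable_continuous_interval c) auto
  then have "integral {0..t} (\<lambda>r. f0 (Y r)) - integral {0..s} (\<lambda>r. f0 (Y r)) - (t - s) *\<^sub>R f0 (Y s)
      = integral {s..t} (\<lambda>r. f0 (Y r)) - integral {s..t} (\<lambda>r. f0 (Y s))"
    using st by (simp add: algebra_simps)
  also have "\<dots> = integral {s..t} (\<lambda>r. f0 (Y r) - f0 (Y s))"
    using st by (intro integral_diff[symmetric] integrable_continuous_interval c continuous_on_const) auto
  also have "norm \<dots> \<le> H * D * (t - s)"
    using st D H0
    by (intro integral_bound continuous_on_diff c continuous_on_const)
      (auto intro!: order_trans[OF drift_lipschitz] mult_left_mono)
  finally show ?thesis .
qed

lemma holder_path_continuous: "holder_path \<alpha> T Y \<Longrightarrow> continuous_on {0..T} Y"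
proof -
  assume "holder_path \<alpha> T Y"
  then obtain C where C: "0 \<le> C" "\<And>s t. s \<in> {0..T} \<Longrightarrow> t \<in> {0..T} \<Longrightarrow> s \<noteq> t \<Longrightarrow> norm (Y t - Y s) \<le> C * \<bar>t - s\<bar> powr \<alpha>"
    unfolding holder_path_def by (rule holder2E) blast
  show ?thesis unfolding continuous_on_def
  proof
    fix s assume s: "s \<in> {0..T}"
    have "((\<lambda>t. \<bar>t - s\<bar> powr \<alpha>) \<longlongrightarrow> 0) (at s within {0..T})"
      using exponent by (intro tendsto_zero_powrI[of _ _ "\<lambda>_. \<alpha>"] tendsto_rabs_zero) (auto intro!: tendsto_eq_intros)
    then have "((\<lambda>t. C * \<bar>t - s\<bar> powr \<alpha>) \<longlongrightarrow> 0) (at s within {0..T})" by (rule tendsto_mult_right_zero)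
    then have "((\<lambda>t. Y t - Y s) \<longlongrightarrow> 0) (at s within {0..T})"
    proof (rule Lim_null_comparison[rotated])
      show "\<forall>\<^sub>F t in at s within {0..T}. norm (Y t - Y s) \<le> C * \<bar>t - s\<bar> powr \<alpha>"
        using C(2)[OF s] by (auto simp: eventually_at_filter)
    qed
    then show "(Y \<longlongrightarrow> Y s) (at s within {0..T})" by (simp add: LIM_zero_iff)
  qed
qed

lemma bounded_along_continuous_path:
  assumes "continuous_on {0..T} Y"
  obtains B where "0 \<le> B" "\<And>t. 0 \<le> t \<Longrightarrow> t \<le> T \<Longrightarrow> norm (Y t) \<le> B \<and> norm (f0 (Y t)) \<le> B"
proof -
  have "compact (Y ` {0..T})" "compact ((\<lambda>t. f0 (Y t)) ` {0..T})"
    using assms continuous_on_compose2[OF continuous_on_f0[of UNIV] assms] by (auto intro!: compact_continuous_image)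
  then have "bounded (Y ` {0..T} \<union> (\<lambda>t. f0 (Y t)) ` {0..T})" by (simp add: compact_imp_bounded)
  then obtain B where "0 < B" "\<forall>x\<in>Y ` {0..T} \<union> (\<lambda>t. f0 (Y t)) ` {0..T}. norm x \<le> B"
    using bounded_pos by blast
  then show ?thesis by (intro that[of B]) auto
qed

text \<open>
  Let \<open>I t\<close> be the rough integral over \<open>[0, t]\<close>. Its increment over \<open>[s, t]\<close> is approximated by the sum over a
  bisection of \<open>[s, t]\<close>: append the bisection to a fine partition of \<open>[0, s]\<close> and subtract. By sewing
  that sum differs from \<open>J (Y s) s t\<close> by \<open>O((t - s)\<^bsup>3\<alpha>\<^esup>)\<close>, uniformly in the fineness. The drift integral
  differs from \<open>(t - s) f0 (Y s)\<close> by a term of order \<open>1 + \<alpha>\<close>.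
\<close>

lemma solution_is_davie_path:
  assumes sol: "rde_solution tensor \<alpha> T X XX f0 f \<xi> Y Y'"
  obtains K h B where "davie_path K h Y" "Y 0 = \<xi>" "0 \<le> B" "continuous_on {0..T} Y"
    "\<And>t. 0 \<le> t \<Longrightarrow> t \<le> T \<Longrightarrow> norm (f0 (Y t)) \<le> B"
proof -
  have holder: "holder_path \<alpha> T Y" and rem: "holder2 (2 * \<alpha>) T (\<lambda>s t. Y t - Y s - Y' s (X t - X s))"
    and Y': "\<And>t. t \<in> {0..T} \<Longrightarrow> Y' t = f (Y t)"
    using sol by (auto simp: rde_solution_def controlled_path_def)
  have cont: "continuous_on {0..T} Y" by (rule holder_path_continuous[OF holder])
  obtain C0 where C0: "0 \<le> C0" "\<And>s t. s \<in> {0..T} \<Longrightarrow> t \<in> {0..T} \<Longrightarrow> s \<noteq> t \<Longrightarrow> norm (Y t - Y s) \<le> C0 * \<bar>t - s\<bar> powr \<alpha>"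
    by (rule holder2E[OF holder[unfolded holder_path_def]]) blast
  obtain C1 where C1: "0 \<le> C1" "\<And>s t. s \<in> {0..T} \<Longrightarrow> t \<in> {0..T} \<Longrightarrow> s \<noteq> t \<Longrightarrow>
      norm (Y t - Y s - Y' s (X t - X s)) \<le> C1 * \<bar>t - s\<bar> powr (2 * \<alpha>)"
    by (rule holder2E[OF rem]) blast
  let ?F = "\<lambda>u v. f (Y u) (X v - X u) + tensor_lift tensor (f1 (Y u) o\<^sub>L Y' u) (XX u v)"
  have FJ: "?F u v = J (Y u) u v" if "u \<in> {0..T}" for u v
    using that by (simp add: J_def g_def Y')
  have "\<forall>t\<in>{0..T}. \<exists>I. (consecutive_sum ?F \<longlongrightarrow> I) (mesh_to_zero t) \<and>
      Y t = \<xi> + integral {0..t} (\<lambda>s. f0 (Y s)) + I"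
    using sol unfolding rde_solution_def has_rough_integral_def rough_sum_eq[abs_def] by (elim conjE)
  from bchoice[OF this] obtain I where "\<forall>t\<in>{0..T}. (consecutive_sum ?F \<longlongrightarrow> I t) (mesh_to_zero t) \<and>
      Y t = \<xi> + integral {0..t} (\<lambda>s. f0 (Y s)) + I t" ..
  then have I: "\<And>t. t \<in> {0..T} \<Longrightarrow> (consecutive_sum ?F \<longlongrightarrow> I t) (mesh_to_zero t)"
    "\<And>t. t \<in> {0..T} \<Longrightarrow> Y t = \<xi> + integral {0..t} (\<lambda>s. f0 (Y s)) + I t"
    by auto
  have I_approx: "\<exists>\<delta>>0. \<forall>ps. ps \<noteq> [] \<longrightarrow> mesh_below \<delta> ps \<longrightarrow> hd ps = 0 \<longrightarrow> last ps = t \<longrightarrow>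
      norm (consecutive_sum ?F ps - I t) < e" if "t \<in> {0..T}" "0 < e" for t e
    using tendstoD[OF I(1)[OF that(1)] that(2)] unfolding eventually_mesh_to_zero dist_norm .
  have I0: "I 0 = 0"
  proof (rule ccontr)
    assume "I 0 \<noteq> 0"
    then obtain \<delta> where "\<forall>ps. ps \<noteq> [] \<longrightarrow> mesh_below \<delta> ps \<longrightarrow> hd ps = 0 \<longrightarrow> last ps = 0 \<longrightarrow>
        norm (consecutive_sum ?F ps - I 0) < norm (I 0)"
      using I_approx[of 0 "norm (I 0)"] horizon by auto
    from this[rule_format, of "[0]"] show False by (simp add: mesh_below_def)
  qed
  define K1 where "K1 = 10 * H ^ 8 * (1 + (C1 + H ^ 4))"
  have K1: "0 \<le> K1" using C1 H_power(3)[of 4] H_power(3)[of 8] by (simp add: K1_def)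
  have defect: "norm (?F s t - ?F s ((s + t) / 2) - ?F ((s + t) / 2) t) \<le> K1 * (t - s) powr (3 * \<alpha>)"
    if st: "0 \<le> s" "s < t" "t \<le> T" "t - s \<le> 1" for s t
  proof -
    let ?m = "(s + t) / 2"
    have tm: "0 \<le> s" "s \<le> ?m" "?m \<le> t" "t \<le> T" "t - s \<le> 1" using st by auto
    \<comment> \<open>Since \<open>Y\<close> is controlled by \<open>X\<close>, the displacement at the midpoint is of order \<open>2\<alpha>\<close> only.\<close>
    define b where "b = Y ?m - Y s - J (Y s) s ?m"
    have "b = (Y ?m - Y s - Y' s (X ?m - X s)) - g (Y s) (XX s ?m)"
      using st Y'[of s] by (simp add: b_def J_def)
    then have "norm b \<le> C1 * \<bar>?m - s\<bar> powr (2 * \<alpha>) + H ^ 4 * (t - s) powr (2 * \<alpha>)"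
      using st C1(2)[of s ?m] gXX_bound[OF tm]
      by (simp only:) (rule order_trans[OF norm_triangle_ineq4 add_mono], auto)
    also have "\<dots> \<le> C1 * (t - s) powr (2 * \<alpha>) + H ^ 4 * (t - s) powr (2 * \<alpha>)"
      using st C1 exponent by (intro add_mono mult_left_mono powr_mono2) (auto simp: abs_if)
    finally have b: "norm b \<le> (C1 + H ^ 4) * (t - s) powr (2 * \<alpha>)" by (simp add: algebra_simps)
    have "norm (?F s t - ?F s ?m - ?F ?m t) = norm (J (Y s) s t - J (Y s) s ?m - J (Y s + J (Y s) s ?m + b) ?m t)"
      using st by (simp add: FJ b_def)
    also have "\<dots> \<le> 10 * H ^ 8 * (t - s) powr \<alpha> * ((t - s) powr (2 * \<alpha>) + norm b)"
      by (rule J_defect_bound[OF tm])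
    also have "\<dots> \<le> 10 * H ^ 8 * (t - s) powr \<alpha> * ((t - s) powr (2 * \<alpha>) + (C1 + H ^ 4) * (t - s) powr (2 * \<alpha>))"
      using b H_power(3)[of 8] by (intro mult_left_mono add_left_mono) auto
    also have "\<dots> = K1 * (t - s) powr (3 * \<alpha>)" unfolding powr3 K1_def by (simp add: algebra_simps)
    finally show ?thesis .
  qed
  define K2 where "K2 = K1 / (1 - 2 powr (1 - 3 * \<alpha>))"
  have K2: "0 \<le> K2" using K1 exponent powr_less_mono[of "1 - 3 * \<alpha>" 0 2] by (simp add: K2_def)
  have incr: "norm (I t - I s - J (Y s) s t) \<le> K2 * (t - s) powr (3 * \<alpha>)"
    if st: "0 \<le> s" "s < t" "t \<le> T" "t - s \<le> 1" for s t
  proof (rule field_le_epsilon)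
    fix e :: real assume e: "0 < e"
    obtain d1 where d1: "0 < d1" "\<And>ps. ps \<noteq> [] \<Longrightarrow> mesh_below d1 ps \<Longrightarrow> hd ps = 0 \<Longrightarrow> last ps = s \<Longrightarrow>
      norm (consecutive_sum ?F ps - I s) < e / 2"
      using I_approx[of s "e / 2"] st e by auto
    obtain d2 where d2: "0 < d2" "\<And>ps. ps \<noteq> [] \<Longrightarrow> mesh_below d2 ps \<Longrightarrow> hd ps = 0 \<Longrightarrow> last ps = t \<Longrightarrow>
      norm (consecutive_sum ?F ps - I t) < e / 2"
      using I_approx[of t "e / 2"] st e by auto
    define d where "d = min d1 d2"
    have d: "0 < d" using d1 d2 by (simp add: d_def)
    have "(\<lambda>n. T / 2 ^ n) \<longlonglongrightarrow> 0" by real_asymp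
    then have "\<forall>\<^sub>F n in sequentially. T / 2 ^ n < d" using d by (rule order_tendstoD)
    then obtain n where n: "T / 2 ^ n < d" by (auto simp: eventually_sequentially)
    have small: "r / 2 ^ n < d" if "r \<le> T" for r
      using n divide_right_mono[OF that, of "2 ^ n"] by simp
    obtain ps where ps: "mesh_below d (ps @ [s])" "hd (ps @ [s]) = 0"
    proof (cases "s = 0")
      case True
      then show ?thesis using that[of "[]"] by (simp add: mesh_below_def)
    next
      case False
      then have "mesh_below d (0 # bisection n 0 s)" using st by (intro bisection_mesh_below small) auto
      moreover obtain qs where "bisection n 0 s = qs @ [s]"
        using bisection_last[of n 0 s] by (metis append_butlast_last_id)
      ultimately show ?thesis using that[of "0 # qs"] by simp
    qed
    have fst: "mesh_below d (s # bisection n s t)" using st by (intro bisection_mesh_below small) auto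
    have mesh_below_mono: "mesh_below d' qs" if "mesh_below d qs" "d \<le> d'" for qs d'
      using that(1) unfolding mesh_below_def by (rule successively_mono) (use that(2) in auto)
    have "mesh_below d (ps @ s # bisection n s t)"
      using ps(1) fst unfolding mesh_below_def by (auto simp: successively_append_iff)
    then have 2: "norm (consecutive_sum ?F (ps @ s # bisection n s t) - I t) < e / 2"
      using ps(2) bisection_last[of n s t] by (intro d2) (auto simp: d_def hd_append intro: mesh_below_mono split: if_splits)
    have 1: "norm (consecutive_sum ?F (ps @ [s]) - I s) < e / 2"
      using ps by (intro d1) (auto simp: d_def intro: mesh_below_mono)
    have "norm (consecutive_sum ?F (s # bisection n s t) - ?F s t) \<le> K1 / (1 - 2 powr (1 - 3 * \<alpha>)) * (t - s) powr (3 * \<alpha>)"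
      using exponent K1 st defect by (intro bisection_sewing[of "3 * \<alpha>" K1 s t]) auto
    then have 3: "norm (consecutive_sum ?F (s # bisection n s t) - J (Y s) s t) \<le> K2 * (t - s) powr (3 * \<alpha>)"
      using st FJ by (simp add: K2_def)
    have "I t - I s - J (Y s) s t = (consecutive_sum ?F (ps @ [s]) - I s) - (consecutive_sum ?F (ps @ s # bisection n s t) - I t)
        + (consecutive_sum ?F (s # bisection n s t) - J (Y s) s t)"
      unfolding consecutive_sum_append[of ?F ps s "bisection n s t"] by simp
    then have "norm (I t - I s - J (Y s) s t) \<le> (e / 2 + e / 2) + K2 * (t - s) powr (3 * \<alpha>)"
      using 1 2 3 by (simp only:) (rule norm_triangle_le[OF add_mono[OF order_trans[OF norm_triangle_ineq4 add_mono]]], auto)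
    then show "norm (I t - I s - J (Y s) s t) \<le> K2 * (t - s) powr (3 * \<alpha>) + e" by simp
  qed
  have "davie_path (H * C0 + K2) 1 Y"
    unfolding davie_path_def
  proof (intro conjI allI impI)
    fix s t assume st: "0 \<le> s" "s \<le> t" "t \<le> T" "t - s \<le> 1"
    show "norm (Y t - step (Y s) s t) \<le> (H * C0 + K2) * (t - s) powr (3 * \<alpha>)"
    proof (cases "s = t")
      case True
      then show ?thesis using st by (simp add: step_def)
    next
      case False
      let ?f0 = "\<lambda>t. integral {0..t} (\<lambda>r. f0 (Y r))"
      have D: "norm (Y r - Y s) \<le> C0 * (t - s) powr \<alpha>" if "s \<le> r" "r \<le> t" for r
      proof (cases "r = s")
        case False
        have "norm (Y r - Y s) \<le> C0 * (r - s) powr \<alpha>" using C0(2)[of s r] that st False by auto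
        also have "\<dots> \<le> C0 * (t - s) powr \<alpha>" using C0 that exponent by (intro mult_left_mono powr_mono2) auto
        finally show ?thesis .
      qed (use C0 in auto)
      have "norm (?f0 t - ?f0 s - (t - s) *\<^sub>R f0 (Y s)) \<le> H * (C0 * (t - s) powr \<alpha>) * (t - s)"
        by (rule drift_integral_expansion[OF cont st(1-3) D])
      also have "\<dots> \<le> H * (C0 * (t - s) powr \<alpha>) * (t - s) powr (2 * \<alpha>)"
        using st H0 C0 by (intro mult_left_mono le_powr2) auto
      also have "\<dots> = H * C0 * (t - s) powr (3 * \<alpha>)" unfolding powr3 by simp
      finally have 1: "norm (?f0 t - ?f0 s - (t - s) *\<^sub>R f0 (Y s)) \<le> H * C0 * (t - s) powr (3 * \<alpha>)" .
      have 2: "norm (I t - I s - J (Y s) s t) \<le> K2 * (t - s) powr (3 * \<alpha>)" using incr st False by simp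
      have "Y t - Y s = (?f0 t - ?f0 s) + (I t - I s)" using I(2)[of t] I(2)[of s] st by simp
      then have "Y t - step (Y s) s t = (?f0 t - ?f0 s - (t - s) *\<^sub>R f0 (Y s)) + (I t - I s - J (Y s) s t)"
        by (simp add: step_def algebra_simps)
      then have "norm (Y t - step (Y s) s t) \<le> H * C0 * (t - s) powr (3 * \<alpha>) + K2 * (t - s) powr (3 * \<alpha>)"
        using 1 2 by (simp only: norm_triangle_le add_mono)
      then show ?thesis by (simp add: algebra_simps)
    qed
  qed (use H0 C0 K2 in auto)
  moreover have "Y 0 = \<xi>" using I(2)[of 0] I0 horizon by simp
  moreover obtain B where "0 \<le> B" "\<And>t. 0 \<le> t \<Longrightarrow> t \<le> T \<Longrightarrow> norm (Y t) \<le> B \<and> norm (f0 (Y t)) \<le> B"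
    by (rule bounded_along_continuous_path[OF cont]) blast
  ultimately show ?thesis using cont by (intro that[of "H * C0 + K2" 1 B]) auto
qed

text \<open>
  A Riemann sum of the rough integral differs from the telescoping sum of \<open>Y v - Y u\<close> minus the drift
  integral by terms of order \<open>3\<alpha>\<close>, whose sum tends to zero with the mesh. The Hoelder bounds are read
  off from the one-step estimate on short intervals, and \<open>Y\<close> is bounded because \<open>[0, T]\<close> is covered by
  finitely many of them.
\<close>

lemma davie_path_is_solution:
  assumes Y: "davie_path K h Y" and B: "0 \<le> B" "\<And>t. 0 \<le> t \<Longrightarrow> t \<le> T \<Longrightarrow> norm (f0 (Y t)) \<le> B"
  shows "rde_solution tensor \<alpha> T X XX f0 f (Y 0) Y (\<lambda>t. f (Y t))"
proof -
  have K: "0 \<le> K" and h: "0 < h" "h \<le> 1" and davie: "\<And>s t. 0 \<le> s \<Longrightarrow> s \<le> t \<Longrightarrow> t \<le> T \<Longrightarrow> t - s \<le> h \<Longrightarrow>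
      norm (Y t - step (Y s) s t) \<le> K * (t - s) powr (3 * \<alpha>)"
    using Y by (auto simp: davie_path_def)
  have expansion: "norm (Y t - Y s - J (Y s) s t) \<le> (B + K) * (t - s) powr (2 * \<alpha>)"
    if st: "0 \<le> s" "s \<le> t" "t \<le> T" "t - s \<le> h" for s t
  proof -
    have "(t - s) * norm (f0 (Y s)) \<le> (t - s) powr (2 * \<alpha>) * B"
      using B(2)[of s] st h by (intro mult_mono le_powr2) auto
    then have d: "norm ((t - s) *\<^sub>R f0 (Y s)) \<le> B * (t - s) powr (2 * \<alpha>)"
      using st by (simp add: mult.commute)
    have "K * (t - s) powr (3 * \<alpha>) \<le> K * (t - s) powr (2 * \<alpha>)"
      using K st h exponent by (intro mult_left_mono powr_mono') auto
    then have e: "norm (Y t - step (Y s) s t) \<le> K * (t - s) powr (2 * \<alpha>)" using davie[OF st] by linarith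
    have "Y t - Y s - J (Y s) s t = (t - s) *\<^sub>R f0 (Y s) + (Y t - step (Y s) s t)" by (simp add: step_def)
    then have "norm (Y t - Y s - J (Y s) s t) \<le> B * (t - s) powr (2 * \<alpha>) + K * (t - s) powr (2 * \<alpha>)"
      using d e by (simp only: norm_triangle_le add_mono)
    then show ?thesis by (simp add: algebra_simps)
  qed
  define C where "C = B + K + 10 * H ^ 8"
  have C: "0 \<le> C" using B K H_power(3)[of 8] by (simp add: C_def)
  have incr: "norm (Y t - Y s) \<le> C * (t - s) powr \<alpha>" if st: "0 \<le> s" "s \<le> t" "t \<le> T" "t - s \<le> h" for s t
  proof -
    have "norm (Y t - Y s) \<le> norm (Y t - Y s - J (Y s) s t) + norm (J (Y s) s t)" by norm
    also have "\<dots> \<le> (B + K) * (t - s) powr (2 * \<alpha>) + 10 * H ^ 8 * (t - s) powr \<alpha>"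
      using st h by (intro add_mono expansion J_bound) auto
    also have "\<dots> \<le> (B + K) * (t - s) powr \<alpha> + 10 * H ^ 8 * (t - s) powr \<alpha>"
      using st h B K exponent by (intro add_mono mult_left_mono powr_mono') auto
    finally show ?thesis by (simp add: C_def algebra_simps)
  qed
  have incr': "norm (Y t - Y s) \<le> C * \<bar>t - s\<bar> powr \<alpha>" if st: "s \<in> {0..T}" "t \<in> {0..T}" "\<bar>t - s\<bar> \<le> h" for s t
    using incr[of s t] incr[of t s] st by (cases "s \<le> t") (auto simp: norm_minus_commute)
  have grow: "norm (Y t) \<le> norm (Y 0) + real n * C" if "0 \<le> t" "t \<le> T" "t \<le> real n * h" for n t
    using that
  proof (induction n arbitrary: t)
    case (Suc n)
    define s where "s = max 0 (t - h)"
    have s: "0 \<le> s" "s \<le> t" "t - s \<le> h" "s \<le> real n * h" using Suc.prems h by (auto simp: s_def algebra_simps)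
    have "norm (Y t - Y s) \<le> C * (t - s) powr \<alpha>" using s Suc.prems by (intro incr) auto
    also have "\<dots> \<le> C * 1" using s h C exponent by (intro mult_left_mono powr_le_1) auto
    finally have "norm (Y t - Y s) \<le> C" by simp
    moreover have "norm (Y s) \<le> norm (Y 0) + real n * C" using s Suc.prems by (intro Suc.IH) auto
    moreover have "norm (Y t) \<le> norm (Y s) + norm (Y t - Y s)" by norm
    ultimately show ?case by (simp add: algebra_simps)
  qed simp
  obtain n :: nat where n: "T / h \<le> real n" using real_arch_simple by blast
  define M where "M = norm (Y 0) + real n * C"
  have nh: "T \<le> real n * h" using n h by (simp add: pos_divide_le_eq)
  have M: "norm (Y t) \<le> M" if "t \<in> {0..T}" for t
    using that nh unfolding M_def by (intro grow) auto
  have M2: "norm (Y t - Y s) \<le> M + M" if "s \<in> {0..T}" "t \<in> {0..T}" for s t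
    using that by (intro order_trans[OF norm_triangle_ineq4] add_mono M)
  have holderY: "holder_path \<alpha> T Y"
    unfolding holder_path_def using h C exponent incr' M2
    by (intro holder2_from_local[where C = C and h = h and M = "M + M"]) auto
  have cont: "continuous_on {0..T} Y" by (rule holder_path_continuous[OF holderY])
  have "holder_path \<alpha> T (\<lambda>t. f (Y t))"
    unfolding holder_path_def
  proof (rule holder2_from_local[where C = "H * C" and h = h and M = "H + H"])
    show "norm (f (Y t) - f (Y s)) \<le> H * C * \<bar>t - s\<bar> powr \<alpha>"
      if "s \<in> {0..T}" "t \<in> {0..T}" "s \<noteq> t" "\<bar>t - s\<bar> \<le> h" for s t
      using mult_left_mono[OF incr'[OF that(1,2,4)] H0] by (intro order_trans[OF f_lip]) (simp add: mult.assoc)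
    show "norm (f (Y t) - f (Y s)) \<le> H + H" for s t
      by (intro order_trans[OF norm_triangle_ineq4] add_mono f_bound)
  qed (use h C H0 exponent in auto)
  moreover have "holder2 (2 * \<alpha>) T (\<lambda>s t. Y t - Y s - f (Y s) (X t - X s))"
  proof (rule holder2_from_local[where C = "B + K + H ^ 4 + H * C * H" and h = h and M = "(M + M) + H * (H * T powr \<alpha>)"])
    fix s t assume st: "s \<in> {0..T}" "t \<in> {0..T}"
    have "\<bar>t - s\<bar> powr \<alpha> \<le> T powr \<alpha>" using st exponent by (intro powr_mono2) auto
    then have "norm (X t - X s) \<le> H * T powr \<alpha>"
      using X_holder[OF st] mult_left_mono[OF _ H0] order_trans by blast
    then show "norm (Y t - Y s - f (Y s) (X t - X s)) \<le> (M + M) + H * (H * T powr \<alpha>)"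
      by (rule order_trans[OF norm_triangle_ineq4 add_mono[OF M2[OF st] apply_le[OF f_bound]]])
    assume "s \<noteq> t" and sth: "\<bar>t - s\<bar> \<le> h"
    have fwd: "norm (Y t - Y s - f (Y s) (X t - X s)) \<le> (B + K + H ^ 4) * (t - s) powr (2 * \<alpha>)"
      if st: "0 \<le> s" "s \<le> t" "t \<le> T" "t - s \<le> h" for s t
    proof -
      have tm: "0 \<le> s" "s \<le> t" "t \<le> t" "t \<le> T" "t - s \<le> 1" using st h by auto
      have "Y t - Y s - f (Y s) (X t - X s) = (Y t - Y s - J (Y s) s t) + g (Y s) (XX s t)" by (simp add: J_def)
      then have "norm (Y t - Y s - f (Y s) (X t - X s)) \<le> (B + K) * (t - s) powr (2 * \<alpha>) + H ^ 4 * (t - s) powr (2 * \<alpha>)"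
        by (simp only:) (rule norm_triangle_le[OF add_mono[OF expansion[OF st] gXX_bound[OF tm]]])
      then show ?thesis by (simp add: algebra_simps)
    qed
    show "norm (Y t - Y s - f (Y s) (X t - X s)) \<le> (B + K + H ^ 4 + H * C * H) * \<bar>t - s\<bar> powr (2 * \<alpha>)"
    proof (cases "s \<le> t")
      case True
      have "norm (Y t - Y s - f (Y s) (X t - X s)) \<le> (B + K + H ^ 4) * \<bar>t - s\<bar> powr (2 * \<alpha>)"
        using fwd[of s t] True st sth by simp
      also have "\<dots> \<le> (B + K + H ^ 4 + H * C * H) * \<bar>t - s\<bar> powr (2 * \<alpha>)"
        using H0 C by (intro mult_right_mono) auto
      finally show ?thesis .
    next
      case False
      have "(f (Y s) - f (Y t)) (X t - X s) = f (Y s) (X t - X s) - f (Y t) (X t - X s)" by (simp add: blinfun.diff_left)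
      moreover have "f (Y t) (X s - X t) = - f (Y t) (X t - X s)" by (simp flip: blinfun.minus_right)
      \<comment> \<open>For \<open>t < s\<close> the roles of the end points are exchanged; the change of \<open>f (Y s)\<close> to \<open>f (Y t)\<close> costs
        another term of order \<open>2\<alpha>\<close>.\<close>
      ultimately have eq: "Y t - Y s - f (Y s) (X t - X s) = - (Y s - Y t - f (Y t) (X s - X t)) - (f (Y s) - f (Y t)) (X t - X s)"
        by simp
      have "norm (f (Y s) - f (Y t)) \<le> H * (C * \<bar>t - s\<bar> powr \<alpha>)"
        using mult_left_mono[OF incr'[OF st(2,1)] H0] sth by (intro order_trans[OF f_lip]) (simp add: abs_minus_commute)
      then have "norm ((f (Y s) - f (Y t)) (X t - X s)) \<le> (H * (C * \<bar>t - s\<bar> powr \<alpha>)) * (H * \<bar>t - s\<bar> powr \<alpha>)"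
        by (intro apply_le X_holder st)
      also have "\<dots> = H * C * H * \<bar>t - s\<bar> powr (2 * \<alpha>)" unfolding powr2 by simp
      finally have a: "norm ((f (Y s) - f (Y t)) (X t - X s)) \<le> H * C * H * \<bar>t - s\<bar> powr (2 * \<alpha>)" .
      have b: "norm (- (Y s - Y t - f (Y t) (X s - X t))) \<le> (B + K + H ^ 4) * \<bar>t - s\<bar> powr (2 * \<alpha>)"
        unfolding norm_minus_cancel using fwd[of t s] False st sth by auto
      have "norm (Y t - Y s - f (Y s) (X t - X s)) \<le> (B + K + H ^ 4) * \<bar>t - s\<bar> powr (2 * \<alpha>) + H * C * H * \<bar>t - s\<bar> powr (2 * \<alpha>)"
        unfolding eq by (rule order_trans[OF norm_triangle_ineq4 add_mono[OF b a]])
      then show ?thesis by (simp add: algebra_simps)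
    qed
  qed (use h H0 C B K exponent in auto)
  ultimately have controlled: "controlled_path \<alpha> T X Y (\<lambda>t. f (Y t))" using holderY by (simp add: controlled_path_def)
  have integral: "has_rough_integral tensor X XX (\<lambda>s. f (Y s)) (\<lambda>s. frechet_blinfun f (Y s) o\<^sub>L f (Y s)) t
      (Y t - Y 0 - integral {0..t} (\<lambda>s. f0 (Y s)))" if t: "t \<in> {0..T}" for t
    unfolding has_rough_integral_def
  proof (rule tendstoI)
    fix e :: real assume e: "0 < e"
    define K' where "K' = H * C + K"
    have K': "0 \<le> K'" using H0 C K by (simp add: K'_def)
    let ?f0 = "\<lambda>t. integral {0..t} (\<lambda>r. f0 (Y r))"
    let ?E = "\<lambda>u v. J (Y u) u v - (Y v - Y u) + (?f0 v - ?f0 u)"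
    obtain d where d: "0 < d" "d \<le> 1" "\<And>x. 0 \<le> x \<Longrightarrow> x \<le> d \<Longrightarrow> (K' * (T + 1)) * x powr (3 * \<alpha> - 1) \<le> e / 2"
      using small_powr[of "3 * \<alpha> - 1" "e / 2" "K' * (T + 1)"] exponent e by auto
    define c where "c = e / 2 / (T + 1)"
    have E: "norm (?E u v) \<le> c * (v - u)" if uv: "0 \<le> u" "u < v" "v \<le> T" "v - u < min d h" for u v
    proof -
      have D: "norm (Y r - Y u) \<le> C * (v - u) powr \<alpha>" if "u \<le> r" "r \<le> v" for r
        using that uv C exponent by (intro order_trans[OF incr] mult_left_mono powr_mono2) auto
      have "norm (?f0 v - ?f0 u - (v - u) *\<^sub>R f0 (Y u)) \<le> H * (C * (v - u) powr \<alpha>) * (v - u)"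
        using uv by (intro drift_integral_expansion[OF cont] D) auto
      also have "\<dots> \<le> H * (C * (v - u) powr \<alpha>) * (v - u) powr (2 * \<alpha>)"
        using uv h H0 C by (intro mult_left_mono le_powr2) auto
      also have "\<dots> = H * C * (v - u) powr (3 * \<alpha>)" unfolding powr3 by simp
      finally have 1: "norm (?f0 v - ?f0 u - (v - u) *\<^sub>R f0 (Y u)) \<le> H * C * (v - u) powr (3 * \<alpha>)" .
      have 2: "norm (Y v - step (Y u) u v) \<le> K * (v - u) powr (3 * \<alpha>)" using uv by (intro davie) auto
      have "?E u v = (?f0 v - ?f0 u - (v - u) *\<^sub>R f0 (Y u)) - (Y v - step (Y u) u v)"
        by (simp add: step_def algebra_simps)
      then have "norm (?E u v) \<le> H * C * (v - u) powr (3 * \<alpha>) + K * (v - u) powr (3 * \<alpha>)"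
        by (simp only:) (rule order_trans[OF norm_triangle_ineq4 add_mono[OF 1 2]])
      also have "\<dots> = K' * (v - u) powr (3 * \<alpha> - 1) * (v - u)"
        using powr_mult_base[of "v - u" "3 * \<alpha> - 1"] uv by (simp add: K'_def algebra_simps)
      also have "\<dots> \<le> c * (v - u)"
      proof (rule mult_right_mono)
        show "K' * (v - u) powr (3 * \<alpha> - 1) \<le> c"
          unfolding c_def
        proof (subst pos_le_divide_eq)
          show "K' * (v - u) powr (3 * \<alpha> - 1) * (T + 1) \<le> e / 2"
            using d(3)[of "v - u"] uv by (simp only: mult_ac)
        qed (use horizon in simp)
      qed (use uv in simp)
      finally show ?thesis .
    qed
    show "\<forall>\<^sub>F ps in mesh_to_zero t. dist (rough_sum tensor X XX (\<lambda>s. f (Y s)) (\<lambda>s. frechet_blinfun f (Y s) o\<^sub>L f (Y s)) ps)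
        (Y t - Y 0 - ?f0 t) < e"
      unfolding eventually_mesh_to_zero
    proof (intro exI[of _ "min d h"] conjI allI impI)
      fix ps assume ps: "ps \<noteq> []" "mesh_below (min d h) ps" "hd ps = 0" "last ps = t"
      have "norm (consecutive_sum ?E ps) \<le> c * (last ps - hd ps)"
        using ps t E by (intro consecutive_sum_bound[where a = 0 and b = T and \<delta> = "min d h"]) auto
      also have "\<dots> = c * t" using ps by simp
      also have "\<dots> < e"
      proof -
        have "c * t \<le> c * (T + 1)" using t e horizon by (intro mult_left_mono) (auto simp: c_def)
        also have "c * (T + 1) = e / 2"
        proof -
          have div_mult: "x / y * y = x" if "y \<noteq> 0" for x y :: real using that by simp
          have "T + 1 \<noteq> 0" using horizon by simp
          then show ?thesis unfolding c_def by (rule div_mult)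
        qed
        finally show ?thesis using e by simp
      qed
      finally have small: "norm (consecutive_sum ?E ps) < e" .
      have "consecutive_sum ?E ps = consecutive_sum (\<lambda>u. J (Y u) u) ps
          - consecutive_sum (\<lambda>u v. Y v - Y u) ps + consecutive_sum (\<lambda>u v. ?f0 v - ?f0 u) ps"
        by (simp only: consecutive_sum_def sum.distrib sum_subtractf)
      moreover have "consecutive_sum (\<lambda>u v. Y v - Y u) ps = Y t - Y 0" "consecutive_sum (\<lambda>u v. ?f0 v - ?f0 u) ps = ?f0 t - ?f0 0"
        using consecutive_sum_telescope[OF ps(1), of Y] consecutive_sum_telescope[OF ps(1), of ?f0] ps by auto
      moreover have "rough_sum tensor X XX (\<lambda>s. f (Y s)) (\<lambda>s. frechet_blinfun f (Y s) o\<^sub>L f (Y s)) ps = consecutive_sum (\<lambda>u. J (Y u) u) ps"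
        unfolding rough_sum_eq J_def[abs_def] g_def ..
      ultimately have "rough_sum tensor X XX (\<lambda>s. f (Y s)) (\<lambda>s. frechet_blinfun f (Y s) o\<^sub>L f (Y s)) ps - (Y t - Y 0 - ?f0 t)
          = consecutive_sum ?E ps"
        by simp
      then show "dist (rough_sum tensor X XX (\<lambda>s. f (Y s)) (\<lambda>s. frechet_blinfun f (Y s) o\<^sub>L f (Y s)) ps)
          (Y t - Y 0 - ?f0 t) < e"
        using small by (simp only: dist_norm)
    qed (use d h in auto)
  qed
  show ?thesis
    unfolding rde_solution_def
  proof (intro conjI ballI exI)
    fix t assume "t \<in> {0..T}"
    then show "has_rough_integral tensor X XX (\<lambda>s. f (Y s)) (\<lambda>s. frechet_blinfun f (Y s) o\<^sub>L f (Y s)) t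
      (Y t - Y 0 - integral {0..t} (\<lambda>s. f0 (Y s)))" by (rule integral)
  qed (use controlled in auto)
qed

lemma solution_exists:
  obtains Y Y' where "rde_solution tensor \<alpha> T X XX f0 f \<xi> Y Y'"
proof -
  obtain Y K h B where Y: "davie_path K h Y" "Y 0 = \<xi>" "\<And>t. 0 \<le> t \<Longrightarrow> t \<le> T \<Longrightarrow> norm (f0 (Y t)) \<le> B"
    by (rule davie_path_exists) blast
  have "0 \<le> B" using Y(3)[of 0] horizon norm_ge_zero[of "f0 (Y 0)"] by linarith
  then show ?thesis using that davie_path_is_solution[OF Y(1) _ Y(3)] Y(2) by blast
qed

end

section \<open>Charts of submanifolds\<close>

locale chart =
  fixes M U :: "'w::banach set" and Om :: "(real ^ 'm) set" and \<phi> :: "real ^ 'm \<Rightarrow> 'w" and \<psi> :: "'w \<Rightarrow> real ^ 'm"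
    and \<phi>1 \<phi>2 \<phi>3
  assumes chart: "C3_chart M U Om \<phi> \<psi>" and derivs: "C3_derivatives Om \<phi> \<phi>1 \<phi>2 \<phi>3"
begin

lemma opens: "open U" "open Om" and homeo: "homeomorphism Om (U \<inter> M) \<phi> \<psi>"
  using chart by (auto simp: C3_chart_def)

lemma derivatives:
  "z \<in> Om \<Longrightarrow> (\<phi> has_derivative blinfun_apply (\<phi>1 z)) (at z)"
  "z \<in> Om \<Longrightarrow> (\<phi>1 has_derivative blinfun_apply (\<phi>2 z)) (at z)"
  "z \<in> Om \<Longrightarrow> (\<phi>2 has_derivative blinfun_apply (\<phi>3 z)) (at z)"
  and continuous_\<phi>3: "continuous_on Om \<phi>3"
  using derivs by (auto simp: C3_derivatives_def)

lemma isCont_\<phi>: "z \<in> Om \<Longrightarrow> isCont \<phi> z" "z \<in> Om \<Longrightarrow> isCont \<phi>1 z" "z \<in> Om \<Longrightarrow> isCont \<phi>2 z"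
  using derivatives has_derivative_continuous by blast+

lemma frechet_\<phi>: "z \<in> Om \<Longrightarrow> frechet_derivative \<phi> (at z) = blinfun_apply (\<phi>1 z)"
  using frechet_derivative_at[OF derivatives(1)] by simp

lemma inj_\<phi>1: "z \<in> Om \<Longrightarrow> inj (blinfun_apply (\<phi>1 z))"
  using chart by (auto simp: C3_chart_def simp flip: frechet_\<phi>)

lemma inverse: "y \<in> U \<inter> M \<Longrightarrow> \<phi> (\<psi> y) = y" "y \<in> U \<inter> M \<Longrightarrow> \<psi> y \<in> Om" "z \<in> Om \<Longrightarrow> \<phi> z \<in> U \<inter> M" "z \<in> Om \<Longrightarrow> \<psi> (\<phi> z) = z"
  using homeo by (auto simp: homeomorphism_def)

lemma \<phi>2_symmetric: "z \<in> Om \<Longrightarrow> \<phi>2 z u v = \<phi>2 z v u"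
  using isCont_\<phi>(3)
  by (intro second_derivative_symmetric[OF opens(2) _ derivatives(1,2)] continuous_at_imp_continuous_on) auto

text \<open>
  Quantitative control of the chart on a closed ball around \<open>z0\<close>: \<open>L\<close> bounds the second derivative and the
  Taylor remainders of both orders, and \<open>c\<close> bounds the inverses of \<open>\<phi>\<close> (seen from the centre) and of its
  derivatives.
\<close>

definition good_ball :: "real ^ 'm \<Rightarrow> real \<Rightarrow> real \<Rightarrow> real \<Rightarrow> bool"
  where "good_ball z0 r L c \<longleftrightarrow> 0 < r \<and> 0 \<le> L \<and> 0 \<le> c \<and> cball z0 r \<subseteq> Om \<and>
    (\<forall>x\<in>cball z0 r. norm (\<phi>2 x) \<le> L \<and> norm (x - z0) \<le> c * norm (\<phi> x - \<phi> z0) \<and>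
      (\<forall>u. norm u \<le> c * norm (\<phi>1 x u)) \<and>
      (\<forall>h. x + h \<in> cball z0 r \<longrightarrow> norm (\<phi> (x + h) - \<phi> x - \<phi>1 x h) \<le> L * (norm h)\<^sup>2 \<and>
        norm (\<phi> (x + h) - \<phi> x - \<phi>1 x h - (1/2) *\<^sub>R \<phi>2 x h h) \<le> L * norm h ^ 3))"

lemma good_ballD:
  assumes "good_ball z0 r L c"
  shows "0 < r" "0 \<le> L" "0 \<le> c" "x \<in> cball z0 r \<Longrightarrow> x \<in> Om"
    and "x \<in> cball z0 r \<Longrightarrow> norm (x - z0) \<le> c * norm (\<phi> x - \<phi> z0)"
    and "x \<in> cball z0 r \<Longrightarrow> norm u \<le> c * norm (\<phi>1 x u)"
    and "x \<in> cball z0 r \<Longrightarrow> x + h \<in> cball z0 r \<Longrightarrow> norm (\<phi> (x + h) - \<phi> x - \<phi>1 x h) \<le> L * (norm h)\<^sup>2"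
    and "x \<in> cball z0 r \<Longrightarrow> x + h \<in> cball z0 r \<Longrightarrow>
      norm (\<phi> (x + h) - \<phi> x - \<phi>1 x h - (1/2) *\<^sub>R \<phi>2 x h h) \<le> L * norm h ^ 3"
    and "x \<in> cball z0 r \<Longrightarrow> norm (\<phi>2 x) \<le> L"
  using assms unfolding good_ball_def subset_iff by blast+

text \<open>
  With a left inverse \<open>P\<close> of the derivative at \<open>z0\<close>, the radius is chosen such that
  \<open>norm P * norm (\<phi>1 x - \<phi>1 z0) \<le> 1/2\<close> on the ball. Then \<open>P\<close> composed with \<open>\<phi>1 x\<close>, and with \<open>\<phi>\<close> itself, is a
  perturbation of the identity by at most one half. Boundedness of the higher derivatives uses that
  closed balls in the coordinate space are compact.
\<close>

lemma good_ball_exists: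
  assumes z0: "z0 \<in> Om"
  obtains r L c where "good_ball z0 r L c"
proof -
  obtain P :: "'w \<Rightarrow>\<^sub>L (real ^ 'm)" where P: "\<And>u. P (\<phi>1 z0 u) = u"
    using bounded_left_inverse[OF inj_\<phi>1[OF z0]] by blast
  obtain r0 where r0: "0 < r0" "cball z0 r0 \<subseteq> Om" using opens(2) z0 by (auto simp: open_contains_cball)
  have "continuous_on (cball z0 r0) \<phi>2"
    using r0(2) isCont_\<phi>(3) by (intro continuous_at_imp_continuous_on) blast
  then have bdd2: "bounded (\<phi>2 ` cball z0 r0)"
    by (rule compact_imp_bounded[OF compact_continuous_image[OF _ compact_cball]])
  have "continuous_on (cball z0 r0) \<phi>3" by (rule continuous_on_subset[OF continuous_\<phi>3 r0(2)])
  then have bdd3: "bounded (\<phi>3 ` cball z0 r0)"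
    by (rule compact_imp_bounded[OF compact_continuous_image[OF _ compact_cball]])
  obtain L2 where L2: "\<forall>x\<in>\<phi>2 ` cball z0 r0. norm x \<le> L2" using bdd2 unfolding bounded_iff ..
  obtain L3 where L3: "\<forall>x\<in>\<phi>3 ` cball z0 r0. norm x \<le> L3" using bdd3 unfolding bounded_iff ..
  have L23: "norm (\<phi>2 x) \<le> L2" "norm (\<phi>3 x) \<le> L3" if "x \<in> cball z0 r0" for x
  proof -
    show "norm (\<phi>2 x) \<le> L2" using that by (intro L2[rule_format] imageI)
    show "norm (\<phi>3 x) \<le> L3" using that by (intro L3[rule_format] imageI)
  qed
  define L where "L = max L2 L3"
  have L: "norm (\<phi>2 x) \<le> L" "norm (\<phi>3 x) \<le> L" if "x \<in> cball z0 r0" for x using L23[OF that] by (auto simp: L_def)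
  have z00: "z0 \<in> cball z0 r0" using r0(1) by simp
  have inOm: "x \<in> Om" if "x \<in> cball z0 r0" for x using r0(2) that by (rule subsetD)
  have L0: "0 \<le> L" by (rule order_trans[OF norm_ge_zero L(1)[OF z00]])
  have lip: "norm (\<phi>1 x - \<phi>1 y) \<le> L * norm (x - y)" "norm (\<phi>2 x - \<phi>2 y) \<le> L * norm (x - y)"
    if xy: "x \<in> cball z0 r0" "y \<in> cball z0 r0" for x y
  proof -
    show "norm (\<phi>1 x - \<phi>1 y) \<le> L * norm (x - y)"
    proof (rule differentiable_bound[OF convex_cball _ _ xy])
      fix x assume x: "x \<in> cball z0 r0"
      show "(\<phi>1 has_derivative blinfun_apply (\<phi>2 x)) (at x within cball z0 r0)"
        by (rule has_derivative_at_withinI[OF derivatives(2)[OF inOm[OF x]]])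
      show "onorm (blinfun_apply (\<phi>2 x)) \<le> L" using L(1)[OF x] by (simp add: norm_blinfun.rep_eq)
    qed
    show "norm (\<phi>2 x - \<phi>2 y) \<le> L * norm (x - y)"
    proof (rule differentiable_bound[OF convex_cball _ _ xy])
      fix x assume x: "x \<in> cball z0 r0"
      show "(\<phi>2 has_derivative blinfun_apply (\<phi>3 x)) (at x within cball z0 r0)"
        by (rule has_derivative_at_withinI[OF derivatives(3)[OF inOm[OF x]]])
      show "onorm (blinfun_apply (\<phi>3 x)) \<le> L" using L(2)[OF x] by (simp add: norm_blinfun.rep_eq)
    qed
  qed
  define D where "D = 2 * (norm P * L + 1)"
  have D: "0 < D" using L0 by (simp add: D_def add_nonneg_pos)
  define r where "r = min r0 (1 / D)"
  have r: "0 < r" "r \<le> r0" using r0 D by (auto simp: r_def)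
  have sub: "cball z0 r \<subseteq> cball z0 r0" using r by (simp add: subset_cball)
  have PLr: "norm P * (L * r) \<le> 1 / 2"
  proof -
    have "r * D \<le> 1 / D * D" unfolding r_def using D by (intro mult_right_mono) auto
    then have "r * D \<le> 1" using D by simp
    then have "2 * (norm P * (L * r)) + 2 * r \<le> 1" by (simp add: D_def algebra_simps)
    then show ?thesis using r by simp
  qed
  have half: "norm P * (L * r * n) \<le> n / 2" if "0 \<le> n" for n
    using mult_right_mono[OF PLr that] by (simp add: mult_ac)
  define c where "c = 2 * norm P"
  have "good_ball z0 r L c"
    unfolding good_ball_def
  proof (intro conjI ballI allI impI)
    show "0 < r" "0 \<le> L" "0 \<le> c" "cball z0 r \<subseteq> Om"
      using r(1) L0 order_trans[OF sub r0(2)] by (simp_all add: c_def)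
    fix x assume x: "x \<in> cball z0 r"
    then have x0: "x \<in> cball z0 r0" by (rule subsetD[OF sub])
    have xz: "norm (x - z0) \<le> r" using x by (simp add: dist_norm norm_minus_commute)
    show "norm (\<phi>2 x) \<le> L" by (rule L(1)[OF x0])
    show "norm u \<le> c * norm (\<phi>1 x u)" for u
    proof -
      have "u - P (\<phi>1 x u) = P ((\<phi>1 z0 - \<phi>1 x) u)" by (simp add: blinfun.diff_left blinfun.diff_right P)
      also have "norm \<dots> \<le> norm P * norm ((\<phi>1 z0 - \<phi>1 x) u)" by (rule norm_blinfun)
      also have "\<dots> \<le> norm P * (L * r * norm u)"
      proof (intro mult_left_mono order_trans[OF norm_blinfun] mult_right_mono)
        have "norm (\<phi>1 z0 - \<phi>1 x) \<le> L * norm (z0 - x)" by (rule lip(1)[OF z00 x0])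
        also have "\<dots> \<le> L * r" using xz L0 by (intro mult_left_mono) (auto simp: norm_minus_commute)
        finally show "norm (\<phi>1 z0 - \<phi>1 x) \<le> L * r" .
      qed auto
      also have "\<dots> \<le> norm u / 2" by (rule half) simp
      finally have "norm (u - P (\<phi>1 x u)) \<le> norm u / 2" .
      then have "norm u \<le> 2 * norm (P (\<phi>1 x u))" using norm_triangle_sub[of u "P (\<phi>1 x u)"] by simp
      then show ?thesis using norm_blinfun[of P "\<phi>1 x u"] by (simp add: c_def)
    qed
    show "norm (x - z0) \<le> c * norm (\<phi> x - \<phi> z0)"
    proof -
      have "norm (\<phi> x - \<phi> z0 - \<phi>1 z0 (x - z0)) \<le> (L * r) * norm (x - z0)"
      proof (rule taylor_first_on_convex[OF convex_cball _ x])
        show "z0 \<in> cball z0 r" using r(1) by simp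
        fix y assume y: "y \<in> cball z0 r"
        show "(\<phi> has_derivative blinfun_apply (\<phi>1 y)) (at y)" by (rule derivatives(1)[OF inOm[OF subsetD[OF sub y]]])
        have "norm (\<phi>1 y - \<phi>1 z0) \<le> L * norm (y - z0)" by (rule lip(1)[OF subsetD[OF sub y] z00])
        also have "\<dots> \<le> L * r" using y L0 by (intro mult_left_mono) (auto simp: dist_norm norm_minus_commute)
        finally show "norm (\<phi>1 y - \<phi>1 z0) \<le> L * r" .
      qed
      then have "norm P * norm (\<phi> x - \<phi> z0 - \<phi>1 z0 (x - z0)) \<le> norm P * (L * r * norm (x - z0))"
        by (intro mult_left_mono) auto
      also have "\<dots> \<le> norm (x - z0) / 2" by (rule half) simp
      finally have "norm (P (\<phi> x - \<phi> z0 - \<phi>1 z0 (x - z0))) \<le> norm (x - z0) / 2"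
        using norm_blinfun[of P] order_trans by blast
      then have "norm (P (\<phi> x - \<phi> z0) - (x - z0)) \<le> norm (x - z0) / 2"
        by (simp add: blinfun.diff_right P)
      then have "norm (x - z0) \<le> 2 * norm (P (\<phi> x - \<phi> z0))"
        using norm_triangle_sub[of "x - z0" "P (\<phi> x - \<phi> z0)"] by (simp add: norm_minus_commute)
      then show ?thesis using norm_blinfun[of P "\<phi> x - \<phi> z0"] by (simp add: c_def)
    qed
    fix h assume h: "x + h \<in> cball z0 r"
    show "norm (\<phi> (x + h) - \<phi> x - \<phi>1 x h - (1/2) *\<^sub>R \<phi>2 x h h) \<le> L * norm h ^ 3"
      by (rule taylor_second_on_convex[OF convex_cball x h derivatives(1,2)[OF inOm[OF subsetD[OF sub]]]
          lip(2)[OF subsetD[OF sub] subsetD[OF sub]] L0])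
    have "norm (\<phi> (x + h) - \<phi> x - \<phi>1 x (x + h - x)) \<le> (L * norm h) * norm (x + h - x)"
    proof (rule taylor_first_on_convex[of "closed_segment x (x + h)"])
      fix y assume y: "y \<in> closed_segment x (x + h)"
      have ys: "y \<in> cball z0 r" using y x h closed_segment_subset[OF x h convex_cball] by blast
      show "(\<phi> has_derivative blinfun_apply (\<phi>1 y)) (at y)" by (rule derivatives(1)[OF inOm[OF subsetD[OF sub ys]]])
      have "norm (\<phi>1 y - \<phi>1 x) \<le> L * norm (y - x)" by (rule lip(1)[OF subsetD[OF sub ys] x0])
      also have "\<dots> \<le> L * norm h" using segment_bound(1)[OF y] L0 by (intro mult_left_mono) auto
      finally show "norm (\<phi>1 y - \<phi>1 x) \<le> L * norm h" .
    qed auto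
    then show "norm (\<phi> (x + h) - \<phi> x - \<phi>1 x h) \<le> L * (norm h)\<^sup>2" by (simp add: power2_eq_square mult.assoc)
  qed
  then show ?thesis by (rule that)
qed

text \<open>
  Limits of tangent vectors are tangent, and the coordinates converge as well: a left inverse at the
  limit point recovers the coordinates at nearby points up to a small relative error.
\<close>

lemma tangent_limit:
  fixes P :: "'w \<Rightarrow>\<^sub>L (real ^ 'm)" and F :: "'x filter"
  assumes z0: "z0 \<in> Om" and P: "\<And>u. P (\<phi>1 z0 u) = u" and F: "F \<noteq> bot"
    and zf: "(zf \<longlongrightarrow> z0) F" and lim: "((\<lambda>x. \<phi>1 (zf x) (c x)) \<longlongrightarrow> w) F"
  shows "\<phi>1 z0 (blinfun_apply P w) = w" "(c \<longlongrightarrow> blinfun_apply P w) F"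
proof -
  have \<phi>1: "((\<lambda>x. \<phi>1 (zf x)) \<longlongrightarrow> \<phi>1 z0) F" by (rule isCont_tendsto_compose[OF isCont_\<phi>(2)[OF z0] zf])
  define A where "A x = \<phi>1 (zf x) (c x)" for x
  define \<eta> where "\<eta> x = norm P * norm (\<phi>1 z0 - \<phi>1 (zf x))" for x
  have "(\<eta> \<longlongrightarrow> norm P * norm (\<phi>1 z0 - \<phi>1 z0)) F" unfolding \<eta>_def by (intro tendsto_intros \<phi>1)
  then have \<eta>: "(\<eta> \<longlongrightarrow> 0) F" by simp
  have PA: "((\<lambda>x. P (A x)) \<longlongrightarrow> P w) F" unfolding A_def by (intro tendsto_intros lim)
  have d: "norm (c x - P (A x)) \<le> \<eta> x * norm (c x)" for x
  proof -
    have "c x - P (A x) = P ((\<phi>1 z0 - \<phi>1 (zf x)) (c x))" by (simp add: A_def blinfun.diff_left blinfun.diff_right P)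
    also have "norm \<dots> \<le> norm P * (norm (\<phi>1 z0 - \<phi>1 (zf x)) * norm (c x))"
      by (intro order_trans[OF norm_blinfun] mult_left_mono norm_blinfun) auto
    finally show ?thesis by (simp add: \<eta>_def mult.assoc)
  qed
  have "\<forall>\<^sub>F x in F. \<eta> x < 1 / 2" using \<eta> by (rule order_tendstoD) simp
  then have ev: "\<forall>\<^sub>F x in F. norm (c x - P (A x)) \<le> \<eta> x * (2 * norm (P (A x)))"
  proof eventually_elim
    case (elim x)
    have "\<eta> x * norm (c x) \<le> 1 / 2 * norm (c x)" using elim by (intro mult_right_mono) auto
    then have "norm (c x) \<le> 2 * norm (P (A x))"
      using d[of x] norm_triangle_sub[of "c x" "P (A x)"] by simp
    then show ?case using d[of x] mult_left_mono[of "norm (c x)" "2 * norm (P (A x))" "\<eta> x"]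
      by (simp add: \<eta>_def order_trans)
  qed
  have "((\<lambda>x. \<eta> x * (2 * norm (P (A x)))) \<longlongrightarrow> 0 * (2 * norm (P w))) F" by (intro tendsto_intros \<eta> PA)
  then have "((\<lambda>x. c x - P (A x)) \<longlongrightarrow> 0) F" using Lim_null_comparison[OF ev] by simp
  from tendsto_add[OF this PA] show c: "(c \<longlongrightarrow> P w) F" by simp
  have "((\<lambda>x. \<phi>1 (zf x) (c x)) \<longlongrightarrow> \<phi>1 z0 (P w)) F" by (intro tendsto_intros \<phi>1 c)
  then show "\<phi>1 z0 (P w) = w" using tendsto_unique[OF F _ lim] by blast
qed

text \<open>
  The Taylor expansion of the chart with its errors measured by the distance in the ambient space.
\<close>

lemma coordinates_expansion:
  assumes y: "y \<in> U \<inter> M"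
  obtains \<delta> C where "0 < \<delta>" "0 \<le> C"
    "\<And>w. w \<in> U \<inter> M \<Longrightarrow> norm (w - y) < \<delta> \<Longrightarrow> norm (\<psi> w - \<psi> y) \<le> C * norm (w - y) \<and>
      norm (w - y - \<phi>1 (\<psi> y) (\<psi> w - \<psi> y)) \<le> C * (norm (w - y))\<^sup>2 \<and>
      norm (w - y - \<phi>1 (\<psi> y) (\<psi> w - \<psi> y) - (1/2) *\<^sub>R \<phi>2 (\<psi> y) (\<psi> w - \<psi> y) (\<psi> w - \<psi> y)) \<le> C * norm (w - y) ^ 3"
proof -
  have z: "\<psi> y \<in> Om" using inverse y by blast
  obtain r L c where gb: "good_ball (\<psi> y) r L c" using good_ball_exists[OF z] by blast
  have r: "0 < r" "0 \<le> L" "0 \<le> c" using gb by (auto simp: good_ball_def)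
  have "continuous_on (U \<inter> M) \<psi>" using homeo by (simp add: homeomorphism_def)
  then have "\<exists>d>0. \<forall>x'\<in>U \<inter> M. dist x' y < d \<longrightarrow> dist (\<psi> x') (\<psi> y) < r"
    using y r(1) unfolding continuous_on_iff by (elim ballE[of _ _ y]) auto
  then obtain \<delta> where \<delta>: "0 < \<delta>" "\<And>w. w \<in> U \<inter> M \<Longrightarrow> dist w y < \<delta> \<Longrightarrow> dist (\<psi> w) (\<psi> y) < r"
    by blast
  define C where "C = max c (max (L * c\<^sup>2) (L * c ^ 3))"
  have C: "c \<le> C" "L * c\<^sup>2 \<le> C" "L * c ^ 3 \<le> C" "0 \<le> C" using r by (auto simp: C_def)
  have "norm (\<psi> w - \<psi> y) \<le> C * norm (w - y) \<and>
      norm (w - y - \<phi>1 (\<psi> y) (\<psi> w - \<psi> y)) \<le> C * (norm (w - y))\<^sup>2 \<and>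
      norm (w - y - \<phi>1 (\<psi> y) (\<psi> w - \<psi> y) - (1/2) *\<^sub>R \<phi>2 (\<psi> y) (\<psi> w - \<psi> y) (\<psi> w - \<psi> y)) \<le> C * norm (w - y) ^ 3"
    if w: "w \<in> U \<inter> M" "norm (w - y) < \<delta>" for w
  proof -
    let ?h = "\<psi> w - \<psi> y" and ?n = "norm (w - y)"
    have inb: "\<psi> w \<in> cball (\<psi> y) r" "\<psi> y \<in> cball (\<psi> y) r" using \<delta>(2)[OF w(1)] w(2) r by (auto simp: dist_norm norm_minus_commute)
    have eqs: "\<phi> (\<psi> w) = w" "\<phi> (\<psi> y) = y" using inverse w y by auto
    have h: "norm ?h \<le> c * ?n" using good_ballD(5)[OF gb inb(1)] unfolding eqs .
    have t: "norm (\<phi> (\<psi> y + ?h) - \<phi> (\<psi> y) - \<phi>1 (\<psi> y) ?h) \<le> L * (norm ?h)\<^sup>2"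
      "norm (\<phi> (\<psi> y + ?h) - \<phi> (\<psi> y) - \<phi>1 (\<psi> y) ?h - (1/2) *\<^sub>R \<phi>2 (\<psi> y) ?h ?h) \<le> L * norm ?h ^ 3"
      using good_ballD(7,8)[OF gb inb(2), of ?h] inb(1) by simp_all
    have "L * (norm ?h)\<^sup>2 \<le> L * (c * ?n)\<^sup>2" "L * norm ?h ^ 3 \<le> L * (c * ?n) ^ 3"
      using h r by (auto intro!: mult_left_mono power_mono)
    moreover have "L * (c * ?n)\<^sup>2 \<le> C * ?n\<^sup>2" "L * (c * ?n) ^ 3 \<le> C * ?n ^ 3" "c * ?n \<le> C * ?n"
      using mult_right_mono[OF C(2), of "?n\<^sup>2"] mult_right_mono[OF C(3), of "?n ^ 3"] mult_right_mono[OF C(1), of ?n]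
      by (simp_all add: power_mult_distrib mult.assoc)
    ultimately show ?thesis using t h by (simp add: eqs)
  qed
  then show ?thesis using \<delta>(1) C(4) by (intro that[of \<delta> C])
qed

lemma curve_velocity_tangent:
  assumes y: "y \<in> U \<inter> M" and w: "\<forall>\<^sub>F n in sequentially. w n \<in> M" and \<tau>: "\<And>n. 0 < \<tau> n" "\<tau> \<longlonglongrightarrow> 0"
    and v: "(\<lambda>n. (1 / \<tau> n) *\<^sub>R (w n - y)) \<longlonglongrightarrow> v"
  shows "v \<in> range (blinfun_apply (\<phi>1 (\<psi> y)))"
proof -
  obtain \<delta> C where \<delta>: "0 < \<delta>" "0 \<le> C" and ex: "\<And>w. w \<in> U \<inter> M \<Longrightarrow> norm (w - y) < \<delta> \<Longrightarrow> norm (\<psi> w - \<psi> y) \<le> C * norm (w - y) \<and>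
      norm (w - y - \<phi>1 (\<psi> y) (\<psi> w - \<psi> y)) \<le> C * (norm (w - y))\<^sup>2 \<and>
      norm (w - y - \<phi>1 (\<psi> y) (\<psi> w - \<psi> y) - (1/2) *\<^sub>R \<phi>2 (\<psi> y) (\<psi> w - \<psi> y) (\<psi> w - \<psi> y)) \<le> C * norm (w - y) ^ 3"
    by (rule coordinates_expansion[OF y]) blast
  have z: "\<psi> y \<in> Om" using inverse y by blast
  obtain P :: "'w \<Rightarrow>\<^sub>L (real ^ 'm)" where P: "\<And>u. P (\<phi>1 (\<psi> y) u) = u"
    using bounded_left_inverse[OF inj_\<phi>1[OF z]] by blast
  let ?q = "\<lambda>n. (1 / \<tau> n) *\<^sub>R (w n - y)"
  have wq: "w n - y = \<tau> n *\<^sub>R ?q n" for n using \<tau>(1)[of n] by simp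
  have "(\<lambda>n. \<tau> n *\<^sub>R ?q n) \<longlonglongrightarrow> 0 *\<^sub>R v" by (intro tendsto_intros \<tau> v)
  then have w0: "(\<lambda>n. w n - y) \<longlonglongrightarrow> 0" by (simp only: wq[symmetric] scaleR_zero_left)
  have wy: "w \<longlonglongrightarrow> y" using w0 by (simp add: LIM_zero_iff)
  have inU: "\<forall>\<^sub>F n in sequentially. w n \<in> U" using topological_tendstoD[OF wy opens(1)] y by blast
  have close: "\<forall>\<^sub>F n in sequentially. norm (w n - y) < \<delta>" using tendstoD[OF wy \<delta>(1)] by (simp add: dist_norm)
  let ?e = "\<lambda>n. ?q n - \<phi>1 (\<psi> y) ((1 / \<tau> n) *\<^sub>R (\<psi> (w n) - \<psi> y))"
  have e: "\<forall>\<^sub>F n in sequentially. norm (?e n) \<le> C * norm (w n - y) * norm (?q n)"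
    using w inU close
  proof eventually_elim
    case (elim n)
    then have "norm (w n - y - \<phi>1 (\<psi> y) (\<psi> (w n) - \<psi> y)) \<le> C * (norm (w n - y))\<^sup>2" using ex by blast
    then have "(1 / \<tau> n) * norm (w n - y - \<phi>1 (\<psi> y) (\<psi> (w n) - \<psi> y)) \<le> (1 / \<tau> n) * (C * (norm (w n - y))\<^sup>2)"
      using \<tau>(1)[of n] by (intro mult_left_mono) auto
    moreover have "?e n = (1 / \<tau> n) *\<^sub>R (w n - y - \<phi>1 (\<psi> y) (\<psi> (w n) - \<psi> y))"
      by (simp only: blinfun.scaleR_right blinfun.diff_right scaleR_diff_right)
    ultimately show ?case using \<tau>(1)[of n] by (simp only: norm_scaleR) (simp add: power2_eq_square mult_ac)
  qed
  have "(\<lambda>n. C * norm (w n - y) * norm (?q n)) \<longlonglongrightarrow> C * norm (0::'w) * norm v"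
    by (intro tendsto_intros w0 v)
  then have "?e \<longlonglongrightarrow> 0" using Lim_null_comparison[OF e] by simp
  from tendsto_diff[OF v this] have "(\<lambda>n. \<phi>1 (\<psi> y) ((1 / \<tau> n) *\<^sub>R (\<psi> (w n) - \<psi> y))) \<longlonglongrightarrow> v" by simp
  then have "\<phi>1 (\<psi> y) (P v) = v"
    by (intro tangent_limit(1)[OF z P sequentially_bot tendsto_const])
  then show ?thesis by (metis rangeI)
qed

text \<open>
  Tangent vectors of another chart are velocities of curves in \<open>M\<close>, and such velocities are tangent in
  the present chart. Hence the union that defines the tangent space is over copies of one space.
\<close>

lemma tangent_space_eq:
  assumes y: "y \<in> U \<inter> M"
  shows "tangent_space TYPE('m) M y = range (blinfun_apply (\<phi>1 (\<psi> y)))"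
proof (intro equalityI subsetI)
  fix v assume "v \<in> range (blinfun_apply (\<phi>1 (\<psi> y)))"
  then have "v \<in> range (frechet_derivative \<phi> (at (\<psi> y)))" using frechet_\<phi> inverse y by simp
  then show "v \<in> tangent_space TYPE('m) M y" unfolding tangent_space_def using y chart by blast
next
  fix v assume "v \<in> tangent_space TYPE('m) M y"
  then obtain U' Om' and \<phi>' :: "real ^ 'm \<Rightarrow> 'w" and \<psi>' where c: "y \<in> U' \<inter> M" "C3_chart M U' Om' \<phi>' \<psi>'"
    and v: "v \<in> range (frechet_derivative \<phi>' (at (\<psi>' y)))"
    unfolding tangent_space_def by blast
  obtain \<phi>1' \<phi>2' \<phi>3' where "C3_derivatives Om' \<phi>' \<phi>1' \<phi>2' \<phi>3'" using c(2) unfolding C3_chart_def C3_on_def by blast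
  then interpret c: chart M U' Om' \<phi>' \<psi>' \<phi>1' \<phi>2' \<phi>3' by unfold_locales (rule c(2))
  have z': "\<psi>' y \<in> Om'" "\<phi>' (\<psi>' y) = y" using c.inverse c(1) by auto
  obtain u where u: "v = \<phi>1' (\<psi>' y) u" using v c.frechet_\<phi>[OF z'(1)] by auto
  define \<tau> where "\<tau> n = 1 / real (Suc n)" for n
  have \<tau>: "0 < \<tau> n" for n by (simp add: \<tau>_def)
  have \<tau>0: "\<tau> \<longlonglongrightarrow> 0" unfolding \<tau>_def by real_asymp
  have "(\<lambda>n. \<psi>' y + \<tau> n *\<^sub>R u) \<longlonglongrightarrow> \<psi>' y + 0 *\<^sub>R u" by (intro tendsto_intros \<tau>0)
  then have "\<forall>\<^sub>F n in sequentially. \<psi>' y + \<tau> n *\<^sub>R u \<in> Om'" using topological_tendstoD[OF _ c.opens(2)] z' by simp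
  then have inM: "\<forall>\<^sub>F n in sequentially. \<phi>' (\<psi>' y + \<tau> n *\<^sub>R u) \<in> M"
    by eventually_elim (use c.inverse(3) in blast)
  have "((\<lambda>h. \<phi>' (\<psi>' y + h *\<^sub>R u)) has_vector_derivative \<phi>1' (\<psi>' y) u) (at 0)"
    by (rule has_vector_derivative_along_line) (simp add: c.derivatives z')
  from has_vector_derivative_quotient[OF this]
  have "((\<lambda>h. (1 / h) *\<^sub>R (\<phi>' (\<psi>' y + h *\<^sub>R u) - y)) \<longlongrightarrow> v) (at 0)"
    by (simp add: z' u)
  moreover have "filterlim \<tau> (at 0) sequentially"
    using \<tau>0 \<tau> by (auto simp: filterlim_at less_imp_neq[symmetric] \<tau>_def)
  ultimately have "(\<lambda>n. (1 / \<tau> n) *\<^sub>R (\<phi>' (\<psi>' y + \<tau> n *\<^sub>R u) - y)) \<longlonglongrightarrow> v"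
    by (rule filterlim_compose)
  then show "v \<in> range (blinfun_apply (\<phi>1 (\<psi> y)))" by (rule curve_velocity_tangent[OF y inM \<tau> \<tau>0])
qed

end

section \<open>One step of the equation in chart coordinates\<close>

locale rough_chart = rough_equation tensor f0 f f1 f2 X XX \<alpha> T H + chart M U Om \<phi> \<psi> \<phi>1 \<phi>2 \<phi>3
  for tensor :: "'v::banach \<Rightarrow> 'v \<Rightarrow> 'e::banach"
    and f0 :: "'w::banach \<Rightarrow> 'w" and f :: "'w \<Rightarrow> 'v \<Rightarrow>\<^sub>L 'w" and f1 f2 X XX \<alpha> T H
    and M U :: "'w set" and Om :: "(real ^ 'm) set" and \<phi> \<psi> \<phi>1 \<phi>2 \<phi>3 +
  assumes geometric: "s \<in> {0..T} \<Longrightarrow> t \<in> {0..T} \<Longrightarrow>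
    tensor_Sym tensor (XX s t) = (1/2) *\<^sub>R tensor (X t - X s) (X t - X s)"
begin

text \<open>
  \<open>Q\<close> is a projection that annihilates exactly the tangent space at \<open>y\<close>. Along the curve \<open>\<phi> (z + h \<xi>)\<close>, which leaves
  \<open>y\<close> with velocity \<open>f y v\<close>, write \<open>f w = \<phi>1 (z + h \<xi>) (c h)\<close> and form difference quotients at \<open>h = 0\<close>.
  Changes of \<open>c\<close> contribute tangent vectors, so only the derivative of \<open>\<phi>1\<close> survives under \<open>Q\<close>, and
  it is enough that \<open>c\<close> is continuous.
\<close>

lemma tangential_derivative:
  fixes P :: "'w \<Rightarrow>\<^sub>L (real ^ 'm)"
  assumes y: "y \<in> U \<inter> M" and tang: "\<And>y v. y \<in> U \<inter> M \<Longrightarrow> f y v \<in> range (blinfun_apply (\<phi>1 (\<psi> y)))"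
    and P: "\<And>u. P (\<phi>1 (\<psi> y) u) = u"
  defines "Q \<equiv> id_blinfun - (\<phi>1 (\<psi> y) o\<^sub>L P)"
  shows "Q (f1 y (f y v) w) = Q (\<phi>2 (\<psi> y) (P (f y v)) (P (f y w)))"
proof -
  define z where "z = \<psi> y"
  have z: "z \<in> Om" "\<phi> z = y" using inverse y by (auto simp: z_def)
  have Pz: "P (\<phi>1 z u) = u" for u using P by (simp add: z_def)
  have Q: "Q x = x - \<phi>1 z (P x)" for x by (simp add: Q_def z_def blinfun.diff_left)
  have Q0: "Q (\<phi>1 z u) = 0" for u by (simp add: Q Pz)
  have fP: "\<phi>1 z (P (f y v)) = f y v" for v
    using tang[OF y, of v] Pz unfolding z_def[symmetric] by auto
  define \<xi> where "\<xi> = P (f y v)"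
  let ?z = "\<lambda>h::real. z + h *\<^sub>R \<xi>"
  have zlim: "(?z \<longlongrightarrow> z) (at 0)" by (auto intro!: tendsto_eq_intros)
  have inOm: "\<forall>\<^sub>F h in at 0. ?z h \<in> Om" using topological_tendstoD[OF zlim opens(2) z(1)] .
  define c where "c h = (SOME c. \<phi>1 (?z h) c = f (\<phi> (?z h)) w)" for h
  have c: "\<phi>1 (?z h) (c h) = f (\<phi> (?z h)) w" if hOm: "?z h \<in> Om" for h
  proof -
    have "f (\<phi> (?z h)) w \<in> range (blinfun_apply (\<phi>1 (\<psi> (\<phi> (?z h)))))" by (rule tang[OF inverse(3)[OF hOm]])
    then obtain u where "\<phi>1 (?z h) u = f (\<phi> (?z h)) w" unfolding inverse(4)[OF hOm] by (auto simp: image_iff)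
    then show ?thesis unfolding c_def by (rule someI)
  qed
  have dF: "((\<lambda>h. f (\<phi> (?z h)) w) has_vector_derivative f1 y (f y v) w) (at 0)"
  proof -
    have "((\<lambda>h. \<phi> (?z h)) has_vector_derivative \<phi>1 z \<xi>) (at 0)"
      by (rule has_vector_derivative_along_line) (simp add: derivatives z)
    then have "((\<lambda>h. \<phi> (?z h)) has_derivative (\<lambda>h. h *\<^sub>R f y v)) (at 0)"
      by (simp add: has_vector_derivative_def \<xi>_def fP)
    moreover have "(f has_derivative blinfun_apply (f1 y)) (at (\<phi> (?z 0)))" using f.deriv by (simp add: z)
    ultimately have "((\<lambda>h. f (\<phi> (?z h))) has_derivative (\<lambda>h. f1 y (h *\<^sub>R f y v))) (at 0)"
      by (rule has_derivative_compose)
    from bounded_linear.has_derivative[OF blinfun.bounded_linear_left this, of w]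
    show ?thesis by (simp add: has_vector_derivative_def blinfun.scaleR_right blinfun.scaleR_left)
  qed
  have Fq: "((\<lambda>h. (1 / h) *\<^sub>R (f (\<phi> (?z h)) w - f y w)) \<longlongrightarrow> f1 y (f y v) w) (at 0)"
    using has_vector_derivative_quotient[OF dF] by (simp add: z)
  have Flim: "((\<lambda>h. f (\<phi> (?z h)) w) \<longlongrightarrow> f y w) (at 0)"
    using has_vector_derivative_continuous[OF dF] by (simp add: continuous_within z)
  have "((\<lambda>h. \<phi>1 (?z h) (c h)) \<longlongrightarrow> f y w) (at 0)"
    by (rule Lim_transform_eventually[OF Flim]) (use inOm c in \<open>auto elim!: eventually_mono\<close>)
  from tangent_limit(2)[OF z(1) Pz _ zlim this] have clim: "(c \<longlongrightarrow> P (f y w)) (at 0)" by simp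
  have "((\<lambda>h. \<phi>1 (?z h)) has_vector_derivative \<phi>2 z \<xi>) (at 0)"
    by (rule has_vector_derivative_along_line) (simp add: derivatives z)
  from has_vector_derivative_quotient[OF this]
  have \<phi>q: "((\<lambda>h. (1 / h) *\<^sub>R (\<phi>1 (?z h) - \<phi>1 z)) \<longlongrightarrow> \<phi>2 z \<xi>) (at 0)" by simp
  have l1: "((\<lambda>h. Q ((1 / h) *\<^sub>R (f (\<phi> (?z h)) w - f y w))) \<longlongrightarrow> Q (f1 y (f y v) w)) (at 0)"
    by (intro tendsto_intros Fq)
  have l2: "((\<lambda>h. Q (((1 / h) *\<^sub>R (\<phi>1 (?z h) - \<phi>1 z)) (c h))) \<longlongrightarrow> Q (\<phi>2 z \<xi> (P (f y w)))) (at 0)"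
    by (intro tendsto_intros \<phi>q clim)
  have "\<forall>\<^sub>F h in at 0. Q ((1 / h) *\<^sub>R (f (\<phi> (?z h)) w - f y w)) = Q (((1 / h) *\<^sub>R (\<phi>1 (?z h) - \<phi>1 z)) (c h))"
    using inOm
  proof eventually_elim
    case (elim h)
    have "Q (f y w) = 0" using Q0[of "P (f y w)"] by (simp add: fP)
    then show ?case using Q0[of "c h"]
      by (simp add: c[OF elim, symmetric] blinfun.scaleR_right blinfun.scaleR_left blinfun.diff_right blinfun.diff_left)
  qed
  from Lim_transform_eventually[OF l1 this] l2 have "Q (f1 y (f y v) w) = Q (\<phi>2 z \<xi> (P (f y w)))"
    by (rule tendsto_unique[rotated]) simp
  then show ?thesis by (simp add: z_def \<xi>_def)
qed

text \<open>
  Modulo tangent vectors, \<open>g y\<close> is a symmetric bilinear form by \<open>tangential_derivative\<close> and the symmetry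
  of the second derivative. So the antisymmetric part of \<open>XX s t\<close>, the area of the signal, is only
  mapped to tangent vectors, while its symmetric part is known from the increment of \<open>X\<close>.
\<close>

lemma second_level_tangential:
  fixes P :: "'w \<Rightarrow>\<^sub>L (real ^ 'm)"
  assumes y: "y \<in> U \<inter> M" and tang: "\<And>y v. y \<in> U \<inter> M \<Longrightarrow> f y v \<in> range (blinfun_apply (\<phi>1 (\<psi> y)))"
    and P: "\<And>u. P (\<phi>1 (\<psi> y) u) = u" and st: "s \<in> {0..T}" "t \<in> {0..T}"
  defines "a \<equiv> P (f y (X t - X s))"
  obtains q where "g y (XX s t) = (1/2) *\<^sub>R \<phi>2 (\<psi> y) a a + \<phi>1 (\<psi> y) q"
proof -
  have z: "\<psi> y \<in> Om" using inverse y by blast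
  define Q where "Q = id_blinfun - (\<phi>1 (\<psi> y) o\<^sub>L P)"
  define L where "L = Q o\<^sub>L g y"
  have Lt: "L (tensor v w) = Q (\<phi>2 (\<psi> y) (P (f y v)) (P (f y w)))" for v w
    using tangential_derivative[OF y tang P, of v w] by (simp add: L_def g_tensor Q_def)
  \<comment> \<open>Elementary tensors span a dense subspace, so the symmetry has to be checked on them only.\<close>
  have "L o\<^sub>L tensor_flip tensor = L"
    by (rule blinfun_eq_on_tensors) (simp add: tensor_flip Lt \<phi>2_symmetric[OF z])
  then have flip: "L (tensor_flip tensor x) = L x" for x by (metis blinfun_apply_blinfun_compose)
  have "L (XX s t) = L (tensor_Sym tensor (XX s t))"
    by (simp add: tensor_Sym_def blinfun.scaleR_right blinfun.add_right flip)
  also have "\<dots> = (1/2) *\<^sub>R Q (\<phi>2 (\<psi> y) a a)" by (simp add: geometric[OF st] blinfun.scaleR_right Lt a_def)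
  finally have "Q (g y (XX s t) - (1/2) *\<^sub>R \<phi>2 (\<psi> y) a a) = 0"
    by (simp add: L_def blinfun.diff_right blinfun.scaleR_right)
  then have "g y (XX s t) - (1/2) *\<^sub>R \<phi>2 (\<psi> y) a a = \<phi>1 (\<psi> y) (P (g y (XX s t) - (1/2) *\<^sub>R \<phi>2 (\<psi> y) a a))"
    by (simp add: Q_def blinfun.diff_left)
  then show ?thesis
    by (intro that[of "P (g y (XX s t) - (1/2) *\<^sub>R \<phi>2 (\<psi> y) a a)"]) (simp add: diff_eq_eq add.commute)
qed

text \<open>
  The coordinates move by \<open>\<eta> = (t - s) a0 + a + q\<close>, where \<open>a0\<close>, \<open>a\<close> and \<open>q\<close> represent the drift, the first
  level and the tangent part of the second level. In the second-order Taylor polynomial, \<open>\<phi>2 x \<eta> \<eta>\<close> may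
  be replaced by \<open>\<phi>2 x a a\<close> with an error of order \<open>3\<alpha>\<close>, because \<open>\<eta> - a\<close> is of order \<open>2\<alpha>\<close>; the result is
  \<open>step (\<phi> x) s t\<close>.
\<close>

lemma step_in_chart:
  assumes tang: "\<And>y v. y \<in> U \<inter> M \<Longrightarrow> f y v \<in> range (blinfun_apply (\<phi>1 (\<psi> y)))"
    and tang0: "\<And>y. y \<in> U \<inter> M \<Longrightarrow> f0 y \<in> range (blinfun_apply (\<phi>1 (\<psi> y)))"
    and gb: "good_ball z0 r L c" and B: "0 \<le> B" "\<And>x. x \<in> cball z0 r \<Longrightarrow> norm (f0 (\<phi> x)) \<le> B"
  obtains h C where "0 < h" "h \<le> 1" "0 \<le> C"
    "\<And>x s t. x \<in> cball z0 (r / 2) \<Longrightarrow> 0 \<le> s \<Longrightarrow> s \<le> t \<Longrightarrow> t \<le> T \<Longrightarrow> t - s \<le> h \<Longrightarrow>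
      \<exists>\<eta>. norm \<eta> \<le> r / 2 \<and> norm (\<phi> (x + \<eta>) - step (\<phi> x) s t) \<le> C * (t - s) powr (3 * \<alpha>)"
proof -
  have r: "0 < r" and L: "0 \<le> L" and c: "0 \<le> c" using good_ballD[OF gb] by auto
  define E2 where "E2 = c * B + c * (H ^ 4 + L * (c * H\<^sup>2)\<^sup>2)"
  define E1 where "E1 = c * H\<^sup>2 + E2"
  have E: "0 \<le> E2" "0 \<le> E1" "c * H\<^sup>2 \<le> E1" using c B L H0 by (auto simp: E1_def E2_def)
  obtain h where h: "0 < h" "h \<le> 1" "\<And>x. 0 \<le> x \<Longrightarrow> x \<le> h \<Longrightarrow> E1 * x powr \<alpha> \<le> r / 2"
    using small_powr[of \<alpha> "r / 2" E1] exponent r by auto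
  have "\<exists>\<eta>. norm \<eta> \<le> r / 2 \<and> norm (\<phi> (x + \<eta>) - step (\<phi> x) s t) \<le> (L * E1 ^ 3 + L * E1 * E2) * (t - s) powr (3 * \<alpha>)"
    if x: "x \<in> cball z0 (r / 2)" and st: "0 \<le> s" "s \<le> t" "t \<le> T" "t - s \<le> h" for x s t
  proof -
    have tm: "0 \<le> s" "s \<le> t" "t \<le> t" "t \<le> T" "t - s \<le> 1" using st h by auto
    have xr: "x \<in> cball z0 r" using x r by (auto simp: dist_norm intro: order_trans)
    have xOm: "x \<in> Om" by (rule good_ballD(4)[OF gb xr])
    define y where "y = \<phi> x"
    have y: "y \<in> U \<inter> M" "\<psi> y = x" using inverse(3,4)[OF xOm] by (auto simp: y_def)
    obtain P :: "'w \<Rightarrow>\<^sub>L (real ^ 'm)" where P: "\<And>u. P (\<phi>1 x u) = u"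
      using bounded_left_inverse[OF inj_\<phi>1[OF xOm]] by blast
    define \<tau> where "\<tau> = (t - s) powr \<alpha>"
    define \<sigma> where "\<sigma> = (t - s) powr (2 * \<alpha>)"
    have \<tau>: "0 \<le> \<tau>" "0 \<le> \<sigma>" "\<sigma> = \<tau> * \<tau>" "\<sigma> \<le> \<tau>" using tau[OF tm] by (auto simp: \<tau>_def \<sigma>_def)
    have below: "norm u \<le> c * norm (\<phi>1 x u)" for u by (rule good_ballD(6)[OF gb xr])
    obtain a0 where a0: "\<phi>1 x a0 = f0 y" using tang0[OF y(1)] y(2) by (metis rangeE)
    define a where "a = P (f y (X t - X s))"
    have a: "\<phi>1 x a = f y (X t - X s)"
      using tang[OF y(1), of "X t - X s"] P unfolding y(2) a_def by auto
    obtain q where q: "g y (XX s t) = (1/2) *\<^sub>R \<phi>2 x a a + \<phi>1 x q"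
    proof (rule second_level_tangential[of y P s t])
      show "P (\<phi>1 (\<psi> y) u) = u" for u by (simp add: P y)
      show "s \<in> {0..T}" "t \<in> {0..T}" using st by auto
      fix q assume "g y (XX s t) = (1 / 2) *\<^sub>R \<phi>2 (\<psi> y) (P (f y (X t - X s))) (P (f y (X t - X s))) + \<phi>1 (\<psi> y) q"
      then show ?thesis by (intro that[of q]) (simp add: y a_def)
    qed (use y tang in auto)
    have na0: "norm a0 \<le> c * B" using below[of a0] B(2)[OF xr] c mult_left_mono[of "norm (f0 y)" B c] by (simp add: a0 y_def)
    have na: "norm a \<le> c * H\<^sup>2 * \<tau>"
    proof -
      have "norm a \<le> c * norm (f y (X t - X s))" using below[of a] by (simp add: a)
      also have "\<dots> \<le> c * (H\<^sup>2 * \<tau>)" using fX_bound[OF tm, of y] c by (intro mult_left_mono) (auto simp: \<tau>_def)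
      finally show ?thesis by (simp add: mult.assoc)
    qed
    have \<phi>2b: "norm (\<phi>2 x u v) \<le> L * norm u * norm v" for u v
    proof -
      have "norm (\<phi>2 x u v) \<le> norm (\<phi>2 x u) * norm v" by (rule norm_blinfun)
      also have "\<dots> \<le> (L * norm u) * norm v"
        by (intro mult_right_mono apply_le[OF good_ballD(9)[OF gb xr] order_refl]) simp
      finally show ?thesis .
    qed
    have nq: "norm q \<le> c * (H ^ 4 + L * (c * H\<^sup>2)\<^sup>2) * \<sigma>"
    proof -
      have "norm (\<phi>2 x a a) \<le> L * norm a * norm a" by (rule \<phi>2b)
      also have "\<dots> \<le> L * (c * H\<^sup>2 * \<tau>) * (c * H\<^sup>2 * \<tau>)"
        using na L c \<tau>(1) by (intro mult_mono mult_left_mono mult_nonneg_nonneg) simp_all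
      also have "\<dots> = L * (c * H\<^sup>2)\<^sup>2 * \<sigma>" by (simp add: \<tau>(3) power2_eq_square mult_ac)
      finally have aa: "norm (\<phi>2 x a a) \<le> L * (c * H\<^sup>2)\<^sup>2 * \<sigma>" .
      have "\<phi>1 x q = g y (XX s t) - (1/2) *\<^sub>R \<phi>2 x a a" by (simp add: q)
      then have "norm (\<phi>1 x q) \<le> H ^ 4 * \<sigma> + norm ((1/2) *\<^sub>R \<phi>2 x a a)"
        using gXX_bound[OF tm, of y] by (simp only: \<sigma>_def) (rule order_trans[OF norm_triangle_ineq4 add_right_mono])
      also have "norm ((1/2) *\<^sub>R \<phi>2 x a a) \<le> norm (\<phi>2 x a a)" by simp
      finally have "norm (\<phi>1 x q) \<le> (H ^ 4 + L * (c * H\<^sup>2)\<^sup>2) * \<sigma>" using aa by (simp add: algebra_simps)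
      then have "c * norm (\<phi>1 x q) \<le> c * ((H ^ 4 + L * (c * H\<^sup>2)\<^sup>2) * \<sigma>)" using c by (rule mult_left_mono)
      then show ?thesis using below[of q] by (simp add: mult.assoc)
    qed
    define \<kappa> where "\<kappa> = (t - s) *\<^sub>R a0 + q"
    define \<eta> where "\<eta> = a + \<kappa>"
    have "norm ((t - s) *\<^sub>R a0) \<le> \<sigma> * (c * B)"
      using na0 st le_powr2[of "t - s" "t - s"] tm by (simp add: \<sigma>_def) (intro mult_mono, auto)
    then have "norm \<kappa> \<le> \<sigma> * (c * B) + c * (H ^ 4 + L * (c * H\<^sup>2)\<^sup>2) * \<sigma>"
      unfolding \<kappa>_def using nq by (intro norm_triangle_le add_mono)
    then have n\<kappa>: "norm \<kappa> \<le> E2 * \<sigma>" by (simp add: E2_def algebra_simps)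
    also have "\<dots> \<le> E2 * \<tau>" using \<tau>(4) E(1) by (rule mult_left_mono)
    finally have "norm \<eta> \<le> c * H\<^sup>2 * \<tau> + E2 * \<tau>" unfolding \<eta>_def using na by (intro norm_triangle_le add_mono)
    then have n\<eta>: "norm \<eta> \<le> E1 * \<tau>" by (simp add: E1_def algebra_simps)
    have "E1 * \<tau> \<le> r / 2" unfolding \<tau>_def using st h by (intro h(3)) auto
    with n\<eta> have \<eta>r: "norm \<eta> \<le> r / 2" by (rule order_trans)
    have "norm (x + \<eta> - z0) \<le> norm (x - z0) + norm \<eta>" by norm
    then have xin: "x + \<eta> \<in> cball z0 r" using x \<eta>r by (simp add: dist_norm norm_minus_commute)
    have na': "norm a \<le> E1 * \<tau>" using na mult_right_mono[OF E(3) \<tau>(1)] by linarith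
    have lin: "\<phi>1 x \<eta> = (t - s) *\<^sub>R f0 y + f y (X t - X s) + (g y (XX s t) - (1/2) *\<^sub>R \<phi>2 x a a)"
      by (simp add: \<eta>_def \<kappa>_def blinfun.add_right blinfun.scaleR_right a0 a q)
    have quad: "\<phi>2 x \<eta> \<eta> - \<phi>2 x a a = \<phi>2 x \<kappa> \<eta> + \<phi>2 x a \<kappa>"
      by (simp add: \<eta>_def blinfun.add_right blinfun.add_left)
    have nquad: "norm (\<phi>2 x \<eta> \<eta> - \<phi>2 x a a) \<le> 2 * (L * E1 * E2 * (\<tau> * \<sigma>))"
    proof -
      have "norm (\<phi>2 x \<kappa> \<eta>) \<le> L * (E2 * \<sigma>) * (E1 * \<tau>)" "norm (\<phi>2 x a \<kappa>) \<le> L * (E1 * \<tau>) * (E2 * \<sigma>)"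
        using n\<kappa> n\<eta> na' L E \<tau>(1,2) by (auto intro!: order_trans[OF \<phi>2b] mult_mono mult_left_mono mult_nonneg_nonneg)
      then have "norm (\<phi>2 x \<eta> \<eta> - \<phi>2 x a a) \<le> L * (E2 * \<sigma>) * (E1 * \<tau>) + L * (E1 * \<tau>) * (E2 * \<sigma>)"
        unfolding quad by (rule norm_triangle_le[OF add_mono])
      then show ?thesis by (simp add: algebra_simps)
    qed
    have "norm (\<phi> (x + \<eta>) - \<phi> x - \<phi>1 x \<eta> - (1/2) *\<^sub>R \<phi>2 x \<eta> \<eta>) \<le> L * norm \<eta> ^ 3"
      by (rule good_ballD(8)[OF gb xr xin])
    also have "\<dots> \<le> L * (E1 * \<tau>) ^ 3" using n\<eta> L by (intro mult_left_mono power_mono) auto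
    also have "\<dots> = L * E1 ^ 3 * (\<tau> * \<sigma>)" by (simp add: \<tau>(3) power3_eq_cube mult_ac)
    finally have tay: "norm (\<phi> (x + \<eta>) - \<phi> x - \<phi>1 x \<eta> - (1/2) *\<^sub>R \<phi>2 x \<eta> \<eta>) \<le> L * E1 ^ 3 * (\<tau> * \<sigma>)" .
    have "\<phi> (x + \<eta>) - step (\<phi> x) s t =
        (\<phi> (x + \<eta>) - \<phi> x - \<phi>1 x \<eta> - (1/2) *\<^sub>R \<phi>2 x \<eta> \<eta>) + (1/2) *\<^sub>R (\<phi>2 x \<eta> \<eta> - \<phi>2 x a a)"
      unfolding lin by (simp add: step_def J_def y_def scaleR_diff_right)
    also have "norm \<dots> \<le> L * E1 ^ 3 * (\<tau> * \<sigma>) + L * E1 * E2 * (\<tau> * \<sigma>)"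
      using tay nquad by (intro norm_triangle_le add_mono) simp_all
    also have "\<dots> = (L * E1 ^ 3 + L * E1 * E2) * (t - s) powr (3 * \<alpha>)"
      unfolding powr3 by (simp add: \<tau>_def \<sigma>_def algebra_simps)
    finally show ?thesis using \<eta>r by blast
  qed
  then show ?thesis using h E L by (intro that[of h "L * E1 ^ 3 + L * E1 * E2"]) auto
qed

end

section \<open>Uniqueness and the propagation of solutions inside a submanifold\<close>

context rough_equation
begin

text \<open>
  Along a grid of step \<open>d\<close> one path is an approximate orbit for the other, with an error \<open>O(d\<^bsup>3\<alpha>\<^esup>)\<close> per
  step and therefore \<open>O(d\<^bsup>3\<alpha>-1\<^esup>)\<close> in total.
\<close>

lemma davie_paths_unique:
  assumes Y1: "davie_path K1 h1 Y1" and Y2: "davie_path K2 h2 Y2" and start: "Y1 0 = Y2 0"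
    and B: "0 \<le> B" "\<And>t. 0 \<le> t \<Longrightarrow> t \<le> T \<Longrightarrow> norm (f0 (Y1 t)) \<le> B" "\<And>t. 0 \<le> t \<Longrightarrow> t \<le> T \<Longrightarrow> norm (f0 (Y2 t)) \<le> B"
    and t: "0 \<le> t" "t \<le> T"
  shows "Y1 t = Y2 t"
proof (cases "t = 0")
  case False
  have tp: "0 < t" using t False by simp
  obtain h' C where h': "0 < h'" and C: "0 \<le> C" and
    shadow: "\<And>a d N z \<epsilon> k. 0 \<le> a \<Longrightarrow> 0 < d \<Longrightarrow> d \<le> h' \<Longrightarrow> a + real N * d \<le> T \<Longrightarrow> K1 * d powr (3 * \<alpha>) \<le> \<epsilon> \<Longrightarrow> \<epsilon> \<le> 1 \<Longrightarrow>
      \<forall>k\<le>N. norm (f0 (z k)) \<le> B \<Longrightarrow>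
      \<forall>k<N. norm (z (Suc k) - step (z k) (a + real k * d) (a + real (Suc k) * d)) \<le> \<epsilon> \<Longrightarrow>
      z 0 = Y1 a \<Longrightarrow> k \<le> N \<Longrightarrow> norm (z k - Y1 (a + real k * d)) \<le> C * real k * \<epsilon>"
    by (rule davie_path_shadowed_by_approximate_orbit[OF Y1 B(1)]) (erule (1) B(2), blast)
  have K: "0 \<le> K1" "0 \<le> K2" "0 < h2" and davie: "\<And>s t. 0 \<le> s \<Longrightarrow> s \<le> t \<Longrightarrow> t \<le> T \<Longrightarrow> t - s \<le> h2 \<Longrightarrow>
      norm (Y2 t - step (Y2 s) s t) \<le> K2 * (t - s) powr (3 * \<alpha>)"
    using Y1 Y2 by (auto simp: davie_path_def)
  define K where "K = K1 + K2"
  have "norm (Y2 t - Y1 t) \<le> 0 + e" if e: "0 < e" for e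
  proof -
    obtain d1 where d1: "0 < d1" "d1 \<le> 1" "\<And>x. 0 \<le> x \<Longrightarrow> x \<le> d1 \<Longrightarrow> (C * t * K) * x powr (3 * \<alpha> - 1) \<le> e"
      using small_powr[of "3 * \<alpha> - 1" e "C * t * K"] exponent e by auto
    obtain d2 where d2: "0 < d2" "d2 \<le> 1" "\<And>x. 0 \<le> x \<Longrightarrow> x \<le> d2 \<Longrightarrow> K * x powr (3 * \<alpha>) \<le> 1"
      using small_powr[of "3 * \<alpha>" 1 K] exponent by auto
    define d0 where "d0 = min (min d1 d2) (min h' h2)"
    have d0: "0 < d0" using d1 d2 h' K by (simp add: d0_def)
    obtain n :: nat where n: "t / d0 < real n" using reals_Archimedean2 by blast
    have n0: "0 < real n" using n tp d0 by (meson divide_pos_pos less_trans)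
    define d where "d = t / real n"
    have d: "0 < d" "real n * d = t" using tp n0 by (auto simp: d_def)
    have "t < real n * d0" using n d0 by (simp add: pos_divide_less_eq)
    then have "d \<le> d0" using n0 by (simp add: d_def pos_divide_le_eq mult.commute)
    then have dle: "d \<le> d1" "d \<le> d2" "d \<le> h'" "d \<le> h2" by (auto simp: d0_def)
    have tk: "0 \<le> real k * d" "real k * d \<le> T" if "k \<le> n" for k
      using mult_right_mono[of "real k" "real n" d] that d t by auto
    have "norm (Y2 (0 + real n * d) - Y1 (0 + real n * d)) \<le> C * real n * (K * d powr (3 * \<alpha>))"
    proof (rule shadow[where N = n and z = "\<lambda>k. Y2 (0 + real k * d)"])
      show "K1 * d powr (3 * \<alpha>) \<le> K * d powr (3 * \<alpha>)" using K by (intro mult_right_mono) (auto simp: K_def)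
      show "K * d powr (3 * \<alpha>) \<le> 1" using d dle d2 by simp
      show "\<forall>k\<le>n. norm (f0 (Y2 (0 + real k * d))) \<le> B" using B(3) tk by simp
      show "\<forall>k<n. norm (Y2 (0 + real (Suc k) * d) - step (Y2 (0 + real k * d)) (0 + real k * d) (0 + real (Suc k) * d)) \<le> K * d powr (3 * \<alpha>)"
      proof (intro allI impI)
        fix k assume k: "k < n"
        have e: "0 + real (Suc k) * d - (0 + real k * d) = d" by (simp add: algebra_simps)
        have "norm (Y2 (0 + real (Suc k) * d) - step (Y2 (0 + real k * d)) (0 + real k * d) (0 + real (Suc k) * d))
            \<le> K2 * (0 + real (Suc k) * d - (0 + real k * d)) powr (3 * \<alpha>)"
          using tk[of k] tk[of "Suc k"] k d dle by (intro davie) (auto simp: algebra_simps)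
        also have "\<dots> \<le> K * d powr (3 * \<alpha>)" unfolding e using K by (intro mult_right_mono) (auto simp: K_def)
        finally show "norm (Y2 (0 + real (Suc k) * d) - step (Y2 (0 + real k * d)) (0 + real k * d) (0 + real (Suc k) * d)) \<le> K * d powr (3 * \<alpha>)" .
      qed
    qed (use d dle t start in auto)
    also have "\<dots> = (C * t * K) * d powr (3 * \<alpha> - 1)"
    proof -
      have "d powr (3 * \<alpha>) = d * d powr (3 * \<alpha> - 1)" using powr_mult_base[of d "3 * \<alpha> - 1"] d by simp
      then show ?thesis by (simp add: d(2)[symmetric] mult_ac)
    qed
    also have "\<dots> \<le> e" using d dle by (intro d1) auto
    finally show ?thesis using d by simp
  qed
  then have "norm (Y2 t - Y1 t) \<le> 0" by (rule field_le_epsilon)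
  then show ?thesis by simp
qed (simp add: start)

lemma solutions_unique:
  assumes "rde_solution tensor \<alpha> T X XX f0 f \<xi> Y1 Y1'" "rde_solution tensor \<alpha> T X XX f0 f \<xi> Y2 Y2'" "0 \<le> t" "t \<le> T"
  shows "Y1 t = Y2 t"
proof -
  obtain K1 h1 B1 where 1: "davie_path K1 h1 Y1" "Y1 0 = \<xi>" "0 \<le> B1" "\<And>t. 0 \<le> t \<Longrightarrow> t \<le> T \<Longrightarrow> norm (f0 (Y1 t)) \<le> B1"
    by (rule solution_is_davie_path[OF assms(1)]) blast
  obtain K2 h2 B2 where 2: "davie_path K2 h2 Y2" "Y2 0 = \<xi>" "0 \<le> B2" "\<And>t. 0 \<le> t \<Longrightarrow> t \<le> T \<Longrightarrow> norm (f0 (Y2 t)) \<le> B2"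
    by (rule solution_is_davie_path[OF assms(2)]) blast
  show ?thesis
  proof (rule davie_paths_unique[OF 1(1) 2(1), of "max B1 B2"])
    show "norm (f0 (Y1 t)) \<le> max B1 B2" if "0 \<le> t" "t \<le> T" for t using 1(4)[OF that] by (simp add: le_max_iff_disj)
    show "norm (f0 (Y2 t)) \<le> max B1 B2" if "0 \<le> t" "t \<le> T" for t using 2(4)[OF that] by (simp add: le_max_iff_disj)
  qed (use 1 2 assms in auto)
qed

end

context rough_chart
begin

text \<open>
  Iterating \<open>step_in_chart\<close> gives an approximate orbit inside \<open>M\<close>. By shadowing it stays close to \<open>Y\<close>, hence
  close to \<open>Y s0\<close>, hence its coordinates remain in the half ball, where the next step can be taken. As
  the step size tends to zero, \<open>Y t\<close> becomes a limit of points of the compact set \<open>\<phi> ` cball z0 (r / 2)\<close>.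
\<close>

lemma davie_path_stays_in_chart:
  assumes tang: "\<And>y v. y \<in> U \<inter> M \<Longrightarrow> f y v \<in> range (blinfun_apply (\<phi>1 (\<psi> y)))"
    and tang0: "\<And>y. y \<in> U \<inter> M \<Longrightarrow> f0 y \<in> range (blinfun_apply (\<phi>1 (\<psi> y)))"
    and Y: "davie_path K h Y" and cont: "continuous_on {0..T} Y"
    and B: "0 \<le> B" "\<And>t. 0 \<le> t \<Longrightarrow> t \<le> T \<Longrightarrow> norm (f0 (Y t)) \<le> B"
    and s0: "0 \<le> s0" "s0 < T" "Y s0 \<in> U \<inter> M"
  obtains T1 where "s0 < T1" "T1 \<le> T" "\<And>t. s0 \<le> t \<Longrightarrow> t \<le> T1 \<Longrightarrow> Y t \<in> M"
proof -
  define z0 where "z0 = \<psi> (Y s0)"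
  have z0: "z0 \<in> Om" "\<phi> z0 = Y s0" using inverse s0 by (auto simp: z0_def)
  obtain r L c where gb: "good_ball z0 r L c" using good_ball_exists[OF z0(1)] by blast
  have r: "0 < r" and c: "0 \<le> c" using good_ballD[OF gb] by auto
  have inOm: "cball z0 r \<subseteq> Om" using good_ballD(4)[OF gb] by blast
  have cont\<phi>: "continuous_on (cball z0 r) \<phi>"
    using isCont_\<phi>(1) inOm by (intro continuous_at_imp_continuous_on) blast
  have "continuous_on (cball z0 r) (\<lambda>x. f0 (\<phi> x))"
    by (rule continuous_on_compose2[OF continuous_on_f0[of UNIV] cont\<phi>]) simp
  then have "bounded ((\<lambda>x. f0 (\<phi> x)) ` cball z0 r)"
    by (rule compact_imp_bounded[OF compact_continuous_image[OF _ compact_cball]])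
  then obtain B1 where B1: "\<forall>x\<in>(\<lambda>x. f0 (\<phi> x)) ` cball z0 r. norm x \<le> B1" unfolding bounded_iff ..
  define B2 where "B2 = max B B1"
  have B2: "0 \<le> B2" using B by (simp add: B2_def)
  have B2Y: "norm (f0 (Y t)) \<le> B2" if "0 \<le> t" "t \<le> T" for t using B(2)[OF that] by (simp add: B2_def)
  have B2\<phi>: "norm (f0 (\<phi> x)) \<le> B2" if "x \<in> cball z0 r" for x
    using B1[rule_format, OF imageI[OF that]] by (simp add: B2_def)
  obtain h1 C1 where h1: "0 < h1" "h1 \<le> 1" "0 \<le> C1" and
    chart_step: "\<And>x s t. x \<in> cball z0 (r / 2) \<Longrightarrow> 0 \<le> s \<Longrightarrow> s \<le> t \<Longrightarrow> t \<le> T \<Longrightarrow> t - s \<le> h1 \<Longrightarrow>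
      \<exists>\<eta>. norm \<eta> \<le> r / 2 \<and> norm (\<phi> (x + \<eta>) - step (\<phi> x) s t) \<le> C1 * (t - s) powr (3 * \<alpha>)"
    by (rule step_in_chart[OF _ _ gb B2]) (erule tang, erule tang0, erule B2\<phi>, blast)
  obtain h2 C2 where h2: "0 < h2" and C2: "0 \<le> C2" and
    shadow: "\<And>a d N z \<epsilon> k. 0 \<le> a \<Longrightarrow> 0 < d \<Longrightarrow> d \<le> h2 \<Longrightarrow> a + real N * d \<le> T \<Longrightarrow> K * d powr (3 * \<alpha>) \<le> \<epsilon> \<Longrightarrow> \<epsilon> \<le> 1 \<Longrightarrow>
      \<forall>k\<le>N. norm (f0 (z k)) \<le> B2 \<Longrightarrow>
      \<forall>k<N. norm (z (Suc k) - step (z k) (a + real k * d) (a + real (Suc k) * d)) \<le> \<epsilon> \<Longrightarrow>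
      z 0 = Y a \<Longrightarrow> k \<le> N \<Longrightarrow> norm (z k - Y (a + real k * d)) \<le> C2 * real k * \<epsilon>"
    by (rule davie_path_shadowed_by_approximate_orbit[OF Y B2]) (erule (1) B2Y, blast)
  have K: "0 \<le> K" using Y by (simp add: davie_path_def)
  \<comment> \<open>A point whose image is within \<open>2 * e1\<close> of \<open>Y s0\<close> has its coordinates in the half ball. One \<open>e1\<close> is
    spent on the motion of \<open>Y\<close>, the other on the distance of the approximate orbit from \<open>Y\<close>.\<close>
  define e1 where "e1 = r / (4 * (c + 1))"
  have e1: "0 < e1" "c * (2 * e1) \<le> r / 2"
  proof -
    show "0 < e1" using r c by (simp add: e1_def)
    have "(c + 1) * (2 * e1) = r / 2" using c by (simp add: e1_def field_simps)
    then show "c * (2 * e1) \<le> r / 2" using \<open>0 < e1\<close> by (simp add: algebra_simps)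
  qed
  obtain d1 where d1: "0 < d1" "\<And>t. t \<in> {0..T} \<Longrightarrow> dist t s0 < d1 \<Longrightarrow> dist (Y t) (Y s0) < e1"
  proof -
    have "s0 \<in> {0..T}" using s0 by simp
    then have "\<exists>d>0. \<forall>t\<in>{0..T}. dist t s0 < d \<longrightarrow> dist (Y t) (Y s0) < e1"
      using cont e1(1) unfolding continuous_on_iff by (elim ballE[of _ _ s0]) auto
    then show ?thesis using that by blast
  qed
  define T1 where "T1 = min T (s0 + d1 / 2)"
  have T1: "s0 < T1" "T1 \<le> T" using s0 d1 by (auto simp: T1_def)
  have near: "norm (Y t - Y s0) \<le> e1" if "s0 \<le> t" "t \<le> T1" for t
    using d1(2)[of t] that s0 d1(1) by (auto simp: T1_def dist_norm intro!: less_imp_le)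
  have "Y t \<in> \<phi> ` cball z0 (r / 2)" if t: "s0 < t" "t \<le> T1" for t
  proof -
    have "continuous_on (cball z0 (r / 2)) \<phi>" using cont\<phi> r by (intro continuous_on_subset[OF cont\<phi>]) (auto intro: subset_cball)
    then have "closed (\<phi> ` cball z0 (r / 2))"
      by (intro compact_imp_closed compact_continuous_image compact_cball)
    moreover have "\<exists>p\<in>\<phi> ` cball z0 (r / 2). dist p (Y t) < e" if e: "0 < e" for e
    proof -
      define K' where "K' = max K C1"
      have K': "K \<le> K'" "C1 \<le> K'" "0 \<le> K'" using K by (auto simp: K'_def)
      define e2 where "e2 = min e1 (e / 2)"
      have e2: "0 < e2" "e2 \<le> e1" "e2 < e" using e e1 by (auto simp: e2_def)
      obtain d2 where d2: "0 < d2" "\<And>x. 0 \<le> x \<Longrightarrow> x \<le> d2 \<Longrightarrow> (C2 * (t - s0) * K') * x powr (3 * \<alpha> - 1) \<le> e2"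
        using small_powr[of "3 * \<alpha> - 1" e2 "C2 * (t - s0) * K'"] exponent e2 by auto
      obtain d3 where d3: "0 < d3" "\<And>x. 0 \<le> x \<Longrightarrow> x \<le> d3 \<Longrightarrow> K' * x powr (3 * \<alpha>) \<le> 1"
        using small_powr[of "3 * \<alpha>" 1 K'] exponent by auto
      define d0 where "d0 = min (min d2 d3) (min h1 h2)"
      have d0: "0 < d0" using d2 d3 h1 h2 by (simp add: d0_def)
      obtain n :: nat where n: "(t - s0) / d0 < real n" using reals_Archimedean2 by blast
      have n0: "0 < real n" using n t d0 by (meson diff_gt_0_iff_gt divide_pos_pos less_trans)
      define d where "d = (t - s0) / real n"
      have d: "0 < d" "real n * d = t - s0" using t n0 by (auto simp: d_def)
      have "t - s0 < real n * d0" using n d0 by (simp add: pos_divide_less_eq)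
      then have "d \<le> d0" using n0 by (simp add: d_def pos_divide_le_eq mult.commute)
      then have dle: "d \<le> d2" "d \<le> d3" "d \<le> h1" "d \<le> h2" by (auto simp: d0_def)
      define \<epsilon> where "\<epsilon> = K' * d powr (3 * \<alpha>)"
      have \<epsilon>: "\<epsilon> \<le> 1" "0 \<le> \<epsilon>" using d dle d3 K' by (auto simp: \<epsilon>_def)
      let ?t = "\<lambda>k. s0 + real k * d"
      have tk: "s0 \<le> ?t k" "?t k \<le> t" if "k \<le> n" for k
        using mult_right_mono[of "real k" "real n" d] that d by auto
      have total: "C2 * real k * \<epsilon> \<le> e2" if "k \<le> n" for k
      proof -
        have "C2 * real k * \<epsilon> \<le> C2 * real n * \<epsilon>" using that C2 \<epsilon> by (intro mult_right_mono mult_left_mono) auto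
        also have "\<dots> = (C2 * (t - s0) * K') * d powr (3 * \<alpha> - 1)"
        proof -
          have "d powr (3 * \<alpha>) = d * d powr (3 * \<alpha> - 1)" using powr_mult_base[of d "3 * \<alpha> - 1"] d by simp
          then show ?thesis by (simp add: \<epsilon>_def d(2)[symmetric] mult_ac)
        qed
        also have "\<dots> \<le> e2" using d dle by (intro d2) auto
        finally show ?thesis .
      qed
      \<comment> \<open>Only meaningful while \<open>x\<close> lies in the half ball; \<open>stay\<close> below shows that the iterates \<open>zs\<close> do.\<close>
      define \<eta> where "\<eta> k x = (SOME \<eta>. norm \<eta> \<le> r / 2 \<and>
        norm (\<phi> (x + \<eta>) - step (\<phi> x) (?t k) (?t (Suc k))) \<le> C1 * (?t (Suc k) - ?t k) powr (3 * \<alpha>))" for k x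
      define zs where "zs = rec_nat z0 (\<lambda>k x. x + \<eta> k x)"
      have zs: "zs 0 = z0" "zs (Suc k) = zs k + \<eta> k (zs k)" for k by (auto simp: zs_def)
      have gap_t: "?t (Suc k) - ?t k = d" for k by (simp add: algebra_simps)
      have one: "norm (\<eta> k x) \<le> r / 2 \<and> norm (\<phi> (x + \<eta> k x) - step (\<phi> x) (?t k) (?t (Suc k))) \<le> C1 * (?t (Suc k) - ?t k) powr (3 * \<alpha>)"
        if "x \<in> cball z0 (r / 2)" "k < n" for k x
        unfolding \<eta>_def
      proof (rule someI_ex[OF chart_step[OF that(1)]])
        show "0 \<le> ?t k" using tk[of k] that s0 by simp
        show "?t k \<le> ?t (Suc k)" "?t (Suc k) - ?t k \<le> h1" using gap_t[of k] d dle by linarith+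
        show "?t (Suc k) \<le> T" using tk(2)[of "Suc k"] that t T1 by simp
      qed
      have stay: "\<forall>i\<le>k. zs i \<in> cball z0 (r / 2) \<and> norm (\<phi> (zs i) - Y (?t i)) \<le> e2" if "k \<le> n" for k
        using that
      proof (induction k)
        case 0
        then show ?case using r e2 z0 by (simp add: zs)
      next
        case (Suc k)
        then have IH: "\<And>i. i \<le> k \<Longrightarrow> zs i \<in> cball z0 (r / 2) \<and> norm (\<phi> (zs i) - Y (?t i)) \<le> e2" by auto
        have k: "k < n" using Suc by simp
        have big: "zs i \<in> cball z0 r" if "i \<le> Suc k" for i
        proof (cases "i = Suc k")
          case True
          have "norm (\<eta> k (zs k)) \<le> r / 2" "norm (zs k - z0) \<le> r / 2"
            using one[of "zs k" k] IH[of k] k by (auto simp: dist_norm norm_minus_commute)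
          then have "norm (zs k + \<eta> k (zs k) - z0) \<le> r" by norm
          then show ?thesis using True by (simp add: zs dist_norm norm_minus_commute)
        next
          case False
          then have "zs i \<in> cball z0 (r / 2)" using IH[of i] that by simp
          then show ?thesis using r by simp
        qed
        have "norm (\<phi> (zs (Suc k)) - Y (?t (Suc k))) \<le> C2 * real (Suc k) * \<epsilon>"
        proof (rule shadow[where N = "Suc k" and z = "\<lambda>k. \<phi> (zs k)"])
          show "K * d powr (3 * \<alpha>) \<le> \<epsilon>" unfolding \<epsilon>_def using K' by (intro mult_right_mono) auto
          show "\<forall>i\<le>Suc k. norm (f0 (\<phi> (zs i))) \<le> B2" using B2\<phi> big by blast
          show "\<forall>i<Suc k. norm (\<phi> (zs (Suc i)) - step (\<phi> (zs i)) (?t i) (?t (Suc i))) \<le> \<epsilon>"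
          proof (intro allI impI)
            fix i assume i: "i < Suc k"
            have "norm (\<phi> (zs (Suc i)) - step (\<phi> (zs i)) (?t i) (?t (Suc i))) \<le> C1 * (?t (Suc i) - ?t i) powr (3 * \<alpha>)"
              using one[of "zs i" i] IH[of i] i k by (simp add: zs)
            also have "\<dots> \<le> \<epsilon>" unfolding gap_t \<epsilon>_def using K' by (intro mult_right_mono) auto
            finally show "norm (\<phi> (zs (Suc i)) - step (\<phi> (zs i)) (?t i) (?t (Suc i))) \<le> \<epsilon>" .
          qed
          show "s0 + real (Suc k) * d \<le> T" using tk(2)[of "Suc k"] Suc.prems t T1 by simp
        qed (use s0 d dle \<epsilon> z0 zs in auto)
        then have close: "norm (\<phi> (zs (Suc k)) - Y (?t (Suc k))) \<le> e2" using total[OF Suc.prems] by linarith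
        have "norm (Y (?t (Suc k)) - Y s0) \<le> e1" using tk[OF Suc.prems] t by (intro near) auto
        then have "norm (\<phi> (zs (Suc k)) - \<phi> z0) \<le> 2 * e1"
          using close e2(2) norm_diff_triangle_le[of "\<phi> (zs (Suc k))" "Y (?t (Suc k))" e2 "Y s0" e1] unfolding z0(2) by simp
        then have "c * norm (\<phi> (zs (Suc k)) - \<phi> z0) \<le> c * (2 * e1)" using c by (rule mult_left_mono)
        then have "norm (zs (Suc k) - z0) \<le> r / 2"
          using good_ballD(5)[OF gb big[OF order_refl]] e1(2) by linarith
        then have "zs (Suc k) \<in> cball z0 (r / 2)" by (simp add: dist_norm norm_minus_commute)
        then show ?case using close IH by (auto simp: le_Suc_eq)
      qed
      have "zs n \<in> cball z0 (r / 2)" "norm (\<phi> (zs n) - Y (?t n)) \<le> e2" using stay[of n] by auto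
      then show ?thesis using d e2 by (intro bexI[of _ "\<phi> (zs n)"]) (auto simp: dist_norm)
    qed
    ultimately show ?thesis using closed_approachable[of "\<phi> ` cball z0 (r / 2)" "Y t"] by blast
  qed
  moreover have "\<phi> ` cball z0 (r / 2) \<subseteq> M"
  proof
    fix p assume "p \<in> \<phi> ` cball z0 (r / 2)"
    then obtain x where x: "x \<in> cball z0 (r / 2)" "p = \<phi> x" by blast
    then have "x \<in> cball z0 r" using r by simp
    then show "p \<in> M" using inverse(3) inOm x by blast
  qed
  ultimately have "Y t \<in> M" if "s0 \<le> t" "t \<le> T1" for t
    using that s0(3) by (cases "t = s0") auto
  then show ?thesis using T1 by (intro that[of T1])
qed

section \<open>Tangency of the coefficients along invariant solutions\<close>

text \<open>
  Both \<open>Y t - Y s - f (Y s) (X t - X s)\<close> and the distance of \<open>Y t - Y s\<close> to the tangent space are of order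
  \<open>2\<alpha>\<close>. If \<open>f (Y s) v\<close> were not tangent, some functional \<open>\<mu> \<noteq> 0\<close> on \<open>'v\<close> would have
  \<open>\<mu> (X t - X s) = O((t - s)\<^bsup>2\<alpha>\<^esup>)\<close>.
\<close>

lemma roughness_forces_tangency:
  assumes sol: "rde_solution tensor \<alpha> T X XX f0 f \<xi> Y Y'" and inM: "\<And>t. 0 \<le> t \<Longrightarrow> t \<le> T0 \<Longrightarrow> Y t \<in> M"
    and s: "0 \<le> s" "s < T0" "T0 \<le> T" "Y s \<in> U"
    and rough: "\<And>v :: 'v \<Rightarrow>\<^sub>L real. v \<noteq> 0 \<Longrightarrow>
      Limsup (at_right s) (\<lambda>t. ereal (\<bar>blinfun_apply v (X t - X s)\<bar> / \<bar>t - s\<bar> powr (2 * \<alpha>))) = \<infinity>"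
  shows "f (Y s) v \<in> range (blinfun_apply (\<phi>1 (\<psi> (Y s))))"
proof -
  have holder: "holder_path \<alpha> T Y" and rem: "holder2 (2 * \<alpha>) T (\<lambda>s t. Y t - Y s - Y' s (X t - X s))"
    and Y': "\<And>t. t \<in> {0..T} \<Longrightarrow> Y' t = f (Y t)"
    using sol by (auto simp: rde_solution_def controlled_path_def)
  have sT: "s \<in> {0..T}" using s by simp
  have y: "Y s \<in> U \<inter> M" using s inM by simp
  have z: "\<psi> (Y s) \<in> Om" using inverse y by blast
  obtain C0 where C0: "0 \<le> C0" "\<And>s t. s \<in> {0..T} \<Longrightarrow> t \<in> {0..T} \<Longrightarrow> s \<noteq> t \<Longrightarrow> norm (Y t - Y s) \<le> C0 * \<bar>t - s\<bar> powr \<alpha>"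
    by (rule holder2E[OF holder[unfolded holder_path_def]]) blast
  obtain C1 where C1: "0 \<le> C1" "\<And>s t. s \<in> {0..T} \<Longrightarrow> t \<in> {0..T} \<Longrightarrow> s \<noteq> t \<Longrightarrow>
      norm (Y t - Y s - Y' s (X t - X s)) \<le> C1 * \<bar>t - s\<bar> powr (2 * \<alpha>)"
    by (rule holder2E[OF rem]) blast
  obtain \<delta> C where \<delta>: "0 < \<delta>" "0 \<le> C" and ex: "\<And>w. w \<in> U \<inter> M \<Longrightarrow> norm (w - Y s) < \<delta> \<Longrightarrow>
      norm (\<psi> w - \<psi> (Y s)) \<le> C * norm (w - Y s) \<and>
      norm (w - Y s - \<phi>1 (\<psi> (Y s)) (\<psi> w - \<psi> (Y s))) \<le> C * (norm (w - Y s))\<^sup>2 \<and>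
      norm (w - Y s - \<phi>1 (\<psi> (Y s)) (\<psi> w - \<psi> (Y s)) - (1/2) *\<^sub>R \<phi>2 (\<psi> (Y s)) (\<psi> w - \<psi> (Y s)) (\<psi> w - \<psi> (Y s))) \<le> C * norm (w - Y s) ^ 3"
    by (rule coordinates_expansion[OF y]) blast
  obtain P :: "'w \<Rightarrow>\<^sub>L (real ^ 'm)" where P: "\<And>u. P (\<phi>1 (\<psi> (Y s)) u) = u"
    using bounded_left_inverse[OF inj_\<phi>1[OF z]] by blast
  define Q where "Q = id_blinfun - (\<phi>1 (\<psi> (Y s)) o\<^sub>L P)"
  have Q: "Q x = x - \<phi>1 (\<psi> (Y s)) (P x)" for x by (simp add: Q_def blinfun.diff_left)
  have Q0: "Q (\<phi>1 (\<psi> (Y s)) u) = 0" for u by (simp add: Q P)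
  have "Q (f (Y s) v) = 0"
  proof (rule ccontr)
    assume "Q (f (Y s) v) \<noteq> 0"
    then obtain l :: "'w \<Rightarrow>\<^sub>L real" where l: "l (Q (f (Y s) v)) \<noteq> 0" by (rule separating_functional)
    define \<mu> where "\<mu> = l o\<^sub>L (Q o\<^sub>L f (Y s))"
    have "\<mu> v \<noteq> 0" using l by (simp add: \<mu>_def)
    then have "\<mu> \<noteq> 0" by auto
    then have inf: "Limsup (at_right s) (\<lambda>t. ereal (\<bar>blinfun_apply \<mu> (X t - X s)\<bar> / \<bar>t - s\<bar> powr (2 * \<alpha>))) = \<infinity>"
      by (rule rough)
    define C2 where "C2 = norm l * (norm Q * (C1 + C * C0\<^sup>2))"
    have "(Y \<longlongrightarrow> Y s) (at s within {0..T})"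
      using holder_path_continuous[OF holder] sT by (simp add: continuous_on_def)
    then have lim: "(Y \<longlongrightarrow> Y s) (at s within {s<..<T0})"
      using s by (rule_tac tendsto_within_subset) auto
    have "at_right s = at s within {s<..<T0}"
      using s by (intro at_within_nhd[of s "{..<T0}"]) auto
    then have limr: "(Y \<longlongrightarrow> Y s) (at_right s)" using lim by simp
    have "\<forall>\<^sub>F t in at_right s. Y t \<in> U" using topological_tendstoD[OF limr opens(1)] s by blast
    moreover have "\<forall>\<^sub>F t in at_right s. dist (Y t) (Y s) < \<delta>" using tendstoD[OF limr \<delta>(1)] .
    moreover have "\<forall>\<^sub>F t in at_right s. t \<in> {s<..<T0}" using s by (auto simp: eventually_at_right_field)
    ultimately have "\<forall>\<^sub>F t in at_right s. ereal (\<bar>blinfun_apply \<mu> (X t - X s)\<bar> / \<bar>t - s\<bar> powr (2 * \<alpha>)) \<le> ereal C2"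
    proof eventually_elim
      case (elim t)
      have tT: "t \<in> {0..T}" "s \<noteq> t" using elim s by auto
      have w: "Y t \<in> U \<inter> M" "norm (Y t - Y s) < \<delta>" using elim inM[of t] s by (auto simp: dist_norm)
      let ?p = "\<bar>t - s\<bar> powr (2 * \<alpha>)"
      have p: "0 < ?p" using tT by simp
      define e1 where "e1 = Y t - Y s - f (Y s) (X t - X s)"
      define e2 where "e2 = Y t - Y s - \<phi>1 (\<psi> (Y s)) (\<psi> (Y t) - \<psi> (Y s))"
      have ne1: "norm e1 \<le> C1 * ?p" using C1(2)[OF sT tT] Y'[OF sT] by (simp add: e1_def)
      have "norm e2 \<le> C * (norm (Y t - Y s))\<^sup>2" using ex[OF w] by (simp add: e2_def)
      also have "\<dots> \<le> C * (C0 * \<bar>t - s\<bar> powr \<alpha>)\<^sup>2" using C0(2)[OF sT tT] \<delta>(2) by (intro mult_left_mono power_mono) auto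
      also have "\<dots> = C * C0\<^sup>2 * ?p" by (simp add: power_mult_distrib powr2 power2_eq_square)
      finally have ne2: "norm e2 \<le> C * C0\<^sup>2 * ?p" .
      have "f (Y s) (X t - X s) = \<phi>1 (\<psi> (Y s)) (\<psi> (Y t) - \<psi> (Y s)) + (e2 - e1)" by (simp add: e1_def e2_def)
      then have "Q (f (Y s) (X t - X s)) = Q (e2 - e1)" by (simp add: blinfun.add_right Q0)
      then have "\<bar>\<mu> (X t - X s)\<bar> = norm (l (Q (e2 - e1)))" by (simp add: \<mu>_def)
      also have "\<dots> \<le> norm l * (norm Q * norm (e2 - e1))"
        by (intro order_trans[OF norm_blinfun] mult_left_mono norm_blinfun) auto
      also have "norm (e2 - e1) \<le> (C1 + C * C0\<^sup>2) * ?p"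
        using order_trans[OF norm_triangle_ineq4 add_mono[OF ne2 ne1]] by (simp add: algebra_simps)
      then have "norm l * (norm Q * norm (e2 - e1)) \<le> norm l * (norm Q * ((C1 + C * C0\<^sup>2) * ?p))"
        by (intro mult_left_mono) auto
      also have "\<dots> = C2 * ?p" by (simp add: C2_def)
      finally show ?case using p by (simp add: pos_divide_le_eq)
    qed
    then have "Limsup (at_right s) (\<lambda>t. ereal (\<bar>blinfun_apply \<mu> (X t - X s)\<bar> / \<bar>t - s\<bar> powr (2 * \<alpha>))) \<le> ereal C2"
      by (rule Limsup_bounded)
    then show False using inf by simp
  qed
  then have "f (Y s) v = \<phi>1 (\<psi> (Y s)) (P (f (Y s) v))" by (simp add: Q)
  then show ?thesis by (metis rangeI)
qed

text \<open>
  Compare the Davie expansion of \<open>Y t - \<xi>\<close> with the second-order Taylor expansion of the chart. Up to tangent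
  vectors and order \<open>3\<alpha>\<close>, the second-level term equals the quadratic Taylor term, because the coordinates
  \<open>\<Delta>\<close> of \<open>Y t\<close> relative to \<open>\<xi>\<close> agree with \<open>a\<close> up to order \<open>2\<alpha>\<close>. What is left is \<open>t Q (f0 \<xi>) = O(t\<^bsup>3\<alpha>\<^esup>)\<close>.
\<close>

lemma drift_tangent:
  assumes tang: "\<And>y v. y \<in> U \<inter> M \<Longrightarrow> f y v \<in> range (blinfun_apply (\<phi>1 (\<psi> y)))"
    and sol: "rde_solution tensor \<alpha> T X XX f0 f \<xi> Y Y'" and inM: "\<And>t. 0 \<le> t \<Longrightarrow> t \<le> T0 \<Longrightarrow> Y t \<in> M"
    and T0: "0 < T0" "T0 \<le> T" and \<xi>: "\<xi> \<in> U \<inter> M"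
  shows "f0 \<xi> \<in> range (blinfun_apply (\<phi>1 (\<psi> \<xi>)))"
proof -
  obtain K h B where Y: "davie_path K h Y" "Y 0 = \<xi>" "continuous_on {0..T} Y"
    by (rule solution_is_davie_path[OF sol]) blast
  have K: "0 \<le> K" "0 < h" "h \<le> 1" and davie: "\<And>s t. 0 \<le> s \<Longrightarrow> s \<le> t \<Longrightarrow> t \<le> T \<Longrightarrow> t - s \<le> h \<Longrightarrow>
      norm (Y t - step (Y s) s t) \<le> K * (t - s) powr (3 * \<alpha>)"
    using Y(1) by (auto simp: davie_path_def)
  define z where "z = \<psi> \<xi>"
  have z: "z \<in> Om" using inverse \<xi> by (auto simp: z_def)
  obtain \<delta> C where \<delta>: "0 < \<delta>" "0 \<le> C" and ex: "\<And>w. w \<in> U \<inter> M \<Longrightarrow> norm (w - \<xi>) < \<delta> \<Longrightarrow>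
      norm (\<psi> w - \<psi> \<xi>) \<le> C * norm (w - \<xi>) \<and>
      norm (w - \<xi> - \<phi>1 (\<psi> \<xi>) (\<psi> w - \<psi> \<xi>)) \<le> C * (norm (w - \<xi>))\<^sup>2 \<and>
      norm (w - \<xi> - \<phi>1 (\<psi> \<xi>) (\<psi> w - \<psi> \<xi>) - (1/2) *\<^sub>R \<phi>2 (\<psi> \<xi>) (\<psi> w - \<psi> \<xi>) (\<psi> w - \<psi> \<xi>)) \<le> C * norm (w - \<xi>) ^ 3"
    by (rule coordinates_expansion[OF \<xi>]) blast
  obtain P :: "'w \<Rightarrow>\<^sub>L (real ^ 'm)" where P: "\<And>u. P (\<phi>1 z u) = u"
    using bounded_left_inverse[OF inj_\<phi>1[OF z]] by blast
  define Q where "Q = id_blinfun - (\<phi>1 z o\<^sub>L P)"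
  have Q: "Q x = x - \<phi>1 z (P x)" for x by (simp add: Q_def blinfun.diff_left)
  have Q0: "Q (\<phi>1 z u) = 0" for u by (simp add: Q P)
  have \<phi>2b: "norm (\<phi>2 z u v) \<le> norm (\<phi>2 z) * norm u * norm v" for u v
    by (rule order_trans[OF norm_blinfun mult_right_mono[OF norm_blinfun norm_ge_zero]])
  \<comment> \<open>\<open>A1\<close>, \<open>A2\<close> and \<open>A3\<close> bound the increment of \<open>Y\<close> without its first-order term, the whole increment, and
    \<open>\<Delta> - a\<close> below; the powers of \<open>t\<close> that go with them are \<open>2\<alpha>\<close>, \<open>\<alpha>\<close> and \<open>2\<alpha>\<close>.\<close>
  define A1 where "A1 = norm (f0 \<xi>) + K + H ^ 4"
  define A2 where "A2 = A1 + H\<^sup>2"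
  define A3 where "A3 = norm P * (A1 + C * A2\<^sup>2)"
  define A where "A = norm Q * (K + C * A2 ^ 3 + norm (\<phi>2 z) * A3 * (C * A2 + norm P * H\<^sup>2))"
  have A_nonneg: "0 \<le> A1" "0 \<le> A2" "0 \<le> A3" using K \<delta> H_power(3) by (auto simp: A1_def A2_def A3_def add_nonneg_nonneg)
  obtain t0 where t0: "0 < t0" "\<And>t. 0 \<le> t \<Longrightarrow> t < t0 \<Longrightarrow> t \<le> T \<Longrightarrow> Y t \<in> U \<and> norm (Y t - \<xi>) < \<delta>"
  proof -
    have lim: "(Y \<longlongrightarrow> \<xi>) (at 0 within {0..T})" using Y(2,3) horizon by (auto simp: continuous_on_def)
    have "\<forall>\<^sub>F t in at 0 within {0..T}. Y t \<in> U \<and> dist (Y t) \<xi> < \<delta>"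
      using topological_tendstoD[OF lim opens(1)] tendstoD[OF lim \<delta>(1)] \<xi> by (auto intro: eventually_conj)
    then obtain t0 where "0 < t0" "\<And>t. t \<in> {0..T} \<Longrightarrow> t \<noteq> 0 \<Longrightarrow> dist t 0 < t0 \<Longrightarrow> Y t \<in> U \<and> dist (Y t) \<xi> < \<delta>"
      unfolding eventually_at by blast
    then have t0: "0 < t0" "\<And>t. t \<in> {0..T} \<Longrightarrow> t \<noteq> 0 \<Longrightarrow> dist t 0 < t0 \<Longrightarrow> Y t \<in> U \<and> dist (Y t) \<xi> < \<delta>" .
    have "Y t \<in> U \<and> norm (Y t - \<xi>) < \<delta>" if "0 \<le> t" "t < t0" "t \<le> T" for t
    proof (cases "t = 0")
      case True
      then show ?thesis using \<xi> Y(2) \<delta>(1) by simp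
    next
      case False
      then show ?thesis using t0(2)[of t] that by (simp add: dist_norm)
    qed
    then show ?thesis by (rule that[OF t0(1)])
  qed
  have main: "norm (Q (f0 \<xi>)) * t \<le> A * t powr (3 * \<alpha>)"
    if t: "0 < t" "t < t0" "t \<le> T0" "t \<le> h" for t
  proof -
    have tm: "0 \<le> (0::real)" "0 \<le> t" "t \<le> t" "t \<le> T" "t - 0 \<le> 1" using t T0 K by auto
    define \<tau> where "\<tau> = t powr \<alpha>"
    define \<sigma> where "\<sigma> = t powr (2 * \<alpha>)"
    have \<tau>: "0 \<le> \<tau>" "0 \<le> \<sigma>" "\<sigma> = \<tau> * \<tau>" "\<sigma> \<le> \<tau>" "t \<le> \<sigma>" "t powr (3 * \<alpha>) = \<tau> * \<sigma>" "\<tau> \<le> 1"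
      using tau[OF tm] le_powr2[of t t] tm by (auto simp: \<tau>_def \<sigma>_def powr3)
    have w: "Y t \<in> U \<inter> M" "norm (Y t - \<xi>) < \<delta>" using t0(2)[of t] inM[of t] t T0 by auto
    define e1 where "e1 = Y t - step \<xi> 0 t"
    define \<Delta> where "\<Delta> = \<psi> (Y t) - z"
    define e2 where "e2 = Y t - \<xi> - \<phi>1 z \<Delta> - (1/2) *\<^sub>R \<phi>2 z \<Delta> \<Delta>"
    define a where "a = P (f \<xi> (X t - X 0))"
    have ne1: "norm e1 \<le> K * (\<tau> * \<sigma>)" using davie[of 0 t] tm t Y(2) by (simp add: e1_def \<tau>(6))
    have fa: "\<phi>1 z a = f \<xi> (X t - X 0)"
      using tang[OF \<xi>, of "X t - X 0"] P unfolding z_def[symmetric] a_def by auto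
    obtain q where q: "g \<xi> (XX 0 t) = (1/2) *\<^sub>R \<phi>2 z a a + \<phi>1 z q"
    proof (rule second_level_tangential[of \<xi> P 0 t])
      show "P (\<phi>1 (\<psi> \<xi>) u) = u" for u using P by (simp add: z_def)
      show "0 \<in> {0..T}" "t \<in> {0..T}" using tm horizon by auto
      fix q assume "g \<xi> (XX 0 t) = (1 / 2) *\<^sub>R \<phi>2 (\<psi> \<xi>) (P (f \<xi> (X t - X 0))) (P (f \<xi> (X t - X 0))) + \<phi>1 (\<psi> \<xi>) q"
      then show ?thesis by (intro that[of q]) (simp add: z_def a_def)
    qed (use \<xi> tang in auto)
    have Yt: "Y t - \<xi> = t *\<^sub>R f0 \<xi> + (\<phi>1 z a + ((1/2) *\<^sub>R \<phi>2 z a a + \<phi>1 z q)) + e1"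
      using q by (simp add: e1_def step_def J_def fa)
    have nfirst: "norm (Y t - \<xi> - \<phi>1 z a) \<le> A1 * \<sigma>"
    proof -
      have "Y t - \<xi> - \<phi>1 z a = (t *\<^sub>R f0 \<xi> + g \<xi> (XX 0 t)) + e1" unfolding Yt q by simp
      moreover have "norm (t *\<^sub>R f0 \<xi>) \<le> \<sigma> * norm (f0 \<xi>)" using \<tau>(5) tm by (simp add: mult_right_mono)
      moreover have "norm (g \<xi> (XX 0 t)) \<le> H ^ 4 * \<sigma>" using gXX_bound[OF tm, of \<xi>] by (simp add: \<sigma>_def)
      moreover have "norm e1 \<le> K * \<sigma>"
      proof -
        have "\<tau> * \<sigma> \<le> 1 * \<sigma>" using \<tau>(2,7) by (intro mult_right_mono)
        then show ?thesis using ne1 mult_left_mono[of "\<tau> * \<sigma>" \<sigma> K] K by simp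
      qed
      ultimately have "norm (Y t - \<xi> - \<phi>1 z a) \<le> (\<sigma> * norm (f0 \<xi>) + H ^ 4 * \<sigma>) + K * \<sigma>"
        by (simp only:) (intro norm_triangle_le add_mono)
      then show ?thesis by (simp add: A1_def algebra_simps)
    qed
    have nf: "norm (\<phi>1 z a) \<le> H\<^sup>2 * \<tau>" using fX_bound[OF tm, of \<xi>] by (simp add: fa \<tau>_def)
    have nY: "norm (Y t - \<xi>) \<le> A2 * \<tau>"
    proof -
      have "norm (Y t - \<xi>) \<le> norm (Y t - \<xi> - \<phi>1 z a) + norm (\<phi>1 z a)" by norm
      also have "\<dots> \<le> A1 * \<sigma> + H\<^sup>2 * \<tau>" using nfirst nf by (rule add_mono)
      also have "\<dots> \<le> A1 * \<tau> + H\<^sup>2 * \<tau>" using \<tau>(4) A_nonneg(1) by (intro add_right_mono mult_left_mono)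
      finally show ?thesis by (simp add: A2_def algebra_simps)
    qed
    have n\<Delta>: "norm \<Delta> \<le> C * A2 * \<tau>"
      using ex[OF w] mult_left_mono[OF nY \<delta>(2)] by (simp add: \<Delta>_def z_def mult.assoc)
    have na: "norm a \<le> norm P * H\<^sup>2 * \<tau>"
      using norm_blinfun[of P "f \<xi> (X t - X 0)"] mult_left_mono[OF nf norm_ge_zero[of P]] unfolding fa by (simp add: a_def mult.assoc)
    have n\<Delta>a: "norm (\<Delta> - a) \<le> A3 * \<sigma>"
    proof -
      have "norm (Y t - \<xi> - \<phi>1 z \<Delta>) \<le> C * (norm (Y t - \<xi>))\<^sup>2" using ex[OF w] by (simp add: \<Delta>_def z_def)
      also have "\<dots> \<le> C * (A2 * \<tau>)\<^sup>2" using nY \<delta>(2) by (intro mult_left_mono power_mono) auto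
      also have "\<dots> = C * A2\<^sup>2 * \<sigma>" by (simp add: \<tau>(3) power2_eq_square mult_ac)
      finally have n2: "norm (Y t - \<xi> - \<phi>1 z \<Delta>) \<le> C * A2\<^sup>2 * \<sigma>" .
      have "\<Delta> - a = P ((Y t - \<xi> - \<phi>1 z a) - (Y t - \<xi> - \<phi>1 z \<Delta>))" by (simp add: blinfun.diff_right P)
      also have "norm \<dots> \<le> norm P * norm ((Y t - \<xi> - \<phi>1 z a) - (Y t - \<xi> - \<phi>1 z \<Delta>))" by (rule norm_blinfun)
      also have "\<dots> \<le> norm P * (A1 * \<sigma> + C * A2\<^sup>2 * \<sigma>)"
        by (rule mult_left_mono[OF order_trans[OF norm_triangle_ineq4 add_mono[OF nfirst n2]] norm_ge_zero])
      finally show ?thesis by (simp add: A3_def algebra_simps)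
    qed
    have "norm e2 \<le> C * norm (Y t - \<xi>) ^ 3" using ex[OF w] by (simp add: e2_def \<Delta>_def z_def)
    also have "\<dots> \<le> C * (A2 * \<tau>) ^ 3" using nY \<delta>(2) by (intro mult_left_mono power_mono) auto
    also have "\<dots> = C * A2 ^ 3 * (\<tau> * \<sigma>)" by (simp add: \<tau>(3) power3_eq_cube mult_ac)
    finally have ne2: "norm e2 \<le> C * A2 ^ 3 * (\<tau> * \<sigma>)" .
    have nq: "norm (\<phi>2 z \<Delta> \<Delta> - \<phi>2 z a a) \<le> norm (\<phi>2 z) * A3 * (C * A2 + norm P * H\<^sup>2) * (\<tau> * \<sigma>)"
    proof -
      have "\<phi>2 z \<Delta> \<Delta> - \<phi>2 z a a = \<phi>2 z (\<Delta> - a) \<Delta> + \<phi>2 z a (\<Delta> - a)"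
        by (simp add: blinfun.diff_right blinfun.diff_left)
      moreover have "norm (\<phi>2 z (\<Delta> - a) \<Delta>) \<le> norm (\<phi>2 z) * (A3 * \<sigma>) * (C * A2 * \<tau>)"
        using n\<Delta>a n\<Delta> A_nonneg(3) \<tau>(2) by (intro order_trans[OF \<phi>2b] mult_mono mult_left_mono) auto
      moreover have "norm (\<phi>2 z a (\<Delta> - a)) \<le> norm (\<phi>2 z) * (norm P * H\<^sup>2 * \<tau>) * (A3 * \<sigma>)"
        using n\<Delta>a na \<tau>(1) by (intro order_trans[OF \<phi>2b] mult_mono mult_left_mono mult_nonneg_nonneg) auto
      ultimately have "norm (\<phi>2 z \<Delta> \<Delta> - \<phi>2 z a a) \<le> norm (\<phi>2 z) * (A3 * \<sigma>) * (C * A2 * \<tau>) + norm (\<phi>2 z) * (norm P * H\<^sup>2 * \<tau>) * (A3 * \<sigma>)"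
        by (simp only: norm_triangle_le add_mono)
      then show ?thesis by (simp add: algebra_simps)
    qed
    have "t *\<^sub>R f0 \<xi> = (\<phi>1 z \<Delta> - \<phi>1 z a - \<phi>1 z q) + ((1/2) *\<^sub>R (\<phi>2 z \<Delta> \<Delta> - \<phi>2 z a a) + (e2 - e1))"
      using Yt by (simp add: e2_def scaleR_diff_right algebra_simps)
    then have "t *\<^sub>R Q (f0 \<xi>) = Q ((\<phi>1 z \<Delta> - \<phi>1 z a - \<phi>1 z q) + ((1/2) *\<^sub>R (\<phi>2 z \<Delta> \<Delta> - \<phi>2 z a a) + (e2 - e1)))"
      by (simp flip: blinfun.scaleR_right)
    also have "\<dots> = Q ((1/2) *\<^sub>R (\<phi>2 z \<Delta> \<Delta> - \<phi>2 z a a) + (e2 - e1))"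
      by (simp only: blinfun.add_right blinfun.diff_right Q0) simp
    finally have "norm (t *\<^sub>R Q (f0 \<xi>)) \<le> norm Q * norm ((1/2) *\<^sub>R (\<phi>2 z \<Delta> \<Delta> - \<phi>2 z a a) + (e2 - e1))"
      by (metis norm_blinfun)
    also have "\<dots> \<le> norm Q * (norm (\<phi>2 z) * A3 * (C * A2 + norm P * H\<^sup>2) * (\<tau> * \<sigma>) + (C * A2 ^ 3 * (\<tau> * \<sigma>) + K * (\<tau> * \<sigma>)))"
    proof (rule mult_left_mono[OF norm_triangle_le[OF add_mono]])
      show "norm ((1/2) *\<^sub>R (\<phi>2 z \<Delta> \<Delta> - \<phi>2 z a a)) \<le> norm (\<phi>2 z) * A3 * (C * A2 + norm P * H\<^sup>2) * (\<tau> * \<sigma>)"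
      proof (rule order_trans[OF _ nq])
        have "norm ((1/2) *\<^sub>R x) \<le> norm x" for x :: 'w by simp
        then show "norm ((1/2) *\<^sub>R (\<phi>2 z \<Delta> \<Delta> - \<phi>2 z a a)) \<le> norm (\<phi>2 z \<Delta> \<Delta> - \<phi>2 z a a)" .
      qed
      show "norm (e2 - e1) \<le> C * A2 ^ 3 * (\<tau> * \<sigma>) + K * (\<tau> * \<sigma>)"
        by (rule order_trans[OF norm_triangle_ineq4 add_mono[OF ne2 ne1]])
    qed simp
    also have "\<dots> = A * t powr (3 * \<alpha>)" unfolding \<tau>(6) A_def by (simp add: algebra_simps)
    finally show ?thesis using t by (simp add: mult.commute)
  qed
  have "norm (Q (f0 \<xi>)) \<le> 0 + e" if e: "0 < e" for e
  proof -
    obtain d where d: "0 < d" "\<And>x. 0 \<le> x \<Longrightarrow> x \<le> d \<Longrightarrow> A * x powr (3 * \<alpha> - 1) \<le> e"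
      using small_powr[of "3 * \<alpha> - 1" e A] exponent e by auto
    define t where "t = min (min d (t0 / 2)) (min T0 h)"
    have t: "0 < t" "t \<le> d" "t < t0" "t \<le> T0" "t \<le> h" using d t0(1) T0 K by (auto simp: t_def)
    have "norm (Q (f0 \<xi>)) * t \<le> A * t powr (3 * \<alpha>)" by (rule main[OF t(1,3,4,5)])
    also have "\<dots> = (A * t powr (3 * \<alpha> - 1)) * t" using powr_mult_base[of t "3 * \<alpha> - 1"] t by (simp add: mult_ac)
    also have "\<dots> \<le> e * t" using d(2)[of t] t by (intro mult_right_mono) auto
    finally show ?thesis using t by simp
  qed
  then have "norm (Q (f0 \<xi>)) \<le> 0" by (rule field_le_epsilon)
  then have "f0 \<xi> = \<phi>1 z (P (f0 \<xi>))" by (simp add: Q)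
  then show ?thesis unfolding z_def by (metis rangeI)
qed

end

section \<open>The invariance theorem\<close>

context rough_equation
begin

lemma chart_around:
  assumes M: "C3_submanifold TYPE('m::finite) M" and y: "y \<in> M"
    and geometric: "\<And>s t. s \<in> {0..T} \<Longrightarrow> t \<in> {0..T} \<Longrightarrow> tensor_Sym tensor (XX s t) = (1/2) *\<^sub>R tensor (X t - X s) (X t - X s)"
  obtains U Om and \<phi> :: "real ^ 'm \<Rightarrow> 'w" and \<psi> \<phi>1 \<phi>2 \<phi>3
  where "y \<in> U" "rough_chart tensor f0 f f1 f2 X XX \<alpha> T H M U Om \<phi> \<psi> \<phi>1 \<phi>2 \<phi>3"
proof -
  obtain U Om and \<phi> :: "real ^ 'm \<Rightarrow> 'w" and \<psi> where c: "y \<in> U" "C3_chart M U Om \<phi> \<psi>"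
    using M y unfolding C3_submanifold_def by blast
  obtain \<phi>1 \<phi>2 \<phi>3 where d: "C3_derivatives Om \<phi> \<phi>1 \<phi>2 \<phi>3"
    using c(2) unfolding C3_chart_def C3_on_def by blast
  have "rough_chart tensor f0 f f1 f2 X XX \<alpha> T H M U Om \<phi> \<psi> \<phi>1 \<phi>2 \<phi>3"
    by (intro rough_chart.intro rough_chart_axioms.intro chart.intro rough_equation_axioms c(2) d geometric)
  then show ?thesis by (rule that[OF c(1)])
qed

text \<open>
  Roughness is only known at the times of a dense set. Along such times \<open>s n\<close> tending to zero the vectors
  \<open>f (Y (s n)) v\<close> are tangent, and tangency persists in the limit \<open>f y v\<close>.
\<close>

lemma volatility_tangent:
  assumes M: "C3_submanifold TYPE('m::finite) M"
    and geometric: "\<And>s t. s \<in> {0..T} \<Longrightarrow> t \<in> {0..T} \<Longrightarrow> tensor_Sym tensor (XX s t) = (1/2) *\<^sub>R tensor (X t - X s) (X t - X s)"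
    and rough: "truly_rough \<alpha> T X" and inv: "locally_invariant tensor \<alpha> T X XX f0 f M" and y: "y \<in> M"
  shows "f y v \<in> tangent_space TYPE('m) M y"
proof -
  obtain U Om and \<phi> :: "real ^ 'm \<Rightarrow> 'w" and \<psi> \<phi>1 \<phi>2 \<phi>3
    where yU: "y \<in> U" and rc: "rough_chart tensor f0 f f1 f2 X XX \<alpha> T H M U Om \<phi> \<psi> \<phi>1 \<phi>2 \<phi>3"
    by (rule chart_around[OF M y geometric])
  interpret rc: rough_chart tensor f0 f f1 f2 X XX \<alpha> T H M U Om \<phi> \<psi> \<phi>1 \<phi>2 \<phi>3 by (rule rc)
  have yUM: "y \<in> U \<inter> M" using y yU by simp
  have z: "\<psi> y \<in> Om" by (rule rc.inverse(2)[OF yUM])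
  obtain Y Y' where sol: "rde_solution tensor \<alpha> T X XX f0 f y Y Y'" by (rule solution_exists)
  obtain T0 where T0: "0 < T0" "T0 \<le> T" and inM: "\<And>t. 0 \<le> t \<Longrightarrow> t \<le> T0 \<Longrightarrow> Y t \<in> M"
    using inv y sol unfolding locally_invariant_def by fastforce
  have Y0: "Y 0 = y" and cont: "continuous_on {0..T} Y"
    by (rule solution_is_davie_path[OF sol], assumption)+
  obtain D where D: "D \<subseteq> {0..<T}" "{0..<T} \<subseteq> closure D" and
    all: "\<forall>s\<in>D. \<forall>v :: 'v \<Rightarrow>\<^sub>L real. v \<noteq> 0 \<longrightarrow>
      Limsup (at_right s) (\<lambda>t. ereal (\<bar>blinfun_apply v (X t - X s)\<bar> / \<bar>t - s\<bar> powr (2 * \<alpha>))) = \<infinity>"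
    using rough unfolding truly_rough_def by (elim conjE exE)
  have limsup: "Limsup (at_right s) (\<lambda>t. ereal (\<bar>blinfun_apply v (X t - X s)\<bar> / \<bar>t - s\<bar> powr (2 * \<alpha>))) = \<infinity>"
    if "s \<in> D" "v \<noteq> 0" for s and v :: "'v \<Rightarrow>\<^sub>L real"
    using all that by blast
  have "0 \<in> closure D" using D(2) horizon by auto
  then obtain s where s: "\<And>n. s n \<in> D" "s \<longlonglongrightarrow> 0" unfolding closure_sequential by blast
  have s0T: "0 \<le> s n" "s n < T" for n using s(1)[of n] D(1) by auto
  have Ylim: "(\<lambda>n. Y (s n)) \<longlonglongrightarrow> y"
    using continuous_on_tendsto_compose[OF cont s(2)] s0T horizon Y0 by (simp add: less_imp_le)
  have ev: "\<forall>\<^sub>F n in sequentially. s n < T0 \<and> Y (s n) \<in> U"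
    using order_tendstoD(2)[OF s(2) T0(1)] topological_tendstoD[OF Ylim rc.opens(1) yU] by (rule eventually_conj)
  have tang: "\<exists>c. \<phi>1 (\<psi> (Y (s n))) c = f (Y (s n)) v" if n: "s n < T0 \<and> Y (s n) \<in> U" for n
  proof -
    have "f (Y (s n)) v \<in> range (blinfun_apply (\<phi>1 (\<psi> (Y (s n)))))"
      using n by (intro rc.roughness_forces_tangency[OF sol inM s0T(1) _ T0(2) _ limsup[OF s(1)]]) auto
    then show ?thesis by (auto simp: image_iff)
  qed
  define c where "c n = (SOME c. \<phi>1 (\<psi> (Y (s n))) c = f (Y (s n)) v)" for n
  have c: "\<phi>1 (\<psi> (Y (s n))) (c n) = f (Y (s n)) v" if "s n < T0 \<and> Y (s n) \<in> U" for n
    unfolding c_def by (rule someI_ex[OF tang[OF that]])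
  have "(\<lambda>n. f (Y (s n))) \<longlonglongrightarrow> f y"
    by (rule isCont_tendsto_compose[OF has_derivative_continuous[OF f.deriv] Ylim])
  then have "(\<lambda>n. f (Y (s n)) v) \<longlonglongrightarrow> f y v" by (intro tendsto_intros)
  then have lim: "(\<lambda>n. \<phi>1 (\<psi> (Y (s n))) (c n)) \<longlonglongrightarrow> f y v"
    by (rule Lim_transform_eventually) (use ev c in \<open>auto elim!: eventually_mono\<close>)
  have \<psi>lim: "(\<lambda>n. \<psi> (Y (s n))) \<longlonglongrightarrow> \<psi> y"
  proof (rule continuous_on_tendsto_compose[OF _ Ylim yUM])
    show "continuous_on (U \<inter> M) \<psi>" using rc.homeo by (simp add: homeomorphism_def)
    show "\<forall>\<^sub>F n in sequentially. Y (s n) \<in> U \<inter> M"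
      using ev by eventually_elim (use inM s0T in \<open>auto intro: less_imp_le\<close>)
  qed
  obtain P :: "'w \<Rightarrow>\<^sub>L (real ^ 'm)" where P: "\<And>u. P (\<phi>1 (\<psi> y) u) = u"
    using bounded_left_inverse[OF rc.inj_\<phi>1[OF z]] by blast
  have "\<phi>1 (\<psi> y) (P (f y v)) = f y v"
    by (rule rc.tangent_limit(1)[OF z P sequentially_bot \<psi>lim lim])
  then show ?thesis unfolding rc.tangent_space_eq[OF yUM] by (metis rangeI)
qed

lemma drift_in_tangent_space:
  assumes M: "C3_submanifold TYPE('m::finite) M"
    and geometric: "\<And>s t. s \<in> {0..T} \<Longrightarrow> t \<in> {0..T} \<Longrightarrow> tensor_Sym tensor (XX s t) = (1/2) *\<^sub>R tensor (X t - X s) (X t - X s)"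
    and tang: "\<And>y v. y \<in> M \<Longrightarrow> f y v \<in> tangent_space TYPE('m) M y"
    and inv: "locally_invariant tensor \<alpha> T X XX f0 f M" and y: "y \<in> M"
  shows "f0 y \<in> tangent_space TYPE('m) M y"
proof -
  obtain U Om and \<phi> :: "real ^ 'm \<Rightarrow> 'w" and \<psi> \<phi>1 \<phi>2 \<phi>3
    where yU: "y \<in> U" and rc: "rough_chart tensor f0 f f1 f2 X XX \<alpha> T H M U Om \<phi> \<psi> \<phi>1 \<phi>2 \<phi>3"
    by (rule chart_around[OF M y geometric])
  interpret rc: rough_chart tensor f0 f f1 f2 X XX \<alpha> T H M U Om \<phi> \<psi> \<phi>1 \<phi>2 \<phi>3 by (rule rc)
  have yUM: "y \<in> U \<inter> M" using y yU by simp
  obtain Y Y' where sol: "rde_solution tensor \<alpha> T X XX f0 f y Y Y'" by (rule solution_exists)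
  obtain T0 where T0: "0 < T0" "T0 \<le> T" and inM: "\<And>t. 0 \<le> t \<Longrightarrow> t \<le> T0 \<Longrightarrow> Y t \<in> M"
    using inv y sol unfolding locally_invariant_def by fastforce
  have tang': "f x v \<in> range (blinfun_apply (\<phi>1 (\<psi> x)))" if "x \<in> U \<inter> M" for x v
    using tang[of x v] that rc.tangent_space_eq[OF that] by auto
  show ?thesis
    unfolding rc.tangent_space_eq[OF yUM] by (rule rc.drift_tangent[OF tang' sol inM T0 yUM])
qed

lemma solution_stays_locally:
  assumes M: "C3_submanifold TYPE('m::finite) M"
    and geometric: "\<And>s t. s \<in> {0..T} \<Longrightarrow> t \<in> {0..T} \<Longrightarrow> tensor_Sym tensor (XX s t) = (1/2) *\<^sub>R tensor (X t - X s) (X t - X s)"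
    and tang: "\<And>y v. y \<in> M \<Longrightarrow> f y v \<in> tangent_space TYPE('m) M y"
    and tang0: "\<And>y. y \<in> M \<Longrightarrow> f0 y \<in> tangent_space TYPE('m) M y"
    and sol: "rde_solution tensor \<alpha> T X XX f0 f \<xi> Y Y'" and s: "0 \<le> s" "s < T" "Y s \<in> M"
  obtains T1 where "s < T1" "T1 \<le> T" "\<And>t. s \<le> t \<Longrightarrow> t \<le> T1 \<Longrightarrow> Y t \<in> M"
proof -
  obtain U Om and \<phi> :: "real ^ 'm \<Rightarrow> 'w" and \<psi> \<phi>1 \<phi>2 \<phi>3
    where yU: "Y s \<in> U" and rc: "rough_chart tensor f0 f f1 f2 X XX \<alpha> T H M U Om \<phi> \<psi> \<phi>1 \<phi>2 \<phi>3"
    by (rule chart_around[OF M s(3) geometric])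
  interpret rc: rough_chart tensor f0 f f1 f2 X XX \<alpha> T H M U Om \<phi> \<psi> \<phi>1 \<phi>2 \<phi>3 by (rule rc)
  have yUM: "Y s \<in> U \<inter> M" using s yU by simp
  have tang': "f x v \<in> range (blinfun_apply (\<phi>1 (\<psi> x)))" and tang0': "f0 x \<in> range (blinfun_apply (\<phi>1 (\<psi> x)))"
    if "x \<in> U \<inter> M" for x v
    using tang[of x v] tang0[of x] that rc.tangent_space_eq[OF that] by auto
  obtain K h B where Y: "davie_path K h Y" "0 \<le> B" "continuous_on {0..T} Y"
    and B: "\<And>t. 0 \<le> t \<Longrightarrow> t \<le> T \<Longrightarrow> norm (f0 (Y t)) \<le> B"
    by (rule solution_is_davie_path[OF sol]) blast
  show ?thesis
    by (rule rc.davie_path_stays_in_chart[OF _ _ Y(1,3,2) _ s(1,2) yUM])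
      (erule tang', erule tang0', erule (1) B, rule that)
qed

end

lemma rough_equation_exists:
  fixes tensor :: "'v::banach \<Rightarrow> 'v \<Rightarrow> 'e::banach" and f0 :: "'w::banach \<Rightarrow> 'w" and f :: "'w \<Rightarrow> 'v \<Rightarrow>\<^sub>L 'w"
  assumes ct: "completed_tensor_product tensor"
    and inj: "canonical_injection TYPE('w) tensor" and T: "T > 0"
    and \<alpha>: "1/3 < \<alpha>" "\<alpha> \<le> 1/2" and f0: "\<exists>L. L-lipschitz_on UNIV f0" and f: "Cb3 f"
    and rp: "rough_path tensor \<alpha> T X XX"
  obtains f1 f2 H where "rough_equation tensor f0 f f1 f2 X XX \<alpha> T H"
proof -
  interpret completed_tensor_product tensor by (rule ct)
  obtain L where L: "\<And>x y. norm (f0 x - f0 y) \<le> L * norm (x - y)"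
    using f0 by (auto simp: lipschitz_on_def dist_norm)
  obtain f1 f2 f3 where d: "C3_derivatives UNIV f f1 f2 f3"
    and bd: "bounded (range f)" "bounded (range f1)" "bounded (range f2)" "bounded (range f3)"
    using f unfolding Cb3_def by blast
  have deriv: "(f has_derivative blinfun_apply (f1 x)) (at x)" "(f1 has_derivative blinfun_apply (f2 x)) (at x)"
    "(f2 has_derivative blinfun_apply (f3 x)) (at x)" for x
    using d by (auto simp: C3_derivatives_def)
  obtain b0 where b0: "\<And>x. norm (f x) \<le> b0" using bd(1) unfolding bounded_iff by auto
  obtain b1 where b1: "\<And>x. norm (f1 x) \<le> b1" using bd(2) unfolding bounded_iff by auto
  obtain b2 where b2: "\<And>x. norm (f2 x) \<le> b2" using bd(3) unfolding bounded_iff by auto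
  obtain b3 where b3: "\<And>x. norm (f3 x) \<le> b3" using bd(4) unfolding bounded_iff by auto
  obtain l where l: "\<And>A :: 'v \<Rightarrow>\<^sub>L 'v \<Rightarrow>\<^sub>L 'w. norm (tensor_lift tensor A) \<le> norm A * l"
    using bounded_linear.bounded[OF tensor_lift_bounded_linear[OF inj]] by blast
  have hp: "holder2 \<alpha> T (\<lambda>s t. X t - X s)" "holder2 (2 * \<alpha>) T XX"
    and chen: "\<And>s u t. s \<in> {0..T} \<Longrightarrow> u \<in> {0..T} \<Longrightarrow> t \<in> {0..T} \<Longrightarrow> XX s t - XX s u - XX u t = tensor (X u - X s) (X t - X u)"
    using rp by (auto simp: rough_path_def holder_path_def)
  obtain c1 where c1: "0 \<le> c1" "\<And>s t. s \<in> {0..T} \<Longrightarrow> t \<in> {0..T} \<Longrightarrow> s \<noteq> t \<Longrightarrow> norm (X t - X s) \<le> c1 * \<bar>t - s\<bar> powr \<alpha>"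
    by (rule holder2E[OF hp(1)]) blast
  obtain c2 where c2: "0 \<le> c2" "\<And>s t. s \<in> {0..T} \<Longrightarrow> t \<in> {0..T} \<Longrightarrow> s \<noteq> t \<Longrightarrow> norm (XX s t) \<le> c2 * \<bar>t - s\<bar> powr (2 * \<alpha>)"
    by (rule holder2E[OF hp(2)]) blast
  have XX0: "XX s s = 0" if "s \<in> {0..T}" for s
  proof -
    have "tensor (X s - X s) (X s - X s) = 0" using norm_tensor[of "X s - X s" "X s - X s"] by simp
    then show ?thesis using chen[OF that that that] by simp
  qed
  define H where "H = Max {1, L, b0, b1, b2, b3, l, c1, c2}"
  have H: "1 \<le> H" "L \<le> H" "b0 \<le> H" "b1 \<le> H" "b2 \<le> H" "b3 \<le> H" "l \<le> H" "c1 \<le> H" "c2 \<le> H"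
    unfolding H_def by (rule Max_ge; simp)+
  have f1_lip: "norm (f1 x - f1 y) \<le> H * norm (x - y)" for x y
    using H b2 by (intro lipschitz_of_bounded_derivative[OF deriv(2)]) (auto intro: order_trans)
  have f2_lip: "norm (f2 x - f2 y) \<le> H * norm (x - y)" for x y
    using H b3 by (intro lipschitz_of_bounded_derivative[OF deriv(3)]) (auto intro: order_trans)
  have "rough_equation tensor f0 f f1 f2 X XX \<alpha> T H"
  proof (intro rough_equation.intro rough_equation_axioms.intro)
    show "completed_tensor_product tensor" by (rule ct)
    show "canonical_injection TYPE('w) tensor" "1/3 < \<alpha>" "\<alpha> \<le> 1/2" "0 < T" "1 \<le> H" using inj \<alpha> T H by auto
    show "norm (f0 x - f0 y) \<le> H * norm (x - y)" for x y
      using H(2) by (intro order_trans[OF L] mult_right_mono) auto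
    show "C2_bounded f f1 H" by (intro C2_bounded.intro deriv(1) f1_lip order_trans[OF b1 H(4)])
    show "C2_bounded f1 f2 H" by (intro C2_bounded.intro deriv(2) f2_lip order_trans[OF b2 H(5)])
    show "norm (f x) \<le> H" for x by (rule order_trans[OF b0 H(3)])
    show "norm (tensor_lift tensor A) \<le> H * norm A" for A :: "'v \<Rightarrow>\<^sub>L 'v \<Rightarrow>\<^sub>L 'w"
      using l[of A] mult_right_mono[OF H(7) norm_ge_zero[of A]] by (simp add: mult.commute)
    fix s t assume st: "s \<in> {0..T}" "t \<in> {0..T}"
    show "norm (X t - X s) \<le> H * \<bar>t - s\<bar> powr \<alpha>"
      by (cases "s = t") (auto intro: order_trans[OF c1(2)[OF st] mult_right_mono[OF H(8)]])
    show "norm (XX s t) \<le> H * \<bar>t - s\<bar> powr (2 * \<alpha>)"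
      using XX0[OF st(1)] by (cases "s = t") (auto intro: order_trans[OF c2(2)[OF st] mult_right_mono[OF H(9)]])
    fix u assume u: "u \<in> {0..T}"
    show "XX s t = XX s u + XX u t + tensor (X u - X s) (X t - X u)"
      using chen[OF st(1) u st(2)] by (simp add: algebra_simps)
  qed
  then show ?thesis by (rule that)
qed

theorem corollary2p6:
  fixes tensor :: "'v::banach \<Rightarrow> 'v \<Rightarrow> 'e::banach"
    and T \<alpha> :: real
    and f0 :: "'w::banach \<Rightarrow> 'w"
    and f :: "'w \<Rightarrow> 'v \<Rightarrow>\<^sub>L 'w"
    and M :: "'w set"
    and X :: "real \<Rightarrow> 'v"
    and XX :: "real \<Rightarrow> real \<Rightarrow> 'e"
  assumes "completed_tensor_product tensor"
    and "canonical_injection TYPE('w) tensor"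
    and "T > 0"
    and "1/3 < \<alpha>" and "\<alpha> \<le> 1/2"
    and "\<exists>L. L-lipschitz_on UNIV f0"
    and "Cb3 f"
    and "C3_submanifold TYPE('m::finite) M"
    and "weakly_geometric_rough_path tensor \<alpha> T X XX"
    and "truly_rough \<alpha> T X"
  shows "(locally_invariant tensor \<alpha> T X XX f0 f M \<longleftrightarrow>
           (\<forall>y\<in>M. f0 y \<in> tangent_space TYPE('m) M y \<and>
                  (\<forall>v. f y v \<in> tangent_space TYPE('m) M y))) \<and>
         (locally_invariant tensor \<alpha> T X XX f0 f M \<and> closed M \<longrightarrow>
           globally_invariant tensor \<alpha> T X XX f0 f M)"
proof -
  have rp: "rough_path tensor \<alpha> T X XX"
    and geometric: "\<And>s t. s \<in> {0..T} \<Longrightarrow> t \<in> {0..T} \<Longrightarrow> tensor_Sym tensor (XX s t) = (1/2) *\<^sub>R tensor (X t - X s) (X t - X s)"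
    using assms(9) by (auto simp: weakly_geometric_rough_path_def)
  obtain f1 f2 H where re: "rough_equation tensor f0 f f1 f2 X XX \<alpha> T H"
    by (rule rough_equation_exists[OF assms(1-7) rp])
  interpret rough_equation tensor f0 f f1 f2 X XX \<alpha> T H by (rule re)
  let ?tangent = "\<forall>y\<in>M. f0 y \<in> tangent_space TYPE('m) M y \<and> (\<forall>v. f y v \<in> tangent_space TYPE('m) M y)"
  have necessary: ?tangent if inv: "locally_invariant tensor \<alpha> T X XX f0 f M"
  proof (intro ballI conjI allI)
    have vol: "f y v \<in> tangent_space TYPE('m) M y" if "y \<in> M" for y v
      by (rule volatility_tangent[OF assms(8) geometric assms(10) inv that])
    fix y assume y: "y \<in> M"
    show "f y v \<in> tangent_space TYPE('m) M y" for v by (rule vol[OF y])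
    show "f0 y \<in> tangent_space TYPE('m) M y"
      by (rule drift_in_tangent_space[OF assms(8) geometric vol inv y])
  qed
  have start: "Y 0 = \<xi>" and cont: "continuous_on {0..T} Y" if "rde_solution tensor \<alpha> T X XX f0 f \<xi> Y Y'" for \<xi> Y Y'
    by (rule solution_is_davie_path[OF that], assumption)+
  have stay: "\<exists>T1. s < T1 \<and> T1 \<le> T \<and> (\<forall>t. s \<le> t \<longrightarrow> t \<le> T1 \<longrightarrow> Y t \<in> M)"
    if tangent: ?tangent and sol: "rde_solution tensor \<alpha> T X XX f0 f \<xi> Y Y'" and s: "0 \<le> s" "s < T" "Y s \<in> M" for \<xi> Y Y' s
    by (rule solution_stays_locally[OF assms(8) geometric _ _ sol s]) (use tangent in blast)+
  have sufficient: "locally_invariant tensor \<alpha> T X XX f0 f M" if tangent: ?tangent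
    unfolding locally_invariant_def
  proof
    fix \<xi> assume \<xi>: "\<xi> \<in> M"
    obtain Y Y' where sol: "rde_solution tensor \<alpha> T X XX f0 f \<xi> Y Y'" by (rule solution_exists)
    obtain T1 where T1: "0 < T1" "T1 \<le> T" "\<And>t. 0 \<le> t \<Longrightarrow> t \<le> T1 \<Longrightarrow> Y t \<in> M"
      using stay[OF tangent sol, of 0] start[OF sol] \<xi> horizon by auto
    show "\<exists>T0\<in>{0<..T}. \<forall>Y Y'. rde_solution tensor \<alpha> T X XX f0 f \<xi> Y Y' \<longrightarrow> (\<forall>t\<in>{0..T0}. Y t \<in> M)"
    proof (intro bexI[of _ T1] allI impI ballI)
      fix Z Z' t assume Z: "rde_solution tensor \<alpha> T X XX f0 f \<xi> Z Z'" and t: "t \<in> {0..T1}"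
      have "Z t = Y t" using t T1 by (intro solutions_unique[OF Z sol]) auto
      then show "Z t \<in> M" using T1(3) t by simp
    qed (use T1 in simp)
  qed
  have global: "globally_invariant tensor \<alpha> T X XX f0 f M" if tangent: ?tangent and closed: "closed M"
    unfolding globally_invariant_def
  proof (intro ballI allI impI)
    fix \<xi> Y Y' t assume \<xi>: "\<xi> \<in> M" and sol: "rde_solution tensor \<alpha> T X XX f0 f \<xi> Y Y'" and t: "t \<in> {0..T}"
    \<comment> \<open>The supremum \<open>\<sigma>\<close> of \<open>S\<close> is attained since \<open>M\<close> is closed, and \<open>\<sigma> < T\<close> is impossible since the
      solution stays in \<open>M\<close> for a while after \<open>\<sigma>\<close>.\<close>
    define S where "S = {r \<in> {0..T}. \<forall>q\<in>{0..r}. Y q \<in> M}"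
    have S0: "0 \<in> S" using start[OF sol] \<xi> horizon by (simp add: S_def)
    have bdd: "bdd_above S" by (rule bdd_aboveI[of _ T]) (simp add: S_def)
    define \<sigma> where "\<sigma> = Sup S"
    have \<sigma>: "0 \<le> \<sigma>" "\<sigma> \<le> T"
      unfolding \<sigma>_def using S0 bdd by (auto intro!: cSup_upper cSup_least simp: S_def)
    have below: "Y q \<in> M" if q: "0 \<le> q" "q < \<sigma>" for q
    proof -
      obtain r where "r \<in> S" "q < r" using q(2) less_cSupD[of S q] S0 unfolding \<sigma>_def by blast
      then show ?thesis using q by (auto simp: S_def)
    qed
    have at: "Y \<sigma> \<in> M"
    proof (cases "\<sigma> = 0")
      case True
      then show ?thesis using start[OF sol] \<xi> by simp
    next
      case False
      have "closed ({0..T} \<inter> Y -` M)" by (rule continuous_closed_preimage[OF cont[OF sol] closed_atLeastAtMost closed])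
      moreover have "{0..<\<sigma>} \<subseteq> {0..T} \<inter> Y -` M" using below \<sigma> by auto
      ultimately have "closure {0..<\<sigma>} \<subseteq> {0..T} \<inter> Y -` M" by (rule closure_minimal[rotated])
      moreover have "\<sigma> \<in> closure {0..<\<sigma>}" using False \<sigma> by simp
      ultimately show ?thesis by blast
    qed
    have upto: "Y q \<in> M" if "0 \<le> q" "q \<le> \<sigma>" for q using below[of q] at that by (cases "q = \<sigma>") auto
    have "\<sigma> = T"
    proof (rule ccontr)
      assume "\<sigma> \<noteq> T"
      then have "\<sigma> < T" using \<sigma> by simp
      then obtain T1 where T1: "\<sigma> < T1" "T1 \<le> T" "\<And>t. \<sigma> \<le> t \<Longrightarrow> t \<le> T1 \<Longrightarrow> Y t \<in> M"
        using stay[OF tangent sol \<sigma>(1) _ at] by blast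
      have "Y q \<in> M" if "q \<in> {0..T1}" for q using upto[of q] T1(3)[of q] that by (cases "q \<le> \<sigma>") auto
      then have "T1 \<in> S" using T1 \<sigma> by (auto simp: S_def)
      then have "T1 \<le> \<sigma>" unfolding \<sigma>_def by (rule cSup_upper[OF _ bdd])
      then show False using T1 by simp
    qed
    then show "Y t \<in> M" using upto t by simp
  qed
  show ?thesis using necessary sufficient global by blast
qed

end
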